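(* Let $\mathbb{K}$ be an algebraically closed field and $q\in\mathbb{K}$ a primitive $l$-th root of unity with $l\geq3$. Let $A=\mathbb{K}_q[X,Y]\rtimes U_q(\mathfrak{sl}_2)$ and let $B\subset A$ be the subalgebra generated by $K^{\pm1},X,Y,\phi,\psi$. Then each simple right $A$-module on which $X$ and $Y$ act invertibly is isomorphic, as a $B$-module, to one of the simple $B$-modules $N_i$, $1\le i\le6$, described in the context (attached to the $X,Y$-torsion free simple $B$-module $N$ obtained by restricting the given $A$-module to $B$). Moreover, the $\mathbb{K}$-dimension of each such simple $A$-module is maximal, equal to the PI degree of $A$.
   Context: $A$ is the $\mathbb{K}$-algebra generated by $E,F,K,K^{-1},X,Y$ with relations ($K^{-1}$ the inverse of $K$) $$KEK^{-1}=q^2E,\ KFK^{-1}=q^{-2}F,\ EF-FE=\tfrac{K-K^{-1}}{q-q^{-1}},\ EX=qXE,\ EY=X+q^{-1}YE,$$ $$FX=YK^{-1}+XF,\ FY=YF,\ KXK^{-1}=qX,\ KYK^{-1}=q^{-1}Y,\ XY=qYX.$$ Put $\phi:=EY-qYE$ and $\psi:=XF-q^2FX$; $B$ is the subalgebra generated by $K^{\pm1},X,Y,\phi,\psi$. In $B$: $\phi X=X\phi$, $\phi Y=q^{-1}Y\phi$, $\phi K=q^{-1}K\phi$, $\psi X=X\psi$, $\psi Y=qY\psi$, $\psi K=qK\psi$, $\psi\phi-\phi\psi=q(1-q^2)KYX$. Modules are right modules. A module is $X,Y$-torsion free if $X$ and $Y$ act injectively on it. (Simple $A$- and $B$-modules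 are finite dimensional, of dimension at most the PI degree; simple $A$-modules with invertible action of $X,Y$ restrict to $X,Y$-torsion free simple $B$-modules.) The modules $N_i$. Let $N$ be an $X,Y$-torsion free simple $B$-module. Case $l$ odd: let $v\in N$ be a common eigenvector of the commuting operators $\phi^l,\psi^l,X^l,K,YX,\psi\phi$, with $v\phi^l=\alpha v$, $v\psi^l=\beta v$. - If $\alpha\ne0$: $N_1$ is the span of $v\phi^aX^b$, $0\le a,b\le l-1$. - If $\alpha=0$, $\beta\neq0$: $N_2$ is the span of $v\psi^aX^b$, $0\le a,b\le l-1$. - If $\alpha=\beta=0$: let $r\ge1$ be smallest with $v\phi^r=0$ and $u:=v\phi^{r-1}$; $N_3$ is the span of $u\psi^aX^b$, $0\le a,b\le l-1$. Case $l$ even: let $v\in N$ be a common eigenvector of the commuting operators $\phi^l,\psi^l,X^l,K,YX,\psi\phi,\phi^{l/2}X^{l/2},\psi^{l/2}X^{l/2}$, with $v\phi^l=\alpha v$, $v\psi^l=\beta v$. - If $\alpha\neq0$: $N_4$ is the span of $v\phi^aX^b$, $0\le a\le\frac l2-1$, $0\le b\le l-1$. - If $\alpha=0$, $\beta\ne0$: choose $0\le r\le\frac l2-1$ with $u:=v\phi^r\neq0$ and $u\phi=0$; $N_5$ is the span of $u\psi^aX^b$, $0\le a\le\frac l2-1$, $0\le b\le l-1$. - If $\alpha=\beta=0$: choose $0\le r\le\frac l2-1$ with $u:=v\phi^r\ne0$ and $u\phi=0$; $N_6$ is the span of $u\psi^aX^b$, $0\le a\le\frac l2-1$, $0\le b\le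 l-1$. *)

theory Defs
  imports
    "HOL-Algebra.Algebra"
    "HOL-Algebra.Algebraic_Closure_Type"
    "HOL-Library.Poly_Mapping"
begin

section \<open>Free algebras\<close>

text \<open>
  The free monoid. It is written additively because that is what the convolution product
  of \<^theory>\<open>HOL-Library.Poly_Mapping\<close> asks for: with this instance
  \<open>'x word \<Rightarrow>\<^sub>0 'c\<close> is the free associative unital \<open>'c\<close>-algebra on the letters \<open>'x\<close>.
\<close>

datatype 'x word = Word (letters: "'x list")

instantiation word :: (type) monoid_add
begin

definition zero_word :: "'a word" where
  "0 = Word []"

definition plus_word :: "'a word \<Rightarrow> 'a word \<Rightarrow> 'a word" where
  "u + v = Word (letters u @ letters v)"

instance
  by standard (simp_all add: zero_word_def plus_word_def)

end

type_synonym ('x, 'c) free_algebra = "'x word \<Rightarrow>\<^sub>0 'c"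

definition gen :: "'x \<Rightarrow> ('x, 'c::zero_neq_one) free_algebra" where
  "gen x = Poly_Mapping.single (Word [x]) 1"

definition const :: "'c::zero \<Rightarrow> ('x, 'c) free_algebra" where
  "const c = Poly_Mapping.single 0 c"


section \<open>The PI degree\<close>

definition word_eval :: "('a, 'b) ring_scheme \<Rightarrow> ('x \<Rightarrow> 'a) \<Rightarrow> 'x word \<Rightarrow> 'a" where
  "word_eval R r w = foldr (\<lambda>x a. r x \<otimes>\<^bsub>R\<^esub> a) (letters w) \<one>\<^bsub>R\<^esub>"

definition poly_eval :: "('a, 'b) ring_scheme \<Rightarrow> ('x \<Rightarrow> 'a) \<Rightarrow> ('x, int) free_algebra \<Rightarrow> 'a" where
  "poly_eval R r f =
     (\<Oplus>\<^bsub>R\<^esub>w\<in>Poly_Mapping.keys f. [Poly_Mapping.lookup f w] \<cdot>\<^bsub>R\<^esub> word_eval R r w)"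

definition polynomial_identity :: "('a, 'b) ring_scheme \<Rightarrow> ('x, int) free_algebra \<Rightarrow> bool" where
  "polynomial_identity R f \<longleftrightarrow> (\<forall>r. range r \<subseteq> carrier R \<longrightarrow> poly_eval R r f = \<zero>\<^bsub>R\<^esub>)"

definition total_degree :: "('x, int) free_algebra \<Rightarrow> nat" where
  "total_degree f = Max ((\<lambda>w. length (letters w)) ` Poly_Mapping.keys f)"

text \<open>A noncommutative polynomial is monic if some monomial of highest degree has coefficient 1.\<close>

definition monic_poly :: "('x, int) free_algebra \<Rightarrow> bool" where
  "monic_poly f \<longleftrightarrow>
     (\<exists>w\<in>Poly_Mapping.keys f. length (letters w) = total_degree f \<and> Poly_Mapping.lookup f w = 1)"

definition PI_min_degree :: "('a, 'b) ring_scheme \<Rightarrow> nat" where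
  "PI_min_degree R =
     (LEAST d. \<exists>f :: (nat, int) free_algebra.
        monic_poly f \<and> polynomial_identity R f \<and> total_degree f = d)"

text \<open>
  For a prime PI ring, half the minimal degree of a monic polynomial identity; by Posner's
  theorem this is the natural number \<open>n\<close> for which the quotient ring is central simple of
  dimension \<open>n\<^sup>2\<close> over its centre. Real-valued, so that the halving is exact by definition.
\<close>

definition PI_degree :: "('a, 'b) ring_scheme \<Rightarrow> real" where
  "PI_degree R = real (PI_min_degree R) / 2"


section \<open>Right modules\<close>

text \<open>
  The unital right \<open>R\<close>-module with underlying subgroup \<open>V\<close> of the abelian group \<open>'m\<close>, where
  \<open>act m a\<close> is the product \<open>m a\<close>. Working with a carrier \<open>V\<close> lets submodules
  share the action of the ambient module.
\<close>

definition right_module ::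
  "('a, 'b) ring_scheme \<Rightarrow> 'm::ab_group_add set \<Rightarrow> ('m \<Rightarrow> 'a \<Rightarrow> 'm) \<Rightarrow> bool" where
  "right_module R V act \<longleftrightarrow>
     0 \<in> V \<and> (\<forall>m\<in>V. \<forall>n\<in>V. m + n \<in> V) \<and> (\<forall>m\<in>V. - m \<in> V) \<and>
     (\<forall>m\<in>V. \<forall>a\<in>carrier R. act m a \<in> V) \<and>
     (\<forall>m\<in>V. \<forall>n\<in>V. \<forall>a\<in>carrier R. act (m + n) a = act m a + act n a) \<and>
     (\<forall>m\<in>V. \<forall>a\<in>carrier R. \<forall>b\<in>carrier R. act m (a \<oplus>\<^bsub>R\<^esub> b) = act m a + act m b) \<and>
     (\<forall>m\<in>V. \<forall>a\<in>carrier R. \<forall>b\<in>carrier R. act m (a \<otimes>\<^bsub>R\<^esub> b) = act (act m a) b) \<and>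
     (\<forall>m\<in>V. act m \<one>\<^bsub>R\<^esub> = m)"

definition simple_right_module ::
  "('a, 'b) ring_scheme \<Rightarrow> 'm::ab_group_add set \<Rightarrow> ('m \<Rightarrow> 'a \<Rightarrow> 'm) \<Rightarrow> bool" where
  "simple_right_module R V act \<longleftrightarrow>
     right_module R V act \<and> V \<noteq> {0} \<and>
     (\<forall>P\<subseteq>V. right_module R P act \<longrightarrow> P = {0} \<or> P = V)"

definition right_module_iso ::
  "('a, 'b) ring_scheme \<Rightarrow> 'm::ab_group_add set \<Rightarrow> ('m \<Rightarrow> 'a \<Rightarrow> 'm) \<Rightarrow>
   'n::ab_group_add set \<Rightarrow> ('n \<Rightarrow> 'a \<Rightarrow> 'n) \<Rightarrow> bool" where
  "right_module_iso R V act W act' \<longleftrightarrow>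
     (\<exists>f. bij_betw f V W \<and>
          (\<forall>m\<in>V. \<forall>n\<in>V. f (m + n) = f m + f n) \<and>
          (\<forall>m\<in>V. \<forall>a\<in>carrier R. f (act m a) = act' (f m) a))"


section \<open>The algebras \<open>A\<close> and \<open>B\<close>\<close>

datatype generator = gen_E | gen_F | gen_K | gen_Kinv | gen_X | gen_Y

type_synonym 'k pre_A = "(generator, 'k) free_algebra"
type_synonym 'k elem_A = "'k pre_A set"

abbreviation gE :: "'k::field pre_A" where "gE \<equiv> gen gen_E"
abbreviation gF :: "'k::field pre_A" where "gF \<equiv> gen gen_F"
abbreviation gK :: "'k::field pre_A" where "gK \<equiv> gen gen_K"
abbreviation gKinv :: "'k::field pre_A" where "gKinv \<equiv> gen gen_Kinv"
abbreviation gX :: "'k::field pre_A" where "gX \<equiv> gen gen_X"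
abbreviation gY :: "'k::field pre_A" where "gY \<equiv> gen gen_Y"

definition relators :: "'k::field \<Rightarrow> 'k pre_A set" where
  "relators q =
     {gK * gKinv - 1,
      gKinv * gK - 1,
      gK * gE * gKinv - const (q^2) * gE,
      gK * gF * gKinv - const (inverse (q^2)) * gF,
      gE * gF - gF * gE - const (inverse (q - inverse q)) * (gK - gKinv),
      gE * gX - const q * gX * gE,
      gE * gY - (gX + const (inverse q) * gY * gE),
      gF * gX - (gY * gKinv + gX * gF),
      gF * gY - gY * gF,
      gK * gX * gKinv - const q * gX,
      gK * gY * gKinv - const (inverse q) * gY,
      gX * gY - const q * gY * gX}"

definition relation_ideal :: "'k::field \<Rightarrow> 'k pre_A set" where
  "relation_ideal q = genideal ring_of_type_algebra (relators q)"

definition alg_A :: "'k::field \<Rightarrow> 'k elem_A ring" where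
  "alg_A q = ring_of_type_algebra Quot relation_ideal q"

text \<open>Elements of \<open>A\<close> are cosets; \<open>cls q w\<close> is the one represented by \<open>w\<close>.\<close>

definition cls :: "'k::field \<Rightarrow> 'k pre_A \<Rightarrow> 'k elem_A" where
  "cls q w = relation_ideal q +>\<^bsub>ring_of_type_algebra\<^esub> w"

definition \<phi> :: "'k::field \<Rightarrow> 'k pre_A" where
  "\<phi> q = gE * gY - const q * gY * gE"

definition \<psi> :: "'k::field \<Rightarrow> 'k pre_A" where
  "\<psi> q = gX * gF - const (q^2) * gF * gX"

text \<open>The scalars are among the generators since \<^const>\<open>generate_ring\<close> only yields the subring.\<close>

definition alg_B :: "'k::field \<Rightarrow> 'k elem_A ring" where
  "alg_B q = (alg_A q)\<lparr>carrier := generate_ring (alg_A q)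
            (cls q ` (range const \<union> {gK, gKinv, gX, gY, \<phi> q, \<psi> q}))\<rparr>"


section \<open>The underlying vector spaces\<close>

definition scalar_act :: "'k::field \<Rightarrow> ('m \<Rightarrow> 'k elem_A \<Rightarrow> 'm) \<Rightarrow> 'k \<Rightarrow> 'm \<Rightarrow> 'm" where
  "scalar_act q act c m = act m (cls q (const c))"

abbreviation K_span ::
  "'k::field \<Rightarrow> ('m::ab_group_add \<Rightarrow> 'k elem_A \<Rightarrow> 'm) \<Rightarrow> 'm set \<Rightarrow> 'm set" where
  "K_span q act \<equiv> Modules.module.span (scalar_act q act)"

text \<open>
  \<^const>\<open>vector_space.dim\<close> is 0 on infinite-dimensional spaces, whence the separate
  predicate for finite dimension.
\<close>

abbreviation K_dim ::
  "'k::field \<Rightarrow> ('m::ab_group_add \<Rightarrow> 'k elem_A \<Rightarrow> 'm) \<Rightarrow> 'm set \<Rightarrow> nat" where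
  "K_dim q act \<equiv> vector_space.dim (scalar_act q act)"

definition K_finite_dim ::
  "'k::field \<Rightarrow> ('m::ab_group_add \<Rightarrow> 'k elem_A \<Rightarrow> 'm) \<Rightarrow> 'm set \<Rightarrow> bool" where
  "K_finite_dim q act V \<longleftrightarrow> (\<exists>S. finite S \<and> S \<subseteq> V \<and> K_span q act S = V)"


section \<open>The modules \<open>N\<^sub>1, \<dots>, N\<^sub>6\<close>\<close>

definition torsion_free_simple ::
  "'k::field \<Rightarrow> ('m::ab_group_add \<Rightarrow> 'k elem_A \<Rightarrow> 'm) \<Rightarrow> 'm set \<Rightarrow> bool" where
  "torsion_free_simple q act N \<longleftrightarrow>
     simple_right_module (alg_B q) N act \<and>
     inj_on (\<lambda>m. act m (cls q gX)) N \<and> inj_on (\<lambda>m. act m (cls q gY)) N"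

definition common_eigenvector ::
  "'k::field \<Rightarrow> ('m::ab_group_add \<Rightarrow> 'k elem_A \<Rightarrow> 'm) \<Rightarrow> 'm set \<Rightarrow> 'k pre_A set \<Rightarrow> 'm \<Rightarrow> bool"
where
  "common_eigenvector q act N T v \<longleftrightarrow>
     v \<in> N \<and> v \<noteq> 0 \<and> (\<forall>t\<in>T. \<exists>c. act v (cls q t) = scalar_act q act c v)"

definition commuting_odd :: "'k::field \<Rightarrow> nat \<Rightarrow> 'k pre_A set" where
  "commuting_odd q l = {\<phi> q ^ l, \<psi> q ^ l, gX ^ l, gK, gY * gX, \<psi> q * \<phi> q}"

definition commuting_even :: "'k::field \<Rightarrow> nat \<Rightarrow> 'k pre_A set" where
  "commuting_even q l =
     commuting_odd q l \<union> {\<phi> q ^ (l div 2) * gX ^ (l div 2), \<psi> q ^ (l div 2) * gX ^ (l div 2)}"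

definition monomial_span ::
  "'k::field \<Rightarrow> ('m::ab_group_add \<Rightarrow> 'k elem_A \<Rightarrow> 'm) \<Rightarrow> 'm \<Rightarrow> 'k pre_A \<Rightarrow> nat \<Rightarrow> nat \<Rightarrow> 'm set"
where
  "monomial_span q act v t m n =
     K_span q act {act v (cls q (t ^ a * gX ^ b)) | a b. a < m \<and> b < n}"

text \<open>
  \<open>N_module q l act N i P\<close>: the subspace \<open>P\<close> is a module \<open>N\<^sub>i\<close> attached to \<open>N\<close>, for some
  admissible choice of the eigenvector \<open>v\<close> (and of \<open>r\<close>).
\<close>

inductive N_module ::
  "'k::field \<Rightarrow> nat \<Rightarrow> ('m::ab_group_add \<Rightarrow> 'k elem_A \<Rightarrow> 'm) \<Rightarrow> 'm set \<Rightarrow> nat \<Rightarrow> 'm set \<Rightarrow> bool"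
  for q :: 'k and l :: nat and act :: "'m::ab_group_add \<Rightarrow> 'k elem_A \<Rightarrow> 'm" and N :: "'m set"
where
  N1: "\<lbrakk>torsion_free_simple q act N; odd l;
        common_eigenvector q act N (commuting_odd q l) v;
        act v (cls q (\<phi> q ^ l)) = scalar_act q act \<alpha> v;
        \<alpha> \<noteq> 0\<rbrakk>
       \<Longrightarrow> N_module q l act N 1 (monomial_span q act v (\<phi> q) l l)"
| N2: "\<lbrakk>torsion_free_simple q act N; odd l;
        common_eigenvector q act N (commuting_odd q l) v;
        act v (cls q (\<phi> q ^ l)) = scalar_act q act 0 v;
        act v (cls q (\<psi> q ^ l)) = scalar_act q act \<beta> v;
        \<beta> \<noteq> 0\<rbrakk>
       \<Longrightarrow> N_module q l act N 2 (monomial_span q act v (\<psi> q) l l)"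
| N3: "\<lbrakk>torsion_free_simple q act N; odd l;
        common_eigenvector q act N (commuting_odd q l) v;
        act v (cls q (\<phi> q ^ l)) = scalar_act q act 0 v;
        act v (cls q (\<psi> q ^ l)) = scalar_act q act 0 v;
        1 \<le> r; act v (cls q (\<phi> q ^ r)) = 0;
        \<forall>s. 1 \<le> s \<and> s < r \<longrightarrow> act v (cls q (\<phi> q ^ s)) \<noteq> 0;
        u = act v (cls q (\<phi> q ^ (r - 1)))\<rbrakk>
       \<Longrightarrow> N_module q l act N 3 (monomial_span q act u (\<psi> q) l l)"
| N4: "\<lbrakk>torsion_free_simple q act N; even l;
        common_eigenvector q act N (commuting_even q l) v;
        act v (cls q (\<phi> q ^ l)) = scalar_act q act \<alpha> v;
        \<alpha> \<noteq> 0\<rbrakk>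
       \<Longrightarrow> N_module q l act N 4 (monomial_span q act v (\<phi> q) (l div 2) l)"
| N5: "\<lbrakk>torsion_free_simple q act N; even l;
        common_eigenvector q act N (commuting_even q l) v;
        act v (cls q (\<phi> q ^ l)) = scalar_act q act 0 v;
        act v (cls q (\<psi> q ^ l)) = scalar_act q act \<beta> v;
        \<beta> \<noteq> 0;
        r \<le> l div 2 - 1; u = act v (cls q (\<phi> q ^ r)); u \<noteq> 0; act u (cls q (\<phi> q)) = 0\<rbrakk>
       \<Longrightarrow> N_module q l act N 5 (monomial_span q act u (\<psi> q) (l div 2) l)"
| N6: "\<lbrakk>torsion_free_simple q act N; even l;
        common_eigenvector q act N (commuting_even q l) v;
        act v (cls q (\<phi> q ^ l)) = scalar_act q act 0 v;
        act v (cls q (\<psi> q ^ l)) = scalar_act q act 0 v;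
        r \<le> l div 2 - 1; u = act v (cls q (\<phi> q ^ r)); u \<noteq> 0; act u (cls q (\<phi> q)) = 0\<rbrakk>
       \<Longrightarrow> N_module q l act N 6 (monomial_span q act u (\<psi> q) (l div 2) l)"

definition primitive_root_of_unity :: "nat \<Rightarrow> 'k::field \<Rightarrow> bool" where
  "primitive_root_of_unity l q \<longleftrightarrow> q ^ l = 1 \<and> (\<forall>k. 0 < k \<and> k < l \<longrightarrow> q ^ k \<noteq> 1)"

end

theory Submission
  imports
    Defs
    "Jordan_Normal_Form.Determinant"
    "HOL-Computational_Algebra.Formal_Power_Series"
    "HOL-Combinatorics.Multiset_Permutations"
    "HOL-Library.Function_Algebras"
    "HOL-Library.Product_Plus"
begin

text \<open>
  Let \<open>l'\<close> be the order of \<open>q\<^sup>2\<close>. The algebra \<open>A\<close> acts faithfully on functions on a lattice by quantum torus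
  operators; those with periods \<open>l\<close> form a free module of rank \<open>l l'\<close> over a commutative ring, so \<open>A\<close> satisfies
  the standard identity of degree \<open>2 l l'\<close> by the theorem of Amitsur and Levitzki (proved as by Rosset, over the
  even part of a Grassmann algebra). Conversely, the \<open>l\<close>-th powers of the generators are central and \<open>A\<close> is finitely
  generated over them, so a weak Nullstellensatz makes every simple module finite dimensional. By density
  \<open>A\<close> induces all matrix units on a simple module of dimension \<open>m\<close>, and a staircase of them violates every
  monic identity of degree less than \<open>2 m\<close>. Hence \<open>m \<le> l l'\<close>, with equality forcing the PI degree to be \<open>m\<close>.

  If \<open>X\<close> and \<open>Y\<close> act invertibly, then \<open>E\<close> and \<open>F\<close> can be recovered from \<open>\<phi>\<close> and \<open>\<psi>\<close>, so the module is simple over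
  \<open>B\<close>. For the vectors \<open>u\<close> in the definition of the \<open>N\<^sub>i\<close>, with \<open>t\<close> one of \<open>\<phi>\<close> and \<open>\<psi>\<close>, the element \<open>t\<^sup>l\<^sup>' X\<^sup>l\<^sup>'\<close> acts
  as a scalar, and therefore the \<open>u t\<^sup>a X\<^sup>b\<close> with \<open>a < l'\<close> and \<open>b < l\<close> span a nonzero \<open>B\<close>-submodule, that is,
  everything. They are joint eigenvectors of \<open>K\<close> and \<open>YX\<close> with distinct pairs of eigenvalues, so the dimension
  is \<open>l l'\<close>.
\<close>

section \<open>Linear functionals on free algebras\<close>

text \<open>The number \<open>l l'\<close> counts pairs of exponents of \<open>q\<close>. On joint
  eigenvectors of \<open>K\<close> and \<open>YX\<close> the elements \<phi>, \<psi> and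
  \<open>X\<close> shift the two exponents by (-1, -1), (1, 1) and (-1, 1). The sum of the exponents
  keeps its parity, so for even \<open>l\<close> only half of the \<open>l * l\<close> pairs of
  residues are reached. The rank in the upper bound and the dimension in the lower bound both count
  these pairs, which is why the bounds meet. Two obstacles shape the rest. The PI degree is defined
  by integral monic identities and the characteristic of the field is arbitrary, while Rosset's
  argument divides by integers. The Grassmann algebra is therefore built over the integers, and what
  leaves it is only an integral statement about signed counts of paths. Moreover, a simple module is
  not assumed to be finite dimensional and the field may be countable, so that eigenvalues cannot be
  had from a cardinality argument. The Nullstellensatz for operators fills this gap.\<close>

lemma poly_mapping_sum_singles:
  "f = (\<Sum>w\<in>Poly_Mapping.keys f. Poly_Mapping.single w (Poly_Mapping.lookup f w))"
  by (rule poly_mapping_eqI) (auto simp: lookup_sum lookup_single when_def in_keys_iff sum.delta)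

lemma single_induct [case_names single add]:
  fixes f :: "'a \<Rightarrow>\<^sub>0 'b::comm_monoid_add"
  assumes single: "\<And>w c. P (Poly_Mapping.single w c)"
    and add: "\<And>f g. P f \<Longrightarrow> P g \<Longrightarrow> P (f + g)"
  shows "P f"
proof -
  have "P (\<Sum>w\<in>A. Poly_Mapping.single w (Poly_Mapping.lookup f w))" if "finite A" for A
    using that
  proof induct
    case empty
    show ?case using single[of undefined 0] by simp
  next
    case (insert x F)
    then show ?case using add single by simp
  qed
  from this[of "Poly_Mapping.keys f"] show ?thesis
    using poly_mapping_sum_singles[of f] by simp
qed

text \<open>The coefficient is an argument of \<open>g\<close>, not a factor, because the targets,
  integers and functions on a lattice, carry different scalar multiplications.\<close>

definition lin :: "('a \<Rightarrow> 'c \<Rightarrow> 'b) \<Rightarrow> ('a \<Rightarrow>\<^sub>0 'c::zero) \<Rightarrow> 'b::comm_monoid_add" where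
  "lin g f = (\<Sum>w\<in>Poly_Mapping.keys f. g w (Poly_Mapping.lookup f w))"

lemma lin_add:
  fixes g :: "'a \<Rightarrow> 'c::comm_monoid_add \<Rightarrow> 'b::comm_monoid_add"
  assumes z: "\<And>w. g w 0 = 0" and a: "\<And>w x y. g w (x + y) = g w x + g w y"
  shows "lin g (f + h) = lin g f + lin g h"
proof -
  let ?U = "Poly_Mapping.keys f \<union> Poly_Mapping.keys h"
  have *: "lin g k = (\<Sum>w\<in>?U. g w (Poly_Mapping.lookup k w))" if "Poly_Mapping.keys k \<subseteq> ?U" for k
    unfolding lin_def by (rule sum.mono_neutral_left) (use that in \<open>auto simp: in_keys_iff z\<close>)
  have "Poly_Mapping.keys (f + h) \<subseteq> ?U" by (rule Poly_Mapping.keys_add)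
  then show ?thesis by (simp add: * lookup_add a sum.distrib)
qed

lemma lin_single: "g w 0 = 0 \<Longrightarrow> lin g (Poly_Mapping.single w c) = g w c"
  by (auto simp: lin_def)

lemma lin_zero [simp]: "lin g 0 = 0"
  by (simp add: lin_def)

lemma single_Nil: "Poly_Mapping.single (Word []) c = const c"
  by (simp add: const_def zero_word_def)

lemma single_Cons:
  "Poly_Mapping.single (Word (x # xs)) (c::'c::semiring_1) = gen x * Poly_Mapping.single (Word xs) c"
  by (simp add: gen_def mult_single plus_word_def)

text \<open>Letters are split off on the left. Under a right action the first letter acts first, so
  the inductions below generalise the vector that is acted on.\<close>

lemma free_algebra_induct [case_names const gen add]:
  fixes f :: "('x, 'c::semiring_1) free_algebra"
  assumes const: "\<And>c. P (const c)"
    and gen: "\<And>x f. P f \<Longrightarrow> P (gen x * f)"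
    and add: "\<And>f g. P f \<Longrightarrow> P g \<Longrightarrow> P (f + g)"
  shows "P f"
proof (induct f rule: single_induct)
  case (single w c)
  show ?case
  proof (cases w)
    case (Word xs)
    have "P (Poly_Mapping.single (Word xs) c)"
      by (induct xs) (simp_all add: single_Nil single_Cons const gen)
    then show ?thesis using Word by simp
  qed
qed (rule add)

lemma const_0 [simp]: "const 0 = 0" by (simp add: const_def)
lemma const_1 [simp]: "const 1 = (1 :: ('x, 'c::zero_neq_one) free_algebra)" by (simp add: const_def)
lemma const_add: "const (a + b) = const a + (const b :: ('x, 'c::monoid_add) free_algebra)"
  by (simp add: const_def single_add)
lemma const_uminus: "const (- a) = - (const a :: ('x, 'c::ab_group_add) free_algebra)"
  by (simp add: const_def single_uminus)
lemma const_diff: "const (a - b) = const a - (const b :: ('x, 'c::ab_group_add) free_algebra)"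
  by (simp add: const_def single_diff)
lemma const_mult: "const (a * b) = const a * (const b :: ('x, 'c::semiring_1) free_algebra)"
  by (simp add: const_def mult_single)
lemma const_central: "const c * f = f * (const c :: ('x, 'c::comm_semiring_1) free_algebra)"
  by (induct f rule: single_induct)
    (simp_all add: const_def mult_single mult.commute distrib_left distrib_right)


section \<open>Matrix identities: the theorem of Amitsur and Levitzki\<close>

no_notation vec_index (infixl "$" 100)

section \<open>Matrices whose powers have trace zero\<close>

lemma fps_deriv_prod:
  fixes f :: "'i \<Rightarrow> 'a::comm_ring_1 fps"
  assumes "finite S"
  shows "fps_deriv (prod f S) = (\<Sum>i\<in>S. fps_deriv (f i) * prod f (S - {i}))"
  using assms
proof induct
  case (insert x F)
  have "(\<Sum>i\<in>F. fps_deriv (f i) * prod f (insert x F - {i})) =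
        (\<Sum>i\<in>F. f x * (fps_deriv (f i) * prod f (F - {i})))"
  proof (rule sum.cong[OF refl])
    fix i assume i: "i \<in> F"
    with insert have "insert x F - {i} = insert x (F - {i})" by auto
    then show "fps_deriv (f i) * prod f (insert x F - {i}) = f x * (fps_deriv (f i) * prod f (F - {i}))"
      using insert by (simp add: ac_simps)
  qed
  moreover have "insert x F - {x} = F" using insert by auto
  ultimately show ?case using insert by (simp add: sum_distrib_left algebra_simps)
qed simp

text \<open>Jacobi's formula. By the Leibniz rule the derivative is the sum over \<open>i\<close> of
  the determinants of \<open>R i\<close>, in which only row \<open>i\<close> is differentiated.
  Expansion along that row gives the cofactors of \<open>A\<close>, since deleting row
  \<open>i\<close> removes the difference.\<close>

lemma fps_deriv_det:
  fixes A :: "'a::comm_ring_1 fps mat"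
  assumes A: "A \<in> carrier_mat n n"
  shows "fps_deriv (det A) = (\<Sum>i<n. \<Sum>j<n. fps_deriv (A $$ (i,j)) * cofactor A i j)"
proof -
  define R where "R i = mat n n (\<lambda>(r,c). if r = i then fps_deriv (A $$ (r,c)) else A $$ (r,c))" for i
  have R: "R i \<in> carrier_mat n n" for i by (simp add: R_def)
  let ?P = "{p. p permutes {0..<n}}"
  have fin: "finite ?P" by (simp add: finite_permutations)
  have sg: "fps_deriv (signof p * x) = signof p * fps_deriv x" for p :: "nat \<Rightarrow> nat" and x :: "'a fps"
    by (simp add: fps_deriv_mult)
  have "fps_deriv (det A) =
      (\<Sum>p\<in>?P. signof p * (\<Sum>i=0..<n. fps_deriv (A $$ (i, p i)) * (\<Prod>j\<in>{0..<n}-{i}. A $$ (j, p j))))"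
    unfolding det_def'[OF A] fps_deriv_sum
    by (intro sum.cong refl) (simp only: sg, subst fps_deriv_prod, auto)
  also have "\<dots> = (\<Sum>i=0..<n. \<Sum>p\<in>?P. signof p * (fps_deriv (A $$ (i, p i)) * (\<Prod>j\<in>{0..<n}-{i}. A $$ (j, p j))))"
    unfolding sum_distrib_left by (rule sum.swap)
  also have "\<dots> = (\<Sum>i=0..<n. det (R i))"
  proof (rule sum.cong[OF refl])
    fix i assume i: "i \<in> {0..<n}"
    show "(\<Sum>p\<in>?P. signof p * (fps_deriv (A $$ (i, p i)) * (\<Prod>j\<in>{0..<n}-{i}. A $$ (j, p j)))) = det (R i)"
      unfolding det_def'[OF R]
    proof (rule sum.cong[OF refl])
      fix p assume "p \<in> ?P"
      then have p: "p j < n" if "j < n" for j using that permutes_in_image[of p "{0..<n}" j] by auto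
      have "(\<Prod>j=0..<n. R i $$ (j, p j)) = R i $$ (i, p i) * (\<Prod>j\<in>{0..<n}-{i}. R i $$ (j, p j))"
        using i by (simp add: prod.remove)
      also have "\<dots> = fps_deriv (A $$ (i, p i)) * (\<Prod>j\<in>{0..<n}-{i}. A $$ (j, p j))"
        using i p by (intro arg_cong2[of _ _ _ _ "(*)"] prod.cong refl) (auto simp: R_def)
      finally show "signof p * (fps_deriv (A $$ (i, p i)) * (\<Prod>j\<in>{0..<n}-{i}. A $$ (j, p j))) =
          signof p * (\<Prod>j=0..<n. R i $$ (j, p j))" by simp
    qed
  qed
  also have "\<dots> = (\<Sum>i<n. \<Sum>j<n. fps_deriv (A $$ (i,j)) * cofactor A i j)"
    unfolding lessThan_atLeast0[symmetric]
  proof (rule sum.cong[OF refl])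
    fix i assume i: "i \<in> {..<n}"
    have "det (R i) = (\<Sum>j<n. R i $$ (i,j) * cofactor (R i) i j)"
      by (rule laplace_expansion_row[OF R]) (use i in auto)
    also have "\<dots> = (\<Sum>j<n. fps_deriv (A $$ (i,j)) * cofactor A i j)"
    proof (rule sum.cong[OF refl])
      fix j assume j: "j \<in> {..<n}"
      have "mat_delete (R i) i j = mat_delete A i j"
        using A i j by (intro eq_matI) (auto simp: mat_delete_def R_def)
      then show "R i $$ (i,j) * cofactor (R i) i j = fps_deriv (A $$ (i,j)) * cofactor A i j"
        using i j by (simp add: cofactor_def R_def)
    qed
    finally show "det (R i) = (\<Sum>j<n. fps_deriv (A $$ (i,j)) * cofactor A i j)" .
  qed
  finally show ?thesis .
qed

text \<open>The factors are polynomials of degree at most 1 viewed as power series, so the degree of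
  the product is at most their number.\<close>

lemma fps_prod_nth_eq_0:
  fixes f :: "'i \<Rightarrow> 'a::comm_ring_1 fps"
  assumes "finite S" and "\<And>i k. i \<in> S \<Longrightarrow> k > 1 \<Longrightarrow> f i $ k = 0" and "k > card S"
  shows "prod f S $ k = 0"
  using assms
proof (induct arbitrary: k)
  case (insert x F)
  have "f x $ i * prod f F $ (k - i) = 0" if "i \<le> k" for i
  proof (cases "i > 1")
    case False
    then have "k - i > card F" using insert by auto
    then show ?thesis using insert by simp
  qed (use insert in auto)
  then show ?case using insert by (simp add: fps_mult_nth)
qed auto

lemma fps_det_nth_eq_0:
  fixes A :: "'a::comm_ring_1 fps mat"
  assumes A: "A \<in> carrier_mat n n" and "\<And>i j k. i < n \<Longrightarrow> j < n \<Longrightarrow> k > 1 \<Longrightarrow> A $$ (i,j) $ k = 0" and "k > n"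
  shows "det A $ k = 0"
proof -
  have "(signof p * (\<Prod>i=0..<n. A $$ (i, p i))) $ k = 0" if "p permutes {0..<n}" for p
  proof -
    have "p i < n" if "i < n" for i using that permutes_in_image[OF \<open>p permutes {0..<n}\<close>, of i] by auto
    then have "(\<Prod>i=0..<n. A $$ (i, p i)) $ k = 0"
      using assms by (intro fps_prod_nth_eq_0) auto
    then show ?thesis by (cases "sign p = 1") (auto simp: sign_def)
  qed
  then show ?thesis unfolding det_def'[OF A] by (simp add: fps_sum_nth)
qed

text \<open>
  Put \<open>B = 1 - t x\<close> and \<open>D = det B\<close>, over power series in \<open>t\<close>. As \<open>adj B = D (1 + t x + t\<^sup>2 x\<^sup>2 + \<dots>)\<close>, Jacobi's
  formula gives \<open>D' = - tr (x adj B) = 0\<close>. So \<open>D = 1\<close>, and the power series of \<open>x\<close> is the polynomial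
  matrix \<open>adj B\<close> of degree less than \<open>n\<close>.
\<close>

lemma pow_mat_eq_0_if_traces_0:
  fixes x :: "'a::comm_ring_1 mat"
  assumes x: "x \<in> carrier_mat n n" and n: "n > 0"
    and tf: "\<And>k (y::'a). of_nat (Suc k) * y = 0 \<Longrightarrow> y = 0"
    and tr: "\<And>k. (\<Sum>i<n. (x ^\<^sub>m Suc k) $$ (i,i)) = 0"
    and ij: "i < n" "j < n"
  shows "(x ^\<^sub>m n) $$ (i,j) = 0"
proof -
  have pc: "x ^\<^sub>m k \<in> carrier_mat n n" for k using x by simp
  have pS: "(x ^\<^sub>m Suc k) $$ (i,j) = (\<Sum>m<n. (x ^\<^sub>m k) $$ (i,m) * x $$ (m,j))"
    if "i < n" "j < n" for i j k
    using that x pc[of k] by (simp add: scalar_prod_def lessThan_atLeast0)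
  have pS2: "(x ^\<^sub>m Suc k) $$ (i,j) = (\<Sum>m<n. x $$ (i,m) * (x ^\<^sub>m k) $$ (m,j))"
    if "i < n" "j < n" for i j k
  proof -
    have "x ^\<^sub>m k * x = x * x ^\<^sub>m k"
    proof (induct k)
      case (Suc k)
      have "x ^\<^sub>m Suc k * x = (x * x ^\<^sub>m k) * x" using Suc by simp
      also have "\<dots> = x * (x ^\<^sub>m k * x)" by (rule assoc_mult_mat[OF x pc x])
      finally show ?case by simp
    qed (use x in auto)
    then show ?thesis using that x pc[of k] by (simp add: scalar_prod_def lessThan_atLeast0)
  qed
  define B where "B = mat n n (\<lambda>(i,j). fps_const (if i = j then 1 else 0) - fps_X * fps_const (x $$ (i,j)))"
  define G where "G = mat n n (\<lambda>(i,j). Abs_fps (\<lambda>k. (x ^\<^sub>m k) $$ (i,j)))"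
  define D where "D = det B"
  have B: "B \<in> carrier_mat n n" and G: "G \<in> carrier_mat n n" by (simp_all add: B_def G_def)
  note adj = adj_mat[OF B]
  have GB: "G * B = 1\<^sub>m n"
  proof (rule eq_matI)
    fix i j assume "i < dim_row (1\<^sub>m n :: 'a fps mat)" "j < dim_col (1\<^sub>m n :: 'a fps mat)"
    then have i: "i < n" and j: "j < n" by auto
    have "(G * B) $$ (i,j) = (\<Sum>m<n. G $$ (i,m) * B $$ (m,j))"
      using i j B G by (simp add: scalar_prod_def lessThan_atLeast0)
    also have "\<dots> = (\<Sum>m<n. (if m = j then G $$ (i,j) else 0) - fps_X * (G $$ (i,m) * fps_const (x $$ (m,j))))"
      using i j by (intro sum.cong refl) (auto simp: B_def algebra_simps)
    also have "\<dots> = G $$ (i,j) - fps_X * (\<Sum>m<n. G $$ (i,m) * fps_const (x $$ (m,j)))"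
      using j by (simp add: sum_subtractf sum_distrib_left)
    also have "\<dots> = (1\<^sub>m n) $$ (i,j)"
    proof (rule fps_ext)
      fix k
      show "(G $$ (i,j) - fps_X * (\<Sum>m<n. G $$ (i,m) * fps_const (x $$ (m,j)))) $ k = (1\<^sub>m n) $$ (i,j) $ k"
      proof (cases k)
        case 0
        then show ?thesis using i j x by (simp add: G_def)
      next
        case (Suc k')
        have "(\<Sum>m<n. G $$ (i,m) * fps_const (x $$ (m,j))) $ k' = (x ^\<^sub>m k) $$ (i,j)"
          using i j by (simp add: Suc pS fps_sum_nth G_def del: pow_mat.simps)
        then show ?thesis using i j Suc by (simp add: G_def del: pow_mat.simps)
      qed
    qed
    finally show "(G * B) $$ (i,j) = (1\<^sub>m n) $$ (i,j)" .
  qed (use B G in auto)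
  have adjG: "adj_mat B = D \<cdot>\<^sub>m G"
  proof -
    have "adj_mat B = (G * B) * adj_mat B" using adj(1) by (simp add: GB)
    also have "\<dots> = G * (B * adj_mat B)" by (rule assoc_mult_mat[OF G B adj(1)])
    also have "\<dots> = D \<cdot>\<^sub>m G" unfolding adj(2) D_def using G
      by (simp add: mult_smult_distrib[OF G one_carrier_mat])
    finally show ?thesis .
  qed
  have cof: "cofactor B i j = D * G $$ (j,i)" if "i < n" "j < n" for i j
  proof -
    have "cofactor B i j = adj_mat B $$ (j,i)" using that B by (simp add: adj_mat_def)
    then show ?thesis using adjG that G by simp
  qed
  have "fps_deriv D = (\<Sum>i<n. \<Sum>j<n. fps_deriv (B $$ (i,j)) * cofactor B i j)"
    unfolding D_def by (rule fps_deriv_det[OF B])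
  also have "\<dots> = (\<Sum>i<n. \<Sum>j<n. - (fps_const (x $$ (i,j)) * (D * G $$ (j,i))))"
  proof (intro sum.cong refl)
    fix i j assume "i \<in> {..<n}" "j \<in> {..<n}"
    then have "fps_deriv (B $$ (i,j)) = - fps_const (x $$ (i,j))"
      by (simp add: B_def)
    then show "fps_deriv (B $$ (i,j)) * cofactor B i j = - (fps_const (x $$ (i,j)) * (D * G $$ (j,i)))"
      using \<open>i \<in> _\<close> \<open>j \<in> _\<close> by (simp add: cof del: fps_const_neg)
  qed
  also have "\<dots> = - D * (\<Sum>i<n. \<Sum>j<n. fps_const (x $$ (i,j)) * G $$ (j,i))"
    by (simp add: sum_distrib_left sum_negf ac_simps)
  also have "(\<Sum>i<n. \<Sum>j<n. fps_const (x $$ (i,j)) * G $$ (j,i)) = 0"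
  proof (rule fps_ext)
    fix k
    have "(\<Sum>i<n. \<Sum>j<n. fps_const (x $$ (i,j)) * G $$ (j,i)) $ k = (\<Sum>i<n. (x ^\<^sub>m Suc k) $$ (i,i))"
      by (simp add: fps_sum_nth G_def pS2 del: pow_mat.simps)
    then show "(\<Sum>i<n. \<Sum>j<n. fps_const (x $$ (i,j)) * G $$ (j,i)) $ k = 0 $ k" using tr by simp
  qed
  finally have D': "fps_deriv D = 0" by simp
  \<comment> \<open>A vanishing derivative only says that \<open>Suc k\<close> times this
    coefficient is 0. This is where torsion has to be excluded.\<close>
  have DS: "D $ Suc k = 0" for k
  proof -
    have "fps_deriv D $ k = 0" using D' by simp
    then show ?thesis using tf[of k "D $ Suc k"] by simp
  qed
  have D0: "D $ 0 = 1"
  proof -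
    have "D $ 0 = det (map_mat (\<lambda>f. f $ 0) B)"
    proof -
      have "comm_ring_hom (\<lambda>f :: 'a fps. f $ 0)" by unfold_locales auto
      from comm_ring_hom.hom_det[OF this] show ?thesis by (simp add: D_def)
    qed
    also have "map_mat (\<lambda>f. f $ 0) B = 1\<^sub>m n" by (rule eq_matI) (auto simp: B_def)
    finally show ?thesis by simp
  qed
  have D1: "D = 1"
  proof (rule fps_ext)
    fix k show "D $ k = 1 $ k" by (cases k) (simp_all add: D0 DS)
  qed
  have "(x ^\<^sub>m n) $$ (i,j) = G $$ (i,j) $ n" using ij by (simp add: G_def)
  also have "\<dots> = cofactor B j i $ n" using cof[of j i] ij D1 by simp
  also have "\<dots> = 0"
  proof -
    have "det (mat_delete B j i) $ n = 0"
    proof (rule fps_det_nth_eq_0)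
      show "mat_delete B j i \<in> carrier_mat (n - 1) (n - 1)" using B by (rule mat_delete_carrier)
    qed (use n ij in \<open>auto simp: mat_delete_def B_def\<close>)
    moreover have "(-1 :: 'a fps) ^ m = 1 \<or> (-1 :: 'a fps) ^ m = -1" for m
      by (induct m) auto
    ultimately show ?thesis unfolding cofactor_def by (metis fps_neg_nth minus_zero mult_1 mult_minus1)
  qed
  finally show ?thesis .
qed


section \<open>A Grassmann algebra\<close>

definition alternating :: "('a list \<Rightarrow> int) \<Rightarrow> bool" where
  "alternating L \<longleftrightarrow> (\<forall>u v i j. L (u @ [i, j] @ v) = - L (u @ [j, i] @ v))"

definition word_functional :: "('a list \<Rightarrow> int) \<Rightarrow> ('a, int) free_algebra \<Rightarrow> int" where
  "word_functional L = lin (\<lambda>w c. c * L (letters w))"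

lemma word_functional_add: "word_functional L (x + y) = word_functional L x + word_functional L y"
  unfolding word_functional_def by (rule lin_add) (simp_all add: algebra_simps)

lemma word_functional_single [simp]:
  "word_functional L (Poly_Mapping.single w c) = c * L (letters w)"
  unfolding word_functional_def by (rule lin_single) simp

lemma word_functional_zero [simp]: "word_functional L 0 = 0"
  by (simp add: word_functional_def)

lemma word_functional_uminus: "word_functional L (- x) = - word_functional L x"
  using word_functional_add[of L "- x" x] by simp

lemma word_functional_sum: "word_functional L (sum f A) = (\<Sum>x\<in>A. word_functional L (f x))"
  by (induct A rule: infinite_finite_induct) (simp_all add: word_functional_add)

lemma word_functional_mult_left:
  "word_functional L (Poly_Mapping.single u c * x) = c * word_functional (\<lambda>w. L (letters u @ w)) x"
  by (induct x rule: single_induct)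
    (simp_all add: mult_single plus_word_def distrib_left word_functional_add)

lemma word_functional_mult_right:
  "word_functional L (x * Poly_Mapping.single v c) = c * word_functional (\<lambda>w. L (w @ letters v)) x"
  by (induct x rule: single_induct)
    (simp_all add: mult_single plus_word_def distrib_left distrib_right word_functional_add)

text \<open>The relations of a Grassmann algebra, described dually as the common kernel of all
  alternating functionals and not by generators. In this form torsion-freeness of the quotient is
  immediate, and any alternating functional, in particular the sign of a word, may be evaluated on a
  representative of an element that is known to vanish.\<close>

definition grass_ideal :: "(nat, int) free_algebra set" where
  "grass_ideal = {x. \<forall>L. alternating L \<longrightarrow> word_functional L x = 0}"

lemma alternatingD: "alternating L \<Longrightarrow> L (u @ [i, j] @ v) = - L (u @ [j, i] @ v)"
  unfolding alternating_def by blast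

text \<open>Multiplication by a word shifts the functional. Stability of the alternating functionals
  under shifts on either side makes their common kernel a two-sided ideal.\<close>

lemma alternating_shift_left:
  assumes "alternating L"
  shows "alternating (\<lambda>w. L (u @ w))"
  unfolding alternating_def using alternatingD[OF assms, of "u @ x" for x]
  unfolding append_assoc by blast

lemma alternating_shift_right:
  assumes "alternating L"
  shows "alternating (\<lambda>w. L (w @ v))"
  unfolding alternating_def using alternatingD[OF assms, of _ _ _ "x @ v" for x]
  unfolding append_assoc by blast

lemma grass_ideal_zero: "0 \<in> grass_ideal" by (simp add: grass_ideal_def)

lemma grass_ideal_add: "x \<in> grass_ideal \<Longrightarrow> y \<in> grass_ideal \<Longrightarrow> x + y \<in> grass_ideal"
  by (simp add: grass_ideal_def word_functional_add)

lemma grass_ideal_uminus: "x \<in> grass_ideal \<Longrightarrow> - x \<in> grass_ideal"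
  by (simp add: grass_ideal_def word_functional_uminus)

lemma grass_ideal_mult_left: "x \<in> grass_ideal \<Longrightarrow> y * x \<in> grass_ideal"
proof (induct y rule: single_induct)
  case (single w c)
  then show ?case
    by (auto simp: grass_ideal_def word_functional_mult_left alternating_shift_left)
qed (simp add: distrib_right grass_ideal_add)

lemma grass_ideal_mult_right: "x \<in> grass_ideal \<Longrightarrow> x * y \<in> grass_ideal"
proof (induct y rule: single_induct)
  case (single w c)
  then show ?case
    by (auto simp: grass_ideal_def word_functional_mult_right alternating_shift_right)
qed (simp add: distrib_left grass_ideal_add)

definition grass_rel :: "(nat, int) free_algebra \<Rightarrow> (nat, int) free_algebra \<Rightarrow> bool" where
  "grass_rel x y \<longleftrightarrow> x - y \<in> grass_ideal"

quotient_type grassmann = "(nat, int) free_algebra" / grass_rel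
proof (rule equivpI)
  show "reflp grass_rel" by (simp add: reflp_def grass_rel_def grass_ideal_zero)
  show "symp grass_rel"
    unfolding symp_def grass_rel_def using grass_ideal_uminus[of "x - y" for x y] by simp
  show "transp grass_rel"
    unfolding transp_def grass_rel_def using grass_ideal_add[of "x - y" "y - z" for x y z] by simp
qed

instantiation grassmann :: ring_1
begin

lift_definition zero_grassmann :: grassmann is 0 .
lift_definition one_grassmann :: grassmann is 1 .
lift_definition plus_grassmann :: "grassmann \<Rightarrow> grassmann \<Rightarrow> grassmann" is "(+)"
  unfolding grass_rel_def using grass_ideal_add[of "a - b" "c - d" for a b c d]
  by (simp add: add_diff_add)
lift_definition uminus_grassmann :: "grassmann \<Rightarrow> grassmann" is uminus
  unfolding grass_rel_def using grass_ideal_uminus[of "a - b" for a b] by simp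
lift_definition minus_grassmann :: "grassmann \<Rightarrow> grassmann \<Rightarrow> grassmann" is "(-)"
  unfolding grass_rel_def
proof -
  fix a b c d :: "(nat, int) free_algebra"
  assume "a - b \<in> grass_ideal" "c - d \<in> grass_ideal"
  then have "(a - b) + - (c - d) \<in> grass_ideal" by (intro grass_ideal_add grass_ideal_uminus)
  then show "a - c - (b - d) \<in> grass_ideal" by (simp add: algebra_simps)
qed
lift_definition times_grassmann :: "grassmann \<Rightarrow> grassmann \<Rightarrow> grassmann" is "(*)"
  unfolding grass_rel_def
proof -
  fix a b c d :: "(nat, int) free_algebra"
  assume "a - b \<in> grass_ideal" "c - d \<in> grass_ideal"
  then have "(a - b) * c + b * (c - d) \<in> grass_ideal"
    by (intro grass_ideal_add grass_ideal_mult_left grass_ideal_mult_right)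
  then show "a * c - b * d \<in> grass_ideal" by (simp add: algebra_simps)
qed

instance
proof
  show "(0::grassmann) \<noteq> 1"
  proof (transfer, unfold grass_rel_def, rule notI)
    \<comment> \<open>The functional reading off the constant term; it is alternating for the
      trivial reason that the words compared are nonempty.\<close>
    let ?L = "\<lambda>w :: nat list. if w = [] then 1 else 0 :: int"
    assume *: "(0 :: (nat, int) free_algebra) - 1 \<in> grass_ideal"
    have "alternating ?L" by (simp add: alternating_def)
    with * have "word_functional ?L (0 - Poly_Mapping.single (Word []) 1) = 0"
      unfolding grass_ideal_def single_Nil const_1 by blast
    then show False by (simp add: word_functional_uminus)
  qed
qed (transfer, simp only: grass_rel_def, simp add: grass_ideal_zero algebra_simps)+

end

lift_definition odd_gen :: "nat \<Rightarrow> grassmann" is gen .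

lemma odd_gen_anticommute: "odd_gen s * odd_gen t = - (odd_gen t * odd_gen s)"
proof (transfer, unfold grass_rel_def grass_ideal_def, intro CollectI allI impI)
  fix s t :: nat and L :: "nat list \<Rightarrow> int"
  assume "alternating L"
  then have "L [s, t] = - L [t, s]" using alternatingD[of L "[]" s t "[]"] by simp
  moreover have "gen s * gen t - - (gen t * gen s) =
      Poly_Mapping.single (Word [s, t]) 1 + Poly_Mapping.single (Word [t, s]) (1::int)"
    by (simp add: gen_def mult_single plus_word_def)
  ultimately show "word_functional L (gen s * gen t - - (gen t * gen s)) = 0"
    by (simp add: word_functional_add)
qed

lemma of_nat_abs_grassmann: "of_nat m * abs_grassmann f = abs_grassmann (of_nat m * f)"
  by (induct m)
    (simp_all add: zero_grassmann_def times_grassmann.abs_eq plus_grassmann.abs_eq distrib_right)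

lemma abs_grassmann_eq_0_iff: "abs_grassmann f = 0 \<longleftrightarrow> f \<in> grass_ideal"
  by (simp add: zero_grassmann_def grassmann.abs_eq_iff grass_rel_def)

text \<open>The functionals that define the ideal have integer values, so a positive multiple of
  \<open>f\<close> lies in their kernels only together with \<open>f\<close>.\<close>

lemma grassmann_torsion_free:
  assumes "of_nat (Suc k) * (x::grassmann) = 0"
  shows "x = 0"
  using assms
proof (induct x rule: grassmann.abs_induct)
  case (1 f)
  then have *: "of_nat (Suc k) * f \<in> grass_ideal"
    by (simp only: of_nat_abs_grassmann abs_grassmann_eq_0_iff)
  have "word_functional L (of_nat m * f) = of_nat m * word_functional L f" for m L
    by (induct m) (simp_all add: word_functional_add algebra_simps)
  with * have "f \<in> grass_ideal" by (auto simp: grass_ideal_def simp del: of_nat_Suc)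
  then show ?case by (simp add: abs_grassmann_eq_0_iff)
qed

lemma grassmann_induct [case_names const gen add]:
  assumes const: "\<And>c. P (abs_grassmann (const c))" and gen: "\<And>s x. P x \<Longrightarrow> P (odd_gen s * x)"
    and add: "\<And>x y. P x \<Longrightarrow> P y \<Longrightarrow> P (x + y)"
  shows "P (x :: grassmann)"
proof (induct x rule: grassmann.abs_induct)
  case (1 f)
  show "P (abs_grassmann f)"
  proof (induct f rule: free_algebra_induct)
    case (gen s f)
    have "abs_grassmann (gen s * f) = odd_gen s * abs_grassmann f"
      by (simp add: odd_gen.abs_eq times_grassmann.abs_eq)
    then show ?case using assms(2) gen by simp
  next
    case (add f g)
    have "abs_grassmann (f + g) = abs_grassmann f + abs_grassmann g"
      by (simp add: plus_grassmann.abs_eq)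
    then show ?case using assms(3) add by simp
  qed (rule const)
qed

lemma abs_grassmann_const_central: "abs_grassmann (const c) * x = x * abs_grassmann (const c)"
  by (induct x rule: grassmann.abs_induct) (simp add: times_grassmann.abs_eq const_central)

definition central :: "'a::ring_1 \<Rightarrow> bool" where
  "central x \<longleftrightarrow> (\<forall>y. x * y = y * x)"

lemma centralD: "central x \<Longrightarrow> x * y = y * x"
  unfolding central_def by blast

lemma central_0: "central 0" and central_1: "central 1"
  by (simp_all add: central_def)

lemma central_add:
  assumes "central x" "central y"
  shows "central (x + y)"
  unfolding central_def distrib_left distrib_right centralD[OF assms(1)] centralD[OF assms(2)]
  by blast

lemma central_uminus:
  assumes "central x"
  shows "central (- x)"
  unfolding central_def mult_minus_left mult_minus_right centralD[OF assms] by blast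

lemma central_diff: "central x \<Longrightarrow> central y \<Longrightarrow> central (x - y)"
  using central_add[of x "- y"] central_uminus[of y] by simp

lemma central_mult:
  assumes "central x" "central y"
  shows "central (x * y)"
  unfolding central_def
proof
  fix z
  have "(x * y) * z = x * (z * y)" by (simp only: mult.assoc centralD[OF assms(2), of z])
  also have "\<dots> = (z * x) * y" by (simp only: mult.assoc[symmetric] centralD[OF assms(1), of z])
  finally show "(x * y) * z = z * (x * y)" by (simp only: mult.assoc)
qed

text \<open>
  The square of a matrix with entries of odd degree has entries of even degree, which are central. The
  centre provides the commutative coefficient ring that determinants require.
\<close>

typedef grassmann_center = "{x :: grassmann. central x}"
  by (rule exI[of _ 0]) (simp add: central_0)

setup_lifting type_definition_grassmann_center

instantiation grassmann_center :: comm_ring_1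
begin

lift_definition zero_grassmann_center :: grassmann_center is 0 by (rule central_0)
lift_definition one_grassmann_center :: grassmann_center is 1 by (rule central_1)
lift_definition plus_grassmann_center :: "grassmann_center \<Rightarrow> grassmann_center \<Rightarrow> grassmann_center" is "(+)"
  by (rule central_add)
lift_definition uminus_grassmann_center :: "grassmann_center \<Rightarrow> grassmann_center" is uminus
  by (rule central_uminus)
lift_definition minus_grassmann_center :: "grassmann_center \<Rightarrow> grassmann_center \<Rightarrow> grassmann_center" is "(-)"
  by (rule central_diff)
lift_definition times_grassmann_center :: "grassmann_center \<Rightarrow> grassmann_center \<Rightarrow> grassmann_center" is "(*)"
  by (rule central_mult)

instance
proof
  fix a b :: grassmann_center
  show "a * b = b * a" by transfer (rule centralD)
qed (transfer, simp add: distrib_right mult.assoc)+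

end

lemma Rep_center_sum:
  "Rep_grassmann_center (sum f A) = (\<Sum>x\<in>A. Rep_grassmann_center (f x))"
  by (induct A rule: infinite_finite_induct)
    (simp_all add: zero_grassmann_center.rep_eq plus_grassmann_center.rep_eq)

lemma grassmann_center_torsion_free:
  assumes "of_nat (Suc k) * (x::grassmann_center) = 0"
  shows "x = 0"
proof -
  have "Rep_grassmann_center (of_nat m * x) = of_nat m * Rep_grassmann_center x" for m
    by (induct m) (simp_all add: zero_grassmann_center.rep_eq plus_grassmann_center.rep_eq algebra_simps)
  from this[of "Suc k"] assms have "of_nat (Suc k) * Rep_grassmann_center x = 0"
    by (simp add: zero_grassmann_center.rep_eq del: of_nat_Suc)
  from grassmann_torsion_free[OF this] show ?thesis
    by (simp add: Rep_grassmann_center_inject[symmetric] zero_grassmann_center.rep_eq)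
qed


section \<open>The Amitsur--Levitzki theorem\<close>

primrec mpow :: "nat \<Rightarrow> (nat \<Rightarrow> nat \<Rightarrow> 'a::ring_1) \<Rightarrow> nat \<Rightarrow> nat \<Rightarrow> nat \<Rightarrow> 'a" where
  "mpow n a 0 = (\<lambda>i j. if i = j then 1 else 0)"
| "mpow n a (Suc k) = (\<lambda>i j. \<Sum>m<n. a i m * mpow n a k m j)"

lemma mpow_Suc2:
  "i < n \<Longrightarrow> j < n \<Longrightarrow> mpow n a (Suc k) i j = (\<Sum>m<n. mpow n a k i m * a m j)"
proof (induct k arbitrary: i)
  case 0
  have "(\<Sum>m<n. a i m * (if m = j then 1 else 0)) = a i j"
    using 0 by (simp add: if_distrib cong: if_cong)
  moreover have "(\<Sum>m<n. (if i = m then 1 else 0) * a m j) = a i j"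
    using 0 by (simp add: if_distribR if_distrib cong: if_cong)
  ultimately show ?case by simp
next
  case (Suc k)
  have "mpow n a (Suc (Suc k)) i j = (\<Sum>m<n. a i m * mpow n a (Suc k) m j)" by simp
  also have "\<dots> = (\<Sum>m<n. a i m * (\<Sum>r<n. mpow n a k m r * a r j))"
    using Suc by (intro sum.cong refl) auto
  also have "\<dots> = (\<Sum>r<n. (\<Sum>m<n. a i m * mpow n a k m r) * a r j)"
    unfolding sum_distrib_left sum_distrib_right mult.assoc by (rule sum.swap)
  finally show ?case by simp
qed

text \<open>An entry of the \<open>k\<close>-th power is a sum of products of \<open>k\<close> odd
  elements, each of which costs one sign. For odd \<open>k\<close> this gives tr (a M) = - tr (M a),
  where M is an odd power of a.\<close>

lemma mpow_anticommute:
  assumes anti: "\<And>i j r s. i < n \<Longrightarrow> j < n \<Longrightarrow> r < n \<Longrightarrow> s < n \<Longrightarrow> a i j * a r s = - (a r s * (a i j :: 'a::ring_1))"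
    and "i < n" "j < n" "r < n" "s < n"
  shows "a i j * mpow n a k r s = (-1) ^ k * (mpow n a k r s * a i j)"
  using assms(2-)
proof (induct k arbitrary: r)
  case (Suc k)
  have *: "(-1 :: 'a) ^ k * x = x * (-1) ^ k" for x
    by (induct k) (simp_all add: mult.assoc[symmetric])
  have "a i j * mpow n a (Suc k) r s = (\<Sum>m<n. (a i j * a r m) * mpow n a k m s)"
    by (simp add: sum_distrib_left mult.assoc)
  also have "\<dots> = (\<Sum>m<n. - (a r m * (a i j * mpow n a k m s)))"
  proof (intro sum.cong refl)
    fix m assume "m \<in> {..<n}"
    with Suc.prems have "a i j * a r m = - (a r m * a i j)" by (intro anti) auto
    then show "a i j * a r m * mpow n a k m s = - (a r m * (a i j * mpow n a k m s))"
      by (simp only: mult_minus_left mult.assoc)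
  qed
  also have "\<dots> = (\<Sum>m<n. - (a r m * ((-1) ^ k * (mpow n a k m s * a i j))))"
    using Suc by (intro sum.cong refl) simp
  also have "\<dots> = (\<Sum>m<n. - ((-1) ^ k * (a r m * mpow n a k m s * a i j)))"
  proof (intro sum.cong refl arg_cong[of _ _ uminus])
    fix m
    have "a r m * ((-1) ^ k * (mpow n a k m s * a i j)) = (a r m * (-1) ^ k) * (mpow n a k m s * a i j)"
      by (simp only: mult.assoc)
    then show "a r m * ((-1) ^ k * (mpow n a k m s * a i j)) = (-1) ^ k * (a r m * mpow n a k m s * a i j)"
      by (simp only: *[symmetric] mult.assoc)
  qed
  also have "\<dots> = (-1) ^ Suc k * (mpow n a (Suc k) r s * a i j)"
    by (simp add: sum_distrib_left sum_distrib_right sum_negf mult.assoc)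
  finally show ?case .
qed auto

text \<open>The square \<open>x\<close> of the matrix has central entries. The trace of the power
  \<open>k + 1\<close> of \<open>x\<close> is tr (a M), where M is the power
  \<open>2 * k + 1\<close> of \<open>a\<close>; it equals its own negative and so is 0. By the
  commutative criterion the \<open>n\<close>-th power of \<open>x\<close>, which is the power
  \<open>2 * n\<close> of \<open>a\<close>, vanishes.\<close>

lemma odd_matrix_nilpotent:
  assumes anti: "\<And>i j r s. i < n \<Longrightarrow> j < n \<Longrightarrow> r < n \<Longrightarrow> s < n \<Longrightarrow> a i j * a r s = - (a r s * (a i j :: grassmann))"
    and central: "\<And>i j r s y. i < n \<Longrightarrow> j < n \<Longrightarrow> r < n \<Longrightarrow> s < n \<Longrightarrow> (a i j * a r s) * y = y * (a i j * a r s)"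
    and ij: "i < n" "j < n"
  shows "mpow n a (2 * n) i j = 0"
proof -
  define b where "b i j = (\<Sum>m<n. a i m * a m j)" for i j
  define x where "x = mat n n (\<lambda>(i,j). Abs_grassmann_center (b i j))"
  have Rep: "Rep_grassmann_center (Abs_grassmann_center (b i j)) = b i j" if "i < n" "j < n" for i j
  proof (rule Abs_grassmann_center_inverse, unfold mem_Collect_eq central_def, rule allI)
    fix y show "b i j * y = y * b i j"
      unfolding b_def sum_distrib_left sum_distrib_right
      using that by (intro sum.cong refl) (simp add: central)
  qed
  have x: "x \<in> carrier_mat n n" by (simp add: x_def)
  have pow: "Rep_grassmann_center ((x ^\<^sub>m k) $$ (i,j)) = mpow n a (2 * k) i j" if "i < n" "j < n" for i j k
    using that
  proof (induct k arbitrary: j)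
    case 0
    then show ?case using x by (simp add: one_grassmann_center.rep_eq zero_grassmann_center.rep_eq)
  next
    case (Suc k)
    have c: "x ^\<^sub>m k \<in> carrier_mat n n" using x by simp
    have "(x ^\<^sub>m Suc k) $$ (i,j) = (\<Sum>m<n. (x ^\<^sub>m k) $$ (i,m) * x $$ (m,j))"
      using Suc.prems x c by (simp add: scalar_prod_def lessThan_atLeast0)
    then have "Rep_grassmann_center ((x ^\<^sub>m Suc k) $$ (i,j)) = (\<Sum>m<n. mpow n a (2 * k) i m * b m j)"
      using Suc by (simp add: Rep_center_sum times_grassmann_center.rep_eq Rep x_def del: pow_mat.simps)
    also have "\<dots> = (\<Sum>r<n. (\<Sum>m<n. mpow n a (2 * k) i m * a m r) * a r j)"
      unfolding b_def sum_distrib_left sum_distrib_right mult.assoc by (rule sum.swap)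
    also have "\<dots> = (\<Sum>r<n. mpow n a (Suc (2 * k)) i r * a r j)"
      using Suc.prems by (intro sum.cong refl) (simp add: mpow_Suc2 del: mpow.simps)
    also have "\<dots> = mpow n a (Suc (Suc (2 * k))) i j"
      using Suc.prems by (simp add: mpow_Suc2 del: mpow.simps)
    finally show ?case by simp
  qed
  have tr: "(\<Sum>i<n. (x ^\<^sub>m Suc k) $$ (i,i)) = 0" for k
  proof -
    define M where "M = mpow n a (Suc (2 * k))"
    have S1: "(\<Sum>i<n. mpow n a (Suc (Suc (2 * k))) i i) = (\<Sum>i<n. \<Sum>m<n. a i m * M m i)"
      by (simp add: M_def)
    also have "\<dots> = (\<Sum>i<n. \<Sum>m<n. - (M m i * a i m))"
      unfolding M_def by (intro sum.cong refl, subst mpow_anticommute[OF anti]) (auto simp del: mpow.simps)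
    also have "\<dots> = - (\<Sum>m<n. \<Sum>i<n. M m i * a i m)"
      by (subst sum.swap) (simp add: sum_negf)
    also have "(\<Sum>m<n. \<Sum>i<n. M m i * a i m) = (\<Sum>m<n. mpow n a (Suc (Suc (2 * k))) m m)"
      unfolding M_def by (intro sum.cong refl) (simp add: mpow_Suc2 del: mpow.simps)
    finally have *: "(\<Sum>i<n. mpow n a (Suc (Suc (2 * k))) i i) = - (\<Sum>i<n. mpow n a (Suc (Suc (2 * k))) i i)" .
    have "of_nat (Suc 1) * T = 0" if "T = - T" for T :: grassmann
      using that mult_2[of T] by (simp add: eq_neg_iff_add_eq_0)
    from grassmann_torsion_free[OF this[OF *]]
    have "(\<Sum>i<n. mpow n a (2 * Suc k) i i) = 0" by (simp del: mpow.simps)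
    then have "Rep_grassmann_center (\<Sum>i<n. (x ^\<^sub>m Suc k) $$ (i,i)) = 0"
      by (simp add: Rep_center_sum pow del: pow_mat.simps mpow.simps)
    then show ?thesis
      by (simp add: Rep_grassmann_center_inject[symmetric] zero_grassmann_center.rep_eq del: pow_mat.simps)
  qed
  have "(x ^\<^sub>m n) $$ (i,j) = 0"
    by (rule pow_mat_eq_0_if_traces_0[OF x _ grassmann_center_torsion_free tr]) (use ij in auto)
  then show ?thesis using pow[OF ij, of n] by (simp add: zero_grassmann_center.rep_eq)
qed

text \<open>\<open>e s\<close> is the position of the matrix unit with label \<open>s\<close>. A
  product of matrix units has the entry 1 at \<open>(i, j)\<close>, and not 0, exactly when the
  positions join up to a path from \<open>i\<close> to \<open>j\<close>.\<close>

primrec is_path :: "(nat \<Rightarrow> 'i \<times> 'i) \<Rightarrow> 'i \<Rightarrow> nat list \<Rightarrow> 'i \<Rightarrow> bool" where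
  "is_path e i [] j \<longleftrightarrow> i = j"
| "is_path e i (s # \<sigma>) j \<longleftrightarrow> fst (e s) = i \<and> is_path e (snd (e s)) \<sigma> j"

text \<open>The matrix is a combination of matrix units with coefficients \<open>x s\<close>.
  Expanding its power gives one term for each sequence of labels, with the coefficients multiplied
  in the order of the path.\<close>

lemma mpow_eq_sum_paths:
  assumes S: "finite S" and e: "\<And>s. s \<in> S \<Longrightarrow> fst (e s) < n \<and> snd (e s) < n"
    and a: "\<And>i j. a i j = (\<Sum>s\<in>S. if e s = (i, j) then (x s :: 'a::ring_1) else 0)"
    and ij: "i < n" "j < n"
  shows "mpow n a k i j =
    (\<Sum>\<sigma> | set \<sigma> \<subseteq> S \<and> length \<sigma> = k. if is_path e i \<sigma> j then prod_list (map x \<sigma>) else 0)"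
  using ij
proof (induct k arbitrary: i)
  case 0
  have "{\<sigma>. set \<sigma> \<subseteq> S \<and> length \<sigma> = 0} = {[]}" by auto
  then show ?case by simp
next
  case (Suc k)
  let ?L = "{\<sigma>. set \<sigma> \<subseteq> S \<and> length \<sigma> = k}"
  have fin: "finite ?L" using S by (rule finite_lists_length_eq)
  let ?p = "\<lambda>m \<sigma>. if is_path e m \<sigma> j then prod_list (map x \<sigma>) else 0"
  have "mpow n a (Suc k) i j = (\<Sum>m<n. a i m * (\<Sum>\<sigma>\<in>?L. ?p m \<sigma>))"
    using Suc by simp
  also have "\<dots> = (\<Sum>m<n. \<Sum>\<sigma>\<in>?L. \<Sum>s\<in>S. (if e s = (i, m) then x s else 0) * ?p m \<sigma>)"
    unfolding a sum_distrib_left sum_distrib_right by (rule refl)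
  also have "\<dots> = (\<Sum>\<sigma>\<in>?L. \<Sum>s\<in>S. \<Sum>m<n. (if e s = (i, m) then x s else 0) * ?p m \<sigma>)"
  proof -
    have "(\<Sum>s\<in>S. \<Sum>m<n. (if e s = (i, m) then x s else 0) * ?p m \<sigma>) =
        (\<Sum>m<n. \<Sum>s\<in>S. (if e s = (i, m) then x s else 0) * ?p m \<sigma>)" for \<sigma>
      by (rule sum.swap)
    then show ?thesis by (simp only: sum.swap[of _ ?L])
  qed
  also have "\<dots> = (\<Sum>\<sigma>\<in>?L. \<Sum>s\<in>S. ?p i (s # \<sigma>))"
  proof (intro sum.cong refl)
    fix \<sigma> s assume s: "s \<in> S"
    have "(\<Sum>m<n. (if e s = (i, m) then x s else 0) * ?p m \<sigma>) =
        (\<Sum>m<n. if m = snd (e s) then ?p i (s # \<sigma>) else 0)"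
      by (intro sum.cong refl) (auto simp: prod_eq_iff)
    then show "(\<Sum>m<n. (if e s = (i, m) then x s else 0) * ?p m \<sigma>) = ?p i (s # \<sigma>)"
      using e[OF s] by simp
  qed
  also have "\<dots> = (\<Sum>\<sigma>\<in>{\<sigma>. set \<sigma> \<subseteq> S \<and> length \<sigma> = Suc k}. ?p i \<sigma>)"
    unfolding lists_length_Suc_eq sum.cartesian_product
    by (subst sum.reindex) (auto simp: inj_on_def intro!: sum.cong)
  finally show ?case by simp
qed

text \<open>For a permutation of \<open>0, ..., n - 1\<close> this is its sign. The determinant
  extends it to all words, with value 0 if a letter is repeated, and exchanging neighbours becomes
  exchanging rows.\<close>

definition list_sgn :: "nat list \<Rightarrow> int" where
  "list_sgn \<sigma> = det (mat (length \<sigma>) (length \<sigma>) (\<lambda>(i,j). if \<sigma> ! i = j then 1 else 0))"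

lemma list_sgn_upt: "list_sgn [0..<n] = 1"
proof -
  have "mat n n (\<lambda>(i,j). if [0..<n] ! i = j then 1 else 0) = (1\<^sub>m n :: int mat)"
    by (rule eq_matI) auto
  then show ?thesis by (simp add: list_sgn_def)
qed

lemma list_sgn_not_distinct:
  assumes "\<not> distinct \<sigma>"
  shows "list_sgn \<sigma> = 0"
proof -
  from assms obtain i j where "i < length \<sigma>" "j < length \<sigma>" "i \<noteq> j" "\<sigma> ! i = \<sigma> ! j"
    by (auto simp: distinct_conv_nth)
  then show ?thesis unfolding list_sgn_def
    by (intro det_identical_rows[of _ "length \<sigma>" i j]) (auto intro!: eq_vecI)
qed

lemma alternating_list_sgn: "alternating list_sgn"
  unfolding alternating_def
proof (intro allI)
  fix u v :: "nat list" and a b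
  let ?n = "length u + 2 + length v" and ?i = "length u" and ?j = "Suc (length u)"
  let ?M = "\<lambda>\<sigma>. mat ?n ?n (\<lambda>(i,j). if \<sigma> ! i = j then 1 else 0 :: int)"
  have "?M (u @ [a, b] @ v) = swaprows ?i ?j (?M (u @ [b, a] @ v))"
  proof (rule eq_matI)
    fix i j assume "i < dim_row (swaprows ?i ?j (?M (u @ [b, a] @ v)))"
      and "j < dim_col (swaprows ?i ?j (?M (u @ [b, a] @ v)))"
    then have ij: "i < ?n" "j < ?n" by simp_all
    consider "i < ?i" | "i = ?i" | "i = ?j" | k where "i = Suc (Suc (length u + k))"
      by (metis less_Suc_eq less_iff_Suc_add not_less_iff_gr_or_eq)
    then show "?M (u @ [a, b] @ v) $$ (i, j) = swaprows ?i ?j (?M (u @ [b, a] @ v)) $$ (i, j)"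
      using ij by cases (simp_all add: mat_swaprows_def nth_append)
  qed simp_all
  moreover have "det (swaprows ?i ?j (?M (u @ [b, a] @ v))) = - det (?M (u @ [b, a] @ v))"
    by (rule det_swaprows[of _ ?n]) auto
  ultimately show "list_sgn (u @ [a, b] @ v) = - list_sgn (u @ [b, a] @ v)"
    by (simp add: list_sgn_def)
qed

text \<open>The theorem for matrix units, with integral coefficients. Let \<open>a\<close> be the
  combination of the \<open>2 * n\<close> given matrix units with the odd generators as
  coefficients. Its power \<open>2 * n\<close> vanishes. Each entry is a sum of words along paths;
  the functional \<open>list_sgn\<close> discards the words with a repeated label and weights the
  others by their sign.\<close>

lemma sum_list_sgn_paths:
  assumes e: "\<And>s. s < 2 * n \<Longrightarrow> fst (e s) < n \<and> snd (e s) < n" and ij: "i < n" "j < n"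
  shows "(\<Sum>\<sigma>\<in>permutations_of_set {..<2 * n}. if is_path e i \<sigma> j then list_sgn \<sigma> else 0) = 0"
proof -
  let ?N = "2 * n"
  let ?S = "{..<?N}"
  let ?L = "{\<sigma>. set \<sigma> \<subseteq> ?S \<and> length \<sigma> = ?N}"
  define a where "a i j = (\<Sum>s\<in>?S. if e s = (i, j) then odd_gen s else 0)" for i j
  have fin: "finite ?L" by (rule finite_lists_length_eq) simp
  have lin_anti: "x * odd_gen t = - (odd_gen t * x)" if "x = sum odd_gen T" for x T t
    unfolding that by (simp add: sum_distrib_left sum_distrib_right odd_gen_anticommute[of _ t] sum_negf)
  have a': "a i j = sum odd_gen {s\<in>?S. e s = (i, j)}" for i j
    unfolding a_def by (rule sum.inter_filter[symmetric]) simp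
  have anti_gen: "a i j * odd_gen t = - (odd_gen t * a i j)" for i j t
    by (rule lin_anti[OF a'])
  have anti: "a i j * a r s = - (a r s * a i j)" for i j r s
    unfolding a'[of r s] by (simp add: sum_distrib_left sum_distrib_right anti_gen sum_negf)
  have central: "(a i j * a r s) * y = y * (a i j * a r s)" for i j r s y
  proof (induct y rule: grassmann_induct)
    case (const c)
    show ?case by (rule abs_grassmann_const_central[symmetric])
  next
    case (gen t x)
    have "(a i j * a r s) * odd_gen t = odd_gen t * (a i j * a r s)"
      unfolding mult.assoc anti_gen[of r s] mult_minus_right
      unfolding mult.assoc[symmetric] anti_gen[of i j] by simp
    then have "(a i j * a r s) * (odd_gen t * x) = odd_gen t * ((a i j * a r s) * x)"
      by (simp only: mult.assoc[symmetric])
    also have "\<dots> = odd_gen t * (x * (a i j * a r s))" by (simp only: gen)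
    finally show ?case by (simp only: mult.assoc)
  qed (simp add: algebra_simps)
  have "prod_list (map odd_gen \<sigma>) = abs_grassmann (Poly_Mapping.single (Word \<sigma>) 1)" for \<sigma>
    by (induct \<sigma>) (simp_all add: single_Nil single_Cons odd_gen.abs_eq times_grassmann.abs_eq one_grassmann_def)
  moreover have abs_sum: "abs_grassmann (\<Sum>x\<in>A. f x) = (\<Sum>x\<in>A. abs_grassmann (f x))" for f and A :: "nat list set"
    by (induct A rule: infinite_finite_induct) (simp_all add: zero_grassmann_def plus_grassmann.abs_eq[symmetric])
  ultimately have "abs_grassmann (\<Sum>\<sigma>\<in>?L. if is_path e i \<sigma> j then Poly_Mapping.single (Word \<sigma>) 1 else 0) =
      (\<Sum>\<sigma>\<in>?L. if is_path e i \<sigma> j then prod_list (map odd_gen \<sigma>) else 0)"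
    unfolding abs_sum by (intro sum.cong refl) (simp add: zero_grassmann_def)
  also have "\<dots> = mpow n a ?N i j"
    by (rule mpow_eq_sum_paths[symmetric]) (use e ij in \<open>auto simp: a_def\<close>)
  also have "\<dots> = 0"
    by (rule odd_matrix_nilpotent[OF anti central ij])
  finally have "word_functional list_sgn
      (\<Sum>\<sigma>\<in>?L. if is_path e i \<sigma> j then Poly_Mapping.single (Word \<sigma>) 1 else 0) = 0"
    using alternating_list_sgn unfolding abs_grassmann_eq_0_iff grass_ideal_def by blast
  then have "(\<Sum>\<sigma>\<in>?L. if is_path e i \<sigma> j then list_sgn \<sigma> else 0) = 0"
    by (simp add: word_functional_sum if_distrib[of "word_functional list_sgn"] cong: if_cong)
  moreover have "(\<Sum>\<sigma>\<in>permutations_of_set ?S. if is_path e i \<sigma> j then list_sgn \<sigma> else 0) =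
      (\<Sum>\<sigma>\<in>?L. if is_path e i \<sigma> j then list_sgn \<sigma> else 0)"
  proof (rule sum.mono_neutral_left[OF fin])
    show "permutations_of_set ?S \<subseteq> ?L"
    proof
      fix \<sigma> assume "\<sigma> \<in> permutations_of_set ?S"
      then have "set \<sigma> = ?S" "distinct \<sigma>"
        by (simp_all add: permutations_of_set_def)
      then show "\<sigma> \<in> ?L" using distinct_card[of \<sigma>] by simp
    qed
    show "\<forall>\<sigma>\<in>?L - permutations_of_set ?S. (if is_path e i \<sigma> j then list_sgn \<sigma> else 0) = 0"
    proof
      fix \<sigma> assume \<sigma>: "\<sigma> \<in> ?L - permutations_of_set ?S"
      have "\<not> distinct \<sigma>"
      proof
        assume d: "distinct \<sigma>"
        then have "card (set \<sigma>) = card ?S" using \<sigma> by (simp add: distinct_card)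
        then have "set \<sigma> = ?S" using \<sigma> by (intro card_subset_eq) auto
        then show False using \<sigma> d by (auto simp: permutations_of_set_def)
      qed
      then show "(if is_path e i \<sigma> j then list_sgn \<sigma> else 0) = 0" by (simp add: list_sgn_not_distinct)
    qed
  qed
  ultimately show ?thesis by simp
qed

primrec mprod :: "'i set \<Rightarrow> (nat \<Rightarrow> 'i \<Rightarrow> 'i \<Rightarrow> 'r::comm_ring_1) \<Rightarrow> nat list \<Rightarrow> 'i \<Rightarrow> 'i \<Rightarrow> 'r" where
  "mprod I a [] i j = (if i = j then 1 else 0)"
| "mprod I a (s # \<sigma>) i j = (\<Sum>m\<in>I. a s i m * mprod I a \<sigma> m j)"

lemma is_path_cong: "(\<And>s. s \<in> set \<sigma> \<Longrightarrow> e s = e' s) \<Longrightarrow> is_path e i \<sigma> j = is_path e' i \<sigma> j"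
proof (induct \<sigma> arbitrary: i)
  case (Cons s \<sigma>)
  have "e s = e' s" by (rule Cons.prems) simp
  moreover have "is_path e (snd (e' s)) \<sigma> j = is_path e' (snd (e' s)) \<sigma> j"
    by (rule Cons.hyps) (rule Cons.prems, simp)
  ultimately show ?case by simp
qed simp

text \<open>Multilinear expansion: \<open>e\<close> chooses one entry of each factor. As the labels
  in \<open>\<sigma>\<close> are distinct, the choices are functions on \<open>set \<sigma>\<close>,
  and the product of the chosen entries does not depend on the order of \<open>\<sigma>\<close>;
  only the path condition does.\<close>

lemma mprod_eq_sum_paths:
  assumes I: "finite I" and "distinct \<sigma>" and "i \<in> I" "j \<in> I"
  shows "mprod I a \<sigma> i j = (\<Sum>e\<in>PiE (set \<sigma>) (\<lambda>_. I \<times> I).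
    if is_path e i \<sigma> j then \<Prod>s\<in>set \<sigma>. a s (fst (e s)) (snd (e s)) else 0)"
  using assms(2,3)
proof (induct \<sigma> arbitrary: i)
  case Nil
  then show ?case by simp
next
  case (Cons s \<sigma>)
  let ?P = "PiE (set \<sigma>) (\<lambda>_. I \<times> I)"
  let ?f = "\<lambda>m g. if is_path g m \<sigma> j then \<Prod>s\<in>set \<sigma>. a s (fst (g s)) (snd (g s)) else 0"
  let ?F = "\<lambda>e. if is_path e i (s # \<sigma>) j then \<Prod>s\<in>set (s # \<sigma>). a s (fst (e s)) (snd (e s)) else 0"
  have s: "s \<notin> set \<sigma>" using Cons by simp
  have fP: "finite ?P" using I by (intro finite_PiE) auto
  have F: "?F (g(s := y)) = (if fst y = i then a s i (snd y) * ?f (snd y) g else 0)" for g y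
  proof -
    have "is_path (g(s := y)) (snd y) \<sigma> j = is_path g (snd y) \<sigma> j"
      by (rule is_path_cong) (use s in auto)
    then have 1: "is_path (g(s := y)) i (s # \<sigma>) j \<longleftrightarrow> fst y = i \<and> is_path g (snd y) \<sigma> j"
      by simp
    have "(\<Prod>t\<in>set \<sigma>. a t (fst ((g(s := y)) t)) (snd ((g(s := y)) t))) =
        (\<Prod>t\<in>set \<sigma>. a t (fst (g t)) (snd (g t)))"
      by (intro prod.cong refl) (use s in auto)
    then have 2: "(\<Prod>t\<in>set (s # \<sigma>). a t (fst ((g(s := y)) t)) (snd ((g(s := y)) t))) =
        a s (fst y) (snd y) * (\<Prod>t\<in>set \<sigma>. a t (fst (g t)) (snd (g t)))"
      using s by (simp del: fun_upd_apply) simp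
    show ?thesis unfolding 1 2 by simp
  qed
  have "(\<Sum>e\<in>PiE (set (s # \<sigma>)) (\<lambda>_. I \<times> I). ?F e) = (\<Sum>(y, g)\<in>(I \<times> I) \<times> ?P. ?F (g(s := y)))"
    unfolding list.set PiE_insert_eq
    by (subst sum.reindex[OF inj_combinator[OF s]]) (simp only: o_def split_def)
  also have "\<dots> = (\<Sum>y\<in>I \<times> I. \<Sum>g\<in>?P. if fst y = i then a s i (snd y) * ?f (snd y) g else 0)"
    unfolding F by (rule sum.cartesian_product[symmetric])
  also have "\<dots> = (\<Sum>(r, m)\<in>I \<times> I. if r = i then a s i m * (\<Sum>g\<in>?P. ?f m g) else 0)"
    by (intro sum.cong refl) (simp add: split_def sum_distrib_left)
  also have "\<dots> = (\<Sum>r\<in>I. \<Sum>m\<in>I. if r = i then a s i m * (\<Sum>g\<in>?P. ?f m g) else 0)"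
    by (rule sum.cartesian_product[symmetric])
  also have "\<dots> = (\<Sum>m\<in>I. \<Sum>r\<in>I. if r = i then a s i m * (\<Sum>g\<in>?P. ?f m g) else 0)"
    by (rule sum.swap)
  also have "\<dots> = (\<Sum>m\<in>I. a s i m * (\<Sum>g\<in>?P. ?f m g))"
    by (intro sum.cong refl) (simp add: I Cons.prems(2))
  also have "\<dots> = (\<Sum>m\<in>I. a s i m * mprod I a \<sigma> m j)"
  proof (intro sum.cong refl arg_cong2[of _ _ _ _ "(*)"])
    fix m assume "m \<in> I"
    then show "(\<Sum>g\<in>?P. ?f m g) = mprod I a \<sigma> m j"
      using Cons.prems(1) by (intro Cons.hyps[symmetric]) simp_all
  qed
  also have "\<dots> = mprod I a (s # \<sigma>) i j" by simp
  finally show ?case by (rule sym)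
qed

lemma mprod_reindex:
  assumes b: "bij_betw b {..<n} I" and "i < n" "j < n"
  shows "mprod I a \<sigma> (b i) (b j) = mprod {..<n} (\<lambda>s i j. a s (b i) (b j)) \<sigma> i j"
  using assms(2)
proof (induct \<sigma> arbitrary: i)
  case Nil
  then have "b i = b j \<longleftrightarrow> i = j"
    using b assms(3) by (intro inj_on_eq_iff[of b "{..<n}"]) (auto simp: bij_betw_def)
  then show ?case by simp
next
  case (Cons s \<sigma>)
  have "(\<Sum>m\<in>I. a s (b i) m * mprod I a \<sigma> m (b j)) = (\<Sum>m<n. a s (b i) (b m) * mprod I a \<sigma> (b m) (b j))"
    by (rule sum.reindex_bij_betw[OF b, symmetric])
  also have "\<dots> = (\<Sum>m<n. a s (b i) (b m) * mprod {..<n} (\<lambda>s i j. a s (b i) (b j)) \<sigma> m j)"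
    by (intro sum.cong refl arg_cong2[of _ _ _ _ "(*)"] Cons.hyps) simp
  finally show ?case by simp
qed

text \<open>After expansion into entries and exchange of the sums, each choice \<open>e\<close> of
  positions contributes a product of entries times an integer that depends on \<open>e\<close>
  alone. The integer vanishes by the case of matrix units, so the ring may have any
  characteristic.\<close>

theorem amitsur_levitzki:
  assumes I: "finite I" and n: "card I = n" and ij: "i \<in> I" "j \<in> I"
  shows "(\<Sum>\<sigma>\<in>permutations_of_set {..<2 * n}. of_int (list_sgn \<sigma>) * mprod I a \<sigma> i j) = 0"
proof -
  let ?S = "{..<2 * n}"
  let ?Pm = "permutations_of_set ?S"
  from I n obtain b where b: "bij_betw b {..<n} I"
    using ex_bij_betw_nat_finite[OF I] unfolding lessThan_atLeast0 by blast
  then obtain i' j' where i': "i' < n" "i = b i'" and j': "j' < n" "j = b j'"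
    using ij by (auto simp: bij_betw_def)
  define c where "c s i j = a s (b i) (b j)" for s i j
  let ?E = "PiE ?S (\<lambda>_. {..<n} \<times> {..<n})"
  let ?c = "\<lambda>e. \<Prod>s\<in>?S. c s (fst (e s)) (snd (e s))"
  have "(\<Sum>\<sigma>\<in>?Pm. of_int (list_sgn \<sigma>) * mprod I a \<sigma> i j) =
      (\<Sum>\<sigma>\<in>?Pm. of_int (list_sgn \<sigma>) * (\<Sum>e\<in>?E. if is_path e i' \<sigma> j' then ?c e else 0))"
  proof (rule sum.cong[OF refl])
    fix \<sigma> assume "\<sigma> \<in> ?Pm"
    then have \<sigma>: "set \<sigma> = ?S" "distinct \<sigma>" by (auto simp: permutations_of_set_def)
    show "of_int (list_sgn \<sigma>) * mprod I a \<sigma> i j =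
        of_int (list_sgn \<sigma>) * (\<Sum>e\<in>?E. if is_path e i' \<sigma> j' then ?c e else 0)"
      unfolding i' j' mprod_reindex[OF b i'(1) j'(1)]
      using mprod_eq_sum_paths[of "{..<n}" \<sigma> i' j' "\<lambda>s i j. a s (b i) (b j)"] \<sigma> i'(1) j'(1)
      by (simp add: c_def cong: if_cong)
  qed
  also have "\<dots> = (\<Sum>e\<in>?E. ?c e * of_int (\<Sum>\<sigma>\<in>?Pm. if is_path e i' \<sigma> j' then list_sgn \<sigma> else 0))"
    unfolding sum_distrib_left of_int_sum
    by (subst sum.swap) (intro sum.cong refl, auto)
  also have "\<dots> = 0"
  proof (rule sum.neutral, rule ballI)
    fix e assume e: "e \<in> ?E"
    have "(\<Sum>\<sigma>\<in>?Pm. if is_path e i' \<sigma> j' then list_sgn \<sigma> else 0) = 0"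
    proof (rule sum_list_sgn_paths[OF _ i'(1) j'(1)])
      fix s assume "s < 2 * n"
      then have "e s \<in> {..<n} \<times> {..<n}" using e by auto
      then show "fst (e s) < n \<and> snd (e s) < n" by auto
    qed
    then show "?c e * of_int (\<Sum>\<sigma>\<in>?Pm. if is_path e i' \<sigma> j' then list_sgn \<sigma> else 0) = 0" by simp
  qed
  finally show ?thesis .
qed


section \<open>Commutative rings of operators\<close>

locale comm_action =
  fixes h :: "'r::comm_ring_1 \<Rightarrow> 'm::ab_group_add \<Rightarrow> 'm"
  assumes act_add: "h (a + b) v = h a v + h b v"
    and act_mult: "h (a * b) v = h a (h b v)"
    and act_one [simp]: "h 1 v = v"
    and act_vadd: "h a (v + w) = h a v + h a w"
begin

text \<open>The image of the ring among the operators is never formed; equations are stated up to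
  null elements instead. The coefficient rings can then be plain polynomial rings.\<close>

definition null :: "'r \<Rightarrow> bool" where
  "null a \<longleftrightarrow> (\<forall>v. h a v = 0)"

lemma act_zero [simp]: "h 0 v = 0"
  using act_add[of 0 0 v] by simp

lemma act_vzero [simp]: "h a 0 = 0"
  using act_vadd[of a 0 0] by simp

lemma act_uminus: "h (- a) v = - h a v"
  using act_add[of a "- a" v] by (simp add: eq_neg_iff_add_eq_0 add.commute)

lemma act_diff: "h (a - b) v = h a v - h b v"
  using act_add[of a "- b" v] by (simp add: act_uminus)

lemma act_sum: "h (sum f A) v = (\<Sum>x\<in>A. h (f x) v)"
  by (induct A rule: infinite_finite_induct) (simp_all add: act_add)

lemma act_vsum: "h a (sum f A) = (\<Sum>x\<in>A. h a (f x))"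
  by (induct A rule: infinite_finite_induct) (simp_all add: act_vadd)

lemma act_comm: "h a (h b v) = h b (h a v)"
  by (metis act_mult mult.commute)

lemma null_0 [simp]: "null 0" by (simp add: null_def)
lemma null_add: "null a \<Longrightarrow> null b \<Longrightarrow> null (a + b)" by (simp add: null_def act_add)
lemma null_uminus: "null a \<Longrightarrow> null (- a)" by (simp add: null_def act_uminus)
lemma null_diff: "null a \<Longrightarrow> null b \<Longrightarrow> null (a - b)" by (simp add: null_def act_diff)
lemma null_mult: "null b \<Longrightarrow> null (a * b)" by (simp add: null_def act_mult)
lemma null_mult2: "null a \<Longrightarrow> null (a * b)" by (simp add: null_def act_mult)
lemma null_sum: "(\<And>x. x \<in> A \<Longrightarrow> null (f x)) \<Longrightarrow> null (sum f A)"
  by (induct A rule: infinite_finite_induct) (simp_all add: null_add)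

lemma null_power_diff: "null (a - b) \<Longrightarrow> null (a ^ k - b ^ k)"
  unfolding power_diff_sumr2[of a k b] by (rule null_mult2)

text \<open>This is what Schur's lemma supplies. It implies that a product is null only if one of
  its factors is.\<close>

definition zero_or_bij :: bool where
  "zero_or_bij \<longleftrightarrow> (\<forall>a. null a \<or> bij (h a))"

text \<open>Inverting \<open>a\<close> turns the image of the ring in the operators into a field.\<close>

definition gen_unit :: bool where
  "gen_unit \<longleftrightarrow> (\<exists>a. \<not> null a \<and> (\<forall>d. \<not> null d \<longrightarrow> (\<exists>e k. null (d * e - a ^ k))))"

lemma null_prime:
  assumes zero_or_bij and "null (a * b)" and "\<not> null a"
  shows "null b"
proof -
  have "bij (h a)" using assms by (auto simp: zero_or_bij_def)
  moreover have "h a (h b v) = h a 0" for v using assms(2) by (simp add: null_def act_mult)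
  ultimately show ?thesis unfolding null_def using bij_is_inj[of "h a"] by (metis injD)
qed

lemma not_null_prod:
  assumes zero_or_bij and "\<not> null 1" and "finite A" and "\<And>x. x \<in> A \<Longrightarrow> \<not> null (f x)"
  shows "\<not> null (prod f A)"
  using assms(3,4)
proof (induct A rule: finite_induct)
  case (insert x A)
  then show ?case using null_prime[OF assms(1), of "f x" "prod f A"] by auto
qed (use assms(2) in simp)

lemma not_null_power:
  assumes zero_or_bij and "\<not> null a"
  shows "\<not> null (a ^ k)"
proof (induct k)
  case 0
  have "null a" if "null 1" using null_mult[OF that, of a] by simp
  then show ?case using assms(2) by auto
next
  case (Suc k)
  then show ?case using null_prime[OF assms(1), of a "a ^ k"] assms(2) by auto
qed

text \<open>
  A finitely generated faithful module over a domain whose non-zero elements act bijectively is a vector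
  space of finite dimension over the fraction field; comparing with the lattice spanned by a maximal
  independent subset of the generators shows that the domain is a field.
\<close>

lemma finitely_generated_imp_gen_unit:
  assumes zb: zero_or_bij and G: "finite G"
    and gen: "\<And>v. \<exists>c. v = (\<Sum>g\<in>G. h (c g) g)" and nz: "(v0::'m) \<noteq> 0"
  shows gen_unit
proof -
  define indep where "indep S \<longleftrightarrow> (\<forall>c. (\<Sum>s\<in>S. h (c s) s) = 0 \<longrightarrow> (\<forall>s\<in>S. null (c s)))" for S
  have n1: "\<not> null 1" using nz by (auto simp: null_def)
  have "\<exists>S. (S \<subseteq> G \<and> indep S) \<and> (\<forall>T. T \<subseteq> G \<and> indep T \<longrightarrow> card T \<le> card S)"
  proof (rule ex_has_greatest_nat[of "\<lambda>S. S \<subseteq> G \<and> indep S" "{}" card "Suc (card G)"])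
    show "{} \<subseteq> G \<and> indep {}" by (simp add: indep_def)
    show "\<forall>T. T \<subseteq> G \<and> indep T \<longrightarrow> card T < Suc (card G)" using G by (simp add: card_mono less_Suc_eq_le)
  qed
  then obtain S where S: "S \<subseteq> G" "indep S"
    and max: "\<And>T. T \<subseteq> G \<Longrightarrow> indep T \<Longrightarrow> card T \<le> card S" by blast
  have fS: "finite S" using S(1) G by (rule finite_subset)
  have "\<exists>b c. \<not> null b \<and> h b g = (\<Sum>s\<in>S. h (c s) s)" if g: "g \<in> G" for g
  proof (cases "g \<in> S")
    case True
    have "h 1 g = (\<Sum>s\<in>S. h (if s = g then 1 else 0) s)"
      using True fS by (simp add: if_distrib[of h] if_distribR cong: if_cong)
    then show ?thesis using n1 by (intro exI conjI) auto
  next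
    case False
    have "\<not> indep (insert g S)"
    proof
      assume "indep (insert g S)"
      then have "card (insert g S) \<le> card S" using S(1) g by (intro max) auto
      then show False using False fS by simp
    qed
    then obtain c where c: "(\<Sum>s\<in>insert g S. h (c s) s) = 0" "\<exists>s\<in>insert g S. \<not> null (c s)"
      by (auto simp: indep_def)
    have c1: "h (c g) g + (\<Sum>s\<in>S. h (c s) s) = 0" using c(1) False fS by simp
    have "\<not> null (c g)"
    proof
      assume n: "null (c g)"
      then have "(\<Sum>s\<in>S. h (c s) s) = 0" using c1 by (simp add: null_def)
      then have "\<forall>s\<in>S. null (c s)" using S(2) by (simp add: indep_def)
      then show False using n c(2) by auto
    qed
    moreover have "h (c g) g = (\<Sum>s\<in>S. h (- c s) s)"
      using c1 by (simp add: act_uminus sum_negf eq_neg_iff_add_eq_0)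
    ultimately show ?thesis by (intro exI conjI)
  qed
  then obtain b c where b: "\<And>g. g \<in> G \<Longrightarrow> \<not> null (b g)"
    and c: "\<And>g. g \<in> G \<Longrightarrow> h (b g) g = (\<Sum>s\<in>S. h (c g s) s)" by metis
  \<comment> \<open>A common denominator: \<open>B\<close> maps every vector into the lattice
    spanned by \<open>S\<close>.\<close>
  define B where "B = prod b G"
  have nB: "\<not> null B" unfolding B_def using b by (intro not_null_prod[OF zb n1 G])
  define c' where "c' g s = prod b (G - {g}) * c g s" for g s
  have Bg: "h B g = (\<Sum>s\<in>S. h (c' g s) s)" if "g \<in> G" for g
  proof -
    have "B = prod b (G - {g}) * b g" unfolding B_def using that G by (simp add: prod.remove mult.commute)
    then have "h B g = h (prod b (G - {g})) (h (b g) g)" by (simp add: act_mult)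
    then show ?thesis using c[OF that] by (simp add: c'_def act_vsum act_mult)
  qed
  have Bv: "\<exists>e. h B v = (\<Sum>s\<in>S. h (e s) s)" for v
  proof -
    obtain d where d: "v = (\<Sum>g\<in>G. h (d g) g)" using gen by blast
    have "h B v = (\<Sum>g\<in>G. h (d g) (h B g))" unfolding d act_vsum by (intro sum.cong refl act_comm)
    also have "\<dots> = (\<Sum>g\<in>G. \<Sum>s\<in>S. h (d g * c' g s) s)"
      by (intro sum.cong refl) (simp add: Bg act_vsum act_mult)
    also have "\<dots> = (\<Sum>s\<in>S. h (\<Sum>g\<in>G. d g * c' g s) s)"
      unfolding act_sum by (rule sum.swap)
    finally show ?thesis by (rule exI[of _ "\<lambda>s. \<Sum>g\<in>G. d g * c' g s"])
  qed
  have "S \<noteq> {}"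
  proof
    assume "S = {}"
    then have "h B v = 0" for v using Bv[of v] by simp
    then show False using nB by (simp add: null_def)
  qed
  then obtain s0 where s0: "s0 \<in> S" by blast
  \<comment> \<open>Divide \<open>s0\<close> by \<open>d\<close>, multiply the quotient by
    \<open>B\<close> and expand the result over \<open>S\<close>. Applying \<open>d\<close> again
    and comparing the coefficients of \<open>s0\<close> gives \<open>d * e = B\<close> up to null
    elements.\<close>
  have dB: "\<exists>e. null (d * e - B)" if "\<not> null d" for d
  proof -
    have "bij (h d)" using zb that by (auto simp: zero_or_bij_def)
    then obtain w where w: "s0 = h d w" by (metis bij_pointE)
    obtain e where e: "h B w = (\<Sum>s\<in>S. h (e s) s)" using Bv by blast
    have "h B s0 = (\<Sum>s\<in>S. h (d * e s) s)"
      unfolding w by (subst act_comm) (simp add: e act_vsum act_mult)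
    moreover have "(\<Sum>s\<in>S. h (if s = s0 then B else 0) s) = h B s0"
      using s0 fS by (simp add: if_distrib[of h] if_distribR cong: if_cong)
    ultimately have "(\<Sum>s\<in>S. h (d * e s - (if s = s0 then B else 0)) s) = 0"
      by (simp add: act_diff sum_subtractf)
    then have "\<forall>s\<in>S. null (d * e s - (if s = s0 then B else 0))"
      using S(2)[unfolded indep_def, rule_format, of "\<lambda>s. d * e s - (if s = s0 then B else 0)"] by blast
    then have "null (d * e s0 - B)" using s0 by auto
    then show ?thesis by blast
  qed
  show ?thesis unfolding gen_unit_def
  proof (rule exI[of _ 1], intro conjI allI impI n1)
    fix d assume d: "\<not> null d"
    \<comment> \<open>Applied to \<open>B * d\<close>, the previous step yields an equation in which
      \<open>B\<close> cancels, so that \<open>d\<close> itself is invertible up to null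
      elements.\<close>
    then have "\<not> null (B * d)" using null_prime[OF zb _ nB] by blast
    from dB[OF this] obtain e where "null (B * d * e - B)" by blast
    then have "null (B * (d * e - 1))" by (simp add: algebra_simps)
    then have "null (d * e - 1 ^ 1)" using null_prime[OF zb _ nB] by simp
    then show "\<exists>e k. null (d * e - 1 ^ k)" by blast
  qed
qed

end

definition poly_act :: "('r::comm_ring_1 \<Rightarrow> 'm::ab_group_add \<Rightarrow> 'm) \<Rightarrow> ('m \<Rightarrow> 'm) \<Rightarrow> 'r poly \<Rightarrow> 'm \<Rightarrow> 'm" where
  "poly_act h z p = fold_coeffs (\<lambda>a f v. h a v + z (f v)) p (\<lambda>_. 0)"

locale poly_action = comm_action h for h :: "'r::comm_ring_1 \<Rightarrow> 'm::ab_group_add \<Rightarrow> 'm" +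
  fixes z :: "'m \<Rightarrow> 'm"
  assumes z_add: "z (v + w) = z v + z w" and z_comm: "h a (z v) = z (h a v)"
begin

abbreviation H where "H \<equiv> poly_act h z"

lemma z_zero [simp]: "z 0 = 0"
  using z_add[of 0 0] by simp

lemma H_0 [simp]: "H 0 v = 0"
  by (simp add: poly_act_def)

lemma H_pCons: "H (pCons a p) v = h a v + z (H p v)"
  by (cases "p = 0 \<and> a = 0") (auto simp: poly_act_def)

lemma H_add: "H (p + q) v = H p v + H q v"
  by (induct p q rule: poly_induct2) (simp_all add: H_pCons act_add z_add)

lemma H_smult: "H (smult a p) v = h a (H p v)"
  by (induct p) (simp_all add: H_pCons act_mult act_vadd z_comm)

lemma H_mult: "H (p * q) v = H p (H q v)"
  by (induct p) (simp_all add: H_pCons H_add H_smult)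

lemma H_const: "H [:a:] v = h a v"
  by (simp add: H_pCons)

lemma H_X: "H [:0, 1:] v = z v"
  by (simp add: H_pCons)

lemma H_vadd: "H p (v + w) = H p v + H p w"
  by (induct p) (simp_all add: H_pCons act_vadd z_add)

lemma H_commute:
  assumes "\<And>v w. t (v + w) = t v + t w" and "\<And>a v. h a (t v) = t (h a v)" and "\<And>v. z (t v) = t (z v)"
  shows "H p (t v) = t (H p v)"
proof (induct p)
  case 0
  then show ?case using assms(1)[of 0 0] by simp
qed (simp add: H_pCons assms)

sublocale P: comm_action H
  by unfold_locales (simp_all add: H_add H_mult H_vadd H_const one_pCons)

lemma P_null_const: "P.null [:a:] \<longleftrightarrow> null a"
  by (simp add: null_def P.null_def H_const)

lemma zero_or_bij_base: "P.zero_or_bij \<Longrightarrow> zero_or_bij"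
  unfolding zero_or_bij_def P.zero_or_bij_def
proof
  fix a assume "\<forall>p. P.null p \<or> bij (H p)"
  moreover have "H [:a:] = h a" using H_const by auto
  ultimately show "null a \<or> bij (h a)" using P_null_const by metis
qed

text \<open>Such a polynomial is zero over the image of the coefficient ring. A null polynomial
  without this property is an algebraic relation for \<open>z\<close>.\<close>

definition coeffs_null :: "'r poly \<Rightarrow> bool" where
  "coeffs_null p \<longleftrightarrow> (\<forall>i. null (coeff p i))"

lemma coeffs_null_pCons: "coeffs_null (pCons a p) \<longleftrightarrow> null a \<and> coeffs_null p"
  unfolding coeffs_null_def by (metis coeff_pCons_0 coeff_pCons_Suc not0_implies_Suc)

lemma coeffs_null_imp_null: "coeffs_null p \<Longrightarrow> P.null p"
proof (induct p)
  case (pCons a p)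
  then show ?case by (simp add: coeffs_null_pCons P.null_def null_def H_pCons)
qed simp

lemma coeffs_null_mult:
  assumes "coeffs_null q"
  shows "coeffs_null (p * q)"
  unfolding coeffs_null_def coeff_mult
  using assms by (intro allI null_sum null_mult) (simp add: coeffs_null_def)

lemma top_coeff:
  assumes "\<not> null (coeff p i)"
  obtains j where "i \<le> j" "\<not> null (coeff p j)" "\<And>m. j < m \<Longrightarrow> null (coeff p m)"
proof -
  let ?A = "{m. \<not> null (coeff p m)}"
  have "m \<le> degree p" if "m \<in> ?A" for m
    using that by (cases "m \<le> degree p") (simp_all add: coeff_eq_0)
  then have fin: "finite ?A" by (meson finite_nat_set_iff_bounded_le)
  have "Max ?A \<in> ?A" using assms fin by (intro Max_in) auto
  moreover have "i \<le> Max ?A" using assms fin by (intro Max_ge) auto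
  moreover have "null (coeff p m)" if "Max ?A < m" for m
  proof (rule ccontr)
    assume "\<not> null (coeff p m)"
    then have "m \<le> Max ?A" using fin by (intro Max_ge) auto
    with that show False by simp
  qed
  ultimately show ?thesis using that[of "Max ?A"] by blast
qed

text \<open>Over a domain, no polynomial \<open>a\<close> has the property that every nonzero
  polynomial divides a power of it: the polynomial \<open>d = 1 + x * a\<close>, with
  \<open>x\<close> the variable, is coprime to \<open>a\<close>, so it would be a unit in spite of
  its positive degree. Here degrees are read off from the last coefficient that is not null.\<close>

lemma no_transcendental_gen_unit:
  assumes zb: "P.zero_or_bij" and gu: "P.gen_unit" and tr: "\<And>p. P.null p \<Longrightarrow> coeffs_null p"
  shows False
proof -
  have zb0: zero_or_bij using zb by (rule zero_or_bij_base)
  obtain a where a: "\<not> P.null a" and div: "\<And>d. \<not> P.null d \<Longrightarrow> \<exists>e k. P.null (d * e - a ^ k)"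
    using gu by (auto simp: P.gen_unit_def)
  \<comment> \<open>The extra factor of the variable gives \<open>d\<close> positive degree even
    when \<open>a\<close> is a constant.\<close>
  define d where "d = 1 + pCons 0 a"
  from a obtain i0 where i0: "\<not> null (coeff a i0)"
    using coeffs_null_imp_null by (auto simp: coeffs_null_def)
  have dS: "coeff d (Suc i) = coeff a i" for i by (simp add: d_def one_pCons)
  have d: "\<not> null (coeff d (Suc i0))" using i0 by (simp add: dS)
  have "\<not> P.null d" using tr[of d] d by (auto simp: coeffs_null_def)
  then obtain e k where ek: "P.null (d * e - a ^ k)" using div by blast
  define x :: "'r poly" where "x = [:0, 1:]"
  have xa: "x * a - (-1) = d" by (simp add: x_def d_def)
  obtain g where g: "(x * a) ^ k - (-1) ^ k = d * g"
    using power_diff_sumr2[of "x * a" k "-1"] unfolding xa by blast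
  define f where "f = x ^ k * e - g"
  have "d * f - (-1) ^ k = x ^ k * (d * e - a ^ k)"
    unfolding f_def right_diff_distrib g[symmetric] by (simp add: power_mult_distrib algebra_simps)
  then have "P.null (d * f - (-1) ^ k)" using ek by (simp add: P.null_mult)
  then have cn: "coeffs_null (d * f - (-1) ^ k)" by (rule tr)
  have n1: "\<not> null 1" using null_mult[of 1 "coeff d (Suc i0)"] d by auto
  have m1: "(-1 :: 'r poly) ^ k = 1 \<or> (-1 :: 'r poly) ^ k = -1" by (induct k) auto
  have "\<not> coeffs_null f"
  proof
    assume "coeffs_null f"
    then have "null (coeff (d * f) 0)" using coeffs_null_mult by (simp add: coeffs_null_def)
    moreover have "null (coeff (d * f - (-1) ^ k) 0)" using cn by (simp add: coeffs_null_def)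
    ultimately have "null (coeff (d * f) 0 - coeff (d * f - (-1) ^ k) 0)" by (rule null_diff)
    then have "null (coeff ((-1) ^ k) 0)" by simp
    then show False using m1 n1 null_uminus[of "-1"] by auto
  qed
  then obtain j0 where "\<not> null (coeff f j0)" by (auto simp: coeffs_null_def)
  then obtain j where j: "\<not> null (coeff f j)" "\<And>m. j < m \<Longrightarrow> null (coeff f m)"
    using top_coeff[of f j0] by blast
  obtain i where i: "Suc i0 \<le> i" "\<not> null (coeff d i)" "\<And>m. i < m \<Longrightarrow> null (coeff d m)"
    using top_coeff[OF d] by blast
  have "null (coeff d i * coeff f j)"
  proof -
    have "null (coeff (d * f - (-1) ^ k) (i + j))" using cn by (simp add: coeffs_null_def)
    moreover have "coeff ((-1 :: 'r poly) ^ k) (i + j) = 0"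
      using m1 i(1) by auto
    ultimately have 1: "null (coeff (d * f) (i + j))" by simp
    have "coeff (d * f) (i + j) = coeff d i * coeff f j + (\<Sum>m\<in>{..i + j} - {i}. coeff d m * coeff f (i + j - m))"
      unfolding coeff_mult by (subst sum.remove[of _ i]) auto
    moreover have "null (\<Sum>m\<in>{..i + j} - {i}. coeff d m * coeff f (i + j - m))"
    proof (rule null_sum)
      fix m assume m: "m \<in> {..i + j} - {i}"
      show "null (coeff d m * coeff f (i + j - m))"
      proof (cases "i < m")
        case True
        then show ?thesis by (intro null_mult2 i)
      next
        case False
        then have "j < i + j - m" using m by auto
        then show ?thesis by (intro null_mult j)
      qed
    qed
    ultimately show ?thesis using 1 null_diff by (metis add_diff_cancel_right')
  qed
  then show False using null_prime[OF zb0] i j by blast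
qed

end

locale poly_action_idom = poly_action h z for h :: "'r::idom \<Rightarrow> 'm::ab_group_add \<Rightarrow> 'm" and z
begin

text \<open>Degrees are those of representatives, whose leading coefficient may be null. Removing it
  lowers the degree without changing the polynomial up to null coefficients, so representatives of
  least degree have a leading coefficient that is not null.\<close>

lemma drop_lead:
  assumes "null (coeff p (degree p))" and "\<not> coeffs_null p"
  obtains p' where "degree p' < degree p" "coeffs_null (p - p')" "\<not> coeffs_null p'"
proof -
  define p' where "p' = p - monom (coeff p (degree p)) (degree p)"
  have cn: "coeffs_null (p - p')" using assms(1) by (auto simp: p'_def coeffs_null_def)
  have n: "\<not> coeffs_null p'"
  proof
    assume "coeffs_null p'"
    then have "coeffs_null ((p - p') + p')" using cn null_add unfolding coeffs_null_def coeff_add by blast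
    then show False using assms(2) by simp
  qed
  have "degree p' \<le> degree p"
    unfolding p'_def by (intro degree_diff_le) (simp_all add: degree_monom_le)
  moreover have "degree p' \<noteq> degree p"
  proof
    assume eq: "degree p' = degree p"
    have "coeff p' (degree p) = 0" by (simp add: p'_def)
    then have "p' = 0" using eq leading_coeff_0_iff[of p'] by simp
    then show False using n by (simp add: coeffs_null_def)
  qed
  ultimately show ?thesis using that[of p'] cn n by linarith
qed

text \<open>
  As in Zariski's lemma: the variable \<open>z\<close> is algebraic, and clearing denominators in the relations of
  \<open>z\<close> and of the distinguished element leads back to the base ring.
\<close>

lemma gen_unit_descends:
  assumes zb: "P.zero_or_bij" and gu: "P.gen_unit"
  shows gen_unit
proof -
  have zb0: zero_or_bij using zb by (rule zero_or_bij_base)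
  have ex: "\<exists>p. P.null p \<and> \<not> coeffs_null p"
    using no_transcendental_gen_unit[OF zb gu] by blast
  then obtain p where p: "P.null p" "\<not> coeffs_null p"
    and min: "\<And>p'. P.null p' \<Longrightarrow> \<not> coeffs_null p' \<Longrightarrow> degree p \<le> degree p'"
    using ex_has_least_nat[of "\<lambda>p. P.null p \<and> \<not> coeffs_null p" _ degree] by blast
  define N where "N = degree p"
  define c where "c = coeff p N"
  have c: "\<not> null c"
  proof
    assume "null c"
    then obtain p' where p': "degree p' < degree p" "coeffs_null (p - p')" "\<not> coeffs_null p'"
      using drop_lead p(2) unfolding c_def N_def by blast
    have "P.null (p - (p - p'))" using p(1) coeffs_null_imp_null[OF p'(2)] by (rule P.null_diff)
    then show False using min[of p'] p' by simp
  qed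
  have N: "N \<noteq> 0"
  proof
    assume "N = 0"
    then have "p = [:c:]" unfolding c_def N_def by (metis degree_0_id)
    then show False using p(1) c P_null_const by simp
  qed
  have indep: "coeffs_null r" if "degree r < N" "P.null r" for r
    using min[of r] that unfolding N_def by (meson not_le)
  \<comment> \<open>Pseudo-division by the relation \<open>p\<close>, at the price of powers of its
    leading coefficient \<open>c\<close>.\<close>
  have red: "\<exists>k r. degree r < N \<and> P.null (smult (c ^ k) f - r)" for f
  proof -
    obtain q r where qr: "pseudo_divmod f p = (q, r)" by force
    have p0: "p \<noteq> 0" using N by (auto simp: N_def)
    note pd = pseudo_divmod[OF p0 qr]
    have "degree r < N" using pd(2) N unfolding N_def by auto
    moreover have "P.null (p * q)" using p(1) by (rule P.null_mult2)
    ultimately show ?thesis using pd(1) unfolding c_def N_def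
      by (intro exI[of _ "Suc (degree f) - degree p"] exI[of _ r]) simp
  qed
  obtain a where a: "\<not> P.null a" and div: "\<And>d. \<not> P.null d \<Longrightarrow> \<exists>e k. P.null (d * e - a ^ k)"
    using gu by (auto simp: P.gen_unit_def)
  \<comment> \<open>Up to null elements, the multiples of \<open>a\<close> that are reduced modulo
    \<open>p\<close> and not null. One of least degree turns out to be a constant, so that
    \<open>a\<close> divides an element of the base ring that is not null.\<close>
  define J where "J r \<longleftrightarrow> degree r < N \<and> \<not> P.null r \<and> (\<exists>e. P.null (a * e - r))" for r
  have "\<exists>r. J r"
  proof -
    obtain k r where r: "degree r < N" "P.null (smult (c ^ k) a - r)" using red by blast
    have "\<not> P.null r"
    proof
      assume "P.null r"
      from P.null_add[OF r(2) this] have "P.null ([:c ^ k:] * a)" by simp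
      moreover have "\<not> P.null [:c ^ k:]" using not_null_power[OF zb0 c] P_null_const by simp
      ultimately show False using a P.null_prime[OF zb] by blast
    qed
    moreover have "P.null (a * [:c ^ k:] - r)" using r(2) by simp
    ultimately show ?thesis using r(1) unfolding J_def by blast
  qed
  then obtain r where r: "J r" and rmin: "\<And>t. J t \<Longrightarrow> degree r \<le> degree t"
    using ex_has_least_nat[of J _ degree] by blast
  from r obtain e1 where r1: "degree r < N" "\<not> P.null r" and e1: "P.null (a * e1 - r)"
    by (auto simp: J_def)
  have rc: "\<not> coeffs_null r" using r1 coeffs_null_imp_null by blast
  define b where "b = coeff r (degree r)"
  have b: "\<not> null b"
  proof
    assume "null b"
    then obtain r' where r': "degree r' < degree r" "coeffs_null (r - r')" "\<not> coeffs_null r'"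
      using drop_lead rc unfolding b_def by blast
    have n: "P.null (r - r')" using coeffs_null_imp_null[OF r'(2)] .
    have "P.null ((a * e1 - r) + (r - r'))" using e1 n by (rule P.null_add)
    then have "P.null (a * e1 - r')" by simp
    moreover have "\<not> P.null r'"
    proof
      assume "P.null r'"
      from P.null_add[OF n this] show False using r1 by simp
    qed
    ultimately have "J r'" using r' r1 unfolding J_def by auto
    then show False using rmin r'(1) by fastforce
  qed
  have deg0: "degree r = 0"
  proof (rule ccontr)
    \<comment> \<open>Pseudo-division of \<open>p\<close> by \<open>r\<close> leaves
      \<open>t\<close>. If \<open>t\<close> is not null, it is a smaller element of
      \<open>J\<close>. If it is null, so is the quotient \<open>s\<close>; its degree is below
      \<open>N\<close>, hence its coefficients are null, and comparison at \<open>N\<close>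
      contradicts that neither \<open>b\<close> nor \<open>c\<close> is null.\<close>
    assume D: "degree r \<noteq> 0"
    obtain s t where st: "pseudo_divmod p r = (s, t)" by force
    have r0: "r \<noteq> 0" using D by auto
    define j where "j = Suc (degree p) - degree r"
    note pd = pseudo_divmod[OF r0 st, folded b_def j_def]
    have dt: "degree t < degree r" using pd(2) D by auto
    have t: "t = smult (b ^ j) p - r * s" using pd(1) by simp
    show False
    proof (cases "P.null t")
      case False
      have "a * (- (e1 * s)) - t = - (smult (b ^ j) p) - (a * e1 - r) * s"
        unfolding t by (simp add: algebra_simps)
      moreover have "P.null \<dots>"
      proof (intro P.null_diff P.null_uminus P.null_mult2[OF e1])
        have "P.null ([:b ^ j:] * p)" using p(1) by (rule P.null_mult)
        then show "P.null (smult (b ^ j) p)" by simp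
      qed
      ultimately have "J t" using False dt r1 unfolding J_def by (metis less_trans)
      then show False using rmin dt by fastforce
    next
      case True
      have "P.null ([:b ^ j:] * p)" using p(1) by (rule P.null_mult)
      then have "P.null (smult (b ^ j) p - t)" using True by (intro P.null_diff) simp_all
      then have "P.null (r * s)" unfolding t by simp
      then have ns: "P.null s" using P.null_prime[OF zb] r1 by blast
      have "degree s < N"
      proof (cases "s = 0")
        case False
        have "degree (r * s) \<le> N"
        proof -
          have "r * s = smult (b ^ j) p - t" unfolding t by simp
          then show ?thesis using dt r1 by (simp add: N_def degree_diff_le degree_smult_le)
        qed
        then show ?thesis using D False r0 by (simp add: degree_mult_eq)
      qed (use N in simp)
      then have cs: "coeffs_null s" using indep ns by blast
      have ct: "coeffs_null t" using indep True dt r1 by simp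
      have "b ^ j * c = coeff (r * s) N + coeff t N"
        using arg_cong[OF pd(1), of "\<lambda>x. coeff x N"] by (simp add: c_def)
      moreover have "null (coeff (r * s) N + coeff t N)"
        using coeffs_null_mult[OF cs] ct by (intro null_add) (simp_all add: coeffs_null_def)
      ultimately have "null (b ^ j * c)" by simp
      then show False using null_prime[OF zb0] not_null_power[OF zb0 b] c by blast
    qed
  qed
  have rb: "r = [:b:]" using deg0 unfolding b_def by (metis degree_0_id)
  show ?thesis unfolding gen_unit_def
  \<comment> \<open>\<open>b\<close> is the constant found above, which \<open>a\<close> divides.
    \<open>c\<close> pays for reducing the cofactor modulo \<open>p\<close>; after that, comparing
    constant coefficients leads back to the base ring.\<close>
  proof (rule exI[of _ "c * b"], intro conjI allI impI)
    show "\<not> null (c * b)" using null_prime[OF zb0] b c by blast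
    fix d assume d: "\<not> null d"
    then have "\<not> P.null [:d:]" using P_null_const by simp
    then obtain e k where ek: "P.null ([:d:] * e - a ^ k)" using div by blast
    have 1: "P.null ((a * e1) ^ k - [:b:] ^ k)" using e1 unfolding rb by (rule P.null_power_diff)
    define e2 where "e2 = e * e1 ^ k"
    have "[:d:] * e2 - [:b ^ k:] = ([:d:] * e - a ^ k) * e1 ^ k + ((a * e1) ^ k - [:b:] ^ k)"
      by (simp add: e2_def algebra_simps power_mult_distrib poly_const_pow)
    then have 2: "P.null ([:d:] * e2 - [:b ^ k:])"
      using P.null_add[OF P.null_mult2[OF ek] 1] by simp
    obtain m s where s: "degree s < N" "P.null (smult (c ^ m) e2 - s)" using red by blast
    have "smult d s - [:c ^ m * b ^ k:] =
        [:c ^ m:] * ([:d:] * e2 - [:b ^ k:]) - [:d:] * (smult (c ^ m) e2 - s)"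
      by (simp add: algebra_simps smult_diff_right)
    then have "P.null (smult d s - [:c ^ m * b ^ k:])"
      by (simp only: P.null_diff[OF P.null_mult[OF 2] P.null_mult[OF s(2)]])
    moreover have "degree (smult d s - [:c ^ m * b ^ k:]) < N"
      using s(1) N by (intro degree_diff_less) (auto intro: le_less_trans[OF degree_smult_le])
    ultimately have "coeffs_null (smult d s - [:c ^ m * b ^ k:])" using indep by blast
    then have "null (coeff (smult d s - [:c ^ m * b ^ k:]) 0)" unfolding coeffs_null_def by blast
    then have "null (d * coeff s 0 - c ^ m * b ^ k)" by simp
    \<comment> \<open>The two exponents are levelled to obtain a power of
      \<open>c * b\<close>.\<close>
    then have "null ((c ^ k * b ^ m) * (d * coeff s 0 - c ^ m * b ^ k))" by (rule null_mult)
    also have "(c ^ k * b ^ m) * (d * coeff s 0 - c ^ m * b ^ k) =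
        d * (c ^ k * b ^ m * coeff s 0) - (c * b) ^ (k + m)"
      by (simp add: algebra_simps power_mult_distrib power_add)
    finally show "\<exists>e k. null (d * e - (c * b) ^ k)" by blast
  qed
qed

end

text \<open>The operator satisfies a polynomial over the field. Splitting off one root at a time,
  some linear factor must be null, because a product is null only if a factor is.\<close>

lemma scalar_if_gen_unit:
  fixes h :: "'k::alg_closed_field \<Rightarrow> 'm::ab_group_add \<Rightarrow> 'm"
  assumes pa: "poly_action h z" and zb: "comm_action.zero_or_bij (poly_act h z)"
    and gu: "comm_action.gen_unit (poly_act h z)" and nz: "(v0::'m) \<noteq> 0"
  shows "\<exists>c. \<forall>v. z v = h c v"
proof -
  interpret poly_action h z by (rule pa)
  have field: "a = 0" if "null a" for a
  proof (rule ccontr)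
    assume "a \<noteq> 0"
    then have "v0 = h (inverse a * a) v0" by simp
    also have "\<dots> = 0" using that by (simp add: act_mult null_def)
    finally show False using nz by simp
  qed
  obtain p where p: "P.null p" "\<not> coeffs_null p"
    using no_transcendental_gen_unit[OF zb gu] by blast
  then have "p \<noteq> 0" by (auto simp: coeffs_null_def)
  with p(1) have "\<exists>c. P.null [:- c, 1:]"
  proof (induct "degree p" arbitrary: p)
    case 0
    then have "p = [:coeff p 0:]" by (metis degree_0_id)
    then have "null (coeff p 0)" using 0(2) P_null_const by metis
    then have "coeff p 0 = 0" by (rule field)
    then show ?case using \<open>p = [:coeff p 0:]\<close> 0(3) by simp
  next
    case (Suc n)
    then obtain c where "poly p c = 0" using alg_closed_imp_poly_has_root[of p] by auto
    then obtain g where g: "p = [:- c, 1:] * g" by (auto simp: poly_eq_0_iff_dvd elim: dvdE)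
    with Suc(4) have "g \<noteq> 0" by auto
    then have "degree p = Suc (degree g)" unfolding g by (subst degree_mult_eq) auto
    then have dg: "n = degree g" using Suc(2) by simp
    show ?case
    proof (cases "P.null [:- c, 1:]")
      case False
      then have "P.null g" using P.null_prime[OF zb] Suc(3) unfolding g by blast
      then show ?thesis using Suc(1)[OF dg] \<open>g \<noteq> 0\<close> by blast
    qed blast
  qed
  then obtain c where "P.null [:- c, 1:]" by blast
  then have "h (- c) v + z v = 0" for v by (simp add: P.null_def H_pCons)
  then have "z v = h c v" for v using act_uminus[of c v] by (metis add.commute eq_neg_iff_add_eq_0 minus_minus)
  then show ?thesis by blast
qed

definition additive_commuting :: "('m \<Rightarrow> 'm) set \<Rightarrow> ('m::ab_group_add \<Rightarrow> 'm) \<Rightarrow> bool" where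
  "additive_commuting T f \<longleftrightarrow> (\<forall>v w. f (v + w) = f v + f w) \<and> (\<forall>t\<in>T. \<forall>v. f (t v) = t (f v))"

lemma poly_act_step:
  assumes ca: "comm_action h" and hT: "\<And>a. additive_commuting T (h a)"
    and z: "z \<in> T" "additive_commuting T z" and T: "\<And>t v w. t \<in> T \<Longrightarrow> t (v + w) = t v + t w"
  shows "poly_action h z" "comm_action (poly_act h z)" "\<And>p. additive_commuting T (poly_act h z p)"
proof -
  show pa: "poly_action h z"
    using ca hT z by (simp add: poly_action_def poly_action_axioms_def additive_commuting_def)
  then interpret poly_action h z .
  show "comm_action H" by (rule P.comm_action_axioms)
  fix p
  show "additive_commuting T (H p)"
    unfolding additive_commuting_def
  proof (intro conjI allI ballI)
    fix t v assume t: "t \<in> T"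
    show "H p (t v) = t (H p v)"
      by (rule H_commute) (use T t hT z in \<open>simp_all add: additive_commuting_def\<close>)
  qed (rule H_vadd)
qed

text \<open>
  Adjoining the six operators one at a time, by iterated univariate polynomial rings, keeps the coefficient
  domains at the level of types.
\<close>

theorem nullstellensatz6:
  fixes h :: "'k::alg_closed_field \<Rightarrow> 'm::ab_group_add \<Rightarrow> 'm"
  assumes ca: "comm_action h" and hT: "\<And>a. h a \<in> T" "\<And>a. additive_commuting T (h a)"
    and zT: "\<And>z. z \<in> {z1,z2,z3,z4,z5,z6} \<Longrightarrow> z \<in> T \<and> additive_commuting T z"
    and T: "\<And>t v w. t \<in> T \<Longrightarrow> t (v + w) = t v + t w"
    and simple: "\<And>f. additive_commuting T f \<Longrightarrow> (\<forall>v. f v = 0) \<or> bij f"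
    and G: "finite G"
    and gen: "\<And>Q. G \<subseteq> Q \<Longrightarrow> 0 \<in> Q \<Longrightarrow> (\<And>v w. v \<in> Q \<Longrightarrow> w \<in> Q \<Longrightarrow> v + w \<in> Q) \<Longrightarrow> (\<And>a v. v \<in> Q \<Longrightarrow> h a v \<in> Q)
      \<Longrightarrow> (\<And>z v. z \<in> {z1,z2,z3,z4,z5,z6} \<Longrightarrow> v \<in> Q \<Longrightarrow> z v \<in> Q) \<Longrightarrow> Q = UNIV"
    and nz: "(v0::'m) \<noteq> 0"
  shows "\<exists>c. \<forall>v. z1 v = h c v"
proof -
  define h1 where "h1 = poly_act h z1"
  define h2 where "h2 = poly_act h1 z2"
  define h3 where "h3 = poly_act h2 z3"
  define h4 where "h4 = poly_act h3 z4"
  define h5 where "h5 = poly_act h4 z5"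
  define h6 where "h6 = poly_act h5 z6"
  note zs = zT[of z1] zT[of z2] zT[of z3] zT[of z4] zT[of z5] zT[of z6]
  note s1 = poly_act_step[OF ca hT(2) _ _ T, of z1, folded h1_def]
  have s1: "poly_action h z1" "comm_action h1" "\<And>p. additive_commuting T (h1 p)"
    using s1 zs by auto
  note s2 = poly_act_step[OF s1(2,3) _ _ T, of z2, folded h2_def]
  have s2: "poly_action h1 z2" "comm_action h2" "\<And>p. additive_commuting T (h2 p)"
    using s2 zs by auto
  note s3 = poly_act_step[OF s2(2,3) _ _ T, of z3, folded h3_def]
  have s3: "poly_action h2 z3" "comm_action h3" "\<And>p. additive_commuting T (h3 p)"
    using s3 zs by auto
  note s4 = poly_act_step[OF s3(2,3) _ _ T, of z4, folded h4_def]
  have s4: "poly_action h3 z4" "comm_action h4" "\<And>p. additive_commuting T (h4 p)"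
    using s4 zs by auto
  note s5 = poly_act_step[OF s4(2,3) _ _ T, of z5, folded h5_def]
  have s5: "poly_action h4 z5" "comm_action h5" "\<And>p. additive_commuting T (h5 p)"
    using s5 zs by auto
  note s6 = poly_act_step[OF s5(2,3) _ _ T, of z6, folded h6_def]
  have s6: "poly_action h5 z6" "comm_action h6" "\<And>p. additive_commuting T (h6 p)"
    using s6 zs by auto
  have zb: "comm_action.zero_or_bij g" if g: "comm_action g" "\<And>p. additive_commuting T (g p)"
    for g :: "'r::comm_ring_1 \<Rightarrow> 'm \<Rightarrow> 'm"
    unfolding comm_action.zero_or_bij_def[OF g(1)] comm_action.null_def[OF g(1)]
    using simple[OF g(2)] by blast
  interpret p1: poly_action_idom h z1 using s1(1) by (rule poly_action_idom.intro)
  interpret p2: poly_action_idom h1 z2 using s2(1) by (rule poly_action_idom.intro)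
  interpret p3: poly_action_idom h2 z3 using s3(1) by (rule poly_action_idom.intro)
  interpret p4: poly_action_idom h3 z4 using s4(1) by (rule poly_action_idom.intro)
  interpret p5: poly_action_idom h4 z5 using s5(1) by (rule poly_action_idom.intro)
  interpret p6: poly_action_idom h5 z6 using s6(1) by (rule poly_action_idom.intro)
  have gu6: "comm_action.gen_unit h6"
  proof (rule comm_action.finitely_generated_imp_gen_unit[OF s6(2) zb[OF s6(2,3)] G _ nz])
    interpret c6: comm_action h6 by (rule s6(2))
    define Q where "Q = {v. \<exists>c. v = (\<Sum>g\<in>G. h6 (c g) g)}"
    have Qh: "h6 p v \<in> Q" if "v \<in> Q" for p v
    proof -
      from that obtain c where "v = (\<Sum>g\<in>G. h6 (c g) g)" by (auto simp: Q_def)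
      then have "h6 p v = (\<Sum>g\<in>G. h6 (p * c g) g)" by (simp add: c6.act_vsum c6.act_mult)
      then show ?thesis unfolding Q_def by (intro CollectI exI[of _ "\<lambda>g. p * c g"])
    qed
    have e5: "h5 p v = h6 [:p:] v" for p v using p6.H_const by (simp add: h6_def)
    have e4: "h4 p v = h6 [:[:p:]:] v" for p v using p5.H_const by (simp add: h5_def e5[symmetric])
    have e3: "h3 p v = h6 [:[:[:p:]:]:] v" for p v using p4.H_const by (simp add: h4_def e4[symmetric])
    have e2: "h2 p v = h6 [:[:[:[:p:]:]:]:] v" for p v using p3.H_const by (simp add: h3_def e3[symmetric])
    have e1: "h1 p v = h6 [:[:[:[:[:p:]:]:]:]:] v" for p v using p2.H_const by (simp add: h2_def e2[symmetric])
    have e0: "h p v = h6 [:[:[:[:[:[:p:]:]:]:]:]:] v" for p v using p1.H_const by (simp add: h1_def e1[symmetric])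
    have "Q = UNIV"
    proof (rule gen)
      show "G \<subseteq> Q"
      proof
        fix g assume g: "g \<in> G"
        have "g = (\<Sum>x\<in>G. h6 (if x = g then 1 else 0) x)"
          using g G by (simp add: if_distrib[of h6] if_distribR cong: if_cong)
        then show "g \<in> Q" unfolding Q_def by (intro CollectI exI[of _ "\<lambda>x. if x = g then 1 else 0"])
      qed
      have "0 = (\<Sum>x\<in>G. h6 0 x)" by simp
      then show "0 \<in> Q" unfolding Q_def by (intro CollectI exI[of _ "\<lambda>x. 0"])
      show "v + w \<in> Q" if vw: "v \<in> Q" "w \<in> Q" for v w
      proof -
        from vw obtain c d where "v = (\<Sum>g\<in>G. h6 (c g) g)" "w = (\<Sum>g\<in>G. h6 (d g) g)"
          by (auto simp: Q_def)
        then have "v + w = (\<Sum>g\<in>G. h6 (c g + d g) g)" by (simp add: c6.act_add sum.distrib)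
        then show ?thesis unfolding Q_def by (intro CollectI exI[of _ "\<lambda>g. c g + d g"])
      qed
      show "h a v \<in> Q" if "v \<in> Q" for a v unfolding e0 using that by (rule Qh)
      show "z v \<in> Q" if z: "z \<in> {z1,z2,z3,z4,z5,z6}" and v: "v \<in> Q" for z v
      proof -
        have "z1 v = h1 [:0,1:] v" "z2 v = h2 [:0,1:] v" "z3 v = h3 [:0,1:] v"
          "z4 v = h4 [:0,1:] v" "z5 v = h5 [:0,1:] v" "z6 v = h6 [:0,1:] v"
          using p1.H_X p2.H_X p3.H_X p4.H_X p5.H_X p6.H_X
          by (simp_all add: h1_def h2_def h3_def h4_def h5_def h6_def)
        then have "z1 v \<in> Q" "z2 v \<in> Q" "z3 v \<in> Q" "z4 v \<in> Q" "z5 v \<in> Q" "z6 v \<in> Q"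
          unfolding e1 e2 e3 e4 e5 using Qh[OF v] by simp_all
        then show ?thesis using z by blast
      qed
    qed
    then show "\<exists>c. v = (\<Sum>g\<in>G. h6 (c g) g)" for v by (auto simp: Q_def)
  qed
  \<comment> \<open>The variables are removed in the opposite order to their adjunction, until
    \<open>z1\<close> alone is left over the field. This is why the conclusion concerns the first
    operator.\<close>
  have gu5: "comm_action.gen_unit h5"
    using p6.gen_unit_descends zb[OF s6(2,3)] gu6 by (simp add: h6_def)
  have gu4: "comm_action.gen_unit h4"
    using p5.gen_unit_descends zb[OF s5(2,3)] gu5 by (simp add: h5_def)
  have gu3: "comm_action.gen_unit h3"
    using p4.gen_unit_descends zb[OF s4(2,3)] gu4 by (simp add: h4_def)
  have gu2: "comm_action.gen_unit h2"
    using p3.gen_unit_descends zb[OF s3(2,3)] gu3 by (simp add: h3_def)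
  have gu1: "comm_action.gen_unit h1"
    using p2.gen_unit_descends zb[OF s2(2,3)] gu2 by (simp add: h2_def)
  show ?thesis
    using scalar_if_gen_unit[OF s1(1) _ _ nz] zb[OF s1(2,3)] gu1 by (simp add: h1_def)
qed


section \<open>The algebra \<open>A\<close> as a quotient\<close>

lemma ring_of_ring_1: "ring (ring_of_type_algebra :: 'a::ring_1 ring)"
proof -
  have "\<exists>y. x + y = 0" for x :: 'a by (rule exI[of _ "- x"]) simp
  moreover have "\<exists>y. y + x = 0" for x :: 'a by (rule exI[of _ "- x"]) simp
  ultimately show ?thesis
    unfolding ring_of_type_algebra_def
    by unfold_locales (auto simp: algebra_simps Units_def)
qed

lemma rta_simps [simp]:
  "carrier ring_of_type_algebra = UNIV"
  "x \<otimes>\<^bsub>ring_of_type_algebra\<^esub> y = x * y"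
  "x \<oplus>\<^bsub>ring_of_type_algebra\<^esub> y = x + y"
  "\<one>\<^bsub>ring_of_type_algebra\<^esub> = 1"
  "\<zero>\<^bsub>ring_of_type_algebra\<^esub> = 0"
  by (simp_all add: ring_of_type_algebra_def)

lemma rta_uminus [simp]: "\<ominus>\<^bsub>ring_of_type_algebra\<^esub> x = - (x :: 'a::ring_1)"
proof -
  interpret ring "ring_of_type_algebra :: 'a ring" by (rule ring_of_ring_1)
  show ?thesis by (rule minus_equality) simp_all
qed

lemma rta_minus [simp]: "x \<ominus>\<^bsub>ring_of_type_algebra\<^esub> y = x - (y :: 'a::ring_1)"
  by (simp add: a_minus_def)

lemma ideal_relation_ideal: "ideal (relation_ideal q) ring_of_type_algebra"
  unfolding relation_ideal_def by (rule ring.genideal_ideal[OF ring_of_ring_1]) simp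

lemma relators_subset: "relators q \<subseteq> relation_ideal q"
  unfolding relation_ideal_def by (rule ring.genideal_self[OF ring_of_ring_1]) simp

lemma relation_ideal_minimal:
  assumes "relators q \<subseteq> J" "0 \<in> J" "\<And>x y. x \<in> J \<Longrightarrow> y \<in> J \<Longrightarrow> x + y \<in> J"
    and l: "\<And>x y. x \<in> J \<Longrightarrow> y * x \<in> J" and "\<And>x y. x \<in> J \<Longrightarrow> x * y \<in> J"
  shows "relation_ideal q \<subseteq> J"
  unfolding relation_ideal_def
proof (rule ring.genideal_minimal[OF ring_of_ring_1 _ assms(1)], rule idealI[OF ring_of_ring_1])
  have m: "- x \<in> J" if "x \<in> J" for x using l[OF that, of "-1"] by simp
  interpret R: ring "ring_of_type_algebra :: 'a pre_A ring" by (rule ring_of_ring_1)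
  show "subgroup J (add_monoid ring_of_type_algebra)"
  proof (rule group.subgroupI[OF R.a_group])
    fix a assume "a \<in> J"
    moreover have "inv\<^bsub>add_monoid ring_of_type_algebra\<^esub> a = - a"
      using rta_uminus[of a] unfolding a_inv_def .
    ultimately show "inv\<^bsub>add_monoid ring_of_type_algebra\<^esub> a \<in> J" using m by simp
  qed (use assms in \<open>auto simp: ring_of_type_algebra_def\<close>)
qed (use assms in simp_all)

lemma cls_eq_iff: "cls q a = cls q b \<longleftrightarrow> a - b \<in> relation_ideal q"
  unfolding cls_def
  using ring.quotient_eq_iff_same_a_r_cos[OF ring_of_ring_1 ideal_relation_ideal, of a b q] by simp

lemma cls_ring_hom: "cls q \<in> Ring.ring_hom ring_of_type_algebra (alg_A q)"
  using ideal.rcos_ring_hom[OF ideal_relation_ideal] unfolding alg_A_def cls_def[abs_def] .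

lemma cls_add: "cls q (a + b) = cls q a \<oplus>\<^bsub>alg_A q\<^esub> cls q b"
  using ring_hom_add[OF cls_ring_hom, of a b q] by simp

lemma cls_mult: "cls q (a * b) = cls q a \<otimes>\<^bsub>alg_A q\<^esub> cls q b"
  using ring_hom_mult[OF cls_ring_hom, of a b q] by simp

lemma cls_one: "cls q 1 = \<one>\<^bsub>alg_A q\<^esub>"
  using ring_hom_one[OF cls_ring_hom, of q] by simp

lemma carrier_alg_A: "carrier (alg_A q) = range (cls q)"
  unfolding alg_A_def FactRing_def A_RCOSETS_def' cls_def by auto

lemma cls_carrier [simp]: "cls q a \<in> carrier (alg_A q)"
  by (simp add: carrier_alg_A)

lemma ring_alg_A: "ring (alg_A q)"
  unfolding alg_A_def by (rule ideal.quotient_is_ring[OF ideal_relation_ideal])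

lemma cls_zero: "cls q 0 = \<zero>\<^bsub>alg_A q\<^esub>"
  using ring_hom_zero[OF cls_ring_hom ring_of_ring_1 ring_alg_A, of q] by simp

lemma cls_relator: "a - b \<in> relators q \<Longrightarrow> cls q a = cls q b"
  unfolding cls_eq_iff using relators_subset[of q] by blast

lemma cls_cong_add: "cls q a = cls q a' \<Longrightarrow> cls q b = cls q b' \<Longrightarrow> cls q (a + b) = cls q (a' + b')"
  by (simp add: cls_add)

lemma cls_cong_mult: "cls q a = cls q a' \<Longrightarrow> cls q b = cls q b' \<Longrightarrow> cls q (a * b) = cls q (a' * b')"
  by (simp add: cls_mult)


section \<open>The product of the algebras \<open>A\<close> over all parameters\<close>

text \<open>
  Working with all \<open>q\<close> at once turns the quotients into a single type, so that identities in \<open>A\<close> become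
  equations in a ring type. Scalars are functions of \<open>q\<close>.
\<close>

definition generic :: "'k::field \<Rightarrow> bool" where
  "generic q \<longleftrightarrow> q \<noteq> 0 \<and> q ^ 2 \<noteq> 1"

text \<open>Only generic parameters count. For the others some denominator in the relations, or in
  the later formulas for \<open>E\<close> and \<open>F\<close>, vanishes, and no identity is
  claimed.\<close>

definition fam_rel :: "('k::field \<Rightarrow> 'k pre_A) \<Rightarrow> ('k \<Rightarrow> 'k pre_A) \<Rightarrow> bool" where
  "fam_rel f g \<longleftrightarrow> (\<forall>q. generic q \<longrightarrow> cls q (f q) = cls q (g q))"

quotient_type (overloaded) 'k fam = "'k::field \<Rightarrow> 'k pre_A" / fam_rel
  by (rule equivpI) (auto simp: reflp_def symp_def transp_def fam_rel_def)

instantiation fam :: (field) "{ring, monoid_mult}"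
begin

lift_definition zero_fam :: "'a fam" is "\<lambda>q. 0" .
lift_definition one_fam :: "'a fam" is "\<lambda>q. 1" .
lift_definition plus_fam :: "'a fam \<Rightarrow> 'a fam \<Rightarrow> 'a fam" is "\<lambda>f g q. f q + g q"
  by (simp add: fam_rel_def cls_add)
lift_definition times_fam :: "'a fam \<Rightarrow> 'a fam \<Rightarrow> 'a fam" is "\<lambda>f g q. f q * g q"
  by (simp add: fam_rel_def cls_mult)
lift_definition uminus_fam :: "'a fam \<Rightarrow> 'a fam" is "\<lambda>f q. - f q"
proof -
  fix f g :: "'a \<Rightarrow> 'a pre_A"
  assume *: "fam_rel f g"
  have "cls q (- f q) = cls q (- g q)" if "generic q" for q
    using cls_cong_mult[of q "-1" "-1" "f q" "g q"] * that by (simp add: fam_rel_def)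
  then show "fam_rel (\<lambda>q. - f q) (\<lambda>q. - g q)" by (simp add: fam_rel_def)
qed
lift_definition minus_fam :: "'a fam \<Rightarrow> 'a fam \<Rightarrow> 'a fam" is "\<lambda>f g q. f q - g q"
proof -
  fix f g h k :: "'a \<Rightarrow> 'a pre_A"
  assume *: "fam_rel f g" "fam_rel h k"
  have "cls q (f q + (-1) * h q) = cls q (g q + (-1) * k q)" if "generic q" for q
    by (intro cls_cong_add cls_cong_mult refl) (use * that in \<open>simp_all add: fam_rel_def\<close>)
  then show "fam_rel (\<lambda>q. f q - h q) (\<lambda>q. g q - k q)" by (simp add: fam_rel_def)
qed

instance by standard (transfer, simp add: fam_rel_def algebra_simps)+

end

definition sc :: "('k \<Rightarrow> 'k) \<Rightarrow> 'k::field fam" where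
  "sc f = abs_fam (\<lambda>q. const (f q))"

definition el :: "'k pre_A \<Rightarrow> 'k::field fam" where
  "el a = abs_fam (\<lambda>_. a)"

lemma abs_fam_eq: "abs_fam f = abs_fam g \<Longrightarrow> generic q \<Longrightarrow> cls q (f q) = cls q (g q)"
  by (simp add: fam.abs_eq_iff fam_rel_def)

lemma abs_fam_eqI: "(\<And>q. generic q \<Longrightarrow> cls q (f q) = cls q (g q)) \<Longrightarrow> abs_fam f = abs_fam g"
  by (simp add: fam.abs_eq_iff fam_rel_def)

lemma abs_fam_add: "abs_fam (\<lambda>q. f q + g q) = abs_fam f + abs_fam g"
  by (simp add: plus_fam.abs_eq)
lemma abs_fam_mult: "abs_fam (\<lambda>q. f q * g q) = abs_fam f * abs_fam g"
  by (simp add: times_fam.abs_eq)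
lemma abs_fam_diff: "abs_fam (\<lambda>q. f q - g q) = abs_fam f - abs_fam g"
  by (simp add: minus_fam.abs_eq)
lemma abs_fam_power: "abs_fam (\<lambda>q. f q ^ n) = abs_fam f ^ n"
  by (induct n) (simp_all add: abs_fam_mult one_fam_def)
lemma abs_fam_const: "abs_fam (\<lambda>q. const (f q)) = sc f"
  by (simp add: sc_def)
lemma abs_fam_1: "abs_fam (\<lambda>q. 1) = 1"
  by (simp add: one_fam_def)

lemma sc_cong: "(\<And>q. generic q \<Longrightarrow> f q = g q) \<Longrightarrow> sc f = sc g"
  unfolding sc_def by (rule abs_fam_eqI) simp

lemma sc_mult: "sc f * sc g = sc (\<lambda>q. f q * g q)"
  by (simp add: sc_def abs_fam_mult[symmetric] const_mult)
lemma sc_add: "sc f + sc g = sc (\<lambda>q. f q + g q)"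
  by (simp add: sc_def abs_fam_add[symmetric] const_add)
lemma sc_diff: "sc f - sc g = sc (\<lambda>q. f q - g q)"
  by (simp add: sc_def abs_fam_diff[symmetric] const_diff)
lemma sc_1: "sc (\<lambda>q. 1) = 1"
  by (simp add: sc_def one_fam_def)
lemma sc_0: "sc (\<lambda>q. 0) = 0"
  by (simp add: sc_def zero_fam_def)
lemma sc_commute: "x * sc f = sc f * x"
  unfolding sc_def by (induct x rule: fam.abs_induct) (simp add: abs_fam_mult[symmetric] const_central)
lemma sc_commute2: "x * (sc f * z) = sc f * (x * z)"
  by (simp only: mult.assoc[symmetric] sc_commute)
lemma sc_mult2: "sc f * (sc g * z) = sc (\<lambda>q. f q * g q) * z"
  by (simp only: mult.assoc[symmetric] sc_mult)

definition qp :: "int \<Rightarrow> 'k::field fam" where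
  "qp n = sc (\<lambda>q. q powi n)"

lemma qp_mult: "qp m * qp n = (qp (m + n) :: 'k::field fam)"
  unfolding qp_def sc_mult by (rule sc_cong) (simp add: generic_def power_int_add)

lemma qp_mult2: "qp m * (qp n * z) = qp (m + n) * z"
  by (simp only: mult.assoc[symmetric] qp_mult)

lemma qp_0 [simp]: "qp 0 = 1" by (simp add: qp_def sc_1)

lemma qp_commute2: "x * (qp n * z) = qp n * (x * z)"
  unfolding qp_def by (rule sc_commute2)

text \<open>Most pairs of generators commute up to a power of \<open>q\<close>. Recording the
  exponent turns the commutation of monomials into additions of integers.\<close>

definition qcomm :: "'k::field fam \<Rightarrow> 'k fam \<Rightarrow> int \<Rightarrow> bool" where
  "qcomm g h m \<longleftrightarrow> g * h = qp m * (h * g)"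

lemma qcommD: "qcomm g h m \<Longrightarrow> g * h = qp m * (h * g)"
  by (simp add: qcomm_def)

lemma qcommD2: "qcomm g h m \<Longrightarrow> g * (h * z) = qp m * (h * (g * z))"
  unfolding qcomm_def by (simp only: mult.assoc[symmetric])

lemma qcomm_sym: "qcomm g h m \<Longrightarrow> qcomm h g (- m)"
  unfolding qcomm_def by (simp add: qp_mult2)

lemma qcomm_self: "qcomm g g 0"
  by (simp add: qcomm_def)

lemma qcomm_1 [simp]: "qcomm g 1 0" "qcomm 1 g 0"
  by (simp_all add: qcomm_def)

lemma qcomm_mult_right:
  assumes "qcomm g h m" and "qcomm g h' m'"
  shows "qcomm g (h * h') (m + m')"
  unfolding qcomm_def mult.assoc qcommD2[OF assms(1)] qcommD[OF assms(2)] qp_commute2[of h] qp_mult2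
  by (simp add: mult.assoc)

lemma qcomm_mult_left:
  assumes "qcomm g h m" and "qcomm g' h m'"
  shows "qcomm (g * g') h (m + m')"
  using qcomm_sym[OF qcomm_mult_right[OF qcomm_sym[OF assms(1)] qcomm_sym[OF assms(2)]]]
  by (simp add: add.commute)

lemma qcomm_power_right:
  assumes "qcomm g h m"
  shows "qcomm g (h ^ j) (m * int j)"
proof (induct j)
  case (Suc j)
  then show ?case using qcomm_mult_right[OF assms, of "h ^ j" "m * int j"]
    by (simp add: algebra_simps)
qed simp

lemma qcomm_power_left:
  assumes "qcomm g h m"
  shows "qcomm (g ^ j) h (m * int j)"
  using qcomm_sym[OF qcomm_power_right[OF qcomm_sym[OF assms]]] by simp

lemma qcomm_add_left: "qcomm g h m \<Longrightarrow> qcomm g' h m \<Longrightarrow> qcomm (g + g') h m"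
  by (simp add: qcomm_def distrib_left distrib_right)

lemma qcomm_diff_left: "qcomm g h m \<Longrightarrow> qcomm g' h m \<Longrightarrow> qcomm (g - g') h m"
  by (simp add: qcomm_def left_diff_distrib right_diff_distrib)

lemma qcomm_sc_left: "qcomm g h m \<Longrightarrow> qcomm (sc f * g) h m"
  unfolding qcomm_def mult.assoc sc_commute2[of h] by (simp only: qp_commute2[of "sc f"])

lemma qcomm_eq: "qcomm g h m \<Longrightarrow> m = n \<Longrightarrow> qcomm g h n"
  by simp

abbreviation "eE \<equiv> el gE"
abbreviation "eF \<equiv> el gF"
abbreviation "eK \<equiv> el gK"
abbreviation "eK' \<equiv> el gKinv"
abbreviation "eX \<equiv> el gX"
abbreviation "eY \<equiv> el gY"

definition nu :: "'k::field fam" where "nu = sc (\<lambda>q. inverse (q - inverse q))"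

lemmas fam_abs = abs_fam_add abs_fam_mult abs_fam_diff abs_fam_power abs_fam_const abs_fam_1
  el_def[of gE, symmetric] el_def[of gF, symmetric] el_def[of gK, symmetric] el_def[of gKinv, symmetric]
  el_def[of gX, symmetric] el_def[of gY, symmetric]

lemma fam_relation:
  assumes "\<And>q. f q - g q \<in> relators q" and "abs_fam f = x" and "abs_fam g = y"
  shows "x = y"
  using abs_fam_eqI[OF cls_relator[OF assms(1)]] assms(2,3) by simp

lemma sc_qp: "sc (\<lambda>q. q) = qp 1" "sc (\<lambda>q. q ^ 2) = qp 2" "sc (\<lambda>q. inverse q) = qp (-1)"
    "sc (\<lambda>q. inverse (q ^ 2)) = qp (-2)"
  unfolding qp_def by (rule sc_cong, simp add: power_int_minus)+

lemma K_Kinv: "eK * eK' = 1"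
  by (rule fam_relation[of "\<lambda>q. gK * gKinv" "\<lambda>q. 1"])
    (simp_all only: relators_def insert_iff simp_thms fam_abs)

lemma Kinv_K: "eK' * eK = 1"
  by (rule fam_relation[of "\<lambda>q. gKinv * gK" "\<lambda>q. 1"])
    (simp_all only: relators_def insert_iff simp_thms fam_abs)

lemma K_Kinv2: "eK * (eK' * z) = z" and Kinv_K2: "eK' * (eK * z) = z"
  by (simp_all add: mult.assoc[symmetric] K_Kinv Kinv_K)

lemma qcomm_K_if:
  assumes "eK * g * eK' = qp m * g"
  shows "qcomm eK g m" and "qcomm eK' g (- m)"
proof -
  have "eK * g = (eK * g * eK') * eK" by (simp add: mult.assoc Kinv_K)
  then show 1: "qcomm eK g m" unfolding qcomm_def assms by (simp add: mult.assoc)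
  have "g * eK' = eK' * (eK * g) * eK'" by (simp add: mult.assoc Kinv_K2)
  also have "\<dots> = qp m * (eK' * g)" unfolding qcommD[OF 1] by (simp add: mult.assoc K_Kinv qp_commute2)
  finally have "qcomm g eK' m" by (simp add: qcomm_def)
  from qcomm_sym[OF this] show "qcomm eK' g (- m)" .
qed

lemma K_conj_E: "eK * eE * eK' = qp 2 * eE"
  by (rule fam_relation[of "\<lambda>q. gK * gE * gKinv" "\<lambda>q. const (q^2) * gE"])
    (simp_all only: relators_def insert_iff simp_thms fam_abs sc_qp)

lemma K_conj_F: "eK * eF * eK' = qp (-2) * eF"
  by (rule fam_relation[of "\<lambda>q. gK * gF * gKinv" "\<lambda>q. const (inverse (q^2)) * gF"])
    (simp_all only: relators_def insert_iff simp_thms fam_abs sc_qp)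

lemma K_conj_X: "eK * eX * eK' = qp 1 * eX"
  by (rule fam_relation[of "\<lambda>q. gK * gX * gKinv" "\<lambda>q. const q * gX"])
    (simp_all only: relators_def insert_iff simp_thms fam_abs sc_qp)

lemma K_conj_Y: "eK * eY * eK' = qp (-1) * eY"
  by (rule fam_relation[of "\<lambda>q. gK * gY * gKinv" "\<lambda>q. const (inverse q) * gY"])
    (simp_all only: relators_def insert_iff simp_thms fam_abs sc_qp)

lemmas qcK = qcomm_K_if[OF K_conj_E] qcomm_K_if[OF K_conj_F] qcomm_K_if[OF K_conj_X] qcomm_K_if[OF K_conj_Y]

lemma qcomm_KK: "qcomm eK eK' 0" "qcomm eK' eK 0"
  by (simp_all add: qcomm_def K_Kinv Kinv_K)

lemma qcEX: "qcomm eE eX 1"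
  unfolding qcomm_def mult.assoc[symmetric]
  by (rule fam_relation[of "\<lambda>q. gE * gX" "\<lambda>q. const q * gX * gE"])
    (simp_all only: relators_def insert_iff simp_thms fam_abs sc_qp)

lemma qcFY: "qcomm eF eY 0"
  unfolding qcomm_def qp_0 mult_1_left
  by (rule fam_relation[of "\<lambda>q. gF * gY" "\<lambda>q. gY * gF"])
    (simp_all only: relators_def insert_iff simp_thms fam_abs sc_qp)

lemma qcXY: "qcomm eX eY 1"
  unfolding qcomm_def mult.assoc[symmetric]
  by (rule fam_relation[of "\<lambda>q. gX * gY" "\<lambda>q. const q * gY * gX"])
    (simp_all only: relators_def insert_iff simp_thms fam_abs sc_qp)

lemma relEF: "eE * eF - eF * eE = nu * (eK - eK')"
  unfolding nu_def
  by (rule fam_relation[of "\<lambda>q. gE * gF - gF * gE" "\<lambda>q. const (inverse (q - inverse q)) * (gK - gKinv)"])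
    (simp_all only: relators_def insert_iff simp_thms fam_abs sc_qp)

lemma relEY: "eE * eY = eX + qp (-1) * (eY * eE)"
  unfolding mult.assoc[symmetric]
  by (rule fam_relation[of "\<lambda>q. gE * gY" "\<lambda>q. gX + const (inverse q) * gY * gE"])
    (simp_all only: relators_def insert_iff simp_thms fam_abs sc_qp)

lemma relFX: "eF * eX = eY * eK' + eX * eF"
  by (rule fam_relation[of "\<lambda>q. gF * gX" "\<lambda>q. gY * gKinv + gX * gF"])
    (simp_all only: relators_def insert_iff simp_thms fam_abs sc_qp)


section \<open>Commutation formulas for powers\<close>

text \<open>\<open>Sm\<close> and \<open>Sp\<close> are quantum integers up to a power of
  \<open>q\<close>. They appear when a generator is moved past a power with which it does not
  q-commute, and at a generic \<open>q\<close> they vanish as soon as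
  \<open>q ^ (2 * n) = 1\<close>.\<close>

definition Sm :: "nat \<Rightarrow> 'k::field fam" where
  "Sm n = sc (\<lambda>q. \<Sum>i<n. q powi (- 2 * int i))"

definition Sp :: "nat \<Rightarrow> 'k::field fam" where
  "Sp n = sc (\<lambda>q. \<Sum>i<n. q powi (2 * int i))"

lemma Sm_0 [simp]: "Sm 0 = 0" and Sp_0 [simp]: "Sp 0 = 0"
  by (simp_all add: Sm_def Sp_def sc_0)

lemma Sm_Suc: "Sm (Suc n) = Sm n + qp (- 2 * int n)"
  by (simp add: Sm_def qp_def sc_add)

lemma Sp_Suc: "Sp (Suc n) = Sp n + qp (2 * int n)"
  by (simp add: Sp_def qp_def sc_add)

text \<open>Here the first summand is split off instead of the last. \<open>E_power_Y\<close> needs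
  this form because its induction step multiplies the old correction term by a power of
  \<open>q\<close>.\<close>

lemma Sm_Suc': "Sm (Suc n) = (1 :: 'k::field fam) + qp (- 2) * Sm n"
proof (induct n)
  case (Suc n)
  have "Sm (Suc (Suc n)) = (1 :: 'k fam) + qp (- 2) * Sm n + qp (- 2 * int (Suc n))"
    unfolding Sm_Suc[of "Suc n"] Suc by simp
  also have "\<dots> = 1 + qp (- 2) * Sm (Suc n)" unfolding Sm_Suc[of n] distrib_left qp_mult by simp
  finally show ?case .
qed (simp add: Sm_Suc)

lemma Sm_commute2: "x * (Sm n * z) = Sm n * (x * z)"
  unfolding Sm_def by (rule sc_commute2)

lemma Sp_commute2: "x * (Sp n * z) = Sp n * (x * z)"
  unfolding Sp_def by (rule sc_commute2)

lemma nu_commute2: "x * (nu * z) = nu * (x * z)"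
  unfolding nu_def by (rule sc_commute2)

lemmas qcE = qcEX qcomm_sym[OF qcK(1)] qcomm_sym[OF qcK(2)]
lemmas qcF = qcFY qcomm_sym[OF qcK(3)] qcomm_sym[OF qcK(4)]
lemmas qcX = qcomm_sym[OF qcK(5)] qcomm_sym[OF qcK(6)]
lemmas qcY = qcomm_sym[OF qcXY] qcomm_sym[OF qcK(7)] qcomm_sym[OF qcK(8)]

text \<open>In this and the following formulas the exponent \<open>b - 1\<close> is truncated at
  \<open>b = 0\<close>; this is harmless because the factor \<open>Sm 0\<close> vanishes.\<close>

lemma E_Y_power: "(eE :: 'k::field fam) * eY ^ b = qp (- int b) * (eY ^ b * eE) + Sm b * (eX * eY ^ (b - 1))"
proof (induct b)
  case (Suc b)
  have 1: "Sm b * ((eX :: 'k::field fam) * (eY ^ (b - 1) * eY)) = Sm b * (eX * eY ^ b)"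
    by (cases b) (simp_all add: power_commutes)
  have 2: "(eY :: 'k::field fam) ^ b * eX = qp (- int b) * (eX * eY ^ b)"
    using qcommD[OF qcomm_power_left[OF qcY(1), of b]] by simp
  have "(eE :: 'k::field fam) * eY ^ Suc b = (eE * eY ^ b) * eY" by (simp only: power_Suc2 mult.assoc)
  also have "\<dots> = qp (- int b) * (eY ^ b * (eE * eY)) + Sm b * (eX * eY ^ b)"
    unfolding Suc unfolding distrib_right mult.assoc 1 ..
  also have "\<dots> = qp (- int b) * (qp (- int b) * (eX * eY ^ b)) + qp (- int b) * (qp (- 1) * (eY ^ b * (eY * eE)))
      + Sm b * (eX * eY ^ b)"
    unfolding relEY distrib_left 2 qp_commute2[of "eY ^ b"] ..
  also have "\<dots> = qp (- int (Suc b)) * (eY ^ Suc b * eE) + Sm (Suc b) * (eX * eY ^ b)"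
    unfolding Sm_Suc qp_mult2 distrib_right power_Suc2 mult.assoc by (simp add: add_ac)
  finally show ?case by simp
qed simp

lemma F_X_power: "(eF :: 'k::field fam) * eX ^ a = eX ^ a * eF + Sm a * (eX ^ (a - 1) * (eY * eK'))"
proof (induct a)
  case (Suc a)
  have 1: "Sm a * ((eX :: 'k::field fam) * (eX ^ (a - 1) * (eY * eK'))) = Sm a * (eX ^ a * (eY * eK'))"
    by (cases a) (simp_all add: mult.assoc)
  have 2: "(eK' :: 'k::field fam) * eX ^ a = qp (- int a) * (eX ^ a * eK')"
    using qcommD[OF qcomm_power_right[OF qcK(6), of a]] by simp
  have 3: "(eY :: 'k::field fam) * (eX ^ a * eK') = qp (- int a) * (eX ^ a * (eY * eK'))"
    using qcommD2[OF qcomm_power_right[OF qcY(1), of a]] by simp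
  have "(eF :: 'k::field fam) * eX ^ Suc a = (eF * eX) * eX ^ a" by (simp only: power_Suc mult.assoc)
  also have "\<dots> = eY * (eK' * eX ^ a) + eX * (eF * eX ^ a)"
    unfolding relFX distrib_right mult.assoc ..
  also have "\<dots> = qp (- int a) * (qp (- int a) * (eX ^ a * (eY * eK'))) + (eX * (eX ^ a * eF) + Sm a * (eX ^ a * (eY * eK')))"
    unfolding 2 qp_commute2[of eY] 3 Suc distrib_left Sm_commute2[of eX] 1 ..
  also have "\<dots> = eX ^ Suc a * eF + Sm (Suc a) * (eX ^ a * (eY * eK'))"
    unfolding Sm_Suc qp_mult2 distrib_right power_Suc mult.assoc by (simp add: add_ac)
  finally show ?case by simp
qed simp

lemma E_power_Y: "(eE :: 'k::field fam) ^ k * eY = qp (- int k) * (eY * eE ^ k) + qp (int k - 1) * (Sm k * (eX * eE ^ (k - 1)))"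
proof (induct k)
  case (Suc k)
  have 1: "Sm k * ((eX :: 'k::field fam) * (eE ^ (k - 1) * eE)) = Sm k * (eX * eE ^ k)"
    by (cases k) (simp_all add: power_commutes)
  have 2: "(eE :: 'k::field fam) ^ k * eX = qp (int k) * (eX * eE ^ k)"
    using qcommD[OF qcomm_power_left[OF qcEX, of k]] by simp
  have "(eE :: 'k::field fam) ^ Suc k * eY = eE ^ k * (eE * eY)" by (simp only: power_Suc2 mult.assoc)
  also have "\<dots> = qp (int k) * (eX * eE ^ k) + qp (- 1) * ((eE ^ k * eY) * eE)"
    unfolding relEY distrib_left qp_commute2[of "eE ^ k"] 2 mult.assoc ..
  also have "\<dots> = qp (int k) * (eX * eE ^ k) + (qp (- int (Suc k)) * (eY * eE ^ Suc k)
      + qp (int k - 2) * (Sm k * (eX * eE ^ k)))"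
    unfolding Suc unfolding distrib_right distrib_left mult.assoc 1 qp_mult2 power_Suc2 by simp
  also have "\<dots> = qp (- int (Suc k)) * (eY * eE ^ Suc k) + qp (int k) * (Sm (Suc k) * (eX * eE ^ k))"
    unfolding Sm_Suc' distrib_right distrib_left mult.assoc qp_mult2 by (simp add: add_ac)
  finally show ?case by simp
qed simp

lemma F_power_X: "(eF :: 'k::field fam) ^ k * eX = eX * eF ^ k + Sm k * (eY * (eK' * eF ^ (k - 1)))"
proof (induct k)
  case (Suc k)
  have 1: "Sm k * ((eY :: 'k::field fam) * (eK' * (eF ^ (k - 1) * eF))) = Sm k * (eY * (eK' * eF ^ k))"
    by (cases k) (simp_all add: power_commutes)
  have 2: "(eF :: 'k::field fam) ^ k * (eY * eK') = eY * (eF ^ k * eK')"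
    using qcommD2[OF qcomm_power_left[OF qcFY, of k], of eK'] by simp
  have 3: "(eF :: 'k::field fam) ^ k * eK' = qp (- 2 * int k) * (eK' * eF ^ k)"
    using qcommD[OF qcomm_power_left[OF qcF(3), of k]] by simp
  have "(eF :: 'k::field fam) ^ Suc k * eX = eF ^ k * (eF * eX)" by (simp only: power_Suc2 mult.assoc)
  also have "\<dots> = qp (- 2 * int k) * (eY * (eK' * eF ^ k)) + (eF ^ k * eX) * eF"
    unfolding relFX distrib_left 2 3 qp_commute2[of eY] mult.assoc ..
  also have "\<dots> = qp (- 2 * int k) * (eY * (eK' * eF ^ k)) + (eX * eF ^ Suc k + Sm k * (eY * (eK' * eF ^ k)))"
    unfolding Suc unfolding distrib_right mult.assoc 1 power_Suc2 ..
  also have "\<dots> = eX * eF ^ Suc k + Sm (Suc k) * (eY * (eK' * eF ^ k))"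
    unfolding Sm_Suc distrib_right by (simp add: add_ac)
  finally show ?case by simp
qed simp

lemma FE: "eF * eE = eE * eF - nu * (eK - eK')"
  unfolding relEF[symmetric] by simp

lemma F_E_power: "(eF :: 'k::field fam) * eE ^ m = eE ^ m * eF - nu * (Sm m * (eK * eE ^ (m - 1)) - Sp m * (eK' * eE ^ (m - 1)))"
proof (induct m)
  case (Suc m)
  have 1: "Sm m * ((eK :: 'k::field fam) * (eE ^ (m - 1) * eE)) = Sm m * (eK * eE ^ m)"
    "Sp m * ((eK' :: 'k::field fam) * (eE ^ (m - 1) * eE)) = Sp m * (eK' * eE ^ m)"
    by (cases m; simp add: power_commutes)+
  have 2: "(eE :: 'k::field fam) ^ m * eK = qp (- 2 * int m) * (eK * eE ^ m)" "(eE :: 'k::field fam) ^ m * eK' = qp (2 * int m) * (eK' * eE ^ m)"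
    using qcommD[OF qcomm_power_left[OF qcE(2), of m]] qcommD[OF qcomm_power_left[OF qcE(3), of m]] by simp_all
  have "(eF :: 'k::field fam) * eE ^ Suc m = (eF * eE ^ m) * eE" by (simp only: power_Suc2 mult.assoc)
  also have "\<dots> = eE ^ m * (eF * eE) - nu * (Sm m * (eK * eE ^ m) - Sp m * (eK' * eE ^ m))"
    unfolding Suc unfolding left_diff_distrib mult.assoc 1 ..
  also have "(eE :: 'k::field fam) ^ m * (eF * eE) = eE ^ Suc m * eF - nu * (qp (- 2 * int m) * (eK * eE ^ m) - qp (2 * int m) * (eK' * eE ^ m))"
    unfolding FE right_diff_distrib nu_commute2[of "eE ^ m"] 2 power_Suc2 mult.assoc ..
  finally have "(eF :: 'k::field fam) * eE ^ Suc m = eE ^ Suc m * eF - nu * (Sm (Suc m) * (eK * eE ^ m) - Sp (Suc m) * (eK' * eE ^ m))"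
    unfolding Sm_Suc Sp_Suc distrib_right by (simp only: right_diff_distrib distrib_left) simp
  then show ?case by simp
qed simp

lemma F_power_E: "(eF :: 'k::field fam) ^ k * eE = eE * eF ^ k - nu * (Sp k * (eK * eF ^ (k - 1)) - Sm k * (eK' * eF ^ (k - 1)))"
proof (induct k)
  case (Suc k)
  have 1: "Sp k * ((eK :: 'k::field fam) * (eF ^ (k - 1) * eF)) = Sp k * (eK * eF ^ k)"
    "Sm k * ((eK' :: 'k::field fam) * (eF ^ (k - 1) * eF)) = Sm k * (eK' * eF ^ k)"
    by (cases k; simp add: power_commutes)+
  have 2: "(eF :: 'k::field fam) ^ k * eK = qp (2 * int k) * (eK * eF ^ k)" "(eF :: 'k::field fam) ^ k * eK' = qp (- 2 * int k) * (eK' * eF ^ k)"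
    using qcommD[OF qcomm_power_left[OF qcF(2), of k]] qcommD[OF qcomm_power_left[OF qcF(3), of k]] by simp_all
  have "(eF :: 'k::field fam) ^ Suc k * eE = eF ^ k * (eF * eE)" by (simp only: power_Suc2 mult.assoc)
  also have "\<dots> = (eF ^ k * eE) * eF - nu * (qp (2 * int k) * (eK * eF ^ k) - qp (- 2 * int k) * (eK' * eF ^ k))"
    unfolding FE right_diff_distrib nu_commute2[of "eF ^ k"] 2 mult.assoc ..
  also have "((eF :: 'k::field fam) ^ k * eE) * eF = eE * eF ^ Suc k - nu * (Sp k * (eK * eF ^ k) - Sm k * (eK' * eF ^ k))"
    unfolding Suc unfolding left_diff_distrib mult.assoc 1 power_Suc2 ..
  finally have "(eF :: 'k::field fam) ^ Suc k * eE = eE * eF ^ Suc k - nu * (Sp (Suc k) * (eK * eF ^ k) - Sm (Suc k) * (eK' * eF ^ k))"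
    unfolding Sm_Suc Sp_Suc distrib_right by (simp only: right_diff_distrib distrib_left) simp
  then show ?case by simp
qed simp


section \<open>The relations of \<open>B\<close>\<close>

definition ep :: "'k::field fam" where "ep = eE * eY - qp 1 * (eY * eE)"
definition es :: "'k::field fam" where "es = eX * eF - qp 2 * (eF * eX)"

lemma abs_fam_phi: "abs_fam \<phi> = ep"
  unfolding \<phi>_def[abs_def] ep_def fam_abs sc_qp mult.assoc ..

lemma abs_fam_psi: "abs_fam \<psi> = es"
  unfolding \<psi>_def[abs_def] es_def fam_abs sc_qp mult.assoc ..

definition la :: "'k::field fam" where "la = sc (\<lambda>q. q - inverse q)"
definition mu :: "'k::field fam" where "mu = sc (\<lambda>q. 1 - q ^ 2)"

lemma la_commute2: "x * (la * z) = la * (x * z)"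
  unfolding la_def by (rule sc_commute2)
lemma mu_commute2: "x * (mu * z) = mu * (x * z)"
  unfolding mu_def by (rule sc_commute2)

lemma la_qp: "la = qp 1 - qp (- 1)" and mu_qp: "mu = 1 - qp 2"
  unfolding la_def mu_def qp_def sc_diff sc_1[symmetric] by (rule sc_cong, simp add: power_int_minus)+

text \<open>This form and the next contain \<open>eE\<close> and \<open>eF\<close> just once, with
  an invertible scalar. They can be solved for \<open>eE\<close> and \<open>eF\<close> wherever
  \<open>Y\<close> and \<open>X\<close> are invertible, which is the source both of the torus
  formulas and of the simplicity over B.\<close>

lemma ep_eq: "ep = eX - la * (eY * eE)"
  unfolding ep_def la_qp relEY left_diff_distrib by simp

lemma es_eq: "es = mu * (eX * eF) - qp 2 * (eY * eK')"
  unfolding es_def mu_qp relFX left_diff_distrib distrib_left by simp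

lemma qc_phi_X: "qcomm ep eX 0"
  unfolding ep_def qp_def
  by (intro qcomm_diff_left qcomm_sc_left)
    (rule qcomm_eq[OF qcomm_mult_left[OF qcEX qcY(1)]] qcomm_eq[OF qcomm_mult_left[OF qcY(1) qcEX]], simp)+

lemma qc_phi_K: "qcomm ep eK (- 1)"
  unfolding ep_def qp_def
  by (intro qcomm_diff_left qcomm_sc_left)
    (rule qcomm_eq[OF qcomm_mult_left[OF qcE(2) qcY(2)]] qcomm_eq[OF qcomm_mult_left[OF qcY(2) qcE(2)]], simp)+

lemma qc_phi_Y: "qcomm (ep :: 'k::field fam) eY (- 1)"
proof -
  have "(ep :: 'k::field fam) * eY = qp 1 * (eY * eX) - la * (eY * (eX + qp (- 1) * (eY * eE)))"
    unfolding ep_eq left_diff_distrib mult.assoc relEY qcommD[OF qcXY] ..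
  also have "\<dots> = qp (- 1) * (eY * eX) - la * (qp (- 1) * (eY * (eY * eE)))"
    unfolding distrib_left qp_commute2[of eY] by (simp add: la_qp left_diff_distrib)
  also have "\<dots> = qp (- 1) * (eY * ep)"
    unfolding ep_eq right_diff_distrib qp_commute2[of la] la_commute2[of eY] ..
  finally show ?thesis by (simp add: qcomm_def)
qed

lemma qc_psi_X: "qcomm (es :: 'k::field fam) eX 0"
proof -
  have 1: "(eY :: 'k::field fam) * (eK' * eX) = qp (- 2) * (eX * (eY * eK'))"
    using qcommD[OF qcomm_mult_left[OF qcY(1) qcK(6)]] by (simp add: mult.assoc)
  have "(es :: 'k::field fam) * eX = mu * (eX * (eY * eK' + eX * eF)) - qp 2 * (qp (- 2) * (eX * (eY * eK')))"
    unfolding es_eq left_diff_distrib mult.assoc relFX 1 ..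
  also have "\<dots> = mu * (eX * (eX * eF)) - qp 2 * (eX * (eY * eK'))"
    unfolding distrib_left qp_mult2 mu_qp by (simp add: left_diff_distrib)
  also have "\<dots> = eX * es"
    unfolding es_eq right_diff_distrib qp_commute2[of eX] mu_commute2[of eX] ..
  finally show ?thesis by (simp add: qcomm_def)
qed

lemma qc_psi_Y: "qcomm es eY 1"
  unfolding es_eq mu_def qp_def
  by (intro qcomm_diff_left qcomm_sc_left)
    (rule qcomm_eq[OF qcomm_mult_left[OF qcXY qcFY]] qcomm_eq[OF qcomm_mult_left[OF qcomm_self qcK(8)]], simp)+

lemma qc_psi_K: "qcomm es eK 1"
  unfolding es_def qp_def
  by (intro qcomm_diff_left qcomm_sc_left)
    (rule qcomm_eq[OF qcomm_mult_left[OF qcX(1) qcF(2)]] qcomm_eq[OF qcomm_mult_left[OF qcF(2) qcX(1)]], simp)+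

definition eh :: "'k::field fam" where "eh = eK * (eY * eX)"

lemma qc_phi_h: "qcomm ep eh (- 2)"
  unfolding eh_def by (rule qcomm_eq[OF qcomm_mult_right[OF qc_phi_K qcomm_mult_right[OF qc_phi_Y qc_phi_X]]]) simp

lemma qc_psi_h: "qcomm es eh 2"
  unfolding eh_def by (rule qcomm_eq[OF qcomm_mult_right[OF qc_psi_K qcomm_mult_right[OF qc_psi_Y qc_psi_X]]]) simp

lemma la_nu: "mu * (nu * z) = - (qp 1 * (z :: 'k::field fam))"
proof -
  have "mu * nu = (- qp 1 :: 'k fam)"
  proof -
    have "mu * nu = sc (\<lambda>q :: 'k. 0 - q)" unfolding mu_def nu_def sc_mult
    proof (rule sc_cong)
      fix q :: 'k assume g: "generic q"
      then have "q \<noteq> 0" "q ^ 2 \<noteq> 1" by (auto simp: generic_def)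
      then have "q - inverse q \<noteq> 0" by (auto simp: field_simps power2_eq_square)
      moreover have "1 - q ^ 2 = - q * (q - inverse q)" using \<open>q \<noteq> 0\<close> by (simp add: field_simps power2_eq_square)
      ultimately show "(1 - q ^ 2) * inverse (q - inverse q) = 0 - q" by simp
    qed
    then show ?thesis unfolding sc_diff[symmetric] sc_0 sc_qp by simp
  qed
  then show ?thesis by (simp add: mult.assoc[symmetric])
qed

text \<open>As \<open>ep\<close> is \<open>eX\<close> minus a multiple of \<open>eY * eE\<close> and
  \<open>es\<close> commutes with \<open>eX\<close>, only the q-commutator of \<open>es\<close> and
  \<open>eE\<close> has to be found. In it the relation between \<open>eE\<close> and
  \<open>eF\<close> produces \<open>eK - eK'\<close>, and the summand \<open>eY * eK'\<close> of
  \<open>es\<close> cancels the part with \<open>eK'\<close>.\<close>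

lemma psi_phi: "(es :: 'k::field fam) * ep = ep * es + qp 1 * (mu * eh)"
proof -
  have 1: "(eK' :: 'k::field fam) * eE = qp (- 2) * (eE * eK')" using qcommD[OF qcK(2)] by simp
  have "qp 1 * ((es :: 'k::field fam) * eE) - eE * es = qp 1 * (mu * (eX * (eF * eE - eE * eF))) + qp 2 * (eX * eK')"
  proof -
    have A: "qp 1 * ((es :: 'k::field fam) * eE) = qp 1 * (mu * (eX * (eF * eE))) - qp 1 * (eY * (eE * eK'))"
      unfolding es_eq left_diff_distrib right_diff_distrib mult.assoc 1 qp_commute2[of eY] qp_mult2 by simp
    have B: "(eE :: 'k::field fam) * es = mu * (qp 1 * (eX * (eE * eF))) - qp 2 * (eX * eK' + qp (- 1) * (eY * (eE * eK')))"
    proof -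
      have "(eE :: 'k::field fam) * (eX * eF) = qp 1 * (eX * (eE * eF))" by (rule qcommD2[OF qcEX])
      moreover have "(eE :: 'k::field fam) * (eY * eK') = eX * eK' + qp (- 1) * (eY * (eE * eK'))"
        unfolding mult.assoc[symmetric, of eE] relEY distrib_right mult.assoc ..
      ultimately show ?thesis
        unfolding es_eq right_diff_distrib mu_commute2[of eE] qp_commute2[of eE] by (simp only:)
    qed
    from B have C: "(eE :: 'k::field fam) * es =
        qp 1 * (mu * (eX * (eE * eF))) - qp 2 * (eX * eK') - qp 1 * (eY * (eE * eK'))"
      unfolding distrib_left qp_mult2 qp_commute2[of mu] by simp
    show ?thesis unfolding A C right_diff_distrib by simp
  qed
  also have "(eF :: 'k::field fam) * eE - eE * eF = - (nu * (eK - eK'))" unfolding relEF[symmetric] by simp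
  also have "qp 1 * (mu * ((eX :: 'k::field fam) * - (nu * (eK - eK')))) = qp 2 * (eX * (eK - eK'))"
    unfolding mult_minus_right nu_commute2[of eX] la_nu qp_mult2 by (simp add: qp_mult2)
  finally have 2: "qp 1 * ((es :: 'k::field fam) * eE) - eE * es = qp 2 * (eX * eK)"
    by (simp add: right_diff_distrib)
  have 3: "(eY :: 'k::field fam) * (eX * eK) = eh"
  proof -
    have "(eY :: 'k::field fam) * (eX * eK) = qp (- 1) * (eY * (eK * eX))" unfolding qcommD[OF qcX(1)] qp_commute2[of eY] ..
    also have "\<dots> = eh" unfolding qcommD2[OF qcY(2)] qp_mult2 eh_def by simp
    finally show ?thesis .
  qed
  have "(es :: 'k::field fam) * ep - ep * es = - (la * (es * (eY * eE)) - la * (eY * (eE * es)))"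
    unfolding ep_eq left_diff_distrib right_diff_distrib la_commute2[of es] mult.assoc
    using qcommD[OF qc_psi_X] by (simp add: algebra_simps)
  also have "\<dots> = - (la * (eY * (qp 1 * (es * eE) - eE * es)))"
    unfolding qcommD2[OF qc_psi_Y] right_diff_distrib qp_commute2[of eY] ..
  also have "\<dots> = - (la * (qp 2 * eh))" unfolding 2 qp_commute2[of eY] 3 ..
  also have "\<dots> = qp 1 * (mu * eh)"
    unfolding la_qp mu_qp left_diff_distrib right_diff_distrib qp_mult2 by simp
  finally show ?thesis by (simp add: algebra_simps)
qed

lemma psi_phi_power: "(es :: 'k::field fam) * ep ^ k = ep ^ k * es + qp 1 * (mu * (Sm k * (eh * ep ^ (k - 1))))"
proof (induct k)
  case (Suc k)
  have 1: "Sm k * ((eh :: 'k::field fam) * (ep ^ (k - 1) * ep)) = Sm k * (eh * ep ^ k)"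
    by (cases k) (simp_all add: power_commutes)
  have 2: "(ep :: 'k::field fam) ^ k * eh = qp (- 2 * int k) * (eh * ep ^ k)"
    using qcommD[OF qcomm_power_left[OF qc_phi_h, of k]] by simp
  have "(es :: 'k::field fam) * ep ^ Suc k = (es * ep ^ k) * ep" by (simp only: power_Suc2 mult.assoc)
  also have "\<dots> = ep ^ k * (es * ep) + qp 1 * (mu * (Sm k * (eh * ep ^ k)))"
    unfolding Suc unfolding distrib_right mult.assoc 1 ..
  also have "(ep :: 'k::field fam) ^ k * (es * ep) = ep ^ Suc k * es + qp 1 * (mu * (qp (- 2 * int k) * (eh * ep ^ k)))"
    unfolding psi_phi distrib_left qp_commute2[of "ep ^ k"] mu_commute2[of "ep ^ k"] 2 power_Suc2 mult.assoc ..
  finally have "(es :: 'k::field fam) * ep ^ Suc k = ep ^ Suc k * es + qp 1 * (mu * (Sm (Suc k) * (eh * ep ^ k)))"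
    unfolding Sm_Suc distrib_right distrib_left by (simp add: add_ac)
  then show ?case by simp
qed simp

lemma phi_psi: "ep * es = es * ep - qp 1 * (mu * eh)"
  unfolding psi_phi by simp

lemma phi_psi_power: "(ep :: 'k::field fam) * es ^ k = es ^ k * ep - qp 1 * (mu * (Sp k * (eh * es ^ (k - 1))))"
proof (induct k)
  case (Suc k)
  have 1: "Sp k * ((eh :: 'k::field fam) * (es ^ (k - 1) * es)) = Sp k * (eh * es ^ k)"
    by (cases k) (simp_all add: power_commutes)
  have 2: "(es :: 'k::field fam) ^ k * eh = qp (2 * int k) * (eh * es ^ k)"
    using qcommD[OF qcomm_power_left[OF qc_psi_h, of k]] by simp
  have "(ep :: 'k::field fam) * es ^ Suc k = (ep * es ^ k) * es" by (simp only: power_Suc2 mult.assoc)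
  also have "\<dots> = es ^ k * (ep * es) - qp 1 * (mu * (Sp k * (eh * es ^ k)))"
    unfolding Suc unfolding left_diff_distrib mult.assoc 1 ..
  also have "(es :: 'k::field fam) ^ k * (ep * es) = es ^ Suc k * ep - qp 1 * (mu * (qp (2 * int k) * (eh * es ^ k)))"
    unfolding phi_psi right_diff_distrib qp_commute2[of "es ^ k"] mu_commute2[of "es ^ k"] 2 power_Suc2 mult.assoc ..
  finally have "(ep :: 'k::field fam) * es ^ Suc k = es ^ Suc k * ep - qp 1 * (mu * (Sp (Suc k) * (eh * es ^ k)))"
    unfolding Sp_Suc distrib_right distrib_left by (simp add: algebra_simps)
  then show ?case by simp
qed simp

text \<open>The coefficient is forced by centrality: \<open>es * ep\<close> and
  \<open>ep * es\<close> differ by q - q^3 times \<open>eh\<close>, and \<open>ep\<close> passes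
  \<open>eh\<close> with the factor q^-2. So \<open>es * ep\<close> plus \<open>a\<close> times
  \<open>eh\<close> commutes with \<open>ep\<close> if a + q - q^3 = a q^-2, that is, for a =
  q^3.\<close>

definition ec :: "'k::field fam" where "ec = es * ep + qp 3 * eh"

lemma phi_psi_ec: "ep * es = ec - qp 1 * eh" and psi_phi_ec: "es * ep = ec - qp 3 * eh"
  unfolding phi_psi ec_def mu_qp left_diff_distrib right_diff_distrib qp_mult2 by simp_all

lemma qc_c_phi: "qcomm (ec :: 'k::field fam) ep 0"
proof -
  have "(ec :: 'k::field fam) * ep = (es * ep) * ep + qp 3 * (eh * ep)" unfolding ec_def distrib_right mult.assoc ..
  moreover have "(ep :: 'k::field fam) * ec = (ep * es) * ep + qp 1 * (eh * ep)"
    unfolding ec_def distrib_left qp_commute2[of ep] qcommD[OF qc_phi_h] mult.assoc qp_mult2 by simp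
  ultimately show ?thesis
    unfolding qcomm_def phi_psi_ec psi_phi_ec left_diff_distrib mult.assoc by simp
qed

lemma qc_c_psi: "qcomm (ec :: 'k::field fam) es 0"
proof -
  have "(es :: 'k::field fam) * ec = es * (ep * es) + qp 1 * (es * eh)"
    unfolding phi_psi_ec right_diff_distrib qp_commute2[of es] by simp
  moreover have "(ec :: 'k::field fam) * es = es * (ep * es) + qp 3 * (eh * es)" unfolding ec_def distrib_right mult.assoc ..
  ultimately show ?thesis unfolding qcomm_def qcommD[OF qc_psi_h] qp_mult2 by simp
qed

lemma qc_c_X: "qcomm ec eX 0"
  unfolding ec_def eh_def qp_def
  by (intro qcomm_add_left qcomm_sc_left)
   (rule qcomm_eq[OF qcomm_mult_left[OF qc_psi_X qc_phi_X]]
      qcomm_eq[OF qcomm_mult_left[OF qcK(5) qcomm_mult_left[OF qcY(1) qcomm_self]]], simp)+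

lemma qc_c_Y: "qcomm ec eY 0"
  unfolding ec_def eh_def qp_def
  by (intro qcomm_add_left qcomm_sc_left)
   (rule qcomm_eq[OF qcomm_mult_left[OF qc_psi_Y qc_phi_Y]]
      qcomm_eq[OF qcomm_mult_left[OF qcK(7) qcomm_mult_left[OF qcomm_self qcXY]]], simp)+

lemma qc_c_K: "qcomm ec eK 0"
  unfolding ec_def eh_def qp_def
  by (intro qcomm_add_left qcomm_sc_left)
   (rule qcomm_eq[OF qcomm_mult_left[OF qc_psi_K qc_phi_K]]
      qcomm_eq[OF qcomm_mult_left[OF qcomm_self qcomm_mult_left[OF qcY(2) qcX(1)]]], simp)+


section \<open>A spanning set of PBW type\<close>

lemma el_mult: "el (a * b) = el a * el b"
  by (simp add: el_def abs_fam_mult[symmetric])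

lemma el_add: "el (a + b) = el a + el b"
  by (simp add: el_def abs_fam_add[symmetric])

lemma el_1: "el 1 = 1"
  by (simp add: el_def one_fam_def)

lemma el_power: "el (a ^ n) = el a ^ n"
  by (induct n) (simp_all add: el_1 el_mult)

lemma el_const: "el (const c) = sc (\<lambda>_. c)"
  by (simp add: el_def sc_def)

definition Kpow :: "int \<Rightarrow> 'k::field pre_A" where
  "Kpow e = (if e \<ge> 0 then gK ^ nat e else gKinv ^ nat (- e))"

lemma K_Kpow: "(eK :: 'k::field fam) * el (Kpow e) = el (Kpow (e + 1))"
proof (cases "e \<ge> 0")
  case True
  then have "nat (e + 1) = Suc (nat e)" by simp
  then show ?thesis using True unfolding Kpow_def el_mult[symmetric] by simp
next
  case False
  then have "nat (- e) = Suc (nat (- (e + 1)))" by simp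
  then have "el (Kpow e) = (eK' :: 'k fam) * eK' ^ nat (- (e + 1))" using False
    unfolding el_power[symmetric] el_mult[symmetric] Kpow_def by simp
  moreover have "el (Kpow (e + 1)) = (eK' :: 'k fam) ^ nat (- (e + 1))"
  proof (cases "e = -1")
    case True
    then show ?thesis by (simp add: Kpow_def el_1)
  qed (use False in \<open>simp add: Kpow_def el_power\<close>)
  ultimately show ?thesis by (simp only: K_Kinv2)
qed

lemma Kinv_Kpow: "eK' * el (Kpow e) = el (Kpow (e - 1))"
  unfolding K_Kpow[of "e - 1", simplified, symmetric] by (rule Kinv_K2)

lemma qcomm_Kpow:
  assumes "qcomm g eK m" and "qcomm g eK' (- m)"
  shows "qcomm g (el (Kpow e)) (m * e)"
proof (cases "e \<ge> 0")
  case True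
  then show ?thesis using qcomm_power_right[OF assms(1), of "nat e"] by (simp add: Kpow_def el_power)
next
  case False
  then show ?thesis using qcomm_power_right[OF assms(2), of "nat (- e)"] by (simp add: Kpow_def el_power)
qed

lemma Kpow_K: "el (Kpow e) * (eK * z) = el (Kpow (e + 1)) * (z :: 'k::field fam)"
proof -
  have "qcomm (eK :: 'k fam) (el (Kpow e)) (0 * e)"
    by (rule qcomm_Kpow) (simp_all add: qcomm_self qcomm_KK)
  then have "eK * el (Kpow e) = el (Kpow e) * (eK :: 'k fam)" by (simp add: qcomm_def)
  then show ?thesis unfolding K_Kpow[symmetric] by (simp only: mult.assoc[symmetric])
qed

lemma Kpow_Kinv: "el (Kpow e) * (eK' * z) = el (Kpow (e - 1)) * (z :: 'k::field fam)"
proof -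
  have "qcomm (eK' :: 'k fam) (el (Kpow e)) (0 * e)"
    by (rule qcomm_Kpow) (simp_all add: qcomm_self qcomm_KK)
  then have "eK' * el (Kpow e) = el (Kpow e) * (eK' :: 'k fam)" by (simp add: qcomm_def)
  then show ?thesis unfolding Kinv_Kpow[symmetric] by (simp only: mult.assoc[symmetric])
qed

lemma qcE_Kpow: "qcomm eE (el (Kpow e)) (- 2 * e)"
  by (rule qcomm_Kpow) (use qcE in simp_all)

lemma qcF_Kpow: "qcomm eF (el (Kpow e)) (2 * e)"
  by (rule qcomm_Kpow) (use qcF in simp_all)

definition pbw :: "nat \<times> nat \<times> int \<times> nat \<times> nat \<Rightarrow> 'k::field pre_A" where
  "pbw = (\<lambda>(a, b, e, m, n). gX ^ a * (gY ^ b * (Kpow e * (gE ^ m * gF ^ n))))"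

abbreviation eP where "eP a b e m n \<equiv> el (pbw (a, b, e, m, n))"

lemma eP_eq: "eP a b e m n = eX ^ a * (eY ^ b * (el (Kpow e) * (eE ^ m * eF ^ n)))"
  by (simp add: pbw_def el_mult el_power)

lemma X_eP: "eX * eP a b e m n = eP (Suc a) b e m n"
  by (simp add: eP_eq mult.assoc)

lemma Y_eP: "eY * eP a b e m n = qp (- int a) * eP a (Suc b) e m n"
  using qcommD2[OF qcomm_power_right[OF qcY(1), of a]] by (simp add: eP_eq mult.assoc)

lemma K_eP: "eK * eP a b e m n = qp (int a - int b) * eP a b (e + 1) m n"
proof -
  have "eK * eP a b e m n = qp (int a) * (eX ^ a * (qp (- int b) * (eY ^ b * (eK * (el (Kpow e) * (eE ^ m * eF ^ n))))))"
    unfolding eP_eq qcommD2[OF qcomm_power_right[OF qcK(5), of a]] qcommD2[OF qcomm_power_right[OF qcK(7), of b]]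
    by simp
  then show ?thesis
    unfolding qp_commute2[of "eX ^ a"] qp_mult2 eP_eq mult.assoc[symmetric, of eK] K_Kpow by simp
qed

lemma Kinv_eP: "eK' * eP a b e m n = qp (int b - int a) * eP a b (e - 1) m n"
proof -
  have "eK' * eP a b e m n = qp (- int a) * (eX ^ a * (qp (int b) * (eY ^ b * (eK' * (el (Kpow e) * (eE ^ m * eF ^ n))))))"
    unfolding eP_eq qcommD2[OF qcomm_power_right[OF qcK(6), of a]] qcommD2[OF qcomm_power_right[OF qcK(8), of b]]
    by simp
  then show ?thesis
    unfolding qp_commute2[of "eX ^ a"] qp_mult2 eP_eq mult.assoc[symmetric, of eK'] Kinv_Kpow by simp
qed

lemma E_eP: "(eE :: 'a::field fam) * eP a b e m n =
    qp (int a) * (qp (- int b) * (qp (- 2 * e) * eP a b e (Suc m) n) + Sm b * eP (Suc a) (b - 1) e m n)"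
proof -
  define R where "R = el (Kpow e) * (eE ^ m * (eF ^ n :: 'a fam))"
  have 1: "(eE :: 'a fam) * R = qp (- 2 * e) * (el (Kpow e) * (eE ^ Suc m * eF ^ n))"
    unfolding R_def qcommD2[OF qcE_Kpow] power_Suc mult.assoc ..
  have "(eE :: 'a fam) * eP a b e m n = qp (int a) * (eX ^ a * (eE * eY ^ b * R))"
    unfolding eP_eq R_def[symmetric] using qcommD2[OF qcomm_power_right[OF qcEX, of a]] by (simp add: mult.assoc)
  also have "(eE :: 'a fam) * eY ^ b * R = qp (- int b) * (qp (- 2 * e) * (eY ^ b * (el (Kpow e) * (eE ^ Suc m * eF ^ n))))
      + Sm b * (eX * (eY ^ (b - 1) * R))"
    unfolding E_Y_power distrib_right mult.assoc 1 qp_commute2[of "eY ^ b"] ..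
  also have "(eX :: 'a fam) ^ a * \<dots> = qp (- int b) * (qp (- 2 * e) * eP a b e (Suc m) n) + Sm b * eP (Suc a) (b - 1) e m n"
    unfolding distrib_left qp_commute2[of "eX ^ a"] Sm_commute2[of "eX ^ a"] eP_eq R_def power_Suc2[of eX] mult.assoc ..
  finally show ?thesis .
qed

lemma F_eP: "(eF :: 'a::field fam) * eP a b e m n =
    qp (2 * e) * (eP a b e m (Suc n) - nu * (Sm m * eP a b (e + 1) (m - 1) n - Sp m * eP a b (e - 1) (m - 1) n))
    + Sm a * (qp (int b) * eP (a - 1) (Suc b) (e - 1) m n)"
proof -
  define R where "R = el (Kpow e) * (eE ^ m * (eF ^ n :: 'a fam))"
  have 1: "(eF :: 'a fam) * R = qp (2 * e) * (el (Kpow e) * (eF * eE ^ m * eF ^ n))"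
    unfolding R_def qcommD2[OF qcF_Kpow] mult.assoc ..
  have 2: "eF * (eY ^ b * z) = eY ^ b * (eF * z)" for z :: "'a fam"
    using qcommD2[OF qcomm_power_right[OF qcFY, of b], of z] by simp
  have 3: "eK' * (eY ^ b * R) = qp (int b) * (eY ^ b * (el (Kpow (e - 1)) * (eE ^ m * eF ^ n)))"
    using qcommD2[OF qcomm_power_right[OF qcK(8), of b], of R]
    unfolding R_def mult.assoc[symmetric, of eK'] Kinv_Kpow by simp
  have "(eF :: 'a fam) * eP a b e m n = (eF * eX ^ a) * (eY ^ b * R)"
    unfolding eP_eq R_def[symmetric] mult.assoc ..
  also have "\<dots> = eX ^ a * (eY ^ b * (eF * R)) + Sm a * (eX ^ (a - 1) * (eY * (eK' * (eY ^ b * R))))"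
    unfolding F_X_power distrib_right mult.assoc 2 ..
  also have "Sm a * ((eX :: 'a fam) ^ (a - 1) * (eY * (eK' * (eY ^ b * R)))) = Sm a * (qp (int b) * eP (a - 1) (Suc b) (e - 1) m n)"
    unfolding 3 qp_commute2[of eY] qp_commute2[of "eX ^ (a - 1)"] eP_eq power_Suc mult.assoc ..
  also have "(eX :: 'a fam) ^ a * (eY ^ b * (eF * R)) =
      qp (2 * e) * (eX ^ a * (eY ^ b * (el (Kpow e) * (eF * eE ^ m * eF ^ n))))"
    unfolding 1 qp_commute2[of "eY ^ b"] qp_commute2[of "eX ^ a"] ..
  also have "(eX :: 'a fam) ^ a * (eY ^ b * (el (Kpow e) * (eF * eE ^ m * eF ^ n))) =
      eP a b e m (Suc n) - nu * (Sm m * eP a b (e + 1) (m - 1) n - Sp m * eP a b (e - 1) (m - 1) n)"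
    unfolding F_E_power left_diff_distrib right_diff_distrib mult.assoc
      nu_commute2[of "el (Kpow e)"] nu_commute2[of "eY ^ b"] nu_commute2[of "eX ^ a"]
      Sm_commute2[of "el (Kpow e)"] Sm_commute2[of "eY ^ b"] Sm_commute2[of "eX ^ a"]
      Sp_commute2[of "el (Kpow e)"] Sp_commute2[of "eY ^ b"] Sp_commute2[of "eX ^ a"]
      Kpow_K Kpow_Kinv eP_eq power_Suc ..
  finally show ?thesis .
qed

text \<open>The coefficients are functions of the parameter: one derivation straightens an element
  for all \<open>q\<close> at once.\<close>

inductive_set pbw_span :: "'k::field fam set" where
  base: "sc f * el (pbw j) \<in> pbw_span"
| add: "x \<in> pbw_span \<Longrightarrow> y \<in> pbw_span \<Longrightarrow> x + y \<in> pbw_span"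

lemma pbw_span_sc: "x \<in> pbw_span \<Longrightarrow> sc f * x \<in> pbw_span"
  by (induct rule: pbw_span.induct) (simp_all add: sc_mult2 distrib_left pbw_span.intros)

lemma pbw_span_el: "el (pbw j) \<in> pbw_span"
  using pbw_span.base[of "\<lambda>_. 1" j] by (simp add: sc_1)

lemma pbw_span_diff: "x \<in> pbw_span \<Longrightarrow> y \<in> pbw_span \<Longrightarrow> x - y \<in> pbw_span"
proof -
  assume "x \<in> pbw_span" "y \<in> pbw_span"
  then have "x + sc (\<lambda>_. 0 - 1) * y \<in> pbw_span" by (intro pbw_span.add pbw_span_sc)
  then show ?thesis unfolding sc_diff[symmetric] sc_0 sc_1 by simp
qed

text \<open>Straightening. Left multiplication by generators suffices, because the elements of the
  free algebra arise by prefixing letters.\<close>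

lemma pbw_span_gen: "x \<in> pbw_span \<Longrightarrow> el (gen g) * x \<in> pbw_span"
proof (induct rule: pbw_span.induct)
  case (base f j)
  obtain a b e m n where j: "j = (a, b, e, m, n)" by (cases j)
  have "el (gen g) * el (pbw j) \<in> pbw_span"
    unfolding j
  proof (cases g)
    case gen_E
    show "el (gen g) * eP a b e m n \<in> pbw_span" unfolding gen_E E_eP qp_def Sm_def
      by (intro pbw_span_sc pbw_span.add pbw_span_el)
  next
    case gen_F
    show "el (gen g) * eP a b e m n \<in> pbw_span" unfolding gen_F F_eP qp_def Sm_def Sp_def nu_def
      by (intro pbw_span_sc pbw_span.add pbw_span_diff pbw_span_el)
  next
    case gen_K
    show "el (gen g) * eP a b e m n \<in> pbw_span" unfolding gen_K K_eP qp_def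
      by (intro pbw_span_sc pbw_span_el)
  next
    case gen_Kinv
    show "el (gen g) * eP a b e m n \<in> pbw_span" unfolding gen_Kinv Kinv_eP qp_def
      by (intro pbw_span_sc pbw_span_el)
  next
    case gen_X
    show "el (gen g) * eP a b e m n \<in> pbw_span" unfolding gen_X X_eP by (rule pbw_span_el)
  next
    case gen_Y
    show "el (gen g) * eP a b e m n \<in> pbw_span" unfolding gen_Y Y_eP qp_def
      by (intro pbw_span_sc pbw_span_el)
  qed
  then show ?case unfolding sc_commute2 by (rule pbw_span_sc)
qed (simp add: distrib_left pbw_span.add)

lemma el_in_pbw_span: "el a \<in> (pbw_span :: 'k::field fam set)"
proof (induct a rule: free_algebra_induct)
  case (const c)
  have "el (pbw (0, 0, 0, 0, 0)) = (1 :: 'k fam)" by (simp add: pbw_def Kpow_def el_1)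
  then show ?case using pbw_span.base[of "\<lambda>_. c" "(0, 0, 0, 0, 0)"] by (simp add: el_const)
qed (simp_all add: el_add el_mult pbw_span.add pbw_span_gen)

lemma pbw_span_imp_sum:
  "x \<in> pbw_span \<Longrightarrow> \<exists>J c. finite J \<and> x = abs_fam (\<lambda>q. \<Sum>j\<in>J. const (c j q) * pbw j)"
proof (induct rule: pbw_span.induct)
  case (base f j)
  show ?case
    by (rule exI[of _ "{j}"], rule exI[of _ "\<lambda>_. f"]) (simp add: abs_fam_mult sc_def el_def)
next
  case (add x y)
  from add.hyps(2) obtain J c where J: "finite J"
    and x: "x = abs_fam (\<lambda>q. \<Sum>j\<in>J. const (c j q) * pbw j)" by (elim exE conjE)
  from add.hyps(4) obtain J' c' where J': "finite J'"
    and y: "y = abs_fam (\<lambda>q. \<Sum>j\<in>J'. const (c' j q) * pbw j)" by (elim exE conjE)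
  define d where "d j q = (if j \<in> J then c j q else 0) + (if j \<in> J' then c' j q else 0)" for j q
  have "(\<Sum>j\<in>J \<union> J'. const (d j q) * pbw j) =
      (\<Sum>j\<in>J. const (c j q) * pbw j) + (\<Sum>j\<in>J'. const (c' j q) * pbw j)" for q
  proof -
    have "(\<Sum>j\<in>J. const (c j q) * pbw j) = (\<Sum>j\<in>J \<union> J'. const (if j \<in> J then c j q else 0) * pbw j)"
      using J J' by (intro sum.mono_neutral_cong_left) auto
    moreover have "(\<Sum>j\<in>J'. const (c' j q) * pbw j) = (\<Sum>j\<in>J \<union> J'. const (if j \<in> J' then c' j q else 0) * pbw j)"
      using J J' by (intro sum.mono_neutral_cong_left) auto
    ultimately show ?thesis by (simp only: d_def const_add distrib_right sum.distrib)
  qed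
  then have "x + y = abs_fam (\<lambda>q. \<Sum>j\<in>J \<union> J'. const (d j q) * pbw j)"
    unfolding x y by (simp add: abs_fam_add)
  moreover have "finite (J \<union> J')" using J J' by simp
  ultimately show ?case by (intro exI conjI)
qed

theorem pbw_spanning:
  assumes "generic q"
  shows "\<exists>J c. finite J \<and> cls q a = cls q (\<Sum>j\<in>J. const (c j) * pbw j)"
proof -
  from pbw_span_imp_sum[OF el_in_pbw_span[of a]] obtain J c
    where J: "finite J" and a: "el a = abs_fam (\<lambda>q. \<Sum>j\<in>J. const (c j q) * pbw j)"
    by (elim exE conjE)
  show ?thesis using J abs_fam_eq[OF a[unfolded el_def] assms] by (intro exI conjI)
qed


section \<open>Identities in \<open>A\<close>\<close>

lemma qcomm_cls:
  assumes "qcomm (abs_fam f) (abs_fam g) m" and "generic q"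
  shows "cls q (f q * g q) = cls q (const (q powi m) * (g q * f q))"
  using abs_fam_eq[OF _ assms(2), of "\<lambda>q. f q * g q" "\<lambda>q. const (q powi m) * (g q * f q)"]
    assms(1)
  by (simp add: qcomm_def qp_def fam_abs)

lemma qcomm_cls_el:
  assumes "qcomm (el g) (el h) m" and "generic q"
  shows "cls q (g * h) = cls q (const (q powi m) * (h * g))"
  using qcomm_cls[of "\<lambda>_. g" "\<lambda>_. h"] assms by (simp add: el_def)

lemma qcomm_cls_el_1:
  assumes "qcomm (el g) (el h) m" and "generic q" and "q powi m = 1"
  shows "cls q (g * h) = cls q (h * g)"
  using qcomm_cls_el[OF assms(1,2)] assms(3) by simp

text \<open>Used with \<open>n = l\<close> for the powers of the generators and with
  \<open>n\<close> the order of \<open>q ^ 2\<close> for those of \<phi> and \<psi>.\<close>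

lemma root_of_unity_sums:
  fixes q :: "'k::field"
  assumes "q ^ 2 \<noteq> 1" and "q ^ (2 * n) = 1" and "q \<noteq> 0"
  shows "(\<Sum>i<n. q powi (2 * int i)) = 0" and "(\<Sum>i<n. q powi (- 2 * int i)) = 0"
proof -
  have 1: "(\<Sum>i<n. x ^ i) = 0" if "x ^ n = 1" "x \<noteq> 1" for x :: 'k
    using power_diff_1_eq[of x n] that by simp
  have "q powi (2 * int i) = (q ^ 2) ^ i" for i
    using power_int_mult[of q 2 "int i"] by simp
  then show "(\<Sum>i<n. q powi (2 * int i)) = 0" using 1[of "q ^ 2"] assms by (simp add: power_mult)
  have "q powi (- 2 * int i) = (inverse (q ^ 2)) ^ i" for i
    using power_int_mult[of q "-2" "int i"] by (simp add: power_int_minus)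
  moreover have "inverse (q ^ 2) \<noteq> 1" using assms(1,3) by (metis inverse_1 inverse_inverse_eq)
  moreover have "(inverse (q ^ 2)) ^ n = 1" using assms(2) by (simp add: power_inverse power_mult)
  ultimately show "(\<Sum>i<n. q powi (- 2 * int i)) = 0" using 1 by simp
qed

lemma qcomm_root_power:
  assumes "qcomm (el z) (el g) m" and "generic q" and "q ^ l = 1"
  shows "cls q (z ^ l * g) = cls q (g * z ^ l)"
proof (rule qcomm_cls_el_1[OF _ assms(2)])
  show "qcomm (el (z ^ l)) (el g) (m * int l)"
    unfolding el_power by (rule qcomm_power_left[OF assms(1)])
  show "q powi (m * int l) = 1"
    using power_int_mult[of q "int l" m] assms(3) by (simp add: mult.commute)
qed

definition central_A :: "'k::field \<Rightarrow> 'k pre_A \<Rightarrow> bool" where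
  "central_A q z \<longleftrightarrow> (\<forall>a. cls q (z * a) = cls q (a * z))"

lemma central_A_if_gens:
  assumes "\<And>g. cls q (z * gen g) = cls q (gen g * z)"
  shows "central_A q z"
  unfolding central_A_def
proof
  fix a show "cls q (z * a) = cls q (a * z)"
  proof (induct a rule: free_algebra_induct)
    case (const c)
    show ?case by (simp add: const_central)
  next
    case (gen g a)
    have "cls q (z * (gen g * a)) = cls q ((gen g * z) * a)"
      unfolding mult.assoc[symmetric] by (intro cls_cong_mult assms refl)
    also have "\<dots> = cls q (gen g * (a * z))"
      unfolding mult.assoc by (intro cls_cong_mult gen refl)
    finally show ?case by (simp add: mult.assoc)
  next
    case (add a b)
    then show ?case by (simp add: distrib_left distrib_right cls_add)
  qed
qed

context
  fixes q :: "'k::field" and l :: nat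
  assumes gq: "generic q" and ql: "q ^ l = 1"
begin

lemma q_powi_l: "q powi int l = 1" "q powi (- int l) = 1" "q powi (- 2 * int l) = 1" "q powi (2 * int l) = 1"
proof -
  show 1: "q powi int l = 1" by (simp add: ql)
  then show 2: "q powi (- int l) = 1" by (simp add: power_int_minus ql)
  show "q powi (- 2 * int l) = 1" using power_int_mult[of q "- int l" 2] 2 by (simp add: mult.commute)
  show "q powi (2 * int l) = 1" using power_int_mult[of q "int l" 2] 1 by (simp add: mult.commute)
qed

lemma q_sums_l: "(\<Sum>i<l. q powi (2 * int i)) = 0" "(\<Sum>i<l. q powi (- 2 * int i)) = 0"
  using gq root_of_unity_sums[of q l] ql by (simp_all add: generic_def power_mult mult.commute[of 2])

text \<open>A generator that q-commutes with \<open>gX\<close> commutes with its \<open>l\<close>-th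
  power. For \<open>gF\<close>, the only other one, the correction term has the factor
  \<open>Sm l\<close>, which vanishes at \<open>q\<close>. The powers of the other generators are
  treated alike.\<close>

lemma central_X: "central_A q (gX ^ l)"
proof (rule central_A_if_gens)
  fix g
  have F: "cls q (gF * gX ^ l) = cls q (gX ^ l * gF)"
    using abs_fam_eq[OF _ gq, of "\<lambda>q. gF * gX ^ l"
        "\<lambda>q. gX ^ l * gF + const (\<Sum>i<l. q powi (- 2 * int i)) * (gX ^ (l - 1) * (gY * gKinv))"]
      F_X_power[of l] q_sums_l(2) by (simp add: fam_abs Sm_def)
  note pw = qcomm_root_power[OF _ gq ql]
  show "cls q (gX ^ l * gen g) = cls q (gen g * gX ^ l)"
    using F pw[OF qcomm_sym[OF qcEX]] pw[OF qcX(1)] pw[OF qcX(2)] pw[OF qcomm_self] pw[OF qcXY]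
    by (cases g; simp only:)
qed

lemma central_Y: "central_A q (gY ^ l)"
proof (rule central_A_if_gens)
  fix g
  have E: "cls q (gE * gY ^ l) = cls q (gY ^ l * gE)"
    using abs_fam_eq[OF _ gq, of "\<lambda>q. gE * gY ^ l"
        "\<lambda>q. const (q powi - int l) * (gY ^ l * gE) + const (\<Sum>i<l. q powi (- 2 * int i)) * (gX * gY ^ (l - 1))"]
      E_Y_power[of l] q_sums_l(2) q_powi_l by (simp add: fam_abs Sm_def qp_def)
  note pw = qcomm_root_power[OF _ gq ql]
  show "cls q (gY ^ l * gen g) = cls q (gen g * gY ^ l)"
    using E pw[OF qcomm_sym[OF qcFY]] pw[OF qcY(1)] pw[OF qcY(2)] pw[OF qcY(3)] pw[OF qcomm_self]
    by (cases g; simp only:)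
qed

lemma central_K: "central_A q (gK ^ l)"
proof (rule central_A_if_gens)
  fix g
  note pw = qcomm_root_power[OF _ gq ql]
  show "cls q (gK ^ l * gen g) = cls q (gen g * gK ^ l)"
    using pw[OF qcK(1)] pw[OF qcK(3)] pw[OF qcK(5)] pw[OF qcK(7)] pw[OF qcomm_self] pw[OF qcomm_KK(1)]
    by (cases g; simp only:)
qed

lemma central_Kinv: "central_A q (gKinv ^ l)"
proof (rule central_A_if_gens)
  fix g
  note pw = qcomm_root_power[OF _ gq ql]
  show "cls q (gKinv ^ l * gen g) = cls q (gen g * gKinv ^ l)"
    using pw[OF qcK(2)] pw[OF qcK(4)] pw[OF qcK(6)] pw[OF qcK(8)] pw[OF qcomm_self] pw[OF qcomm_KK(2)]
    by (cases g; simp only:)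
qed

lemma central_E: "central_A q (gE ^ l)"
proof (rule central_A_if_gens)
  fix g
  have Y: "cls q (gE ^ l * gY) = cls q (gY * gE ^ l)"
    using abs_fam_eq[OF _ gq, of "\<lambda>q. gE ^ l * gY"
        "\<lambda>q. const (q powi - int l) * (gY * gE ^ l) + const (q powi (int l - 1)) *
          (const (\<Sum>i<l. q powi (- 2 * int i)) * (gX * gE ^ (l - 1)))"]
      E_power_Y[of l] q_sums_l(2) q_powi_l by (simp add: fam_abs Sm_def qp_def)
  have F: "cls q (gF * gE ^ l) = cls q (gE ^ l * gF)"
    using abs_fam_eq[OF _ gq, of "\<lambda>q. gF * gE ^ l"
        "\<lambda>q. gE ^ l * gF - const (inverse (q - inverse q)) *
          (const (\<Sum>i<l. q powi (- 2 * int i)) * (gK * gE ^ (l - 1)) -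
           const (\<Sum>i<l. q powi (2 * int i)) * (gKinv * gE ^ (l - 1)))"]
      F_E_power[of l] q_sums_l by (simp add: fam_abs Sm_def Sp_def nu_def)
  note pw = qcomm_root_power[OF _ gq ql]
  show "cls q (gE ^ l * gen g) = cls q (gen g * gE ^ l)"
    using Y F pw[OF qcEX] pw[OF qcE(2)] pw[OF qcE(3)] pw[OF qcomm_self]
    by (cases g; simp only:)
qed

lemma central_F: "central_A q (gF ^ l)"
proof (rule central_A_if_gens)
  fix g
  have X: "cls q (gF ^ l * gX) = cls q (gX * gF ^ l)"
    using abs_fam_eq[OF _ gq, of "\<lambda>q. gF ^ l * gX"
        "\<lambda>q. gX * gF ^ l + const (\<Sum>i<l. q powi (- 2 * int i)) * (gY * (gKinv * gF ^ (l - 1)))"]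
      F_power_X[of l] q_sums_l(2) by (simp add: fam_abs Sm_def)
  have E: "cls q (gF ^ l * gE) = cls q (gE * gF ^ l)"
    using abs_fam_eq[OF _ gq, of "\<lambda>q. gF ^ l * gE"
        "\<lambda>q. gE * gF ^ l - const (inverse (q - inverse q)) *
          (const (\<Sum>i<l. q powi (2 * int i)) * (gK * gF ^ (l - 1)) -
           const (\<Sum>i<l. q powi (- 2 * int i)) * (gKinv * gF ^ (l - 1)))"]
      F_power_E[of l] q_sums_l by (simp add: fam_abs Sm_def Sp_def nu_def)
  note pw = qcomm_root_power[OF _ gq ql]
  show "cls q (gF ^ l * gen g) = cls q (gen g * gF ^ l)"
    using X E pw[OF qcFY] pw[OF qcF(2)] pw[OF qcF(3)] pw[OF qcomm_self]
    by (cases g; simp only:)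
qed

end


section \<open>A representation on a quantum torus\<close>

type_synonym lattice = "int \<times> int \<times> int \<times> int \<times> int"

type_synonym 'k torus_fun = "int \<Rightarrow> int \<Rightarrow> (lattice \<Rightarrow>\<^sub>0 'k)"

definition sm :: "'k \<Rightarrow> 'k torus_fun \<Rightarrow> 'k::field torus_fun" where
  "sm c f = (\<lambda>s d. Poly_Mapping.single 0 c * f s d)"

text \<open>
  The coefficient of the basis vector with \<open>K\<close>-eigenvalue \<open>q\<^sup>-\<^sup>s\<close> and \<open>YX\<close>-eigenvalue \<open>q\<^sup>d\<close> is \<open>f s d\<close>. The index
  \<open>(w, k, x, p, r)\<close> stands for \<open>(YX)\<^sup>w K\<^sup>k X\<^sup>x \<phi>\<^sup>p c\<^sup>r\<close> with \<open>c\<close> the central element \<open>\<psi>\<phi> + q\<^sup>3KYX\<close>.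
\<close>

fun U :: "'k \<Rightarrow> lattice \<Rightarrow> 'k torus_fun \<Rightarrow> 'k::field torus_fun" where
  "U q (w, k, x, p, r) f = (\<lambda>s d.
     Poly_Mapping.single (w, k, x, p, r) (q powi (w * (d - x + p) - k * (s - x - p))) * f (s - x - p) (d - x + p))"

lemma U_add: "U q g (f + h) = U q g f + U q g h"
  by (cases g) (auto simp: fun_eq_iff distrib_left)

lemma U_diff: "U q g (f - h) = U q g f - U q g h"
  by (cases g) (auto simp: fun_eq_iff right_diff_distrib)

lemma U_sm: "U q g (sm c f) = sm c (U q g f)"
  by (cases g) (auto simp: fun_eq_iff sm_def ac_simps)

lemma sm_add: "sm c (f + h) = sm c f + sm c h"
  by (auto simp: fun_eq_iff sm_def distrib_left)

lemma sm_diff: "sm c (f - h) = sm c f - sm c h"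
  by (auto simp: fun_eq_iff sm_def right_diff_distrib)

lemma sm_sm: "sm a (sm b f) = sm (a * b) f"
  by (auto simp: fun_eq_iff sm_def mult.assoc[symmetric] mult_single)

lemma sm_1: "sm 1 f = f"
  by (auto simp: fun_eq_iff sm_def)

lemma sm_0: "sm 0 f = 0"
  by (auto simp: fun_eq_iff sm_def)

lemma sm_add_left: "sm (a + b) f = sm a f + sm b f"
  by (auto simp: fun_eq_iff sm_def single_add distrib_right)

lemma sm_uminus_left: "sm (- a) f = - sm a f"
  by (auto simp: fun_eq_iff sm_def single_uminus)

fun form :: "lattice \<Rightarrow> lattice \<Rightarrow> int" where
  "form (w, k, x, p, r) (w', k', x', p', r') = w' * (x - p) - k' * (x + p)"

lemma U_U:
  assumes "q \<noteq> 0"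
  shows "U q h (U q g f) = sm (q powi form g h) (U q (g + h) f)"
proof -
  obtain w k x p r where g: "g = (w, k, x, p, r)" by (cases g)
  obtain w' k' x' p' r' where h: "h = (w', k', x', p', r')" by (cases h)
  show ?thesis
  proof (intro ext)
    fix s d
    have 1: "s - x' - p' - x - p = s - (x + x') - (p + p')" "d - x' + p' - x + p = d - (x + x') + (p + p')"
      by simp_all
    have 2: "w' * (d - x' + p') - k' * (s - x' - p') + (w * (d - (x + x') + (p + p')) - k * (s - (x + x') - (p + p'))) =
      form g h + ((w + w') * (d - (x + x') + (p + p')) - (k + k') * (s - (x + x') - (p + p')))"
      by (simp add: g h algebra_simps)
    have 3: "h + g = g + h" by (rule add.commute)
    have "U q h (U q g f) s d =
        Poly_Mapping.single (h + g) (q powi (w' * (d - x' + p') - k' * (s - x' - p')) *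
          q powi (w * (d - (x + x') + (p + p')) - k * (s - (x + x') - (p + p')))) *
        f (s - (x + x') - (p + p')) (d - (x + x') + (p + p'))"
      unfolding g h U.simps 1 mult.assoc[symmetric] mult_single ..
    also have "\<dots> = Poly_Mapping.single (g + h) (q powi form g h *
          q powi ((w + w') * (d - (x + x') + (p + p')) - (k + k') * (s - (x + x') - (p + p')))) *
        f (s - (x + x') - (p + p')) (d - (x + x') + (p + p'))"
      unfolding 3 power_int_add[OF disjI1[OF assms], symmetric] 2 ..
    also have "\<dots> = sm (q powi form g h) (U q (g + h) f) s d"
      unfolding sm_def g h by (simp add: mult.assoc[symmetric] mult_single)
    finally show "U q h (U q g f) s d = sm (q powi form g h) (U q (g + h) f) s d" .
  qed
qed

declare U.simps [simp del]

text \<open>The formulas for \<open>E\<close> and \<open>F\<close> solve \<phi> = X - (q - q^-1) Y E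
  and \<psi> = (1 - q^2) X F - q^2 Y K^-1, where \<psi> is replaced by (c - q^3 K Y X) times the
  inverse of \<phi>. The inverse of \<open>Y\<close> is q^-1 times the operator with index
  \<open>(-1, 0, 1, 0, 0)\<close>, whence the factor \<open>inverse q\<close> for \<open>E\<close>;
  in \<open>F\<close> that factor is q^2 times a q^-3 from reordering.\<close>

fun torus_gen :: "'k::field \<Rightarrow> generator \<Rightarrow> 'k torus_fun \<Rightarrow> 'k torus_fun" where
  "torus_gen q gen_X f = U q (0, 0, 1, 0, 0) f"
| "torus_gen q gen_Y f = U q (1, 0, -1, 0, 0) f"
| "torus_gen q gen_K f = U q (0, 1, 0, 0, 0) f"
| "torus_gen q gen_Kinv f = U q (0, -1, 0, 0, 0) f"
| "torus_gen q gen_E f = sm (inverse q * inverse (q - inverse q))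
     (U q (-1, 0, 2, 0, 0) f - U q (-1, 0, 1, 1, 0) f)"
| "torus_gen q gen_F f = sm (inverse (1 - q ^ 2))
     (U q (0, 0, -1, -1, 1) f - sm (q ^ 3) (U q (1, 1, -1, -1, 0) f) + sm (inverse q) (U q (1, -1, -2, 0, 0) f))"

lemma torus_gen_add: "torus_gen q g (f + h) = torus_gen q g f + torus_gen q g h"
  by (cases g) (simp_all add: U_add sm_add sm_diff U_diff algebra_simps)

lemma torus_gen_sm: "torus_gen q g (sm c f) = sm c (torus_gen q g f)"
  by (cases g) (simp_all add: U_sm sm_add sm_diff sm_sm ac_simps)

definition torus_act :: "'k::field \<Rightarrow> 'k pre_A \<Rightarrow> 'k torus_fun \<Rightarrow> 'k torus_fun" where
  "torus_act q a f = lin (\<lambda>w c. sm c (foldl (\<lambda>v x. torus_gen q x v) f (letters w))) a"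

lemma torus_act_add: "torus_act q (a + b) f = torus_act q a f + torus_act q b f"
  unfolding torus_act_def by (rule lin_add) (simp_all add: sm_0 sm_add_left)

lemma torus_act_single:
  "torus_act q (Poly_Mapping.single w c) f = sm c (foldl (\<lambda>v x. torus_gen q x v) f (letters w))"
  unfolding torus_act_def by (rule lin_single) (simp add: sm_0)

lemma torus_act_zero: "torus_act q 0 f = 0"
  by (simp add: torus_act_def)

lemma torus_act_uminus: "torus_act q (- a) f = - torus_act q a f"
  using torus_act_add[of q "- a" a f] by (simp add: torus_act_zero eq_neg_iff_add_eq_0)

lemma torus_act_diff: "torus_act q (a - b) f = torus_act q a f - torus_act q b f"
  using torus_act_add[of q a "- b" f] by (simp add: torus_act_uminus)

lemma torus_act_sum: "torus_act q (sum g A) f = (\<Sum>x\<in>A. torus_act q (g x) f)"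
  by (induct A rule: infinite_finite_induct) (simp_all add: torus_act_add torus_act_zero)

lemma torus_act_const: "torus_act q (const c) f = sm c f"
  by (simp add: const_def torus_act_single zero_word_def)

lemma torus_act_1: "torus_act q 1 f = f"
  using torus_act_const[of q 1 f] by (simp add: sm_1)

lemma torus_act_const_mult: "torus_act q (const c * a) f = sm c (torus_act q a f)"
proof (induct a rule: single_induct)
  case (single w b)
  show ?case by (simp add: const_def mult_single torus_act_single sm_sm)
next
  case (add a b)
  then show ?case by (simp only: distrib_left torus_act_add sm_add)
qed

lemma torus_act_gen_mult: "torus_act q (gen x * a) f = torus_act q a (torus_gen q x f)"
proof (induct a rule: single_induct)
  case (single w b)
  show ?case by (simp add: gen_def mult_single plus_word_def torus_act_single)
next
  case (add a b)
  then show ?case by (simp only: distrib_left torus_act_add)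
qed

lemma torus_act_vadd: "torus_act q a (f + h) = torus_act q a f + torus_act q a h"
proof (induct a arbitrary: f h rule: free_algebra_induct)
  case (const c)
  show ?case by (simp only: torus_act_const sm_add)
next
  case (gen x a)
  then show ?case by (simp only: torus_act_gen_mult torus_gen_add)
next
  case (add a b)
  then show ?case by (simp only: torus_act_add add_ac)
qed

lemma torus_act_sm: "torus_act q a (sm c f) = sm c (torus_act q a f)"
proof (induct a arbitrary: f rule: free_algebra_induct)
  case (const b)
  show ?case by (simp only: torus_act_const sm_sm mult.commute)
next
  case (gen x a)
  then show ?case by (simp only: torus_act_gen_mult torus_gen_sm)
next
  case (add a b)
  then show ?case by (simp only: torus_act_add sm_add)
qed

lemma torus_act_mult: "torus_act q (a * b) f = torus_act q b (torus_act q a f)"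
proof (induct a arbitrary: f rule: free_algebra_induct)
  case (const c)
  show ?case by (simp only: torus_act_const_mult torus_act_const torus_act_sm)
next
  case (gen x a)
  then show ?case by (simp only: torus_act_gen_mult mult.assoc)
next
  case (add a b)
  then show ?case by (simp only: torus_act_add distrib_right torus_act_vadd)
qed

lemma torus_act_gen: "torus_act q (gen x) f = torus_gen q x f"
  using torus_act_gen_mult[of q x 1 f] by (simp add: torus_act_1)

context
  fixes q :: "'k::field"
  assumes gq: "generic q"
begin

lemma q_nonzero: "q \<noteq> 0" "q ^ 2 \<noteq> 1" "q - inverse q \<noteq> 0" "1 - q ^ 2 \<noteq> 0"
  using gq by (auto simp: generic_def field_simps power2_eq_square)

lemma U_0: "U q (0, 0, 0, 0, 0) f = f"
proof (intro ext)
  fix s d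
  have 0: "(0, 0, 0, 0, 0) = (0 :: lattice)" by (simp add: zero_prod_def)
  have "U q (0, 0, 0, 0, 0) f s d = Poly_Mapping.single (0, 0, 0, 0, 0) 1 * f s d" by (simp add: U.simps)
  then show "U q (0, 0, 0, 0, 0) f s d = f s d" unfolding 0 by simp
qed

lemma powi_simps: "q powi 2 = q ^ 2" "q powi 3 = q ^ 3" "q powi 4 = q ^ 4" "q powi 1 = q" "q powi -1 = inverse q"
    "q powi -2 = inverse (q ^ 2)"
  by (simp_all add: power_int_minus)

lemmas torus_rel = torus_act_diff torus_act_add torus_act_const_mult torus_act_const torus_act_mult torus_act_gen
  torus_act_1 U_add U_diff U_sm sm_add sm_diff sm_sm sm_1 U_U[OF q_nonzero(1)] U_0 powi_simps

lemma torus_act_KKinv: "torus_act q (gK * gKinv - 1) f = 0"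
  using q_nonzero by (simp add: torus_rel ac_simps)

lemma torus_act_KinvK: "torus_act q (gKinv * gK - 1) f = 0"
  using q_nonzero by (simp add: torus_rel ac_simps)

lemma torus_act_KE: "torus_act q (gK * gE * gKinv - const (q^2) * gE) f = 0"
  using q_nonzero by (simp add: torus_rel ac_simps)

lemma torus_act_KF: "torus_act q (gK * gF * gKinv - const (inverse (q^2)) * gF) f = 0"
  using q_nonzero by (simp add: torus_rel ac_simps)

lemma torus_act_EF: "torus_act q (gE * gF - gF * gE - const (inverse (q - inverse q)) * (gK - gKinv)) f = 0"
proof -
  define n where "n = inverse (q - inverse q)"
  define m where "m = inverse (1 - q ^ 2)"
  have m: "m * (1 - q ^ 2) = 1" using q_nonzero by (simp add: m_def)
  have "inverse q * (inverse q * (n * (q ^ 2 * m))) - inverse q * (inverse q * (n * (q ^ 4 * m))) =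
      inverse q * (inverse q * (q ^ 2 * (n * (m * (1 - q ^ 2)))))"
    by (simp add: algebra_simps power2_eq_square power4_eq_xxxx)
  also have "\<dots> = n" unfolding m using q_nonzero by (simp add: field_simps power2_eq_square)
  finally have 1: "inverse q * (inverse q * (n * (q ^ 2 * m))) = inverse q * (inverse q * (n * (q ^ 4 * m))) + n"
    by (simp add: algebra_simps)
  have "inverse q * (n * (q ^ 3 * (inverse (q ^ 2) * m))) - inverse q * (n * (q ^ 3 * m)) =
      inverse q * (q ^ 3 * (inverse (q ^ 2) * (n * (m * (1 - q ^ 2)))))"
    using q_nonzero by (simp add: field_simps power2_eq_square power3_eq_cube)
  also have "\<dots> = n" unfolding m using q_nonzero by (simp add: field_simps power2_eq_square power3_eq_cube)
  finally have 2: "inverse q * (n * (q ^ 3 * (inverse (q ^ 2) * m))) = inverse q * (n * (q ^ 3 * m)) + n"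
    by (simp add: algebra_simps)
  show ?thesis
    using q_nonzero by (simp add: torus_rel ac_simps 1[unfolded n_def m_def] 2[unfolded n_def m_def] sm_add_left)
qed

lemma torus_act_EX: "torus_act q (gE * gX - const q * gX * gE) f = 0"
  using q_nonzero by (simp add: torus_rel ac_simps)

lemma torus_act_EY: "torus_act q (gE * gY - (gX + const (inverse q) * gY * gE)) f = 0"
proof -
  have 1: "inverse q * (inverse (q - inverse q) * q ^ 2) = 1 + inverse q * inverse (q - inverse q)"
    using q_nonzero by (simp add: field_simps power2_eq_square power3_eq_cube power4_eq_xxxx)
  show ?thesis
    using q_nonzero by (simp add: torus_rel ac_simps 1 sm_add_left)
qed

lemma torus_act_FX: "torus_act q (gF * gX - (gY * gKinv + gX * gF)) f = 0"
proof -
  have 1: "inverse q * inverse (1 - q ^ 2) = inverse q + inverse q * (q ^ 2 * inverse (1 - q ^ 2))"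
    using q_nonzero by (simp add: field_simps power2_eq_square power3_eq_cube power4_eq_xxxx)
  show ?thesis
    using q_nonzero by (simp add: torus_rel ac_simps 1 sm_add_left)
qed

lemma torus_act_FY: "torus_act q (gF * gY - gY * gF) f = 0"
  using q_nonzero by (simp add: torus_rel ac_simps)

lemma torus_act_KX: "torus_act q (gK * gX * gKinv - const q * gX) f = 0"
  using q_nonzero by (simp add: torus_rel ac_simps)

lemma torus_act_KY: "torus_act q (gK * gY * gKinv - const (inverse q) * gY) f = 0"
  using q_nonzero by (simp add: torus_rel ac_simps)

lemma torus_act_XY: "torus_act q (gX * gY - const q * gY * gX) f = 0"
  using q_nonzero by (simp add: torus_rel ac_simps)

lemma torus_act_relator: "w \<in> relators q \<Longrightarrow> torus_act q w f = 0"
  unfolding relators_def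
  by (elim insertE emptyE)
    (simp_all only: torus_act_KKinv torus_act_KinvK torus_act_KE torus_act_KF torus_act_EF torus_act_EX torus_act_EY torus_act_FX torus_act_FY torus_act_KX torus_act_KY torus_act_XY)

end

lemma torus_act_cls:
  assumes gq: "generic q" and eq: "cls q a = cls q b"
  shows "torus_act q a f = torus_act q b f"
proof -
  let ?J = "{w. \<forall>f. torus_act q w f = 0}"
  have z: "torus_act q w 0 = 0" for w
    using torus_act_vadd[of q w 0 0] by simp
  have "relation_ideal q \<subseteq> ?J"
    by (rule relation_ideal_minimal)
      (use torus_act_relator[OF gq] z in \<open>auto simp: torus_act_zero torus_act_add torus_act_mult\<close>)
  then have "torus_act q (a - b) f = 0" using eq unfolding cls_eq_iff by blast
  then show ?thesis by (simp add: torus_act_diff)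
qed


section \<open>Linear independence of the PBW monomials\<close>

lemma lookup_single_mult:
  fixes y :: "('g::ab_group_add) \<Rightarrow>\<^sub>0 'k::semiring_0"
  shows "Poly_Mapping.lookup (Poly_Mapping.single g c * y) h = c * Poly_Mapping.lookup y (h - g)"
proof (induct y rule: single_induct)
  case (single w b)
  show ?case by (auto simp: mult_single lookup_single when_def)
next
  case (add x y)
  then show ?case by (simp add: distrib_left lookup_add)
qed

definition supp :: "'k::field torus_fun \<Rightarrow> lattice set" where
  "supp f = {g. \<exists>s d. Poly_Mapping.lookup (f s d) g \<noteq> 0}"

lemma supp_U:
  assumes "q \<noteq> 0"
  shows "h \<in> supp (U q g f) \<longleftrightarrow> h - g \<in> supp f"
proof -
  obtain w k x p r where g: "g = (w, k, x, p, r)" by (cases g)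
  let ?c = "\<lambda>s d. q powi (w * (d - x + p) - k * (s - x - p))"
  have 1: "Poly_Mapping.lookup (U q g f s d) h = ?c s d * Poly_Mapping.lookup (f (s - x - p) (d - x + p)) (h - g)" for s d
    unfolding g U.simps lookup_single_mult ..
  show ?thesis
  proof
    assume "h \<in> supp (U q g f)"
    then show "h - g \<in> supp f" unfolding supp_def mem_Collect_eq 1 by fastforce
  next
    assume "h - g \<in> supp f"
    then obtain s d where "Poly_Mapping.lookup (f s d) (h - g) \<noteq> 0" by (auto simp: supp_def)
    then have "Poly_Mapping.lookup (U q g f (s + x + p) (d + x - p)) h \<noteq> 0"
      using assms unfolding 1 by simp
    then show "h \<in> supp (U q g f)" by (auto simp: supp_def)
  qed
qed

lemma supp_sm: "c \<noteq> 0 \<Longrightarrow> supp (sm c f) = supp f"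
  by (simp add: supp_def sm_def lookup_single_mult)

lemma supp_add: "supp (f + h) \<subseteq> supp f \<union> supp h"
proof
  fix g assume "g \<in> supp (f + h)"
  then obtain s d where "Poly_Mapping.lookup (f s d) g + Poly_Mapping.lookup (h s d) g \<noteq> 0"
    unfolding supp_def mem_Collect_eq plus_fun_apply lookup_add by blast
  then have "Poly_Mapping.lookup (f s d) g \<noteq> 0 \<or> Poly_Mapping.lookup (h s d) g \<noteq> 0" by auto
  then show "g \<in> supp f \<union> supp h" unfolding supp_def by blast
qed

lemma lookup_add_supp:
  assumes "g \<in> supp f" and "g \<notin> supp h"
  shows "g \<in> supp (f + h)"
proof -
  from assms(1) obtain s d where "Poly_Mapping.lookup (f s d) g \<noteq> 0" unfolding supp_def by blast
  moreover have "Poly_Mapping.lookup (h s d) g = 0" using assms(2) unfolding supp_def by blast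
  ultimately have "Poly_Mapping.lookup ((f + h) s d) g \<noteq> 0" by (simp add: lookup_add)
  then show ?thesis unfolding supp_def by blast
qed

lemma supp_zero: "supp 0 = {}"
  by (simp add: supp_def)

lemma supp_sum: "supp (sum f A) \<subseteq> (\<Union>x\<in>A. supp (f x))"
proof (induct A rule: infinite_finite_induct)
  case (infinite A)
  then show ?case unfolding sum.infinite[OF infinite] supp_zero by blast
next
  case empty
  show ?case unfolding sum.empty supp_zero by blast
next
  case (insert x F)
  then show ?case using supp_add[of "f x" "sum f F"] unfolding sum.insert[OF insert.hyps(1,2)] by blast
qed

fun ldeg :: "lattice \<Rightarrow> int" where
  "ldeg (w, k, x, p, r) = p + 2 * r"

lemma ldeg_add: "ldeg (g + h) = ldeg g + ldeg h"
  by (cases g; cases h) simp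

lemma ldeg_diff: "ldeg (g - h) = ldeg g - ldeg h"
  by (cases g; cases h) simp

text \<open>Leading terms with respect to the degree in which \<open>\<phi>\<close> counts once and \<open>c\<close> twice.\<close>

definition leading :: "'k::field torus_fun \<Rightarrow> lattice \<Rightarrow> bool" where
  "leading f g \<longleftrightarrow> g \<in> supp f \<and> (\<forall>h\<in>supp f. h = g \<or> ldeg h < ldeg g)"

lemma leading_U:
  assumes "q \<noteq> 0" and "leading f g"
  shows "leading (U q h f) (g + h)"
  unfolding leading_def supp_U[OF assms(1)]
proof (intro conjI ballI)
  show "g + h - h \<in> supp f" using assms(2) by (simp add: leading_def)
  fix k assume "k \<in> supp (U q h f)"
  then have "k - h \<in> supp f" using supp_U[OF assms(1)] by blast
  then have "k - h = g \<or> ldeg (k - h) < ldeg g" using assms(2) by (auto simp: leading_def)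
  then show "k = g + h \<or> ldeg k < ldeg (g + h)" by (auto simp: ldeg_add ldeg_diff diff_eq_eq)
qed

lemma leading_sm: "c \<noteq> 0 \<Longrightarrow> leading f g \<Longrightarrow> leading (sm c f) g"
  by (simp add: leading_def supp_sm)

lemma leading_add:
  assumes f: "leading f g" and h: "\<And>k. k \<in> supp h \<Longrightarrow> ldeg k < ldeg g"
  shows "leading (f + h) g"
  unfolding leading_def
proof (intro conjI ballI)
  show "g \<in> supp (f + h)"
  proof (rule lookup_add_supp)
    show "g \<in> supp f" using f by (simp add: leading_def)
    show "g \<notin> supp h" using h[of g] by blast
  qed
  fix k assume "k \<in> supp (f + h)"
  then have "k \<in> supp f \<or> k \<in> supp h" using supp_add by blast
  then show "k = g \<or> ldeg k < ldeg g" using f h unfolding leading_def by blast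
qed

lemma supp_U_ldeg:
  assumes "q \<noteq> 0" and "leading f g" and "k \<in> supp (U q h f)"
  shows "ldeg k \<le> ldeg g + ldeg h"
proof -
  have "k - h \<in> supp f" using supp_U[OF assms(1)] assms(3) by blast
  then have "ldeg (k - h) \<le> ldeg g" using assms(2) by (auto simp: leading_def)
  then show ?thesis by (simp add: ldeg_diff)
qed

lemma supp_uminus: "supp (- f) = supp f"
  by (simp add: supp_def)

lemma leading_E:
  assumes gq: "generic q" and f: "leading f g"
  shows "leading (torus_gen q gen_E f) (g + (-1, 0, 1, 1, 0))"
proof -
  have q: "q \<noteq> 0" "q - inverse q \<noteq> 0"
    using gq by (auto simp: generic_def field_simps power2_eq_square)
  have "leading (sm (- 1) (U q (-1, 0, 1, 1, 0) f)) (g + (-1, 0, 1, 1, 0))"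
    by (intro leading_sm leading_U f q) simp
  then have "leading (sm (- 1) (U q (-1, 0, 1, 1, 0) f) + U q (-1, 0, 2, 0, 0) f) (g + (-1, 0, 1, 1, 0))"
  proof (rule leading_add)
    fix k assume "k \<in> supp (U q (-1, 0, 2, 0, 0) f)"
    from supp_U_ldeg[OF q(1) f this] show "ldeg k < ldeg (g + (-1, 0, 1, 1, 0))" by (simp add: ldeg_add)
  qed
  then have "leading (U q (-1, 0, 2, 0, 0) f - U q (-1, 0, 1, 1, 0) f) (g + (-1, 0, 1, 1, 0))"
    by (simp only: sm_uminus_left sm_1 uminus_add_conv_diff)
  then show ?thesis unfolding torus_gen.simps using q by (intro leading_sm) simp_all
qed

lemma leading_F:
  assumes gq: "generic q" and f: "leading f g"
  shows "leading (torus_gen q gen_F f) (g + (0, 0, -1, -1, 1))"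
proof -
  have q: "q \<noteq> 0" "1 - q ^ 2 \<noteq> 0"
    using gq by (auto simp: generic_def)
  have "leading (U q (0, 0, -1, -1, 1) f) (g + (0, 0, -1, -1, 1))"
    by (intro leading_U f q)
  then have "leading (U q (0, 0, -1, -1, 1) f + - sm (q ^ 3) (U q (1, 1, -1, -1, 0) f)) (g + (0, 0, -1, -1, 1))"
  proof (rule leading_add)
    fix k assume "k \<in> supp (- sm (q ^ 3) (U q (1, 1, -1, -1, 0) f))"
    then have "k \<in> supp (U q (1, 1, -1, -1, 0) f)" using q
      unfolding supp_uminus by (simp add: supp_sm)
    from supp_U_ldeg[OF q(1) f this] show "ldeg k < ldeg (g + (0, 0, -1, -1, 1))" by (simp add: ldeg_add)
  qed
  then have "leading (U q (0, 0, -1, -1, 1) f + - sm (q ^ 3) (U q (1, 1, -1, -1, 0) f)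
      + sm (inverse q) (U q (1, -1, -2, 0, 0) f)) (g + (0, 0, -1, -1, 1))"
  proof (rule leading_add)
    fix k assume "k \<in> supp (sm (inverse q) (U q (1, -1, -2, 0, 0) f))"
    then have "k \<in> supp (U q (1, -1, -2, 0, 0) f)" using q by (simp add: supp_sm)
    from supp_U_ldeg[OF q(1) f this] show "ldeg k < ldeg (g + (0, 0, -1, -1, 1))" by (simp add: ldeg_add)
  qed
  then show ?thesis unfolding torus_gen.simps add_uminus_conv_diff using q by (intro leading_sm) simp_all
qed

text \<open>The amount by which a monomial moves the index of a leading term. A factor
  \<open>E\<close> contributes the index of Y^-1 \<phi>, a factor \<open>F\<close> that of X^-1
  \<phi>^-1 c. Since the map is injective, leading indices tell the monomials apart.\<close>

fun pbw_index :: "nat \<times> nat \<times> int \<times> nat \<times> nat \<Rightarrow> lattice" where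
  "pbw_index (a, b, e, m, n) =
     (int b - int m, e, int a - int b + int m - int n, int m - int n, int n)"

lemma inj_pbw_index: "pbw_index i = pbw_index j \<Longrightarrow> i = j"
  by (cases i; cases j) auto

lemma leading_power:
  assumes "\<And>f g. leading f g \<Longrightarrow> leading (torus_gen q x f) (g + u)" and "leading f g"
  shows "leading (torus_act q (gen x ^ n) f) (g + (int n * fst u, int n * fst (snd u), int n * fst (snd (snd u)),
    int n * fst (snd (snd (snd u))), int n * snd (snd (snd (snd u)))))"
  using assms(2)
proof (induct n arbitrary: f g)
  case 0
  then show ?case by (simp add: torus_act_1 flip: zero_prod_def)
next
  case (Suc n)
  have 1: "leading (torus_gen q x f) (g + u)" by (rule assms(1)) (rule Suc.prems)
  obtain u1 u2 u3 u4 u5 where u: "u = (u1, u2, u3, u4, u5)" by (cases u)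
  obtain g1 g2 g3 g4 g5 where g: "g = (g1, g2, g3, g4, g5)" by (cases g)
  show ?case using Suc.hyps[OF 1] unfolding power_Suc torus_act_mult torus_act_gen u g
    by (simp add: algebra_simps)
qed

lemma leading_pbw:
  assumes gq: "generic q" and f: "leading f g"
  shows "leading (torus_act q (pbw j) f) (g + pbw_index j)"
proof -
  have q: "q \<noteq> 0" using gq by (simp add: generic_def)
  obtain a b e m n where j: "j = (a, b, e, m, n)" by (cases j)
  obtain g1 g2 g3 g4 g5 where g: "g = (g1, g2, g3, g4, g5)" by (cases g)
  have gX: "leading (torus_gen q gen_X h) (k + (0, 0, 1, 0, 0))"
    and gY: "leading (torus_gen q gen_Y h) (k + (1, 0, -1, 0, 0))"
    and gK: "leading (torus_gen q gen_K h) (k + (0, 1, 0, 0, 0))"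
    and gKinv: "leading (torus_gen q gen_Kinv h) (k + (0, -1, 0, 0, 0))" if "leading h k" for h k
    unfolding torus_gen.simps by (rule leading_U[OF q that])+
  have K: "leading (torus_act q (Kpow e) h) (k + (0, e, 0, 0, 0))" if "leading h k" for h k
  proof (cases "e \<ge> 0")
    case True
    then show ?thesis using leading_power[OF gK that, of "nat e"] by (simp add: Kpow_def)
  next
    case False
    then show ?thesis using leading_power[OF gKinv that, of "nat (- e)"] by (simp add: Kpow_def)
  qed
  have X: "leading (torus_act q (gX ^ a) h) (k + (0, 0, int a, 0, 0))" if "leading h k" for h k
    using leading_power[OF gX that, of a] by simp
  have Y: "leading (torus_act q (gY ^ b) h) (k + (int b, 0, - int b, 0, 0))" if "leading h k" for h k
    using leading_power[OF gY that, of b] by simp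
  have E: "leading (torus_act q (gE ^ m) h) (k + (- int m, 0, int m, int m, 0))" if "leading h k" for h k
    using leading_power[OF leading_E[OF gq] that, of m] by simp
  have F: "leading (torus_act q (gF ^ n) h) (k + (0, 0, - int n, - int n, int n))" if "leading h k" for h k
    using leading_power[OF leading_F[OF gq] that, of n] by simp
  show ?thesis
    using F[OF E[OF K[OF Y[OF X[OF f]]]]] unfolding j g pbw_def prod.case torus_act_mult
    by (simp add: algebra_simps)
qed

text \<open>Among the monomials with nonzero coefficient, one of maximal degree has a leading index
  that occurs in no other term: terms of the same degree lead elsewhere, and lower ones do not reach
  it. A single vector with a leading term thus detects every nonzero combination of
  monomials.\<close>

theorem pbw_independent:
  assumes gq: "generic q" and J: "finite J" and f: "leading f g"
    and z: "torus_act q (\<Sum>j\<in>J. const (c j) * pbw j) f = 0" and j: "j \<in> J"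
  shows "c j = 0"
proof (rule ccontr)
  assume nz: "c j \<noteq> 0"
  define J' where "J' = {j\<in>J. c j \<noteq> 0}"
  have "j \<in> J'" using j nz by (simp add: J'_def)
  then have J': "finite J'" "J' \<noteq> {}" using J by (simp add: J'_def, blast)
  define D where "D j = ldeg (pbw_index j)" for j
  have "\<exists>m\<in>J'. \<forall>j\<in>J'. D j \<le> D m"
  proof -
    have "Max (D ` J') \<in> D ` J'" using J' by (intro Max_in) auto
    then obtain m where "m \<in> J'" "D m = Max (D ` J')" by auto
    then show ?thesis using J' by (intro bexI[of _ m]) auto
  qed
  then obtain m where m: "m \<in> J'" and max: "\<And>j. j \<in> J' \<Longrightarrow> D j \<le> D m" by blast
  let ?t = "\<lambda>j. sm (c j) (torus_act q (pbw j) f)"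
  have L: "leading (?t j) (g + pbw_index j)" if "j \<in> J'" for j
    using that by (intro leading_sm leading_pbw[OF gq f]) (simp add: J'_def)
  have "(\<Sum>j\<in>J. ?t j) = (\<Sum>j\<in>J'. ?t j)"
    using J by (intro sum.mono_neutral_right) (auto simp: J'_def sm_0)
  then have "(\<Sum>j\<in>J'. ?t j) = 0"
    using z by (simp only: torus_act_sum torus_act_const_mult)
  then have "?t m + (\<Sum>j\<in>J' - {m}. ?t j) = 0"
    using J' m by (simp only: sum.remove[of J' m])
  moreover have "g + pbw_index m \<in> supp (?t m + (\<Sum>j\<in>J' - {m}. ?t j))"
  proof (rule lookup_add_supp)
    show "g + pbw_index m \<in> supp (?t m)" using L[OF m] by (simp add: leading_def)
    show "g + pbw_index m \<notin> supp (\<Sum>j\<in>J' - {m}. ?t j)"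
    proof
      assume "g + pbw_index m \<in> supp (\<Sum>j\<in>J' - {m}. ?t j)"
      then obtain j where j: "j \<in> J'" "j \<noteq> m" "g + pbw_index m \<in> supp (?t j)"
        using supp_sum[of ?t "J' - {m}"] by blast
      then have "g + pbw_index m = g + pbw_index j \<or> ldeg (g + pbw_index m) < ldeg (g + pbw_index j)"
        using L[OF j(1)] unfolding leading_def by blast
      then show False using inj_pbw_index[of m j] j(2) max[OF j(1)] by (auto simp: ldeg_add D_def)
    qed
  qed
  ultimately show False by (simp only: supp_zero empty_iff)
qed


section \<open>The standard identity for \<open>A\<close>\<close>

text \<open>The group ring of the lattice serves as the ring of scalars. It commutes with the
  operators, which therefore become matrices over a commutative ring.\<close>

definition cm :: "(lattice \<Rightarrow>\<^sub>0 'k) \<Rightarrow> 'k torus_fun \<Rightarrow> 'k::field torus_fun" where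
  "cm t f = (\<lambda>s d. t * f s d)"

lemma cm_add: "cm t (f + h) = cm t f + cm t h"
  by (intro ext) (simp add: cm_def distrib_left)

lemma cm_diff: "cm t (f - h) = cm t f - cm t h"
  by (intro ext) (simp add: cm_def right_diff_distrib)

lemma cm_sm: "cm t (sm c f) = sm c (cm t f)"
  by (intro ext) (simp add: cm_def sm_def ac_simps)

lemma cm_U: "cm t (U q g f) = U q g (cm t f)"
  by (cases g) (intro ext, simp add: cm_def U.simps ac_simps)

lemma cm_torus_gen: "cm t (torus_gen q x f) = torus_gen q x (cm t f)"
  by (cases x) (simp_all only: torus_gen.simps cm_U cm_sm cm_add cm_diff)

lemma torus_act_cm: "torus_act q a (cm t f) = cm t (torus_act q a f)"
proof (induct a arbitrary: f rule: free_algebra_induct)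
  case (const c)
  show ?case by (simp only: torus_act_const cm_sm)
next
  case (gen x a)
  then show ?case by (simp only: torus_act_gen_mult cm_torus_gen[symmetric])
next
  case (add a b)
  then show ?case by (simp only: torus_act_add cm_add)
qed

lemma torus_act_vsum: "torus_act q a (\<Sum>x\<in>A. f x) = (\<Sum>x\<in>A. torus_act q a (f x))"
proof -
  have z: "torus_act q a 0 = 0" using torus_act_vadd[of q a 0 0] by simp
  show ?thesis
  proof (induct A rule: infinite_finite_induct)
    case (infinite A)
    show ?case unfolding sum.infinite[OF infinite] by (rule z)
  next
    case empty
    show ?case unfolding sum.empty by (rule z)
  next
    case (insert x F)
    show ?case unfolding sum.insert[OF insert.hyps(1,2)] torus_act_vadd insert.hyps(3) ..
  qed
qed

text \<open>An operator \<open>U\<close> shifts the sum \<open>s + d\<close> by the even number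
  \<open>2 * x\<close>, so the functions supported on even sums form a submodule. For even
  \<open>l\<close> this condition is compatible with the periods and halves the rank; the periods
  alone would leave the rank \<open>l * l\<close>.\<close>

definition wp :: "nat \<Rightarrow> 'k::field torus_fun set" where
  "wp l = {f. (\<forall>s d. f (s + int l) d = f s d \<and> f s (d + int l) = f s d) \<and>
     (even l \<longrightarrow> (\<forall>s d. odd (s + d) \<longrightarrow> f s d = 0))}"

lemma wpI:
  assumes "\<And>s d. f (s + int l) d = f s d" "\<And>s d. f s (d + int l) = f s d"
    and "\<And>s d. even l \<Longrightarrow> odd (s + d) \<Longrightarrow> f s d = 0"
  shows "f \<in> wp l"
  using assms unfolding wp_def by blast

lemma wpD:
  assumes "f \<in> wp l"
  shows "f (s + int l) d = f s d" "f s (d + int l) = f s d" "even l \<Longrightarrow> odd (s + d) \<Longrightarrow> f s d = 0"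
  using assms unfolding wp_def by blast+

lemma wp_add: "f \<in> wp l \<Longrightarrow> h \<in> wp l \<Longrightarrow> f + h \<in> wp l"
  by (rule wpI) (simp_all add: wpD)

lemma wp_diff: "f \<in> wp l \<Longrightarrow> h \<in> wp l \<Longrightarrow> f - h \<in> wp l"
  by (rule wpI) (simp_all add: wpD)

lemma wp_sm: "f \<in> wp l \<Longrightarrow> sm c f \<in> wp l"
  by (rule wpI) (simp_all add: wpD sm_def)

lemma wp_mod:
  assumes "f \<in> wp l"
  shows "f s d = f (s mod int l) (d mod int l)"
proof -
  have 1: "f (s + int l * int k) d = f s d" "f s (d + int l * int k) = f s d" for s d k
  proof (induct k)
    case (Suc k)
    have *: "t + int l * int (Suc k) = (t + int l * int k) + int l" for t
      by (simp add: algebra_simps)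
    show "f (s + int l * int (Suc k)) d = f s d" unfolding * wpD(1)[OF assms] by (rule Suc(1))
    show "f s (d + int l * int (Suc k)) = f s d" unfolding * wpD(2)[OF assms] by (rule Suc(2))
  qed simp_all
  have 2: "f (s + int l * k) d = f s d" "f s (d + int l * k) = f s d" for s d k
  proof -
    have "f (s + int l * k) d = f s d \<and> f s (d + int l * k) = f s d"
    proof (cases "k \<ge> 0")
      case True
      then show ?thesis using 1(1)[of s "nat k" d] 1(2)[of s d "nat k"] by simp
    next
      case False
      then show ?thesis using 1(1)[of "s + int l * k" "nat (- k)" d] 1(2)[of s "d + int l * k" "nat (- k)"] by simp
    qed
    then show "f (s + int l * k) d = f s d" "f s (d + int l * k) = f s d" by blast+
  qed
  have "f s d = f (s mod int l + int l * (s div int l)) (d mod int l + int l * (d div int l))" by simp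
  also have "\<dots> = f (s mod int l) (d mod int l)" by (simp only: 2)
  finally show ?thesis .
qed

definition idx :: "nat \<Rightarrow> (int \<times> int) set" where
  "idx l = Sigma {0..<int l} (\<lambda>s. {d\<in>{0..<int l}. even l \<longrightarrow> even (s + d)})"

lemma finite_idx: "finite (idx l)"
  unfolding idx_def by (rule finite_subset[of _ "{0..<int l} \<times> {0..<int l}"]) auto

lemma card_idx: "card (idx l) = l * (if even l then l div 2 else l)"
proof -
  have "card {d\<in>{0..<int l}. even l \<longrightarrow> even (s + d)} = (if even l then l div 2 else l)" for s
  proof (cases "even l")
    case True
    then obtain k where k: "l = 2 * k" by blast
    have "{d\<in>{0..<int l}. even l \<longrightarrow> even (s + d)} = (\<lambda>e. 2 * e + s mod 2) ` {0..<int k}" (is "?A = ?B")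
    proof
      show "?B \<subseteq> ?A"
      proof
        fix d assume "d \<in> ?B"
        then obtain e where e: "0 \<le> e" "e < int k" "d = 2 * e + s mod 2" by auto
        have "0 \<le> s mod 2" "s mod 2 < 2" by simp_all
        then have "0 \<le> d" "d < int l" using e k by linarith+
        moreover have "even (s + d)" unfolding e(3) by presburger
        ultimately show "d \<in> ?A" by simp
      qed
      show "?A \<subseteq> ?B"
      proof
        fix d assume "d \<in> ?A"
        then have d: "0 \<le> d" "d < 2 * int k" "even (s + d)" using True k by auto
        have "d = 2 * (d div 2) + s mod 2" using d(3) by presburger
        moreover have "d div 2 \<in> {0..<int k}" using d by auto
        ultimately show "d \<in> ?B" by (rule image_eqI)
      qed
    qed
    moreover have "card ?B = k" by (subst card_image) (simp_all add: inj_on_def)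
    ultimately show ?thesis using True k by simp
  next
    case False
    then have "{d\<in>{0..<int l}. even l \<longrightarrow> even (s + d)} = {0..<int l}" by auto
    then show ?thesis using False by simp
  qed
  moreover have "finite {d\<in>{0..<int l}. even l \<longrightarrow> even (s + d)}" for s :: int
    by (rule finite_subset[of _ "{0..<int l}"]) auto
  ultimately show ?thesis unfolding idx_def by (subst card_SigmaI) simp_all
qed

definition basis :: "nat \<Rightarrow> int \<times> int \<Rightarrow> 'k::field torus_fun" where
  "basis l i = (\<lambda>s d. if s mod int l = fst i \<and> d mod int l = snd i then 1 else 0)"

lemma basis_wp: "i \<in> idx l \<Longrightarrow> basis l i \<in> wp l"
proof (rule wpI)
  fix s d :: int assume i: "i \<in> idx l" and e: "even l" "odd (s + d)"
  have "even (fst i + snd i)" using i e by (auto simp: idx_def)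
  moreover have "even (s mod int l) = even s" "even (d mod int l) = even d"
    using e(1) by (simp_all add: dvd_mod_iff)
  ultimately show "basis l i s d = 0" using e(2) by (auto simp: basis_def)
qed (simp_all add: basis_def)

lemma wp_expand:
  assumes f: "f \<in> wp l" and l: "l > 0"
  shows "f = (\<Sum>i\<in>idx l. cm (f (fst i) (snd i)) (basis l i))"
proof (intro ext)
  fix s d
  let ?m = "(s mod int l, d mod int l)"
  have app: "(\<Sum>i\<in>A. g i) s d = (\<Sum>i\<in>A. g i s d)" for A :: "(int \<times> int) set" and g :: "int \<times> int \<Rightarrow> 'a torus_fun"
    by (induct A rule: infinite_finite_induct) simp_all
  have "(\<Sum>i\<in>idx l. cm (f (fst i) (snd i)) (basis l i)) s d =
      (\<Sum>i\<in>idx l. if i = ?m then f (fst i) (snd i) else 0)"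
    unfolding app by (intro sum.cong refl) (auto simp: cm_def basis_def prod_eq_iff)
  also have "\<dots> = (if ?m \<in> idx l then f (s mod int l) (d mod int l) else 0)"
    using finite_idx by (simp add: sum.delta')
  also have "\<dots> = f s d"
  proof (cases "?m \<in> idx l")
    case True
    then show ?thesis using wp_mod[OF f, of s d] by simp
  next
    case False
    then have "even l \<and> odd (s mod int l + d mod int l)" using l by (auto simp: idx_def)
    then have "f (s mod int l) (d mod int l) = 0" using wpD(3)[OF f] by blast
    then show ?thesis using False wp_mod[OF f, of s d] by simp
  qed
  finally show "f s d = (\<Sum>i\<in>idx l. cm (f (fst i) (snd i)) (basis l i)) s d" by simp
qed

definition standard_poly :: "(nat \<Rightarrow> 'k::field pre_A) \<Rightarrow> nat \<Rightarrow> 'k pre_A" where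
  "standard_poly a N =
     (\<Sum>\<sigma>\<in>permutations_of_set {..<N}. const (of_int (list_sgn \<sigma>)) * prod_list (map a \<sigma>))"

context
  fixes q :: "'k::field" and l :: nat
  assumes gq: "generic q" and ql: "q ^ l = 1" and l: "l > 0"
begin

lemma powi_periodic: "q powi (a + int l * b) = q powi a"
proof -
  have "q powi (int l * b) = 1" using power_int_mult[of q "int l" b] ql by simp
  then show ?thesis using gq by (simp add: power_int_add generic_def)
qed

lemma wp_U: "f \<in> wp l \<Longrightarrow> U q g f \<in> wp l"
proof (rule wpI)
  fix s d assume f: "f \<in> wp l"
  obtain w k x p r where g: "g = (w, k, x, p, r)" by (cases g)
  have 1: "w * (d - x + p) - k * (s + int l - x - p) = (w * (d - x + p) - k * (s - x - p)) + int l * (- k)"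
    by (simp add: algebra_simps)
  have 2: "w * (d + int l - x + p) - k * (s - x - p) = (w * (d - x + p) - k * (s - x - p)) + int l * w"
    by (simp add: algebra_simps)
  have 3: "s + int l - x - p = s - x - p + int l" "d + int l - x + p = d - x + p + int l" by simp_all
  show "U q g f (s + int l) d = U q g f s d" unfolding g U.simps 1 powi_periodic unfolding 3 wpD[OF f] ..
  show "U q g f s (d + int l) = U q g f s d" unfolding g U.simps 2 powi_periodic unfolding 3 wpD[OF f] ..
  assume e: "even l" "odd (s + d)"
  have "odd ((s - x - p) + (d - x + p))" using e(2) by simp
  then have "f (s - x - p) (d - x + p) = 0" by (rule wpD(3)[OF f e(1)])
  then show "U q g f s d = 0" unfolding g U.simps by simp
qed

lemma wp_torus_gen: "f \<in> wp l \<Longrightarrow> torus_gen q x f \<in> wp l"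
  by (cases x) (simp_all only: torus_gen.simps wp_U wp_sm wp_add wp_diff)

lemma wp_torus_act: "f \<in> wp l \<Longrightarrow> torus_act q a f \<in> wp l"
proof (induct a arbitrary: f rule: free_algebra_induct)
  case (const c)
  then show ?case by (simp only: torus_act_const wp_sm)
next
  case (gen x a)
  then show ?case by (simp only: torus_act_gen_mult wp_torus_gen)
next
  case (add a b)
  then show ?case by (simp only: torus_act_add wp_add)
qed

text \<open>Row \<open>i\<close> is the image of the basis function \<open>i\<close>. With this
  convention the right action turns products into matrix products in the same order.\<close>

definition tmat :: "'k pre_A \<Rightarrow> int \<times> int \<Rightarrow> int \<times> int \<Rightarrow> (lattice \<Rightarrow>\<^sub>0 'k)" where
  "tmat a i j = torus_act q a (basis l i) (fst j) (snd j)"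

lemma torus_act_apply:
  assumes f: "f \<in> wp l"
  shows "torus_act q a f s d = (\<Sum>i\<in>idx l. f (fst i) (snd i) * torus_act q a (basis l i) s d)"
proof -
  have app: "(\<Sum>i\<in>A. g i) s d = (\<Sum>i\<in>A. g i s d)" for A :: "(int \<times> int) set" and g :: "int \<times> int \<Rightarrow> 'k torus_fun"
    by (induct A rule: infinite_finite_induct) simp_all
  have "torus_act q a f = (\<Sum>i\<in>idx l. cm (f (fst i) (snd i)) (torus_act q a (basis l i)))"
    by (subst wp_expand[OF f l]) (simp only: torus_act_vsum torus_act_cm)
  then show ?thesis by (simp only: app cm_def)
qed

lemma tmat_prod_list:
  assumes "i \<in> idx l" and "j \<in> idx l"
  shows "tmat (prod_list (map a \<sigma>)) i j = mprod (idx l) (\<lambda>s. tmat (a s)) \<sigma> i j"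
  using assms(1)
proof (induct \<sigma> arbitrary: i)
  case Nil
  have "fst j mod int l = fst j" "snd j mod int l = snd j" using assms(2) by (auto simp: idx_def)
  then show ?case by (auto simp: tmat_def torus_act_1 basis_def prod_eq_iff)
next
  case (Cons s \<sigma>)
  have "tmat (prod_list (map a (s # \<sigma>))) i j =
      torus_act q (prod_list (map a \<sigma>)) (torus_act q (a s) (basis l i)) (fst j) (snd j)"
    by (simp only: tmat_def list.map prod_list.Cons torus_act_mult)
  also have "\<dots> = (\<Sum>m\<in>idx l. tmat (a s) i m * tmat (prod_list (map a \<sigma>)) m j)"
    unfolding tmat_def by (rule torus_act_apply[OF wp_torus_act[OF basis_wp[OF Cons.prems]]])
  also have "\<dots> = (\<Sum>m\<in>idx l. tmat (a s) i m * mprod (idx l) (\<lambda>s. tmat (a s)) \<sigma> m j)"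
    by (intro sum.cong refl arg_cong2[of _ _ _ _ "(*)"] Cons.hyps)
  finally show ?case by simp
qed

lemma leading_basis: "leading (basis l (0, 0) :: 'k torus_fun) 0"
proof -
  have "supp (basis l (0, 0) :: 'k torus_fun) = {0}"
  proof
    show "supp (basis l (0, 0) :: 'k torus_fun) \<subseteq> {0}"
    proof
      fix g assume "g \<in> supp (basis l (0, 0) :: 'k torus_fun)"
      then obtain s d where "Poly_Mapping.lookup (basis l (0, 0) s d :: lattice \<Rightarrow>\<^sub>0 'k) g \<noteq> 0"
        unfolding supp_def by blast
      then show "g \<in> {0}"
        by (cases "g = 0") (simp_all add: basis_def lookup_one split: if_splits)
    qed
    have "Poly_Mapping.lookup (basis l (0, 0) 0 0 :: lattice \<Rightarrow>\<^sub>0 'k) 0 \<noteq> 0" by (simp add: basis_def)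
    then show "{0} \<subseteq> supp (basis l (0, 0) :: 'k torus_fun)" unfolding supp_def by blast
  qed
  then show ?thesis by (simp add: leading_def)
qed

text \<open>By the theorem of Amitsur and Levitzki the standard polynomial kills one basis function.
  Once it is rewritten in PBW monomials, their independence on that function forces all coefficients
  to be 0.\<close>

theorem standard_identity:
  "cls q (standard_poly a (2 * (l * (if even l then l div 2 else l)))) = cls q 0"
proof -
  define N where "N = 2 * (l * (if even l then l div 2 else l))"
  have N: "N = 2 * card (idx l)" by (simp add: N_def card_idx)
  let ?b = "basis l (0, 0) :: 'k torus_fun"
  have i0: "(0, 0) \<in> idx l" using l by (simp add: idx_def)
  have app: "(\<Sum>i\<in>A. g i) s d = (\<Sum>i\<in>A. g i s d)" for A :: "nat list set" and g :: "nat list \<Rightarrow> 'k torus_fun" and s d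
    by (induct A rule: infinite_finite_induct) simp_all
  have zero: "torus_act q (standard_poly a N) ?b (fst j) (snd j) = 0" if j: "j \<in> idx l" for j
  proof -
    have "torus_act q (standard_poly a N) ?b (fst j) (snd j) = (\<Sum>\<sigma>\<in>permutations_of_set {..<N}.
        of_int (list_sgn \<sigma>) * mprod (idx l) (\<lambda>s. tmat (a s)) \<sigma> (0, 0) j)"
      unfolding standard_poly_def torus_act_sum torus_act_const_mult app sm_def
        tmat_prod_list[OF i0 j, symmetric] unfolding tmat_def by simp
    also have "\<dots> = 0" unfolding N by (rule amitsur_levitzki[OF finite_idx refl i0 j])
    finally show ?thesis .
  qed
  have "torus_act q (standard_poly a N) ?b = 0"
  proof (intro ext)
    fix s d
    have w: "torus_act q (standard_poly a N) ?b \<in> wp l" by (rule wp_torus_act[OF basis_wp[OF i0]])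
    have "torus_act q (standard_poly a N) ?b s d =
        (\<Sum>i\<in>idx l. cm (torus_act q (standard_poly a N) ?b (fst i) (snd i)) (basis l i)) s d"
      by (rule fun_cong[OF fun_cong[OF wp_expand[OF w l]]])
    also have "(\<Sum>i\<in>idx l. cm (torus_act q (standard_poly a N) ?b (fst i) (snd i)) (basis l i)) = 0"
      by (rule sum.neutral, rule ballI, subst zero) (auto simp: cm_def fun_eq_iff)
    finally show "torus_act q (standard_poly a N) ?b s d = 0 s d" .
  qed
  moreover obtain J c where J: "finite J"
    and c: "cls q (standard_poly a N) = cls q (\<Sum>j\<in>J. const (c j) * pbw j)"
    using pbw_spanning[OF gq, of "standard_poly a N"] by (elim exE conjE)
  ultimately have "torus_act q (\<Sum>j\<in>J. const (c j) * pbw j) ?b = 0"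
    using torus_act_cls[OF gq c] by simp
  then have "c j = 0" if "j \<in> J" for j
    using pbw_independent[OF gq J leading_basis _ that] by blast
  then have "(\<Sum>j\<in>J. const (c j) * pbw j) = 0" by (intro sum.neutral) simp
  then show ?thesis using c unfolding N_def by simp
qed

end


section \<open>Right \<open>A\<close>-modules\<close>

locale A_module =
  fixes q :: "'k::field" and act :: "'m::ab_group_add \<Rightarrow> 'k elem_A \<Rightarrow> 'm"
  assumes module_A: "right_module (alg_A q) UNIV act"
begin

definition ap :: "'m \<Rightarrow> 'k pre_A \<Rightarrow> 'm" (infixl "\<triangleright>" 75) where
  "v \<triangleright> a = act v (cls q a)"

lemma ap_vadd: "(v + w) \<triangleright> a = v \<triangleright> a + w \<triangleright> a"
  using module_A unfolding right_module_def ap_def by simp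

lemma ap_add: "v \<triangleright> (a + b) = v \<triangleright> a + v \<triangleright> b"
  using module_A unfolding right_module_def ap_def cls_add by simp

lemma ap_mult: "v \<triangleright> (a * b) = v \<triangleright> a \<triangleright> b"
  using module_A unfolding right_module_def ap_def cls_mult by simp

lemma ap_one [simp]: "v \<triangleright> 1 = v"
  using module_A unfolding right_module_def ap_def cls_one by simp

lemma ap_cong: "cls q a = cls q b \<Longrightarrow> v \<triangleright> a = v \<triangleright> b"
  by (simp add: ap_def)

lemma ap_zero [simp]: "v \<triangleright> 0 = 0"
  using ap_add[of v 0 0] by simp

lemma ap_vzero [simp]: "0 \<triangleright> a = 0"
  using ap_vadd[of 0 0 a] by simp

lemma ap_uminus: "v \<triangleright> (- a) = - (v \<triangleright> a)"
  using ap_add[of v "- a" a] by (simp add: eq_neg_iff_add_eq_0)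

lemma ap_vuminus: "(- v) \<triangleright> a = - (v \<triangleright> a)"
  using ap_vadd[of "- v" v a] by (simp add: eq_neg_iff_add_eq_0)

lemma ap_diff: "v \<triangleright> (a - b) = v \<triangleright> a - v \<triangleright> b"
  using ap_add[of v a "- b"] by (simp add: ap_uminus)

lemma ap_vdiff: "(v - w) \<triangleright> a = v \<triangleright> a - w \<triangleright> a"
  using ap_vadd[of v "- w" a] by (simp add: ap_vuminus)

lemma ap_sum: "v \<triangleright> (sum f A) = (\<Sum>x\<in>A. v \<triangleright> f x)"
  by (induct A rule: infinite_finite_induct) (simp_all add: ap_add)

lemma ap_vsum: "(sum f A) \<triangleright> a = (\<Sum>x\<in>A. f x \<triangleright> a)"
  by (induct A rule: infinite_finite_induct) (simp_all add: ap_vadd)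

lemma ap_const: "v \<triangleright> const c \<triangleright> a = v \<triangleright> a \<triangleright> const c"
  unfolding ap_mult[symmetric] const_central ..

lemma ap_const_mult: "v \<triangleright> (const c * a) = v \<triangleright> a \<triangleright> const c"
  by (simp only: ap_mult ap_const)

lemma ap_const_const: "v \<triangleright> const c \<triangleright> const d = v \<triangleright> const (c * d)"
  by (simp only: ap_mult const_mult)

lemma scalar_act_eq: "scalar_act q act c v = v \<triangleright> const c"
  by (simp add: scalar_act_def ap_def)

sublocale VS: vector_space "scalar_act q act"
  by unfold_locales (simp_all add: scalar_act_eq ap_vadd const_add ap_add ap_const_const mult.commute)

lemma const_eq_0_iff: "v \<triangleright> const c = 0 \<longleftrightarrow> c = 0 \<or> v = 0"
  using VS.scale_eq_0_iff[of c v] by (simp add: scalar_act_eq)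

lemma const_inverse: "c \<noteq> 0 \<Longrightarrow> v \<triangleright> const c \<triangleright> const (inverse c) = v"
  by (simp add: ap_const_const)

text \<open>Stability under generators replaces the submodule condition over the quotient rings;
  \<open>Z\<close> will be the generators of A or those of B.\<close>

definition closed_under :: "'k pre_A set \<Rightarrow> 'm set \<Rightarrow> bool" where
  "closed_under Z P \<longleftrightarrow> 0 \<in> P \<and> (\<forall>v\<in>P. \<forall>w\<in>P. v + w \<in> P) \<and> (\<forall>v\<in>P. \<forall>c. v \<triangleright> const c \<in> P) \<and>
     (\<forall>v\<in>P. \<forall>a\<in>Z. v \<triangleright> a \<in> P)"

lemma closed_underI:
  assumes "0 \<in> P" "\<And>v w. v \<in> P \<Longrightarrow> w \<in> P \<Longrightarrow> v + w \<in> P" "\<And>v c. v \<in> P \<Longrightarrow> v \<triangleright> const c \<in> P"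
    "\<And>v a. v \<in> P \<Longrightarrow> a \<in> Z \<Longrightarrow> v \<triangleright> a \<in> P"
  shows "closed_under Z P"
  using assms unfolding closed_under_def by blast

lemma closed_underD:
  assumes "closed_under Z P"
  shows "0 \<in> P" "v \<in> P \<Longrightarrow> w \<in> P \<Longrightarrow> v + w \<in> P" "v \<in> P \<Longrightarrow> v \<triangleright> const c \<in> P"
    "v \<in> P \<Longrightarrow> a \<in> Z \<Longrightarrow> v \<triangleright> a \<in> P"
  using assms unfolding closed_under_def by blast+

lemma closed_under_uminus:
  assumes "closed_under Z P" and "v \<in> P"
  shows "- v \<in> P"
  using closed_underD(3)[OF assms, of "- 1"] by (simp add: const_uminus ap_uminus)

lemma closed_under_diff:
  assumes "closed_under Z P" and "v \<in> P" and "w \<in> P"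
  shows "v - w \<in> P"
  using closed_underD(2)[OF assms(1,2) closed_under_uminus[OF assms(1,3)]] by simp

lemma closed_under_gens:
  assumes P: "closed_under (range gen) P" and v: "v \<in> P"
  shows "v \<triangleright> a \<in> P"
  using v
proof (induct a arbitrary: v rule: free_algebra_induct)
  case (const c)
  then show ?case by (rule closed_underD(3)[OF P])
next
  case (gen x a)
  have "v \<triangleright> gen x \<in> P" by (rule closed_underD(4)[OF P gen.prems]) simp
  then show ?case unfolding ap_mult by (rule gen.hyps)
next
  case (add a b)
  then show ?case unfolding ap_add by (intro closed_underD(2)[OF P])
qed

lemma right_module_if_closed:
  assumes P: "closed_under (range gen) P"
  shows "right_module (alg_A q) P act"
  unfolding right_module_def
proof (intro conjI ballI)
  show "0 \<in> P" by (rule closed_underD(1)[OF P])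
  show "m + n \<in> P" if "m \<in> P" "n \<in> P" for m n using that by (rule closed_underD(2)[OF P])
  show "- m \<in> P" if "m \<in> P" for m using that by (rule closed_under_uminus[OF P])
  show "act m a \<in> P" if "m \<in> P" "a \<in> carrier (alg_A q)" for m a
    using that closed_under_gens[OF P] unfolding carrier_alg_A ap_def by blast
qed (use module_A in \<open>simp_all add: right_module_def\<close>)

end

locale simple_A_module = A_module q act
  for q :: "'k::field" and act :: "'m::ab_group_add \<Rightarrow> 'k elem_A \<Rightarrow> 'm" +
  assumes simple_A: "simple_right_module (alg_A q) UNIV act"
begin

lemma closed_eq_UNIV:
  assumes P: "closed_under (range gen) P" and "v \<in> P" "v \<noteq> 0"
  shows "P = UNIV"
  using simple_A right_module_if_closed[OF P] assms(2,3) unfolding simple_right_module_def by blast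

lemma ex_nonzero: "\<exists>v :: 'm. v \<noteq> 0"
  using simple_A unfolding simple_right_module_def by blast

lemma orbit_UNIV:
  assumes "v \<noteq> 0"
  shows "\<exists>a. w = v \<triangleright> a"
proof -
  have "closed_under (range gen) (range (ap v))"
  proof (rule closed_underI)
    show "0 \<in> range (ap v)" by (rule range_eqI[of _ _ 0]) simp
    show "x + y \<in> range (ap v)" if "x \<in> range (ap v)" "y \<in> range (ap v)" for x y
    proof -
      from that obtain a b where "x = v \<triangleright> a" "y = v \<triangleright> b" by blast
      then have "x + y = v \<triangleright> (a + b)" by (simp add: ap_add)
      then show ?thesis by blast
    qed
    have *: "x \<triangleright> a \<in> range (ap v)" if "x \<in> range (ap v)" for x a
    proof -
      from that obtain b where "x = v \<triangleright> b" by blast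
      then have "x \<triangleright> a = v \<triangleright> (b * a)" by (simp add: ap_mult)
      then show ?thesis by blast
    qed
    show "x \<triangleright> const c \<in> range (ap v)" "x \<triangleright> a \<in> range (ap v)" if "x \<in> range (ap v)" for x c a
      using that by (rule *)+
  qed
  moreover have "v \<in> range (ap v)" by (rule range_eqI[of _ _ 1]) simp
  ultimately have "range (ap v) = UNIV" using assms by (rule closed_eq_UNIV)
  then show ?thesis by blast
qed

lemma schur_zero_or_bij:
  fixes f :: "'m \<Rightarrow> 'm"
  assumes add: "\<And>v w. f (v + w) = f v + f w" and comm: "\<And>v a. f (v \<triangleright> a) = f v \<triangleright> a"
  shows "(\<forall>v. f v = 0) \<or> bij f"
proof (cases "\<forall>v. f v = 0")
  case False
  then obtain v0 where v0: "f v0 \<noteq> 0" by blast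
  have f0: "f 0 = 0" using add[of 0 0] by simp
  have fd: "f (v - w) = f v - f w" for v w using add[of "v - w" w] by simp
  have "inj f"
  proof (rule injI)
    fix v w assume "f v = f w"
    then have "f (v - w) = 0" by (simp add: fd)
    have "closed_under (range gen) {v. f v = 0}"
      by (rule closed_underI) (simp_all add: f0 add comm)
    then have "v - w = 0"
      using closed_eq_UNIV[of "{v. f v = 0}" "v - w"] \<open>f (v - w) = 0\<close> v0 by blast
    then show "v = w" by simp
  qed
  moreover have "closed_under (range gen) (range f)"
  proof (rule closed_underI)
    show "0 \<in> range f" by (rule range_eqI[of _ _ 0]) (simp add: f0)
    show "x + y \<in> range f" if "x \<in> range f" "y \<in> range f" for x y
      using that by (auto simp: add[symmetric])
    have *: "x \<triangleright> a \<in> range f" if "x \<in> range f" for x a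
      using that by (auto simp: comm[symmetric])
    show "x \<triangleright> const c \<in> range f" "x \<triangleright> a \<in> range f" if "x \<in> range f" for x c a
      using that by (rule *)+
  qed
  then have "range f = UNIV" using v0 by (intro closed_eq_UNIV[of _ "f v0"]) simp_all
  ultimately show ?thesis by (simp add: bij_def)
qed simp

end

context A_module
begin

lemma comm_action_const: "comm_action (\<lambda>c v. v \<triangleright> const c)"
  by unfold_locales (simp_all add: const_add ap_add ap_vadd ap_const_const mult.commute)

text \<open>If no polynomial annihilated \<open>u\<close>, the first \<open>card G + 1\<close>
  iterates of \<open>u\<close> under \<open>z\<close> would be distinct and independent, which is
  one too many.\<close>

lemma ex_annihilating_poly:
  assumes pa: "poly_action (\<lambda>c v. v \<triangleright> const c) z" and G: "finite G" "VS.span G = UNIV"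
  shows "\<exists>p. p \<noteq> 0 \<and> poly_act (\<lambda>c v. v \<triangleright> const c) z p u = 0"
proof (rule ccontr)
  interpret pa: poly_action "\<lambda>c v. v \<triangleright> const c" z by (rule pa)
  assume "\<not> ?thesis"
  then have nz: "p = 0" if "pa.H p u = 0" for p using that by blast
  define e where "e i = pa.H (monom 1 i) u" for i
  have comb: "(\<Sum>i\<in>A. e i \<triangleright> const (c i)) = pa.H (\<Sum>i\<in>A. monom (c i) i) u" for A c
  proof -
    have "pa.H (monom (c i) i) u = e i \<triangleright> const (c i)" for i
      using pa.H_smult[of "c i" "monom 1 i" u] by (simp add: smult_monom e_def)
    then show ?thesis by (simp add: pa.P.act_sum)
  qed
  have inj: "inj e"
  proof (rule injI)
    fix i j assume "e i = e j"
    then have "pa.H (monom 1 i - monom 1 j) u = 0" by (simp add: pa.P.act_diff e_def)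
    then have "monom 1 i = (monom 1 j :: 'k poly)" using nz by fastforce
    then show "i = j" by (metis coeff_monom zero_neq_one)
  qed
  let ?S = "e ` {..card G}"
  have "VS.independent ?S"
  proof
    assume "VS.dependent ?S"
    then obtain c where c: "\<exists>v\<in>?S. c v \<noteq> 0" "(\<Sum>v\<in>?S. scalar_act q act (c v) v) = 0"
      by (auto simp: VS.dependent_finite)
    have "(\<Sum>i\<in>{..card G}. e i \<triangleright> const (c (e i))) = 0"
      using c(2) by (subst (asm) sum.reindex) (simp_all add: scalar_act_eq inj_on_subset[OF inj])
    then have "(\<Sum>i\<in>{..card G}. monom (c (e i)) i) = 0" unfolding comb by (rule nz)
    then have z: "coeff (\<Sum>i\<in>{..card G}. monom (c (e i)) i) k = 0" for k by simp
    have "c (e k) = 0" if "k \<le> card G" for k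
      using z[of k] that by (simp add: coeff_sum if_distrib cong: if_cong)
    then show False using c(1) by auto
  qed
  then have "card ?S \<le> card G" using VS.independent_span_bound[OF G(1), of ?S] G(2) by simp
  moreover have "card ?S = Suc (card G)" using inj by (simp add: card_image inj_on_subset)
  ultimately show False by simp
qed

end

text \<open>Let \<open>p\<close> have least degree among the polynomials annihilating
  \<open>u\<close>, and split off a root \<open>c\<close>. The cofactor applied to \<open>u\<close>
  is not 0, lies in \<open>P\<close> and is an eigenvector. The subspace \<open>P\<close> makes it
  possible to find common eigenvectors of commuting operators.\<close>

lemma (in A_module) ex_eigenvector:
  assumes alg: "\<And>p :: 'k poly. degree p > 0 \<Longrightarrow> \<exists>x. poly p x = 0"
    and add: "\<And>v w. z (v + w) = z v + z w" and comm: "\<And>v c. z (v \<triangleright> const c) = z v \<triangleright> const c"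
    and G: "finite G" "VS.span G = UNIV"
    and P: "0 \<in> P" "\<And>v w. v \<in> P \<Longrightarrow> w \<in> P \<Longrightarrow> v + w \<in> P" "\<And>v c. v \<in> P \<Longrightarrow> v \<triangleright> const c \<in> P"
    and zP: "\<And>v. v \<in> P \<Longrightarrow> z v \<in> P" and u: "u \<in> P" "u \<noteq> 0"
  shows "\<exists>v c. v \<in> P \<and> v \<noteq> 0 \<and> z v = v \<triangleright> const c"
proof -
  have pa: "poly_action (\<lambda>c v. v \<triangleright> const c) z"
    by (intro poly_action.intro comm_action_const poly_action_axioms.intro) (simp_all add: add comm)
  interpret pa: poly_action "\<lambda>c v. v \<triangleright> const c" z by (rule pa)
  obtain p where p: "p \<noteq> 0" "pa.H p u = 0"
    and min: "\<And>p'. p' \<noteq> 0 \<Longrightarrow> pa.H p' u = 0 \<Longrightarrow> degree p \<le> degree p'"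
    using ex_annihilating_poly[OF pa G, of u]
      ex_has_least_nat[of "\<lambda>p. p \<noteq> 0 \<and> pa.H p u = 0" _ degree] by blast
  have "degree p > 0"
  proof (rule ccontr)
    assume "\<not> degree p > 0"
    then have "p = [:coeff p 0:]" by (simp add: degree_0_id)
    then have "u \<triangleright> const (coeff p 0) = 0" using p(2) pa.H_const by metis
    then have "coeff p 0 = 0" using u by (simp add: const_eq_0_iff)
    then show False using \<open>p = [:coeff p 0:]\<close> p(1) by simp
  qed
  then obtain c where "poly p c = 0" using alg by blast
  then obtain g where g: "p = [:- c, 1:] * g" by (auto simp: poly_eq_0_iff_dvd elim: dvdE)
  with p(1) have g0: "g \<noteq> 0" by auto
  then have "degree p = Suc (degree g)" unfolding g by (subst degree_mult_eq) auto
  then have w: "pa.H g u \<noteq> 0" using min[OF g0] by auto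
  have HP: "pa.H r u \<in> P" for r
  proof (induct r)
    case 0
    then show ?case by (simp add: P)
  next
    case (pCons a r)
    then show ?case by (simp add: pa.H_pCons P zP u)
  qed
  have "pa.H [:- c, 1:] (pa.H g u) = 0" using p(2) unfolding g pa.H_mult .
  then have "z (pa.H g u) = pa.H g u \<triangleright> const c"
    by (simp add: pa.H_pCons const_uminus ap_uminus)
  then show ?thesis using w HP by blast
qed


section \<open>Finite dimension\<close>

lemma (in A_module) central_commute:
  "central_A q z \<Longrightarrow> v \<triangleright> z \<triangleright> a = v \<triangleright> a \<triangleright> z"
  unfolding ap_mult[symmetric] by (rule ap_cong) (simp add: central_A_def)

lemma central_A_power: "central_A q z \<Longrightarrow> central_A q (z ^ n)"
proof (induct n)
  case 0
  then show ?case by (simp add: central_A_def)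
next
  case (Suc n)
  show ?case unfolding central_A_def
  proof
    fix a
    have "cls q (z * (z ^ n * a)) = cls q (z * (a * z ^ n))"
      by (rule cls_cong_mult[OF refl]) (use Suc in \<open>simp add: central_A_def\<close>)
    also have "\<dots> = cls q ((a * z) * z ^ n)"
      unfolding mult.assoc[symmetric, of z]
      by (rule cls_cong_mult[OF _ refl]) (use Suc in \<open>simp add: central_A_def\<close>)
    finally show "cls q (z ^ Suc n * a) = cls q (a * z ^ Suc n)" by (simp add: mult.assoc)
  qed
qed

locale simple_A_module_root = simple_A_module q act
  for q :: "'k::alg_closed_field" and act :: "'m::ab_group_add \<Rightarrow> 'k elem_A \<Rightarrow> 'm" +
  fixes l :: nat
  assumes gq: "generic q" and ql: "q ^ l = 1" and l: "l > 0"
begin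

lemmas central_powers = central_X[OF gq ql] central_Y[OF gq ql] central_K[OF gq ql] central_Kinv[OF gq ql]
  central_E[OF gq ql] central_F[OF gq ql]

text \<open>The exponent of \<open>K\<close> runs in both directions, since negative exponents are
  reduced by the central power of \<open>gKinv\<close>.\<close>

definition small_index :: "(nat \<times> nat \<times> int \<times> nat \<times> nat) set" where
  "small_index = {..<l} \<times> {..<l} \<times> {- int l<..<int l} \<times> {..<l} \<times> {..<l}"

lemma finite_small_index: "finite small_index"
  by (simp add: small_index_def)

lemma power_split: "v \<triangleright> x ^ n = v \<triangleright> x ^ (n mod l) \<triangleright> (x ^ l) ^ (n div l)"
proof -
  have "x ^ n = x ^ (n mod l) * (x ^ l) ^ (n div l)"
    by (simp add: power_mult[symmetric] power_add[symmetric] add.commute)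
  then show ?thesis by (simp only: ap_mult)
qed

text \<open>A is a finite module over the central powers. After division of the exponents with
  remainder, the central factors are moved to the end, where they act on an element already known to
  be in \<open>Q\<close>.\<close>

lemma pbw_reduce:
  assumes Q: "\<And>v z. v \<in> Q \<Longrightarrow> z \<in> {gX ^ l, gY ^ l, gK ^ l, gKinv ^ l, gE ^ l, gF ^ l} \<Longrightarrow> v \<triangleright> z \<in> Q"
    and small: "\<And>j. j \<in> small_index \<Longrightarrow> v \<triangleright> pbw j \<in> Q"
  shows "v \<triangleright> pbw j \<in> Q"
proof -
  obtain a b e m n where j: "j = (a, b, e, m, n)" by (cases j)
  have Qp: "v \<triangleright> z ^ i \<in> Q" if "v \<in> Q" "z \<in> {gX ^ l, gY ^ l, gK ^ l, gKinv ^ l, gE ^ l, gF ^ l}" for v z i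
  proof (induct i)
    case (Suc i)
    then show ?case using Q[OF _ that(2)] by (simp only: power_Suc2 ap_mult)
  qed (use that in simp)
  have K: "\<exists>e' z i. e' \<in> {- int l<..<int l} \<and> z \<in> {gK ^ l, gKinv ^ l} \<and>
      (\<forall>v. v \<triangleright> Kpow e = v \<triangleright> Kpow e' \<triangleright> z ^ i)"
  proof (cases "e \<ge> 0")
    case True
    have "Kpow (int (nat e mod l)) = (gK ^ (nat e mod l) :: 'k pre_A)" by (simp add: Kpow_def)
    then have "\<forall>v. v \<triangleright> Kpow e = v \<triangleright> Kpow (int (nat e mod l)) \<triangleright> (gK ^ l) ^ (nat e div l)"
      using True power_split[of _ gK "nat e"] by (simp add: Kpow_def)
    moreover have "int (nat e mod l) \<in> {- int l<..<int l}"
      using l mod_less_divisor[of l "nat e"] by (simp del: of_nat_mod mod_less_divisor)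
    ultimately show ?thesis by blast
  next
    case False
    have "Kpow (- int (nat (- e) mod l)) = (gKinv ^ (nat (- e) mod l) :: 'k pre_A)"
      by (cases "nat (- e) mod l = 0") (simp_all add: Kpow_def del: of_nat_mod)
    then have "\<forall>v. v \<triangleright> Kpow e = v \<triangleright> Kpow (- int (nat (- e) mod l)) \<triangleright> (gKinv ^ l) ^ (nat (- e) div l)"
      using False power_split[of _ gKinv "nat (- e)"] by (simp add: Kpow_def)
    moreover have "- int (nat (- e) mod l) \<in> {- int l<..<int l}"
      using l mod_less_divisor[of l "nat (- e)"] by (simp del: of_nat_mod mod_less_divisor)
    ultimately show ?thesis by blast
  qed
  then obtain e' z i where e': "e' \<in> {- int l<..<int l}" and z: "z \<in> {gK ^ l, gKinv ^ l}"
    and Ke: "\<And>v. v \<triangleright> Kpow e = v \<triangleright> Kpow e' \<triangleright> z ^ i" by blast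
  have cz: "central_A q z" using z central_powers by blast
  note cc = central_commute[OF central_A_power[OF central_powers(1)]]
    central_commute[OF central_A_power[OF central_powers(2)]]
    central_commute[OF central_A_power[OF cz]] central_commute[OF central_A_power[OF central_powers(5)]]
  define w where "w = v \<triangleright> pbw (a mod l, b mod l, e', m mod l, n mod l)"
  have w: "w \<in> Q" unfolding w_def
    by (rule small) (use e' l in \<open>simp add: small_index_def\<close>)
  have "v \<triangleright> pbw j = v \<triangleright> gX ^ (a mod l) \<triangleright> (gX ^ l) ^ (a div l) \<triangleright> gY ^ (b mod l) \<triangleright> (gY ^ l) ^ (b div l) \<triangleright>
      Kpow e' \<triangleright> z ^ i \<triangleright> gE ^ (m mod l) \<triangleright> (gE ^ l) ^ (m div l) \<triangleright> gF ^ (n mod l) \<triangleright> (gF ^ l) ^ (n div l)"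
    unfolding j pbw_def prod.case ap_mult
    by (simp only: power_split[of _ gX a] power_split[of _ gY b] Ke power_split[of _ gE m] power_split[of _ gF n])
  also have "\<dots> = w \<triangleright> (gX ^ l) ^ (a div l) \<triangleright> (gY ^ l) ^ (b div l) \<triangleright> z ^ i \<triangleright> (gE ^ l) ^ (m div l) \<triangleright> (gF ^ l) ^ (n div l)"
    unfolding w_def pbw_def prod.case ap_mult
    by (simp only: cc(1)[of _ _ "gY ^ (b mod l)"] cc(1)[of _ _ "Kpow e'"] cc(1)[of _ _ "gE ^ (m mod l)"] cc(1)[of _ _ "gF ^ (n mod l)"]
        cc(2)[of _ _ "Kpow e'"] cc(2)[of _ _ "gE ^ (m mod l)"] cc(2)[of _ _ "gF ^ (n mod l)"]
        cc(3)[of _ _ "gE ^ (m mod l)"] cc(3)[of _ _ "gF ^ (n mod l)"] cc(4)[of _ _ "gF ^ (n mod l)"])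
  also have "\<dots> \<in> Q" by (intro Qp w) (use z in blast)+
  finally show ?thesis .
qed

definition gens :: "'m \<Rightarrow> 'm set" where
  "gens v = (\<lambda>j. v \<triangleright> pbw j) ` small_index"

lemma gens_generate:
  assumes v: "v \<noteq> 0" and G: "gens v \<subseteq> Q" and Q: "0 \<in> Q" "\<And>v w. v \<in> Q \<Longrightarrow> w \<in> Q \<Longrightarrow> v + w \<in> Q"
    "\<And>v c. v \<in> Q \<Longrightarrow> v \<triangleright> const c \<in> Q"
    and z: "\<And>v z. v \<in> Q \<Longrightarrow> z \<in> {gX ^ l, gY ^ l, gK ^ l, gKinv ^ l, gE ^ l, gF ^ l} \<Longrightarrow> v \<triangleright> z \<in> Q"
  shows "Q = UNIV"
proof -
  have "w \<in> Q" for w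
  proof -
    obtain a where a: "w = v \<triangleright> a" using orbit_UNIV[OF v] by blast
    obtain J c where J: "finite J" and c: "cls q a = cls q (\<Sum>j\<in>J. const (c j) * pbw j)"
      using pbw_spanning[OF gq, of a] by (elim exE conjE)
    have w: "w = (\<Sum>j\<in>J. v \<triangleright> pbw j \<triangleright> const (c j))"
      unfolding a ap_cong[OF c] ap_sum ap_const_mult ..
    have vp: "v \<triangleright> pbw j \<in> Q" for j
      by (rule pbw_reduce[OF z]) (use G in \<open>auto simp: gens_def\<close>)
    have "(\<Sum>j\<in>J. v \<triangleright> pbw j \<triangleright> const (c j)) \<in> Q" using J
      by (induct J rule: finite_induct) (simp_all add: Q vp)
    with w show ?thesis by simp
  qed
  then show ?thesis by blast
qed

text \<open>The Nullstellensatz makes only the first of the six operators scalar. The claim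
  \<open>main\<close> is therefore proved for an arbitrary enumeration of the central powers and
  used with each of them in front.\<close>

lemma central_power_scalar:
  assumes z: "z \<in> {gX ^ l, gY ^ l, gK ^ l, gKinv ^ l, gE ^ l, gF ^ l}"
  shows "\<exists>c. \<forall>v. v \<triangleright> z = v \<triangleright> const c"
proof -
  obtain v0 :: 'm where v0: "v0 \<noteq> 0" using ex_nonzero by blast
  define T where "T = range (\<lambda>a v. v \<triangleright> a)"
  have main: "\<exists>c. \<forall>v. v \<triangleright> z1 = v \<triangleright> const c"
    if Z: "{z1, z2, z3, z4, z5, z6} = {gX ^ l, gY ^ l, gK ^ l, gKinv ^ l, gE ^ l, gF ^ l}" for z1 z2 z3 z4 z5 z6 :: "'k pre_A"
  proof (rule nullstellensatz6[of "\<lambda>c v. v \<triangleright> const c" T "\<lambda>v. v \<triangleright> z1" "\<lambda>v. v \<triangleright> z2" "\<lambda>v. v \<triangleright> z3"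
        "\<lambda>v. v \<triangleright> z4" "\<lambda>v. v \<triangleright> z5" "\<lambda>v. v \<triangleright> z6" "gens v0" v0, OF comm_action_const])
    have cz: "central_A q z" if "z \<in> {z1, z2, z3, z4, z5, z6}" for z
      using that central_powers unfolding Z by blast
    show "(\<lambda>v. v \<triangleright> const a) \<in> T" for a unfolding T_def by blast
    show "additive_commuting T (\<lambda>v. v \<triangleright> const a)" for a
      unfolding additive_commuting_def T_def using ap_const by (auto simp: ap_vadd)
    show "f \<in> T \<and> additive_commuting T f"
      if "f \<in> {\<lambda>v. v \<triangleright> z1, \<lambda>v. v \<triangleright> z2, \<lambda>v. v \<triangleright> z3, \<lambda>v. v \<triangleright> z4, \<lambda>v. v \<triangleright> z5, \<lambda>v. v \<triangleright> z6}" for f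
    proof -
      from that obtain z where z: "z \<in> {z1, z2, z3, z4, z5, z6}" and f: "f = (\<lambda>v. v \<triangleright> z)" by blast
      have "f \<in> T" unfolding f T_def by blast
      moreover have "additive_commuting T f"
        unfolding additive_commuting_def T_def f
        using central_commute[OF cz[OF z]] by (auto simp: ap_vadd)
      ultimately show ?thesis ..
    qed
    show "t (v + w) = t v + t w" if "t \<in> T" for t v w
      using that by (auto simp: T_def ap_vadd)
    show "(\<forall>v. f v = 0) \<or> bij f" if "additive_commuting T f" for f
      using that by (intro schur_zero_or_bij) (auto simp: additive_commuting_def T_def)
    show "finite (gens v0)" by (simp add: gens_def finite_small_index)
    show "v0 \<noteq> 0" by (rule v0)
    fix Q assume Q: "gens v0 \<subseteq> Q" "0 \<in> Q" "\<And>v w. v \<in> Q \<Longrightarrow> w \<in> Q \<Longrightarrow> v + w \<in> Q"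
      "\<And>a v. v \<in> Q \<Longrightarrow> v \<triangleright> const a \<in> Q"
      and zQ: "\<And>f v. f \<in> {\<lambda>v. v \<triangleright> z1, \<lambda>v. v \<triangleright> z2, \<lambda>v. v \<triangleright> z3, \<lambda>v. v \<triangleright> z4, \<lambda>v. v \<triangleright> z5, \<lambda>v. v \<triangleright> z6} \<Longrightarrow> v \<in> Q \<Longrightarrow> f v \<in> Q"
    show "Q = UNIV"
    proof (rule gens_generate[OF v0 Q])
      fix v and z :: "'k pre_A" assume v: "v \<in> Q" and "z \<in> {gX ^ l, gY ^ l, gK ^ l, gKinv ^ l, gE ^ l, gF ^ l}"
      then have "z \<in> {z1, z2, z3, z4, z5, z6}" unfolding Z by blast
      then have "(\<lambda>v. v \<triangleright> z) \<in> {\<lambda>v. v \<triangleright> z1, \<lambda>v. v \<triangleright> z2, \<lambda>v. v \<triangleright> z3, \<lambda>v. v \<triangleright> z4, \<lambda>v. v \<triangleright> z5, \<lambda>v. v \<triangleright> z6}" by blast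
      from zQ[OF this v] show "v \<triangleright> z \<in> Q" .
    qed
  qed
  from z consider "z = gX ^ l" | "z = gY ^ l" | "z = gK ^ l" | "z = gKinv ^ l" | "z = gE ^ l" | "z = gF ^ l" by blast
  then show ?thesis
  proof cases
    case 1
    show ?thesis unfolding 1 by (rule main[of _ "gY ^ l" "gK ^ l" "gKinv ^ l" "gE ^ l" "gF ^ l"]) blast
  next
    case 2
    show ?thesis unfolding 2 by (rule main[of _ "gX ^ l" "gK ^ l" "gKinv ^ l" "gE ^ l" "gF ^ l"]) blast
  next
    case 3
    show ?thesis unfolding 3 by (rule main[of _ "gX ^ l" "gY ^ l" "gKinv ^ l" "gE ^ l" "gF ^ l"]) blast
  next
    case 4
    show ?thesis unfolding 4 by (rule main[of _ "gX ^ l" "gY ^ l" "gK ^ l" "gE ^ l" "gF ^ l"]) blast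
  next
    case 5
    show ?thesis unfolding 5 by (rule main[of _ "gX ^ l" "gY ^ l" "gK ^ l" "gKinv ^ l" "gF ^ l"]) blast
  next
    case 6
    show ?thesis unfolding 6 by (rule main[of _ "gX ^ l" "gY ^ l" "gK ^ l" "gKinv ^ l" "gE ^ l"]) blast
  qed
qed

theorem finite_dimensional: "\<exists>G. finite G \<and> VS.span G = UNIV"
proof -
  obtain v0 :: 'm where v0: "v0 \<noteq> 0" using ex_nonzero by blast
  have "VS.span (gens v0) = UNIV"
  proof (rule gens_generate[OF v0])
    show "gens v0 \<subseteq> VS.span (gens v0)" by (rule VS.span_superset)
    show const: "v \<triangleright> const c \<in> VS.span (gens v0)" if "v \<in> VS.span (gens v0)" for v c
      using VS.span_scale[OF that, of c] by (simp add: scalar_act_eq)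
    show "v \<triangleright> z \<in> VS.span (gens v0)" if "v \<in> VS.span (gens v0)"
      "z \<in> {gX ^ l, gY ^ l, gK ^ l, gKinv ^ l, gE ^ l, gF ^ l}" for v z
      using central_power_scalar[OF that(2)] const[OF that(1)] by force
  qed (simp_all add: VS.span_zero VS.span_add)
  then show ?thesis using finite_small_index by (intro exI[of _ "gens v0"]) (simp add: gens_def)
qed

end


section \<open>Density\<close>

context simple_A_module_root
begin

lemma ex_root: "degree (p :: 'k poly) > 0 \<Longrightarrow> \<exists>x. poly p x = 0"
  by (rule alg_closed_imp_poly_has_root)

lemma schur_scalar:
  fixes f :: "'m \<Rightarrow> 'm"
  assumes add: "\<And>v w. f (v + w) = f v + f w" and comm: "\<And>v a. f (v \<triangleright> a) = f v \<triangleright> a"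
  shows "\<exists>c. \<forall>v. f v = v \<triangleright> const c"
proof -
  obtain G where G: "finite G" "VS.span G = UNIV" using finite_dimensional by blast
  obtain v0 :: 'm where v0: "v0 \<noteq> 0" using ex_nonzero by blast
  obtain v c where v: "v \<noteq> 0" "f v = v \<triangleright> const c"
    using ex_eigenvector[of f G UNIV v0, OF ex_root add comm G] v0 by auto
  define g where "g w = f w - w \<triangleright> const c" for w
  have "(\<forall>w. g w = 0) \<or> bij g"
    by (rule schur_zero_or_bij) (simp_all add: g_def add comm ap_vadd ap_vdiff ap_const)
  moreover have "g v = 0" "g 0 = 0" using v(2) add[of 0 0] by (simp_all add: g_def)
  then have "\<not> bij g" using v(1) by (auto simp: bij_def inj_def)
  ultimately have "\<forall>w. f w = w \<triangleright> const c" by (simp add: g_def)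
  then show ?thesis ..
qed

text \<open>Jacobson density. If \<open>w\<close> were killed by all that kills \<open>Z\<close> and
  \<open>u\<close>, then sending \<open>u \<triangleright> a\<close> to
  \<open>w \<triangleright> a\<close>, for the \<open>a\<close> that kill \<open>Z\<close>, would be
  a well-defined endomorphism of the module, hence a scalar \<open>c\<close>. So whatever kills
  \<open>Z\<close> kills \<open>w - u \<triangleright> const c\<close>, which by induction lies in
  the span of \<open>Z\<close>.\<close>

lemma ex_annihilator:
  assumes "finite Z" and "VS.independent Z" and "w \<notin> VS.span Z"
  shows "\<exists>a. (\<forall>v\<in>Z. v \<triangleright> a = 0) \<and> w \<triangleright> a \<noteq> 0"
  using assms
proof (induct Z arbitrary: w rule: finite_induct)
  case empty
  then have "w \<triangleright> 1 \<noteq> 0" by simp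
  then show ?case by blast
next
  case (insert u Z)
  have indep: "VS.independent Z" and u: "u \<notin> VS.span Z"
    using insert.prems(1) insert.hyps(2) by (simp_all add: VS.independent_insert)
  show ?case
  proof (rule ccontr)
    assume "\<not> ?thesis"
    then have contra: "w \<triangleright> a = 0" if "\<forall>v\<in>Z. v \<triangleright> a = 0" "u \<triangleright> a = 0" for a using that by blast
    obtain a0 where a0: "\<forall>v\<in>Z. v \<triangleright> a0 = 0" "u \<triangleright> a0 \<noteq> 0" using insert.hyps(3)[OF indep u] by blast
    have ex: "\<exists>a. (\<forall>v\<in>Z. v \<triangleright> a = 0) \<and> u \<triangleright> a = x" for x
    proof -
      obtain b where "x = u \<triangleright> a0 \<triangleright> b" using orbit_UNIV[OF a0(2)] by blast
      then show ?thesis using a0(1) by (intro exI[of _ "a0 * b"]) (simp add: ap_mult)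
    qed
    \<comment> \<open>A choice of \<open>a\<close> with \<open>u \<triangleright> a = x\<close>
      among the elements that kill \<open>Z\<close>. The map \<theta> does not depend on it, since
      the difference of two choices kills \<open>Z\<close> and \<open>u\<close> and so kills
      \<open>w\<close>.\<close>
    define \<alpha> where "\<alpha> x = (SOME a. (\<forall>v\<in>Z. v \<triangleright> a = 0) \<and> u \<triangleright> a = x)" for x
    have \<alpha>: "(\<forall>v\<in>Z. v \<triangleright> \<alpha> x = 0) \<and> u \<triangleright> \<alpha> x = x" for x
      unfolding \<alpha>_def by (rule someI_ex[OF ex])
    define \<theta> where "\<theta> x = w \<triangleright> \<alpha> x" for x
    have \<theta>: "\<theta> (u \<triangleright> a) = w \<triangleright> a" if "\<forall>v\<in>Z. v \<triangleright> a = 0" for a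
    proof -
      have "w \<triangleright> (\<alpha> (u \<triangleright> a) - a) = 0" by (rule contra) (use \<alpha> that in \<open>simp_all add: ap_diff\<close>)
      then show ?thesis by (simp add: \<theta>_def ap_diff)
    qed
    have "\<exists>c. \<forall>x. \<theta> x = x \<triangleright> const c"
    proof (rule schur_scalar)
      fix x y
      have "\<theta> (u \<triangleright> (\<alpha> x + \<alpha> y)) = w \<triangleright> (\<alpha> x + \<alpha> y)" by (rule \<theta>) (use \<alpha> in \<open>simp add: ap_add\<close>)
      then show "\<theta> (x + y) = \<theta> x + \<theta> y" using \<alpha> by (simp add: ap_add \<theta>_def)
    next
      fix x a
      have "\<theta> (u \<triangleright> (\<alpha> x * a)) = w \<triangleright> (\<alpha> x * a)" by (rule \<theta>) (use \<alpha> in \<open>simp add: ap_mult\<close>)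
      then show "\<theta> (x \<triangleright> a) = \<theta> x \<triangleright> a" using \<alpha> by (simp add: ap_mult \<theta>_def)
    qed
    then obtain c where c: "\<And>x. \<theta> x = x \<triangleright> const c" by blast
    let ?w = "w - u \<triangleright> const c"
    have "?w \<notin> VS.span Z"
    proof
      assume "?w \<in> VS.span Z"
      then have "?w \<in> VS.span (insert u Z)" using VS.span_mono[of Z "insert u Z"] by blast
      moreover have "u \<triangleright> const c \<in> VS.span (insert u Z)"
        using VS.span_scale[OF VS.span_base, of u "insert u Z" c] by (simp add: scalar_act_eq)
      ultimately have "?w + u \<triangleright> const c \<in> VS.span (insert u Z)" by (rule VS.span_add)
      then show False using insert.prems(2) by simp
    qed
    then obtain a where a: "\<forall>v\<in>Z. v \<triangleright> a = 0" "?w \<triangleright> a \<noteq> 0" using insert.hyps(3)[OF indep] by blast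
    then show False using \<theta>[OF a(1)] c[of "u \<triangleright> a"] by (simp add: ap_vdiff ap_const)
  qed
qed

lemma matrix_unit:
  fixes b :: "nat \<Rightarrow> 'm"
  assumes inj: "inj_on b {..<m}" and indep: "VS.independent (b ` {..<m})" and i: "i < m"
  shows "\<exists>a. \<forall>k<m. b k \<triangleright> a = (if k = i then x else 0)"
proof -
  let ?Z = "b ` ({..<m} - {i})"
  have Z: "?Z = b ` {..<m} - {b i}" using inj i by (auto simp: inj_on_def)
  have 1: "VS.independent ?Z" by (rule VS.independent_mono[OF indep]) blast
  have 2: "b i \<notin> VS.span ?Z" using indep i unfolding Z VS.dependent_def by blast
  have "finite ?Z" by simp
  then obtain a where a: "\<forall>v\<in>?Z. v \<triangleright> a = 0" "b i \<triangleright> a \<noteq> 0"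
    using ex_annihilator[OF _ 1 2] by blast
  obtain c where "x = b i \<triangleright> a \<triangleright> c" using orbit_UNIV[OF a(2)] by blast
  then have "\<forall>k<m. b k \<triangleright> (a * c) = (if k = i then x else 0)" using a(1) by (auto simp: ap_mult)
  then show ?thesis ..
qed

end


section \<open>Polynomial identities of \<open>A\<close>\<close>

lemma word_eval_cls: "word_eval (alg_A q) (\<lambda>x. cls q (a x)) w = cls q (prod_list (map a (letters w)))"
proof -
  have "foldr (\<lambda>x. (\<otimes>\<^bsub>alg_A q\<^esub>) (cls q (a x))) u \<one>\<^bsub>alg_A q\<^esub> = cls q (prod_list (map a u))" for u
    by (induct u) (simp_all add: cls_one cls_mult)
  then show ?thesis by (simp add: word_eval_def)
qed

lemma const_of_nat: "const (of_nat n) = (of_nat n :: 'k::field pre_A)"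
  by (induct n) (simp_all add: const_add)

lemma const_of_int: "const (of_int n) = (of_int n :: 'k::field pre_A)"
  by (cases n rule: int_cases2) (simp_all add: const_of_nat const_uminus)

lemma add_pow_cls: "[k] \<cdot>\<^bsub>alg_A q\<^esub> cls q x = cls q (const (of_int k) * x)" for k :: int
proof -
  interpret R: ring "alg_A q" by (rule ring_alg_A)
  have nat: "[n] \<cdot>\<^bsub>alg_A q\<^esub> cls q x = cls q (of_nat n * x)" for n :: nat
  proof (induct n)
    case 0
    show ?case by (simp add: cls_zero)
  next
    case (Suc n)
    have "cls q (of_nat (Suc n) * x) = cls q (of_nat n * x + x)" by (simp add: distrib_right add.commute)
    then show ?case unfolding R.add.nat_pow_Suc Suc cls_add by (rule sym)
  qed
  have neg: "\<ominus>\<^bsub>alg_A q\<^esub> cls q y = cls q (- y)" for y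
    by (rule R.minus_equality) (simp_all add: cls_add[symmetric] cls_zero)
  show ?thesis
  proof (cases "k \<ge> 0")
    case True
    then show ?thesis unfolding add_pow_int_ge[OF True] nat const_of_int by simp
  next
    case False
    then have "k < 0" by simp
    from this show ?thesis unfolding add_pow_int_lt[OF \<open>k < 0\<close>] nat const_of_int neg by simp
  qed
qed

lemma poly_eval_cls:
  "poly_eval (alg_A q) (\<lambda>x. cls q (a x)) f =
     cls q (\<Sum>w\<in>Poly_Mapping.keys f. const (of_int (Poly_Mapping.lookup f w)) * prod_list (map a (letters w)))"
proof -
  interpret R: ring "alg_A q" by (rule ring_alg_A)
  have "(\<Oplus>\<^bsub>alg_A q\<^esub>w\<in>W. cls q (g w)) = cls q (sum g W)" if "finite W" for W and g :: "'b word \<Rightarrow> 'a pre_A"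
    using that by (induct W rule: finite_induct) (simp_all add: cls_zero cls_add)
  then show ?thesis unfolding poly_eval_def word_eval_cls add_pow_cls by simp
qed

lemma polynomial_identity_cls:
  "polynomial_identity (alg_A q) f \<longleftrightarrow>
     (\<forall>a. cls q (\<Sum>w\<in>Poly_Mapping.keys f. const (of_int (Poly_Mapping.lookup f w)) * prod_list (map a (letters w)))
        = cls q 0)"
proof -
  have "(\<forall>r. range r \<subseteq> carrier (alg_A q) \<longrightarrow> poly_eval (alg_A q) r f = \<zero>\<^bsub>alg_A q\<^esub>) \<longleftrightarrow>
      (\<forall>a. poly_eval (alg_A q) (\<lambda>x. cls q (a x)) f = \<zero>\<^bsub>alg_A q\<^esub>)"
  proof (intro iffI allI impI)
    fix r :: "'b \<Rightarrow> 'a elem_A"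
    assume *: "\<forall>a. poly_eval (alg_A q) (\<lambda>x. cls q (a x)) f = \<zero>\<^bsub>alg_A q\<^esub>" and "range r \<subseteq> carrier (alg_A q)"
    then have "\<forall>x. \<exists>y. r x = cls q y" unfolding carrier_alg_A by blast
    then obtain a where "\<And>x. r x = cls q (a x)" by metis
    then have "r = (\<lambda>x. cls q (a x))" by blast
    then show "poly_eval (alg_A q) r f = \<zero>\<^bsub>alg_A q\<^esub>" using * by simp
  qed (auto simp: image_subset_iff)
  then show ?thesis unfolding polynomial_identity_def poly_eval_cls cls_zero .
qed

definition free_standard :: "nat \<Rightarrow> (nat, int) free_algebra" where
  "free_standard N = (\<Sum>\<sigma>\<in>permutations_of_set {..<N}. Poly_Mapping.single (Word \<sigma>) (list_sgn \<sigma>))"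

lemma lookup_free_standard:
  "Poly_Mapping.lookup (free_standard N) w =
     (if letters w \<in> permutations_of_set {..<N} then list_sgn (letters w) else 0)"
proof -
  have "Poly_Mapping.lookup (free_standard N) w =
      (\<Sum>\<sigma>\<in>permutations_of_set {..<N}. if \<sigma> = letters w then list_sgn \<sigma> else 0)"
    unfolding free_standard_def lookup_sum lookup_single by (intro sum.cong) (auto simp: when_def)
  then show ?thesis by simp
qed

lemma upt_permutation: "[0..<N] \<in> permutations_of_set {..<N}"
  by (auto simp: permutations_of_set_def)

lemma keys_free_standard: "Poly_Mapping.keys (free_standard N) \<subseteq> Word ` permutations_of_set {..<N}"
proof
  fix w assume "w \<in> Poly_Mapping.keys (free_standard N)"
  then have "letters w \<in> permutations_of_set {..<N}" by (auto simp: in_keys_iff lookup_free_standard split: if_splits)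
  then show "w \<in> Word ` permutations_of_set {..<N}" by (metis image_eqI word.collapse)
qed

lemma upt_in_keys: "Word [0..<N] \<in> Poly_Mapping.keys (free_standard N)"
  by (simp add: in_keys_iff lookup_free_standard upt_permutation list_sgn_upt)

lemma total_degree_free_standard: "total_degree (free_standard N) = N"
proof -
  have "(\<lambda>w. length (letters w)) ` Poly_Mapping.keys (free_standard N) = {N}"
  proof (intro equalityI subsetI)
    fix k assume "k \<in> (\<lambda>w. length (letters w)) ` Poly_Mapping.keys (free_standard N)"
    then obtain \<sigma> where "\<sigma> \<in> permutations_of_set {..<N}" "k = length \<sigma>" using keys_free_standard by fastforce
    then show "k \<in> {N}" by (simp add: length_finite_permutations_of_set)
  next
    fix k assume "k \<in> {N}"
    then show "k \<in> (\<lambda>w. length (letters w)) ` Poly_Mapping.keys (free_standard N)"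
      using upt_in_keys[of N] by (intro image_eqI[of _ _ "Word [0..<N]"]) simp_all
  qed
  then show ?thesis by (simp add: total_degree_def)
qed

lemma monic_free_standard: "monic_poly (free_standard N)"
  unfolding monic_poly_def
  by (rule bexI[OF _ upt_in_keys]) (simp add: total_degree_free_standard lookup_free_standard upt_permutation list_sgn_upt)

lemma eval_free_standard:
  "(\<Sum>w\<in>Poly_Mapping.keys (free_standard N).
      const (of_int (Poly_Mapping.lookup (free_standard N) w)) * prod_list (map a (letters w))) =
    (standard_poly a N :: 'k::field pre_A)" (is "?lhs = _")
proof -
  have "?lhs = (\<Sum>w\<in>Word ` permutations_of_set {..<N}.
      const (of_int (Poly_Mapping.lookup (free_standard N) w)) * prod_list (map a (letters w)))"
    by (rule sum.mono_neutral_left[OF _ keys_free_standard]) (simp_all add: in_keys_iff)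
  also have "\<dots> = standard_poly a N"
    unfolding standard_poly_def
    by (subst sum.reindex) (auto simp: inj_on_def lookup_free_standard intro!: sum.cong)
  finally show ?thesis .
qed

lemma identity_free_standard:
  assumes "generic q" and "q ^ l = 1" and "l > 0"
  shows "polynomial_identity (alg_A q) (free_standard (2 * (l * (if even l then l div 2 else l))))"
  unfolding polynomial_identity_cls eval_free_standard using standard_identity[OF assms] by blast

text \<open>Inclusion and exclusion, by induction on \<open>D\<close>. It isolates the words that
  use every label in \<open>D\<close> and so takes the place of a linearisation of the
  identity.\<close>

lemma sum_eq_set_zero:
  fixes h :: "nat list \<Rightarrow> 'b::comm_monoid_add"
  assumes fin: "finite \<Lambda>" "finite D"
    and zero: "\<And>Z. Z \<subseteq> D \<Longrightarrow> (\<Sum>\<sigma>\<in>{\<sigma>\<in>\<Lambda>. set \<sigma> \<subseteq> Z}. h \<sigma>) = 0"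
  shows "(\<Sum>\<sigma>\<in>{\<sigma>\<in>\<Lambda>. set \<sigma> = D}. h \<sigma>) = 0"
  using fin(2) zero
proof (induct D rule: finite_psubset_induct)
  case (psubset D)
  have *: "(\<Sum>\<sigma>\<in>{\<sigma>\<in>\<Lambda>. set \<sigma> = Z}. h \<sigma>) = 0" if "Z \<subset> D" for Z
    by (rule psubset(2)[OF that]) (use psubset.prems that in blast)
  have "(\<Sum>\<sigma>\<in>{\<sigma>\<in>\<Lambda>. set \<sigma> \<subseteq> D}. h \<sigma>) = (\<Sum>Z\<in>Pow D. \<Sum>\<sigma>\<in>{\<sigma>\<in>{\<sigma>\<in>\<Lambda>. set \<sigma> \<subseteq> D}. set \<sigma> = Z}. h \<sigma>)"
    by (rule sum.group[symmetric]) (use fin psubset.hyps in auto)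
  also have "\<dots> = (\<Sum>Z\<in>Pow D. \<Sum>\<sigma>\<in>{\<sigma>\<in>\<Lambda>. set \<sigma> = Z}. h \<sigma>)"
    by (intro sum.cong refl) auto
  also have "\<dots> = (\<Sum>\<sigma>\<in>{\<sigma>\<in>\<Lambda>. set \<sigma> = D}. h \<sigma>) +
      (\<Sum>Z\<in>Pow D - {D}. \<Sum>\<sigma>\<in>{\<sigma>\<in>\<Lambda>. set \<sigma> = Z}. h \<sigma>)"
    by (rule sum.remove) (use psubset.hyps(1) in auto)
  also have "(\<Sum>Z\<in>Pow D - {D}. \<Sum>\<sigma>\<in>{\<sigma>\<in>\<Lambda>. set \<sigma> = Z}. h \<sigma>) = 0"
    by (intro sum.neutral ballI *) blast
  finally show ?case using psubset.prems[of D] by simp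
qed

context simple_A_module_root
begin

text \<open>
  The staircase: \<open>e p\<close> sends the basis vector \<open>b (p div 2)\<close> to \<open>b ((p + 1) div 2)\<close> and the other
  ones to 0, so among the products of \<open>d\<close> distinct units \<open>e p\<close>, \<open>p < d\<close>, only
  \<open>e 0 * \<dots> * e (d - 1)\<close> moves \<open>b 0\<close> to a nonzero vector.
\<close>

lemma staircase_path:
  fixes b :: "nat \<Rightarrow> 'm" and d m :: nat
  assumes e: "\<And>p k. p < d \<Longrightarrow> k < m \<Longrightarrow> b k \<triangleright> e p = (if k = p div 2 then b ((p + 1) div 2) else 0)"
    and d: "d < 2 * m" and "k < m" and "set \<sigma> \<subseteq> {..<d}" and "distinct \<sigma>"
    and "b k \<triangleright> prod_list (map e \<sigma>) \<noteq> 0" and "\<sigma> = p # \<tau>"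
  shows "p div 2 = k \<and> sorted_wrt (<) \<sigma>"
  using assms(3-)
proof (induct \<tau> arbitrary: p k \<sigma>)
  case Nil
  then show ?case using e by (auto simp: ap_mult split: if_splits)
next
  case (Cons p' \<tau>)
  have p: "p < d" using Cons.prems by simp
  have k: "k = p div 2"
    using Cons.prems e[OF p Cons.prems(1)] by (auto simp: ap_mult split: if_splits)
  have k': "(p + 1) div 2 < m" using p d by linarith
  have "b ((p + 1) div 2) \<triangleright> prod_list (map e (p' # \<tau>)) \<noteq> 0"
    using Cons.prems(4,5) e[OF p Cons.prems(1)] k by (simp add: ap_mult)
  then have *: "p' div 2 = (p + 1) div 2 \<and> sorted_wrt (<) (p' # \<tau>)"
    using Cons.prems(2,3,5) by (intro Cons.hyps[OF k']) auto
  have "p' \<noteq> p" using Cons.prems(3,5) by auto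
  moreover have "p' div 2 = (p + 1) div 2" using * by blast
  ultimately have "p < p'" by presburger
  with * show ?case using k Cons.prems(5) by auto
qed

text \<open>Each letter \<open>i\<close> is replaced by the sum of the \<open>e p\<close> whose
  label \<open>p\<close> lies over \<open>i\<close>. A word then expands into the sum over its
  liftings along \<open>\<iota>\<close>.\<close>

lemma expand_prod_list:
  assumes "finite Z"
  shows "v \<triangleright> prod_list (map (\<lambda>i. \<Sum>p\<in>{p\<in>Z. \<iota> p = i}. e p) u) =
    (\<Sum>\<sigma>\<in>{\<sigma>. set \<sigma> \<subseteq> Z \<and> map \<iota> \<sigma> = u}. v \<triangleright> prod_list (map e \<sigma>))"
proof (induct u arbitrary: v)
  case Nil
  have "{\<sigma>. set \<sigma> \<subseteq> Z \<and> map \<iota> \<sigma> = []} = {[]}" by auto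
  then show ?case by simp
next
  case (Cons i u)
  let ?P = "{p\<in>Z. \<iota> p = i}" and ?L = "{\<sigma>. set \<sigma> \<subseteq> Z \<and> map \<iota> \<sigma> = u}"
  have L: "{\<sigma>. set \<sigma> \<subseteq> Z \<and> map \<iota> \<sigma> = i # u} = (\<lambda>(p, \<sigma>). p # \<sigma>) ` (?P \<times> ?L)"
    by (auto simp: map_eq_Cons_conv image_iff)
  have "v \<triangleright> prod_list (map (\<lambda>i. \<Sum>p\<in>{p\<in>Z. \<iota> p = i}. e p) (i # u)) =
      (\<Sum>p\<in>?P. v \<triangleright> e p \<triangleright> prod_list (map (\<lambda>i. \<Sum>p\<in>{p\<in>Z. \<iota> p = i}. e p) u))"
    by (simp add: ap_mult ap_sum ap_vsum)
  also have "\<dots> = (\<Sum>p\<in>?P. \<Sum>\<sigma>\<in>?L. v \<triangleright> prod_list (map e (p # \<sigma>)))"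
    by (simp add: Cons ap_mult)
  also have "\<dots> = (\<Sum>\<sigma>\<in>{\<sigma>. set \<sigma> \<subseteq> Z \<and> map \<iota> \<sigma> = i # u}. v \<triangleright> prod_list (map e \<sigma>))"
    unfolding L by (subst sum.reindex) (auto simp: inj_on_def sum.cartesian_product intro!: sum.cong)
  finally show ?case .
qed

text \<open>The units of the staircase are labelled by the positions in a word \<open>w0\<close> of
  full degree with coefficient 1, and each letter is replaced by the sum of the units at its
  positions in \<open>Z\<close>. Varying \<open>Z\<close> isolates the products that use each of the
  \<open>d\<close> units. As words have length at most \<open>d\<close>, these are orderings of the
  units. Only the natural one does not kill \<open>b 0\<close>, and it stems from \<open>w0\<close>
  alone.\<close>

theorem identity_degree:
  fixes f :: "(nat, int) free_algebra"
  assumes f: "monic_poly f" and id: "polynomial_identity (alg_A q) f"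
  shows "2 * VS.dim (UNIV :: 'm set) \<le> total_degree f"
proof (rule ccontr)
  define m where "m = VS.dim (UNIV :: 'm set)"
  define d where "d = total_degree f"
  assume "\<not> ?thesis"
  \<comment> \<open>This keeps the staircase inside the basis: its last index is
    \<open>d div 2\<close>.\<close>
  then have d: "d < 2 * m" by (simp add: m_def d_def)
  obtain B :: "'m set" where B: "VS.independent B" "card B = m"
    using VS.basis_exists[of UNIV] unfolding m_def by blast
  have m: "m > 0" using d by simp
  then have "finite B" using B(2) card_ge_0_finite by blast
  then obtain b where "bij_betw b {0..<m} B" using ex_bij_betw_nat_finite B(2) by blast
  then have b: "inj_on b {..<m}" "b ` {..<m} = B"
    by (auto simp: bij_betw_def lessThan_atLeast0)
  have b0: "b k \<noteq> 0" if "k < m" for k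
    using B(1) VS.dependent_zero[of B] that b(2) by auto
  have "\<exists>a. \<forall>k<m. b k \<triangleright> a = (if k = p div 2 then b ((p + 1) div 2) else 0)" if "p < d" for p
    by (rule matrix_unit[OF b(1)]) (use b(2) B(1) d that in auto)
  then have "\<forall>p\<in>{..<d}. \<exists>a. \<forall>k<m. b k \<triangleright> a = (if k = p div 2 then b ((p + 1) div 2) else 0)" by simp
  from bchoice[OF this] obtain e
    where e: "b k \<triangleright> e p = (if k = p div 2 then b ((p + 1) div 2) else 0)" if "p < d" "k < m" for p k
    by (auto simp del: ap_vzero)
  obtain w0 where w0: "w0 \<in> Poly_Mapping.keys f" "length (letters w0) = d" "Poly_Mapping.lookup f w0 = 1"
    using f unfolding monic_poly_def d_def by blast
  have deg: "length (letters w) \<le> d" if "w \<in> Poly_Mapping.keys f" for w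
    unfolding d_def total_degree_def by (rule Max_ge) (use that in auto)
  define \<iota> where "\<iota> p = letters w0 ! p" for p
  have \<iota>: "map \<iota> [0..<d] = letters w0" using w0(2) map_nth[of "letters w0"] by (simp add: \<iota>_def[abs_def])
  define \<Lambda> where "\<Lambda> = {\<sigma>. set \<sigma> \<subseteq> {..<d} \<and> length \<sigma> \<le> d}"
  have fin: "finite \<Lambda>" unfolding \<Lambda>_def by (rule finite_lists_length_le) simp
  define h where "h \<sigma> = b 0 \<triangleright> prod_list (map e \<sigma>) \<triangleright> const (of_int (Poly_Mapping.lookup f (Word (map \<iota> \<sigma>))))" for \<sigma>
  have "(\<Sum>\<sigma>\<in>{\<sigma>\<in>\<Lambda>. set \<sigma> \<subseteq> Z}. h \<sigma>) = 0" if Z: "Z \<subseteq> {..<d}" for Z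
  proof -
    have finZ: "finite Z" using Z finite_subset by blast
    let ?a = "\<lambda>i. \<Sum>p\<in>{p\<in>Z. \<iota> p = i}. e p"
    have fibre: "{\<sigma> \<in> {\<sigma>\<in>\<Lambda>. set \<sigma> \<subseteq> Z \<and> Word (map \<iota> \<sigma>) \<in> Poly_Mapping.keys f}. Word (map \<iota> \<sigma>) = w} =
        {\<sigma>. set \<sigma> \<subseteq> Z \<and> map \<iota> \<sigma> = letters w}" if w: "w \<in> Poly_Mapping.keys f" for w
    proof (intro equalityI subsetI)
      fix \<sigma> assume "\<sigma> \<in> {\<sigma>. set \<sigma> \<subseteq> Z \<and> map \<iota> \<sigma> = letters w}"
      then have "set \<sigma> \<subseteq> Z" "Word (map \<iota> \<sigma>) = w" by simp_all
      moreover have "length \<sigma> \<le> d" using deg[OF w] \<open>Word (map \<iota> \<sigma>) = w\<close> by auto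
      ultimately show "\<sigma> \<in> {\<sigma> \<in> {\<sigma>\<in>\<Lambda>. set \<sigma> \<subseteq> Z \<and> Word (map \<iota> \<sigma>) \<in> Poly_Mapping.keys f}. Word (map \<iota> \<sigma>) = w}"
        using w Z by (auto simp: \<Lambda>_def)
    qed auto
    have "0 = b 0 \<triangleright> (\<Sum>w\<in>Poly_Mapping.keys f. const (of_int (Poly_Mapping.lookup f w)) * prod_list (map ?a (letters w)))"
      using ap_cong[OF id[unfolded polynomial_identity_cls, rule_format, of ?a], of "b 0"] by simp
    also have "\<dots> = (\<Sum>w\<in>Poly_Mapping.keys f. \<Sum>\<sigma>\<in>{\<sigma>. set \<sigma> \<subseteq> Z \<and> map \<iota> \<sigma> = letters w}. h \<sigma>)"
      unfolding ap_sum ap_const_mult expand_prod_list[OF finZ] ap_vsum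
      by (intro sum.cong refl) (simp add: h_def)
    also have "\<dots> = (\<Sum>w\<in>Poly_Mapping.keys f. \<Sum>\<sigma>\<in>{\<sigma> \<in> {\<sigma>\<in>\<Lambda>. set \<sigma> \<subseteq> Z \<and> Word (map \<iota> \<sigma>) \<in> Poly_Mapping.keys f}. Word (map \<iota> \<sigma>) = w}. h \<sigma>)"
      by (intro sum.cong refl) (simp only: fibre)
    also have "\<dots> = (\<Sum>\<sigma>\<in>{\<sigma>\<in>\<Lambda>. set \<sigma> \<subseteq> Z \<and> Word (map \<iota> \<sigma>) \<in> Poly_Mapping.keys f}. h \<sigma>)"
      by (rule sum.group) (use fin in auto)
    also have "\<dots> = (\<Sum>\<sigma>\<in>{\<sigma>\<in>\<Lambda>. set \<sigma> \<subseteq> Z}. h \<sigma>)"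
      by (rule sum.mono_neutral_left) (use fin in \<open>auto simp: h_def in_keys_iff\<close>)
    finally show ?thesis ..
  qed
  then have 0: "(\<Sum>\<sigma>\<in>{\<sigma>\<in>\<Lambda>. set \<sigma> = {..<d}}. h \<sigma>) = 0" by (rule sum_eq_set_zero[OF fin finite_lessThan])
  have "(\<Sum>\<sigma>\<in>{\<sigma>\<in>\<Lambda>. set \<sigma> = {..<d}}. h \<sigma>) = (\<Sum>\<sigma>\<in>{[0..<d]}. h \<sigma>)"
  proof (rule sum.mono_neutral_right)
    show "finite {\<sigma> \<in> \<Lambda>. set \<sigma> = {..<d}}" using fin by simp
    show "{[0..<d]} \<subseteq> {\<sigma> \<in> \<Lambda>. set \<sigma> = {..<d}}" by (auto simp: \<Lambda>_def)
    show "\<forall>\<sigma>\<in>{\<sigma> \<in> \<Lambda>. set \<sigma> = {..<d}} - {[0..<d]}. h \<sigma> = 0"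
    proof
      fix \<sigma> assume \<sigma>: "\<sigma> \<in> {\<sigma> \<in> \<Lambda>. set \<sigma> = {..<d}} - {[0..<d]}"
      then have len: "length \<sigma> \<le> d" and set: "set \<sigma> = {..<d}" by (auto simp: \<Lambda>_def)
      have "card (set \<sigma>) = d" by (simp add: set)
      then have dist: "distinct \<sigma>" using len card_length[of \<sigma>] by (intro card_distinct) simp
      have "b 0 \<triangleright> prod_list (map e \<sigma>) = 0"
      proof (rule ccontr)
        assume nz: "b 0 \<triangleright> prod_list (map e \<sigma>) \<noteq> 0"
        have "sorted_wrt (<) \<sigma>"
        proof (cases \<sigma>)
          case (Cons p \<tau>)
          have "p div 2 = 0 \<and> sorted_wrt (<) \<sigma>"
            by (rule staircase_path[where b = b and e = e, OF _ d m _ dist nz Cons]) (simp_all only: e set order_refl)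
          then show ?thesis ..
        qed simp
        then have "sorted \<sigma>" by (simp add: strict_sorted_iff)
        then have "\<sigma> = [0..<d]"
          by (rule sorted_distinct_set_unique) (simp_all add: dist set lessThan_atLeast0)
        then show False using \<sigma> by simp
      qed
      then show "h \<sigma> = 0" by (simp add: h_def)
    qed
  qed
  also have "\<dots> = h [0..<d]" by simp
  also have "\<dots> = b (d div 2)"
  proof -
    have "k \<le> d \<Longrightarrow> b 0 \<triangleright> prod_list (map e [0..<k]) = b (k div 2)" for k
    proof (induct k)
      case (Suc k)
      have "b 0 \<triangleright> prod_list (map e [0..<Suc k]) = b 0 \<triangleright> prod_list (map e [0..<k]) \<triangleright> e k"
        by (simp add: ap_mult)
      also have "b 0 \<triangleright> prod_list (map e [0..<k]) = b (k div 2)" using Suc by simp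
      also have "b (k div 2) \<triangleright> e k = b ((k + 1) div 2)"
        by (subst e) (use Suc.prems d in auto)
      finally show ?case by simp
    qed simp
    from this[OF order_refl] show ?thesis
      unfolding h_def \<iota> word.collapse w0(3) by simp
  qed
  finally have "b (d div 2) = 0" unfolding 0 by (rule sym)
  moreover have "d div 2 < m" using d by simp
  ultimately show False using b0 by blast
qed

lemma PI_min_degree_le: "PI_min_degree (alg_A q) \<le> 2 * (l * (if even l then l div 2 else l))"
  unfolding PI_min_degree_def
proof (rule Least_le, rule exI, intro conjI)
  show "monic_poly (free_standard (2 * (l * (if even l then l div 2 else l))))" by (rule monic_free_standard)
qed (rule identity_free_standard[OF gq ql l] total_degree_free_standard)+

lemma dim_le_PI_min_degree: "2 * VS.dim (UNIV :: 'm set) \<le> PI_min_degree (alg_A q)"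
proof -
  let ?P = "\<lambda>d. \<exists>f :: (nat, int) free_algebra. monic_poly f \<and> polynomial_identity (alg_A q) f \<and> total_degree f = d"
  have "?P (total_degree (free_standard (2 * (l * (if even l then l div 2 else l)))))"
    by (rule exI[of _ "free_standard (2 * (l * (if even l then l div 2 else l)))"])
      (rule conjI[OF monic_free_standard conjI[OF identity_free_standard[OF gq ql l] refl]])
  then have "?P (PI_min_degree (alg_A q))" unfolding PI_min_degree_def by (rule LeastI)
  then obtain f :: "(nat, int) free_algebra" where "monic_poly f" "polynomial_identity (alg_A q) f"
    "total_degree f = PI_min_degree (alg_A q)" by (elim exE conjE)
  then show ?thesis using identity_degree[of f] by simp
qed

end


section \<open>Modules with invertible action of \<open>X\<close> and \<open>Y\<close>\<close>

lemma (in A_module) qcomm_ap: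
  assumes "qcomm (abs_fam f) (abs_fam g) m" and "generic q"
  shows "v \<triangleright> f q \<triangleright> g q = v \<triangleright> g q \<triangleright> f q \<triangleright> const (q powi m)"
  using ap_cong[OF qcomm_cls[OF assms], of v] unfolding ap_const_mult unfolding ap_mult .

lemmas abs_fam_gens = el_def[of gK, symmetric] el_def[of gX, symmetric] el_def[of gY, symmetric]

lemmas abs_fam_B = abs_fam_mult abs_fam_power abs_fam_phi abs_fam_psi abs_fam_gens

text \<open>The order of \<open>q\<^sup>2\<close>, for \<open>q\<close> of order \<open>l\<close>.\<close>

definition half_order :: "nat \<Rightarrow> nat" where
  "half_order l = (if even l then l div 2 else l)"

locale invertible_XY = simple_A_module_root q act l
  for q :: "'k::alg_closed_field" and act :: "'m::ab_group_add \<Rightarrow> 'k elem_A \<Rightarrow> 'm" and l :: nat +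
  assumes prim: "primitive_root_of_unity l q"
    and bij_X: "bij (\<lambda>v. v \<triangleright> gX)" and bij_Y: "bij (\<lambda>v. v \<triangleright> gY)"
begin

abbreviation "h \<equiv> half_order l"

lemma l_gt_1: "l > 1"
proof -
  have "l \<noteq> 1" using gq ql by (auto simp: generic_def)
  with l show ?thesis by simp
qed

lemma h_le: "h \<le> l" and h_pos: "h > 0"
  using l_gt_1 by (cases "even l", simp_all add: half_order_def)+

lemma q0: "q \<noteq> 0"
  using gq by (simp add: generic_def)

lemma powi_eq_1D:
  assumes "q powi n = 1"
  shows "int l dvd n"
proof (rule ccontr)
  assume "\<not> int l dvd n"
  define r where "r = nat (n mod int l)"
  have "n mod int l \<noteq> 0" "0 \<le> n mod int l" "n mod int l < int l"
    using \<open>\<not> int l dvd n\<close> l by (simp_all add: mod_eq_0_iff_dvd)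
  then have r: "int r = n mod int l" "0 < r" "r < l" unfolding r_def by linarith+
  have "n = int l * (n div int l) + int r" by (simp add: r(1))
  from arg_cong[OF this, of "\<lambda>n. q powi n"]
  have "q powi n = (q powi int l) powi (n div int l) * q powi int r"
    unfolding power_int_add[OF disjI1[OF q0]] power_int_mult .
  then have "q ^ r = 1" using assms ql by simp
  then show False using prim r unfolding primitive_root_of_unity_def by blast
qed

text \<open>\<open>h\<close> is the least positive integer whose double is divisible by
  \<open>l\<close>.\<close>

lemma dvd_twice:
  assumes "int l dvd 2 * d" and "\<bar>d\<bar> < int h"
  shows "d = 0"
proof -
  have "int h dvd d"
  proof (cases "even l")
    case True
    then have "l = 2 * h" by (simp add: half_order_def)
    then have "int l = 2 * int h" by linarith
    with assms(1) show ?thesis by simp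
  next
    case False
    then have "coprime (int l) 2" by simp
    with assms(1) False show ?thesis by (simp add: half_order_def coprime_dvd_mult_right_iff)
  qed
  with assms(2) show ?thesis using dvd_imp_le_int[of d "int h"] by fastforce
qed

lemma q_power_2h: "q ^ (2 * h) = 1"
  using ql 
  by (cases "even l") (simp_all add: half_order_def power_mult power2_eq_square power_mult_distrib)

lemma q2_neq_1: "q ^ 2 \<noteq> 1"
  using gq by (simp add: generic_def)

lemma q_diff: "q - inverse q \<noteq> 0"
proof
  assume "q - inverse q = 0"
  then have "q * q = q * inverse q" by simp
  then show False using q0 q2_neq_1 by (simp add: power2_eq_square)
qed

lemma powi_h: "q powi (2 * int h) = 1" "q powi (- 2 * int h) = 1"
proof -
  have "q powi int (2 * h) = 1" unfolding power_int_of_nat by (rule q_power_2h)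
  then show *: "q powi (2 * int h) = 1" by simp
  show "q powi (- 2 * int h) = 1" using * power_int_minus[of q "2 * int h"] by simp
qed


subsection \<open>Simplicity over \<open>B\<close>\<close>

abbreviation B_gens :: "'k pre_A set" where
  "B_gens \<equiv> {gK, gX, gY, \<phi> q, \<psi> q}"

lemma inj_X: "v \<triangleright> gX = 0 \<longleftrightarrow> v = 0" and inj_Y: "v \<triangleright> gY = 0 \<longleftrightarrow> v = 0"
  using injD[OF bij_is_inj[OF bij_X], of v 0] injD[OF bij_is_inj[OF bij_Y], of v 0] by auto

lemma K_Kinv_ap: "v \<triangleright> gK \<triangleright> gKinv = v" "v \<triangleright> gKinv \<triangleright> gK = v"
proof -
  have "abs_fam (\<lambda>q. gK * gKinv) = abs_fam (\<lambda>q. 1 :: 'k pre_A)"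
    unfolding fam_abs by (rule K_Kinv)
  from ap_cong[OF abs_fam_eq[OF this gq], of v] show "v \<triangleright> gK \<triangleright> gKinv = v" by (simp add: ap_mult)
  have "abs_fam (\<lambda>q. gKinv * gK) = abs_fam (\<lambda>q. 1 :: 'k pre_A)"
    unfolding fam_abs by (rule Kinv_K)
  from ap_cong[OF abs_fam_eq[OF this gq], of v] show "v \<triangleright> gKinv \<triangleright> gK = v" by (simp add: ap_mult)
qed

lemma inj_K: "v \<triangleright> gK = 0 \<longleftrightarrow> v = 0"
  using K_Kinv_ap(1)[of v] by auto

lemma inj_power:
  assumes "\<And>v. v \<triangleright> a = 0 \<longleftrightarrow> v = 0"
  shows "v \<triangleright> a ^ n = 0 \<longleftrightarrow> v = 0"
  by (induct n arbitrary: v) (simp_all add: ap_mult assms)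

lemma power_l_scalar:
  "\<exists>c. c \<noteq> 0 \<and> (\<forall>v. v \<triangleright> gX ^ l = v \<triangleright> const c)"
  "\<exists>c. c \<noteq> 0 \<and> (\<forall>v. v \<triangleright> gY ^ l = v \<triangleright> const c)"
  "\<exists>c. c \<noteq> 0 \<and> (\<forall>v. v \<triangleright> gK ^ l = v \<triangleright> const c)"
proof -
  have *: "\<exists>c. c \<noteq> 0 \<and> (\<forall>v. v \<triangleright> a ^ l = v \<triangleright> const c)"
    if a: "a ^ l \<in> {gX ^ l, gY ^ l, gK ^ l, gKinv ^ l, gE ^ l, gF ^ l}"
      and inj: "\<And>v. v \<triangleright> a = 0 \<longleftrightarrow> v = 0" for a
  proof -
    obtain c where c: "\<And>v. v \<triangleright> a ^ l = v \<triangleright> const c" using central_power_scalar[OF a] by blast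
    obtain v :: 'm where "v \<noteq> 0" using ex_nonzero by blast
    then have "v \<triangleright> const c \<noteq> 0" unfolding c[symmetric] inj_power[OF inj] .
    then have "c \<noteq> 0" by auto
    with c show ?thesis by blast
  qed
  show "\<exists>c. c \<noteq> 0 \<and> (\<forall>v. v \<triangleright> gX ^ l = v \<triangleright> const c)" by (rule *[OF _ inj_X]) simp
  show "\<exists>c. c \<noteq> 0 \<and> (\<forall>v. v \<triangleright> gY ^ l = v \<triangleright> const c)" by (rule *[OF _ inj_Y]) simp
  show "\<exists>c. c \<noteq> 0 \<and> (\<forall>v. v \<triangleright> gK ^ l = v \<triangleright> const c)" by (rule *[OF _ inj_K]) simp
qed

definition x_l :: 'k where "x_l = (SOME c. c \<noteq> 0 \<and> (\<forall>v. v \<triangleright> gX ^ l = v \<triangleright> const c))"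

lemma x_l: "x_l \<noteq> 0" "v \<triangleright> gX ^ l = v \<triangleright> const x_l"
  using someI_ex[OF power_l_scalar(1)] unfolding x_l_def by blast+

lemma power_l_inverse:
  assumes "c \<noteq> 0" and "\<And>v. v \<triangleright> a ^ l = v \<triangleright> const c"
  shows "v \<triangleright> a ^ (l - 1) \<triangleright> const (inverse c) \<triangleright> a = v"
proof -
  have "v \<triangleright> a ^ (l - 1) \<triangleright> const (inverse c) \<triangleright> a = v \<triangleright> a ^ (l - 1) \<triangleright> a \<triangleright> const (inverse c)"
    by (rule ap_const)
  also have "v \<triangleright> a ^ (l - 1) \<triangleright> a = v \<triangleright> a ^ l"
    unfolding ap_mult[symmetric] using l by (simp add: power_Suc2[symmetric])
  finally show ?thesis using assms by (simp add: const_inverse)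
qed

lemma phi_ap: "v \<triangleright> \<phi> q = v \<triangleright> gX - v \<triangleright> gY \<triangleright> gE \<triangleright> const (q - inverse q)"
proof -
  have "abs_fam \<phi> = abs_fam (\<lambda>q. gX - const (q - inverse q) * (gY * gE) :: 'k pre_A)"
    unfolding fam_abs abs_fam_phi ep_eq la_def ..
  from ap_cong[OF abs_fam_eq[OF this gq], of v] show ?thesis
    unfolding ap_diff ap_const_mult unfolding ap_mult .
qed

lemma psi_ap: "v \<triangleright> \<psi> q = v \<triangleright> gX \<triangleright> gF \<triangleright> const (1 - q ^ 2) - v \<triangleright> gY \<triangleright> gKinv \<triangleright> const (q powi 2)"
proof -
  have "abs_fam \<psi> = abs_fam (\<lambda>q. const (1 - q ^ 2) * (gX * gF) - const (q powi 2) * (gY * gKinv) :: 'k pre_A)"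
    unfolding fam_abs abs_fam_psi es_eq mu_def qp_def ..
  from ap_cong[OF abs_fam_eq[OF this gq], of v] show ?thesis
    unfolding ap_diff ap_const_mult unfolding ap_mult .
qed

lemma closed_under_power:
  assumes P: "closed_under Z P" and "a \<in> Z" and "v \<in> P"
  shows "v \<triangleright> a ^ n \<in> P"
  using assms(3)
  by (induct n arbitrary: v) (simp_all add: ap_mult closed_underD(4)[OF P _ assms(2)])

text \<open>A subspace stable under B is also stable under the inverses of \<open>K\<close>,
  \<open>X\<close> and \<open>Y\<close>: the \<open>l\<close>-th powers are nonzero scalars, so the
  inverses are multiples of the powers with exponent \<open>l - 1\<close>. Solving
  \<open>phi_ap\<close> and \<open>psi_ap\<close> then yields stability under \<open>E\<close> and
  \<open>F\<close>.\<close>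

lemma closed_B_eq_UNIV:
  assumes P: "closed_under B_gens P" and v: "v \<in> P" "v \<noteq> 0"
  shows "P = UNIV"
proof (rule closed_eq_UNIV[OF _ v])
  note cl = closed_underD(3)[OF P] closed_underD(4)[OF P] closed_under_power[OF P] closed_under_diff[OF P]
    closed_underD(2)[OF P]
  have Kinv: "w \<triangleright> gKinv \<in> P" if w: "w \<in> P" for w
  proof -
    obtain c where c: "c \<noteq> 0" "\<And>v. v \<triangleright> gK ^ l = v \<triangleright> const c"
      using power_l_scalar(3) by blast
    have "w \<triangleright> gKinv = w \<triangleright> gK ^ (l - 1) \<triangleright> const (inverse c) \<triangleright> gK \<triangleright> gKinv"
      unfolding power_l_inverse[OF c] ..
    also have "\<dots> = w \<triangleright> gK ^ (l - 1) \<triangleright> const (inverse c)" by (rule K_Kinv_ap)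
    also have "\<dots> \<in> P" using w by (intro cl(1) cl(3)) simp_all
    finally show ?thesis .
  qed
  have E: "w \<triangleright> gE \<in> P" if w: "w \<in> P" for w
  proof -
    obtain c where c: "c \<noteq> 0" "\<And>v. v \<triangleright> gY ^ l = v \<triangleright> const c"
      using power_l_scalar(2) by blast
    define u where "u = w \<triangleright> gY ^ (l - 1) \<triangleright> const (inverse c)"
    have u: "u \<in> P" unfolding u_def using w by (intro cl(1) cl(3)) simp_all
    have "u \<triangleright> gY = w" unfolding u_def by (rule power_l_inverse[OF c])
    then have "w \<triangleright> gE \<triangleright> const (q - inverse q) = u \<triangleright> gX - u \<triangleright> \<phi> q" by (simp add: phi_ap)
    also have "\<dots> \<in> P" using u by (intro cl(4) cl(2)) simp_all
    finally have "w \<triangleright> gE \<triangleright> const (q - inverse q) \<triangleright> const (inverse (q - inverse q)) \<in> P" by (rule cl(1))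
    then show ?thesis unfolding const_inverse[OF q_diff] .
  qed
  have F: "w \<triangleright> gF \<in> P" if w: "w \<in> P" for w
  proof -
    define u where "u = w \<triangleright> gX ^ (l - 1) \<triangleright> const (inverse x_l)"
    have u: "u \<in> P" unfolding u_def using w by (intro cl(1) cl(3)) simp_all
    have "u \<triangleright> gX = w" unfolding u_def by (rule power_l_inverse[OF x_l])
    then have "w \<triangleright> gF \<triangleright> const (1 - q ^ 2) = u \<triangleright> \<psi> q + u \<triangleright> gY \<triangleright> gKinv \<triangleright> const (q powi 2)"
      by (simp add: psi_ap)
    also have "\<dots> \<in> P" using u by (intro cl(5) cl(2) cl(1) Kinv) simp_all
    finally have "w \<triangleright> gF \<triangleright> const (1 - q ^ 2) \<triangleright> const (inverse (1 - q ^ 2)) \<in> P" by (rule cl(1))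
    moreover have "1 - q ^ 2 \<noteq> 0" using q2_neq_1 by simp
    ultimately show ?thesis by (subst (asm) const_inverse)
  qed
  show "closed_under (range gen) P"
  proof (rule closed_underI)
    fix w a assume w: "w \<in> P" and "a \<in> range (gen :: generator \<Rightarrow> 'k pre_A)"
    then obtain x where "a = gen x" by blast
    have B: "w \<triangleright> gK \<in> P" "w \<triangleright> gX \<in> P" "w \<triangleright> gY \<in> P" using w by (intro cl(2); simp)+
    show "w \<triangleright> a \<in> P" unfolding \<open>a = gen x\<close>
      by (cases x) (simp_all only: E[OF w] F[OF w] Kinv[OF w] B)
  qed (blast intro: closed_underD(1-3)[OF P])+
qed

lemma schur_B:
  assumes "\<And>v a. a \<in> B_gens \<Longrightarrow> v \<triangleright> z \<triangleright> a = v \<triangleright> a \<triangleright> z"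
  shows "\<exists>c. \<forall>v. v \<triangleright> z = v \<triangleright> const c"
proof -
  obtain G where G: "finite G" "VS.span G = UNIV" using finite_dimensional by blast
  obtain v0 :: 'm where v0: "v0 \<noteq> 0" using ex_nonzero by blast
  obtain v c where v: "v \<noteq> 0" "v \<triangleright> z = v \<triangleright> const c"
    using ex_eigenvector[of "\<lambda>v. v \<triangleright> z" G UNIV v0, OF ex_root ap_vadd ap_const G] v0 by auto
  have "closed_under B_gens {v. v \<triangleright> z = v \<triangleright> const c}"
  proof (rule closed_underI)
    fix w a assume "w \<in> {v. v \<triangleright> z = v \<triangleright> const c}" and a: "a \<in> B_gens"
    then have w: "w \<triangleright> z = w \<triangleright> const c" by simp
    have "w \<triangleright> a \<triangleright> z = w \<triangleright> z \<triangleright> a" by (rule assms[OF a, symmetric])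
    also have "\<dots> = w \<triangleright> a \<triangleright> const c" unfolding w by (rule ap_const)
    finally show "w \<triangleright> a \<in> {v. v \<triangleright> z = v \<triangleright> const c}" by simp
  next
    fix w d assume "w \<in> {v. v \<triangleright> z = v \<triangleright> const c}"
    then have w: "w \<triangleright> z = w \<triangleright> const c" by simp
    have "w \<triangleright> const d \<triangleright> z = w \<triangleright> z \<triangleright> const d" by (rule ap_const)
    also have "\<dots> = w \<triangleright> const d \<triangleright> const c" unfolding w by (rule ap_const)
    finally show "w \<triangleright> const d \<in> {v. v \<triangleright> z = v \<triangleright> const c}" by simp
  qed (simp_all add: ap_vadd)
  then have "{v. v \<triangleright> z = v \<triangleright> const c} = UNIV" using v by (intro closed_B_eq_UNIV[of _ v]) simp_all
  then show ?thesis by blast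
qed

lemma right_module_B: "right_module (alg_B q) UNIV act"
proof -
  have "cls q ` Z \<subseteq> carrier (alg_A q)" for Z by (rule image_subsetI) (rule cls_carrier)
  from ring.generate_ring_incl[OF ring_alg_A this]
  have "carrier (alg_B q) \<subseteq> carrier (alg_A q)"
    unfolding alg_B_def by (simp del: image_insert image_Un Un_insert_right)
  then have "\<And>a. a \<in> carrier (alg_B q) \<Longrightarrow> a \<in> carrier (alg_A q)" by blast
  then show ?thesis
    using module_A unfolding right_module_def by (simp add: alg_B_def)
qed

lemma simple_B: "simple_right_module (alg_B q) UNIV act"
  unfolding simple_right_module_def
proof (intro conjI allI impI)
  show "right_module (alg_B q) UNIV act" by (rule right_module_B)
  show "(UNIV :: 'm set) \<noteq> {0}" using ex_nonzero by blast
  fix P :: "'m set"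
  assume P: "right_module (alg_B q) P act"
  have gen: "cls q a \<in> carrier (alg_B q)" if "a \<in> range const \<union> {gK, gKinv, gX, gY, \<phi> q, \<psi> q}" for a
    using generate_ring.incl[OF imageI[OF that]] unfolding alg_B_def by simp
  have "closed_under B_gens P"
  proof (rule closed_underI)
    show "v \<triangleright> const c \<in> P" if "v \<in> P" for v c
      using P that gen[of "const c"] unfolding right_module_def ap_def by simp
    show "v \<triangleright> a \<in> P" if "v \<in> P" "a \<in> B_gens" for v a
    proof -
      have "cls q a \<in> carrier (alg_B q)" using that(2) by (intro gen) blast
      then show ?thesis using P that(1) unfolding right_module_def ap_def by simp
    qed
  qed (use P in \<open>simp_all add: right_module_def\<close>)
  then have "P = UNIV" if "v \<in> P" "v \<noteq> 0" for v using that by (rule closed_B_eq_UNIV)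
  moreover have "0 \<in> P" using P by (simp add: right_module_def)
  ultimately show "P = {0} \<or> P = UNIV" by blast
qed

lemma torsion_free: "torsion_free_simple q act UNIV"
  using simple_B bij_is_inj[OF bij_X] bij_is_inj[OF bij_Y] by (simp add: torsion_free_simple_def ap_def)


subsection \<open>Central elements of \<open>B\<close>\<close>

lemma phi_psi_power_ap:
  "v \<triangleright> \<phi> q \<triangleright> \<psi> q ^ k = v \<triangleright> \<psi> q ^ k \<triangleright> \<phi> q -
     v \<triangleright> gK \<triangleright> (gY * gX) \<triangleright> \<psi> q ^ (k - 1) \<triangleright> const (q * (1 - q ^ 2) * (\<Sum>i<k. q powi (2 * int i)))"
proof -
  have "abs_fam (\<lambda>q. \<phi> q * \<psi> q ^ k) = abs_fam (\<lambda>q. \<psi> q ^ k * \<phi> q - const (q powi 1) * (const (1 - q ^ 2) *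
      (const (\<Sum>i<k. q powi (2 * int i)) * ((gK * (gY * gX)) * \<psi> q ^ (k - 1)))) :: 'k pre_A)"
    unfolding fam_abs abs_fam_phi abs_fam_psi phi_psi_power qp_def mu_def Sp_def eh_def ..
  from ap_cong[OF abs_fam_eq[OF this gq], of v] show ?thesis
    unfolding ap_diff ap_const_mult unfolding ap_mult ap_const_const by (simp add: mult_ac)
qed

lemma psi_phi_power_ap:
  "v \<triangleright> \<psi> q \<triangleright> \<phi> q ^ k = v \<triangleright> \<phi> q ^ k \<triangleright> \<psi> q +
     v \<triangleright> gK \<triangleright> (gY * gX) \<triangleright> \<phi> q ^ (k - 1) \<triangleright> const (q * (1 - q ^ 2) * (\<Sum>i<k. q powi (- 2 * int i)))"
proof -
  have "abs_fam (\<lambda>q. \<psi> q * \<phi> q ^ k) = abs_fam (\<lambda>q. \<phi> q ^ k * \<psi> q + const (q powi 1) * (const (1 - q ^ 2) *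
      (const (\<Sum>i<k. q powi (- 2 * int i)) * ((gK * (gY * gX)) * \<phi> q ^ (k - 1)))) :: 'k pre_A)"
    unfolding fam_abs abs_fam_phi abs_fam_psi psi_phi_power qp_def mu_def Sm_def eh_def ..
  from ap_cong[OF abs_fam_eq[OF this gq], of v] show ?thesis
    unfolding ap_add ap_const_mult unfolding ap_mult ap_const_const by (simp add: mult_ac)
qed

lemma commute_if_qcomm:
  assumes "qcomm (abs_fam f) (abs_fam g) m" and "q powi m = 1"
  shows "v \<triangleright> f q \<triangleright> g q = v \<triangleright> g q \<triangleright> f q"
  using qcomm_ap[OF assms(1) gq, of v] assms(2) by simp

text \<open>The factor \<open>gX ^ h\<close> corrects a sign. For even \<open>l\<close>, the power
  \<open>\<phi> q ^ h\<close> commutes with \<open>gK\<close> and \<open>gY\<close> only up to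
  \<open>q ^ h = - 1\<close>, and so does \<open>gX ^ h\<close>. It commutes with \<psi> because the
  sum in \<open>psi_phi_power_ap\<close> vanishes for \<open>k = h\<close>.\<close>

lemma phi_h_scalar: "\<exists>c. \<forall>v. v \<triangleright> \<phi> q ^ h \<triangleright> gX ^ h = v \<triangleright> const c"
proof -
  have "\<exists>c. \<forall>v. v \<triangleright> (\<phi> q ^ h * gX ^ h) = v \<triangleright> const c"
  proof (rule schur_B)
    fix v a assume "a \<in> B_gens"
    then consider "a = gK" | "a = gX" | "a = gY" | "a = \<phi> q" | "a = \<psi> q" by blast
    then show "v \<triangleright> (\<phi> q ^ h * gX ^ h) \<triangleright> a = v \<triangleright> a \<triangleright> (\<phi> q ^ h * gX ^ h)"
    proof cases
      case 1
      have "qcomm (abs_fam (\<lambda>q. \<phi> q ^ h * gX ^ h)) (abs_fam (\<lambda>q. gK)) (- 1 * int h + - 1 * int h)"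
        unfolding abs_fam_B by (intro qcomm_mult_left qcomm_power_left qc_phi_K qcX(1))
      from commute_if_qcomm[OF this] show ?thesis using powi_h by (simp add: 1)
    next
      case 2
      have "qcomm (abs_fam (\<lambda>q. \<phi> q ^ h * gX ^ h)) (abs_fam (\<lambda>q. gX)) (0 * int h + 0 * int h)"
        unfolding abs_fam_B by (intro qcomm_mult_left qcomm_power_left qc_phi_X qcomm_self)
      from commute_if_qcomm[OF this] show ?thesis by (simp add: 2)
    next
      case 3
      have "qcomm (abs_fam (\<lambda>q. \<phi> q ^ h * gX ^ h)) (abs_fam (\<lambda>q. gY)) (- 1 * int h + 1 * int h)"
        unfolding abs_fam_B by (intro qcomm_mult_left qcomm_power_left qc_phi_Y qcXY)
      from commute_if_qcomm[OF this] show ?thesis by (simp add: 3)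
    next
      case 4
      have "qcomm (abs_fam (\<lambda>q. \<phi> q ^ h * gX ^ h)) (abs_fam \<phi>) (0 * int h + - 0 * int h)"
        unfolding abs_fam_B by (intro qcomm_mult_left qcomm_power_left qcomm_sym[OF qc_phi_X] qcomm_self)
      from commute_if_qcomm[OF this] show ?thesis by (simp add: 4)
    next
      case 5
      have "qcomm (abs_fam \<psi>) (abs_fam (\<lambda>q. gX ^ h)) (0 * int h)"
        unfolding abs_fam_B by (rule qcomm_power_right[OF qc_psi_X])
      note X = commute_if_qcomm[OF this, of v for v, simplified]
      show ?thesis
        using psi_phi_power_ap[of v h] root_of_unity_sums(2)[OF q2_neq_1 q_power_2h q0]
        by (simp add: 5 ap_mult X)
    qed
  qed
  then show ?thesis by (simp add: ap_mult)
qed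

lemma psi_h_scalar: "\<exists>c. \<forall>v. v \<triangleright> \<psi> q ^ h \<triangleright> gX ^ h = v \<triangleright> const c"
proof -
  have "\<exists>c. \<forall>v. v \<triangleright> (\<psi> q ^ h * gX ^ h) = v \<triangleright> const c"
  proof (rule schur_B)
    fix v a assume "a \<in> B_gens"
    then consider "a = gK" | "a = gX" | "a = gY" | "a = \<phi> q" | "a = \<psi> q" by blast
    then show "v \<triangleright> (\<psi> q ^ h * gX ^ h) \<triangleright> a = v \<triangleright> a \<triangleright> (\<psi> q ^ h * gX ^ h)"
    proof cases
      case 1
      have "qcomm (abs_fam (\<lambda>q. \<psi> q ^ h * gX ^ h)) (abs_fam (\<lambda>q. gK)) (1 * int h + - 1 * int h)"
        unfolding abs_fam_B by (intro qcomm_mult_left qcomm_power_left qc_psi_K qcX(1))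
      from commute_if_qcomm[OF this] show ?thesis by (simp add: 1)
    next
      case 2
      have "qcomm (abs_fam (\<lambda>q. \<psi> q ^ h * gX ^ h)) (abs_fam (\<lambda>q. gX)) (0 * int h + 0 * int h)"
        unfolding abs_fam_B by (intro qcomm_mult_left qcomm_power_left qc_psi_X qcomm_self)
      from commute_if_qcomm[OF this] show ?thesis by (simp add: 2)
    next
      case 3
      have "qcomm (abs_fam (\<lambda>q. \<psi> q ^ h * gX ^ h)) (abs_fam (\<lambda>q. gY)) (1 * int h + 1 * int h)"
        unfolding abs_fam_B by (intro qcomm_mult_left qcomm_power_left qc_psi_Y qcXY)
      from commute_if_qcomm[OF this] show ?thesis using powi_h by (simp add: 3)
    next
      case 4
      have "qcomm (abs_fam \<phi>) (abs_fam (\<lambda>q. gX ^ h)) (0 * int h)"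
        unfolding abs_fam_B by (rule qcomm_power_right[OF qc_phi_X])
      note X = commute_if_qcomm[OF this, of v for v, simplified]
      show ?thesis
        using phi_psi_power_ap[of v h] root_of_unity_sums(1)[OF q2_neq_1 q_power_2h q0]
        by (simp add: 4 ap_mult X)
    next
      case 5
      have "qcomm (abs_fam (\<lambda>q. \<psi> q ^ h * gX ^ h)) (abs_fam \<psi>) (0 * int h + - 0 * int h)"
        unfolding abs_fam_B by (intro qcomm_mult_left qcomm_power_left qcomm_sym[OF qc_psi_X] qcomm_self)
      from commute_if_qcomm[OF this] show ?thesis by (simp add: 5)
    qed
  qed
  then show ?thesis by (simp add: ap_mult)
qed

lemma casimir_scalar: "\<exists>c. \<forall>v. v \<triangleright> \<psi> q \<triangleright> \<phi> q + v \<triangleright> gK \<triangleright> (gY * gX) \<triangleright> const (q powi 3) = v \<triangleright> const c"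
proof -
  let ?c = "\<lambda>q. \<psi> q * \<phi> q + const (q powi 3) * (gK * (gY * gX)) :: 'k pre_A"
  have c: "abs_fam ?c = ec"
    unfolding fam_abs abs_fam_phi abs_fam_psi ec_def eh_def qp_def ..
  have *: "v \<triangleright> ?c q \<triangleright> g q = v \<triangleright> g q \<triangleright> ?c q" if "qcomm ec (abs_fam g) 0" for g v
    using commute_if_qcomm[of ?c g 0 v] that unfolding c by simp
  have "\<exists>c. \<forall>v. v \<triangleright> ?c q = v \<triangleright> const c"
  proof (rule schur_B)
    fix v a assume "a \<in> B_gens"
    then consider "a = gK" | "a = gX" | "a = gY" | "a = \<phi> q" | "a = \<psi> q" by blast
    then show "v \<triangleright> ?c q \<triangleright> a = v \<triangleright> a \<triangleright> ?c q"
    proof cases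
      case 1
      show ?thesis unfolding 1 by (rule *[of "\<lambda>q. gK", unfolded abs_fam_gens, OF qc_c_K])
    next
      case 2
      show ?thesis unfolding 2 by (rule *[of "\<lambda>q. gX", unfolded abs_fam_gens, OF qc_c_X])
    next
      case 3
      show ?thesis unfolding 3 by (rule *[of "\<lambda>q. gY", unfolded abs_fam_gens, OF qc_c_Y])
    next
      case 4
      show ?thesis unfolding 4 by (rule *[of \<phi>, unfolded abs_fam_phi, OF qc_c_phi])
    next
      case 5
      show ?thesis unfolding 5 by (rule *[of \<psi>, unfolded abs_fam_psi, OF qc_c_psi])
    qed
  qed
  then show ?thesis unfolding ap_add ap_const_mult unfolding ap_mult .
qed

end


subsection \<open>Joint eigenvectors of \<open>K\<close> and \<open>Y X\<close>\<close>

context invertible_XY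
begin

definition eig :: "'k \<Rightarrow> 'k \<Rightarrow> 'm \<Rightarrow> bool" where
  "eig \<kappa> \<omega> v \<longleftrightarrow> v \<triangleright> gK = v \<triangleright> const \<kappa> \<and> v \<triangleright> (gY * gX) = v \<triangleright> const \<omega>"

lemma eigI:
  assumes a: "\<And>v. v \<triangleright> a \<triangleright> gK = v \<triangleright> gK \<triangleright> a \<triangleright> const (q powi m)"
    "\<And>v. v \<triangleright> a \<triangleright> (gY * gX) = v \<triangleright> (gY * gX) \<triangleright> a \<triangleright> const (q powi n)" and v: "eig \<kappa> \<omega> v"
  shows "eig (\<kappa> * q powi m) (\<omega> * q powi n) (v \<triangleright> a)"
proof -
  have "v \<triangleright> const c \<triangleright> a \<triangleright> const d = v \<triangleright> a \<triangleright> const (c * d)" for c d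
    unfolding ap_const[of v c a] ap_const_const ..
  then show ?thesis using v by (simp only: eig_def a)
qed

lemma eig_phi: "eig \<kappa> \<omega> v \<Longrightarrow> eig (\<kappa> * q powi - 1) (\<omega> * q powi - 1) (v \<triangleright> \<phi> q)"
proof (rule eigI)
  show "v \<triangleright> \<phi> q \<triangleright> gK = v \<triangleright> gK \<triangleright> \<phi> q \<triangleright> const (q powi - 1)" for v
    using qcomm_ap[of \<phi> "\<lambda>_. gK" "- 1", unfolded abs_fam_B, OF qc_phi_K gq] .
  have "qcomm (abs_fam \<phi>) (abs_fam (\<lambda>_. gY * gX)) (- 1 + 0)"
    unfolding abs_fam_B by (intro qcomm_mult_right qc_phi_Y qc_phi_X)
  from qcomm_ap[OF this gq]
  show "v \<triangleright> \<phi> q \<triangleright> (gY * gX) = v \<triangleright> (gY * gX) \<triangleright> \<phi> q \<triangleright> const (q powi - 1)" for v by simp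
qed

lemma eig_psi: "eig \<kappa> \<omega> v \<Longrightarrow> eig (\<kappa> * q powi 1) (\<omega> * q powi 1) (v \<triangleright> \<psi> q)"
proof (rule eigI)
  show "v \<triangleright> \<psi> q \<triangleright> gK = v \<triangleright> gK \<triangleright> \<psi> q \<triangleright> const (q powi 1)" for v
    using qcomm_ap[of \<psi> "\<lambda>_. gK" 1, unfolded abs_fam_B, OF qc_psi_K gq] .
  have "qcomm (abs_fam \<psi>) (abs_fam (\<lambda>_. gY * gX)) (1 + 0)"
    unfolding abs_fam_B by (intro qcomm_mult_right qc_psi_Y qc_psi_X)
  from qcomm_ap[OF this gq]
  show "v \<triangleright> \<psi> q \<triangleright> (gY * gX) = v \<triangleright> (gY * gX) \<triangleright> \<psi> q \<triangleright> const (q powi 1)" for v by simp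
qed

lemma X_Y_ap: "v \<triangleright> gX \<triangleright> gY = v \<triangleright> (gY * gX) \<triangleright> const (q powi 1)"
  using qcomm_ap[of "\<lambda>_. gX" "\<lambda>_. gY" 1, unfolded abs_fam_B, OF qcXY gq, of v] by (simp only: ap_mult)

lemma eig_X: "eig \<kappa> \<omega> v \<Longrightarrow> eig (\<kappa> * q powi - 1) (\<omega> * q powi 1) (v \<triangleright> gX)"
proof (rule eigI)
  show "v \<triangleright> gX \<triangleright> gK = v \<triangleright> gK \<triangleright> gX \<triangleright> const (q powi - 1)" for v
    using qcomm_ap[of "\<lambda>_. gX" "\<lambda>_. gK" "- 1", unfolded abs_fam_B, OF qcX(1) gq] .
  show "v \<triangleright> gX \<triangleright> (gY * gX) = v \<triangleright> (gY * gX) \<triangleright> gX \<triangleright> const (q powi 1)" for v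
    unfolding ap_mult[of _ gY gX] X_Y_ap ap_const ap_mult ..
qed

lemma eig_const: "eig \<kappa> \<omega> v \<Longrightarrow> eig \<kappa> \<omega> (v \<triangleright> const c)"
  unfolding eig_def by (simp only: ap_const[of v c gK] ap_const[of v c "gY * gX"] ap_const_const mult.commute simp_thms)

lemma eig_power:
  assumes "\<And>\<kappa> \<omega> v. eig \<kappa> \<omega> v \<Longrightarrow> eig (\<kappa> * q powi m) (\<omega> * q powi n) (v \<triangleright> a)" and "eig \<kappa> \<omega> v"
  shows "eig (\<kappa> * q powi (m * int k)) (\<omega> * q powi (n * int k)) (v \<triangleright> a ^ k)"
proof (induct k)
  case 0
  show ?case using assms(2) by simp
next
  case (Suc k)
  have "c * q powi (i * int k) * q powi i = c * q powi (i * int (Suc k))" for c i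
    using q0 by (simp add: distrib_left power_int_add mult_ac)
  with assms(1)[OF Suc] show ?case by (simp only: power_Suc2 ap_mult)
qed

lemma eig_nonzero:
  assumes "eig \<kappa> \<omega> v" and "v \<noteq> 0"
  shows "\<kappa> \<noteq> 0" and "\<omega> \<noteq> 0"
proof -
  have "v \<triangleright> gK \<noteq> 0" "v \<triangleright> (gY * gX) \<noteq> 0" using assms(2) by (simp_all add: inj_K ap_mult inj_X inj_Y)
  then show "\<kappa> \<noteq> 0" "\<omega> \<noteq> 0" using assms(1) by (auto simp: eig_def)
qed

lemma ex_eig: "\<exists>v \<kappa> \<omega>. v \<noteq> 0 \<and> eig \<kappa> \<omega> v"
proof -
  obtain G where G: "finite G" "VS.span G = UNIV" using finite_dimensional by blast
  obtain v0 :: 'm where v0: "v0 \<noteq> 0" using ex_nonzero by blast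
  obtain v \<kappa> where v: "v \<noteq> 0" "v \<triangleright> gK = v \<triangleright> const \<kappa>"
    using ex_eigenvector[of "\<lambda>v. v \<triangleright> gK" G UNIV v0, OF ex_root ap_vadd ap_const G] v0 by auto
  define P where "P = {v. v \<triangleright> gK = v \<triangleright> const \<kappa>}"
  have "qcomm (abs_fam (\<lambda>_. gK)) (abs_fam (\<lambda>_. gY * gX)) (- 1 + 1)"
    unfolding abs_fam_B by (intro qcomm_mult_right qcK)
  note comm = commute_if_qcomm[OF this, simplified]
  have "\<exists>w \<omega>. w \<in> P \<and> w \<noteq> 0 \<and> w \<triangleright> (gY * gX) = w \<triangleright> const \<omega>"
  proof (rule ex_eigenvector[of "\<lambda>v. v \<triangleright> (gY * gX)" G P v, OF ex_root ap_vadd ap_const G])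
    show "0 \<in> P" by (simp add: P_def)
    show "x + y \<in> P" if "x \<in> P" "y \<in> P" for x y using that by (simp add: P_def ap_vadd)
    show "x \<triangleright> const c \<in> P" if "x \<in> P" for x c
      using that by (simp add: P_def ap_const[of x c gK] ap_const_const mult.commute)
    show "x \<triangleright> (gY * gX) \<in> P" if "x \<in> P" for x
    proof -
      have "x \<triangleright> (gY * gX) \<triangleright> gK = x \<triangleright> gK \<triangleright> (gY * gX)" by (rule comm[symmetric])
      also have "\<dots> = x \<triangleright> (gY * gX) \<triangleright> const \<kappa>" using that by (simp only: P_def mem_Collect_eq ap_const[of x \<kappa>])
      finally show ?thesis by (simp add: P_def)
    qed
  qed (use v in \<open>simp_all add: P_def\<close>)
  then show ?thesis unfolding P_def eig_def by blast
qed

lemma eig_independent: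
  assumes "finite I" and "\<And>i. i \<in> I \<Longrightarrow> eig (\<kappa> i) (\<omega> i) (y i)"
    and "\<And>i j. i \<in> I \<Longrightarrow> j \<in> I \<Longrightarrow> \<kappa> i = \<kappa> j \<Longrightarrow> \<omega> i = \<omega> j \<Longrightarrow> i = j"
    and "(\<Sum>i\<in>I. y i) = 0" and "i \<in> I"
  shows "y i = 0"
  using assms
proof (induct I arbitrary: y i rule: finite_induct)
  case (insert j I)
  \<comment> \<open>Applying \<open>a\<close> to the sum and subtracting \<open>e\<close> times the
    sum removes the summand \<open>y j\<close> and only scales the others, so the induction
    hypothesis applies.\<close>
  have *: "y k \<triangleright> const c = 0"
    if ck: "\<And>k. k \<in> I \<Longrightarrow> y k \<triangleright> a = y k \<triangleright> const (d k)" and cj: "y j \<triangleright> a = y j \<triangleright> const e"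
      and k: "k \<in> I" and c: "c = d k - e" for k a d e c
  proof -
    have "(\<Sum>k\<in>I. y k \<triangleright> const (d k - e)) = (\<Sum>k\<in>insert j I. y k) \<triangleright> a - (\<Sum>k\<in>insert j I. y k) \<triangleright> const e"
      using insert.hyps ck cj
      by (simp add: ap_vadd ap_vsum const_diff ap_diff sum_subtractf)
    also have "\<dots> = 0" using insert.prems(3) by simp
    finally have sum: "(\<Sum>k\<in>I. y k \<triangleright> const (d k - e)) = 0" .
    show ?thesis unfolding c
      by (rule insert.hyps(3)[OF _ _ sum k]) (use insert.prems in \<open>auto intro: eig_const\<close>)
  qed
  have I: "y k = 0" if k: "k \<in> I" for k
  proof -
    have "y k \<triangleright> const (\<kappa> k - \<kappa> j) = 0"
      by (rule *[of gK \<kappa> "\<kappa> j", OF _ _ k refl]) (use insert.prems(1) in \<open>auto simp: eig_def\<close>)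
    moreover have "y k \<triangleright> const (\<omega> k - \<omega> j) = 0"
      by (rule *[of "gY * gX" \<omega> "\<omega> j", OF _ _ k refl]) (use insert.prems(1) in \<open>auto simp: eig_def\<close>)
    moreover have "\<kappa> k \<noteq> \<kappa> j \<or> \<omega> k \<noteq> \<omega> j" using insert.prems(2)[of k j] k insert.hyps(2) by auto
    ultimately show ?thesis by (auto simp: const_eq_0_iff)
  qed
  moreover from this have "y j = 0" using insert.prems(3) insert.hyps by simp
  ultimately show ?case using insert.prems(4) by blast
qed simp


subsection \<open>The spans of the monomials\<close>

text \<open>
  The properties of the pairs \<open>(\<phi>, \<psi>)\<close> and \<open>(\<psi>, \<phi>)\<close> that make the six modules accessible to one
  argument.
\<close>

definition ladder :: "'k pre_A \<Rightarrow> 'k pre_A \<Rightarrow> int \<Rightarrow> bool" where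
  "ladder t o' s \<longleftrightarrow> {t, o'} = {\<phi> q, \<psi> q} \<and> \<bar>s\<bar> = 1 \<and>
     (\<forall>v. v \<triangleright> t \<triangleright> gX = v \<triangleright> gX \<triangleright> t) \<and> (\<forall>v. v \<triangleright> o' \<triangleright> gX = v \<triangleright> gX \<triangleright> o') \<and>
     (\<forall>v \<kappa> \<omega>. eig \<kappa> \<omega> v \<longrightarrow> eig (\<kappa> * q powi s) (\<omega> * q powi s) (v \<triangleright> t)) \<and>
     (\<forall>v \<kappa> \<omega>. eig \<kappa> \<omega> v \<longrightarrow> (\<exists>c. v \<triangleright> t \<triangleright> o' = v \<triangleright> const c))"

lemma phi_X_ap: "v \<triangleright> \<phi> q \<triangleright> gX = v \<triangleright> gX \<triangleright> \<phi> q" and psi_X_ap: "v \<triangleright> \<psi> q \<triangleright> gX = v \<triangleright> gX \<triangleright> \<psi> q"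
  using commute_if_qcomm[of \<phi> "\<lambda>_. gX" 0, unfolded abs_fam_B, OF qc_phi_X]
    commute_if_qcomm[of \<psi> "\<lambda>_. gX" 0, unfolded abs_fam_B, OF qc_psi_X] by simp_all

text \<open>The Casimir element acts as a scalar, and so does K Y X on \<open>v\<close>; both
  products of \<phi> and \<psi> are combinations of the two.\<close>

lemma psi_phi_eig:
  assumes "eig \<kappa> \<omega> v"
  shows "\<exists>c. v \<triangleright> \<psi> q \<triangleright> \<phi> q = v \<triangleright> const c" and "\<exists>c. v \<triangleright> \<phi> q \<triangleright> \<psi> q = v \<triangleright> const c"
proof -
  have h: "v \<triangleright> gK \<triangleright> (gY * gX) = v \<triangleright> const (\<omega> * \<kappa>)"
    using assms unfolding eig_def by (simp only: ap_const[of v \<kappa>] ap_const_const)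
  obtain c where "v \<triangleright> \<psi> q \<triangleright> \<phi> q + v \<triangleright> gK \<triangleright> (gY * gX) \<triangleright> const (q powi 3) = v \<triangleright> const c"
    using casimir_scalar by blast
  then have 1: "v \<triangleright> \<psi> q \<triangleright> \<phi> q = v \<triangleright> const (c - \<omega> * \<kappa> * q powi 3)"
    unfolding h ap_const_const const_diff ap_diff by (simp add: eq_diff_eq)
  then show "\<exists>c. v \<triangleright> \<psi> q \<triangleright> \<phi> q = v \<triangleright> const c" by blast
  have "v \<triangleright> \<phi> q \<triangleright> \<psi> q = v \<triangleright> \<psi> q \<triangleright> \<phi> q - v \<triangleright> gK \<triangleright> (gY * gX) \<triangleright> const (q * (1 - q ^ 2))"
    using phi_psi_power_ap[of v 1] by simp
  then have "v \<triangleright> \<phi> q \<triangleright> \<psi> q = v \<triangleright> const (c - \<omega> * \<kappa> * q powi 3 - \<omega> * \<kappa> * (q * (1 - q ^ 2)))"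
    unfolding 1 h ap_const_const const_diff ap_diff .
  then show "\<exists>c. v \<triangleright> \<phi> q \<triangleright> \<psi> q = v \<triangleright> const c" by blast
qed

lemma ladder_phi: "ladder (\<phi> q) (\<psi> q) (- 1)"
  unfolding ladder_def using phi_X_ap psi_X_ap eig_phi psi_phi_eig(2) by simp

lemma ladder_psi: "ladder (\<psi> q) (\<phi> q) 1"
  unfolding ladder_def using phi_X_ap psi_X_ap eig_psi psi_phi_eig(1) by (simp add: insert_commute)

lemma ladder_eig: "ladder t o' s \<Longrightarrow> eig \<kappa> \<omega> v \<Longrightarrow> eig (\<kappa> * q powi s) (\<omega> * q powi s) (v \<triangleright> t)"
  unfolding ladder_def by blast

lemma commute_powers:
  assumes "\<And>v. v \<triangleright> a \<triangleright> b = v \<triangleright> b \<triangleright> a"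
  shows "v \<triangleright> a ^ i \<triangleright> b ^ j = v \<triangleright> b ^ j \<triangleright> a ^ i"
proof -
  have *: "v \<triangleright> a \<triangleright> b ^ j = v \<triangleright> b ^ j \<triangleright> a" for v
    by (induct j arbitrary: v) (simp_all add: ap_mult assms)
  show ?thesis by (induct i arbitrary: v) (simp_all add: ap_mult *)
qed

lemma X_power_reduce:
  "\<exists>c. \<forall>v. v \<triangleright> gX ^ b = v \<triangleright> gX ^ (b mod l) \<triangleright> const c"
proof -
  have *: "\<exists>c. \<forall>v. v \<triangleright> (gX ^ l) ^ k = v \<triangleright> const c" for k
  proof (induct k)
    case 0
    show ?case by (rule exI[of _ 1]) simp
  next
    case (Suc k)
    then obtain c where "\<And>v. v \<triangleright> (gX ^ l) ^ k = v \<triangleright> const c" by blast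
    then have "\<forall>v. v \<triangleright> (gX ^ l) ^ Suc k = v \<triangleright> const (x_l * c)"
      by (simp only: power_Suc ap_mult x_l(2) ap_const_const simp_thms)
    then show ?case by blast
  qed
  obtain c where "\<And>v. v \<triangleright> (gX ^ l) ^ (b div l) = v \<triangleright> const c" using * by blast
  then show ?thesis using power_split[of _ gX b] by auto
qed

text \<open>Since \<open>gX ^ l\<close> is a nonzero scalar, \<open>t ^ h\<close> is a multiple of a
  power of \<open>gX\<close>. This reduces exponents of \<open>t\<close> below \<open>h\<close>,
  whether or not \<gamma> is 0.\<close>

lemma ladder_power_h:
  assumes "\<And>v. v \<triangleright> t ^ h \<triangleright> gX ^ h = v \<triangleright> const \<gamma>"
  shows "v \<triangleright> t ^ h = v \<triangleright> gX ^ (l - h) \<triangleright> const (\<gamma> * inverse x_l)"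
proof -
  have "v \<triangleright> t ^ h = v \<triangleright> t ^ h \<triangleright> gX ^ l \<triangleright> const (inverse x_l)"
    by (simp only: x_l(2) const_inverse[OF x_l(1)])
  also have "v \<triangleright> t ^ h \<triangleright> gX ^ l = v \<triangleright> t ^ h \<triangleright> gX ^ h \<triangleright> gX ^ (l - h)"
    unfolding ap_mult[symmetric] mult.assoc power_add[symmetric] using h_le by simp
  also have "\<dots> = v \<triangleright> gX ^ (l - h) \<triangleright> const \<gamma>"
    unfolding assms by (rule ap_const)
  finally show ?thesis by (simp only: ap_const_const)
qed

lemma monomial_span_eq:
  "monomial_span q act u t m n = VS.span {u \<triangleright> t ^ a \<triangleright> gX ^ b | a b. a < m \<and> b < n}"
  unfolding monomial_span_def ap_def[symmetric] ap_mult ..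

text \<open>The delicate operator is \<open>o'\<close>. On a monomial with a positive power of
  \<open>t\<close> it cancels one factor \<open>t\<close> up to a scalar. On \<open>u\<close> times
  a power of \<open>gX\<close> it is handled by \<open>alt\<close>: either \<open>o'\<close> kills
  \<open>u\<close>, or \<open>u\<close> is itself a multiple of
  \<open>u \<triangleright> t ^ h \<triangleright> gX ^ h\<close>.\<close>

lemma ladder_span:
  assumes lad: "ladder t o' s" and u: "eig \<kappa> \<omega> u" "u \<noteq> 0"
    and \<gamma>: "\<And>v. v \<triangleright> t ^ h \<triangleright> gX ^ h = v \<triangleright> const \<gamma>" and alt: "u \<triangleright> o' = 0 \<or> \<gamma> \<noteq> 0"
  shows "monomial_span q act u t h l = UNIV"
proof -
  define P where "P = monomial_span q act u t h l"
  have P_zero: "0 \<in> P" and P_add: "\<And>v w. v \<in> P \<Longrightarrow> w \<in> P \<Longrightarrow> v + w \<in> P"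
    and P_const: "\<And>v c. v \<in> P \<Longrightarrow> v \<triangleright> const c \<in> P"
    using VS.span_scale unfolding P_def monomial_span_eq
    by (auto simp: VS.span_zero VS.span_add scalar_act_eq)
  have tX: "v \<triangleright> t ^ i \<triangleright> gX ^ j = v \<triangleright> gX ^ j \<triangleright> t ^ i" and oX: "v \<triangleright> o' \<triangleright> gX ^ j = v \<triangleright> gX ^ j \<triangleright> o'" for v i j
    using commute_powers[of t gX v i j] commute_powers[of o' gX v 1 j] lad by (simp_all add: ladder_def)
  have small: "u \<triangleright> t ^ a \<triangleright> gX ^ b \<in> P" if "a < h" for a b
  proof -
    obtain c where "u \<triangleright> t ^ a \<triangleright> gX ^ b = u \<triangleright> t ^ a \<triangleright> gX ^ (b mod l) \<triangleright> const c" using X_power_reduce by blast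
    moreover have "u \<triangleright> t ^ a \<triangleright> gX ^ (b mod l) \<in> P"
      unfolding P_def monomial_span_eq 
      by (rule VS.span_base, rule CollectI, rule exI[of _ a], rule exI[of _ "b mod l"]) (use that l in simp)
    ultimately show ?thesis using P_const by simp
  qed
  have M: "u \<triangleright> t ^ a \<triangleright> gX ^ b \<in> P" for a b
  proof (induct a arbitrary: b rule: less_induct)
    case (less a)
    show ?case
    proof (cases "a < h")
      case False
      have "u \<triangleright> t ^ a = u \<triangleright> t ^ (a - h) \<triangleright> t ^ h"
        unfolding ap_mult[symmetric] power_add[symmetric] using False by simp
      also have "\<dots> = u \<triangleright> t ^ (a - h) \<triangleright> gX ^ (l - h) \<triangleright> const (\<gamma> * inverse x_l)"
        by (rule ladder_power_h[OF \<gamma>])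
      finally have "u \<triangleright> t ^ a \<triangleright> gX ^ b = u \<triangleright> t ^ (a - h) \<triangleright> gX ^ (l - h) \<triangleright> gX ^ b \<triangleright> const (\<gamma> * inverse x_l)"
        by (simp only: ap_const)
      also have "\<dots> = u \<triangleright> t ^ (a - h) \<triangleright> gX ^ (l - h + b) \<triangleright> const (\<gamma> * inverse x_l)"
        by (simp only: power_add ap_mult)
      also have "\<dots> \<in> P" using False h_pos by (intro P_const less) simp
      finally show ?thesis .
    qed (rule small)
  qed
  have eig_M: "eig (\<kappa> * q powi (s * int a) * q powi (- 1 * int b)) (\<omega> * q powi (s * int a) * q powi (1 * int b))
      (u \<triangleright> t ^ a \<triangleright> gX ^ b)" for a b
    by (rule eig_power[OF eig_X eig_power[OF ladder_eig[OF lad] u(1)]])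
  have Mo_Suc: "u \<triangleright> t ^ Suc a \<triangleright> gX ^ b \<triangleright> o' \<in> P" for a b
  proof -
    have "eig (\<kappa> * q powi (s * int a)) (\<omega> * q powi (s * int a)) (u \<triangleright> t ^ a)" using eig_M[of a 0] by simp
    then obtain c where c: "u \<triangleright> t ^ a \<triangleright> t \<triangleright> o' = u \<triangleright> t ^ a \<triangleright> const c"
      using lad unfolding ladder_def by blast
    have "u \<triangleright> t ^ Suc a \<triangleright> gX ^ b \<triangleright> o' = u \<triangleright> t ^ a \<triangleright> t \<triangleright> o' \<triangleright> gX ^ b"
      by (simp only: power_Suc2 ap_mult oX)
    also have "\<dots> = u \<triangleright> t ^ a \<triangleright> gX ^ b \<triangleright> const c" unfolding c by (rule ap_const)
    finally show ?thesis using P_const[OF M] by simp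
  qed
  have Mo_0: "u \<triangleright> gX ^ b \<triangleright> o' \<in> P" for b
    using alt
  proof
    assume "u \<triangleright> o' = 0"
    then show ?thesis by (simp only: oX[symmetric] ap_vzero P_zero)
  next
    assume "\<gamma> \<noteq> 0"
    then have "u = u \<triangleright> t ^ h \<triangleright> gX ^ h \<triangleright> const (inverse \<gamma>)" unfolding \<gamma> by (rule const_inverse[symmetric])
    then have "u \<triangleright> gX ^ b \<triangleright> o' = u \<triangleright> t ^ h \<triangleright> gX ^ h \<triangleright> const (inverse \<gamma>) \<triangleright> gX ^ b \<triangleright> o'" by (rule arg_cong)
    also have "\<dots> = u \<triangleright> t ^ h \<triangleright> gX ^ (h + b) \<triangleright> o' \<triangleright> const (inverse \<gamma>)"
      by (simp only: ap_const power_add ap_mult)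
    also have "\<dots> \<in> P" using Mo_Suc[of "h - 1" "h + b"] h_pos by (intro P_const) simp
    finally show ?thesis .
  qed
  have Mo: "u \<triangleright> t ^ a \<triangleright> gX ^ b \<triangleright> o' \<in> P" for a b
    by (cases a) (simp_all only: Mo_Suc Mo_0 power_0 ap_one)
  have Mt: "u \<triangleright> t ^ a \<triangleright> gX ^ b \<triangleright> t \<in> P" for a b
  proof -
    have "u \<triangleright> t ^ a \<triangleright> gX ^ b \<triangleright> t = u \<triangleright> t ^ Suc a \<triangleright> gX ^ b"
      using tX[of "u \<triangleright> t ^ a" 1 b] by (simp only: power_Suc2 ap_mult power_one_right)
    then show ?thesis using M by (simp only:)
  qed
  have MX: "u \<triangleright> t ^ a \<triangleright> gX ^ b \<triangleright> gX \<in> P" for a b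
    using M[of a "Suc b"] by (simp only: power_Suc2 ap_mult)
  have MK: "u \<triangleright> t ^ a \<triangleright> gX ^ b \<triangleright> gK \<in> P" for a b
    using eig_M[of a b] P_const[OF M] by (simp add: eig_def)
  have MY: "u \<triangleright> t ^ a \<triangleright> gX ^ b \<triangleright> gY \<in> P" for a b
  proof -
    \<comment> \<open>The preimage of the monomial under \<open>gX\<close>. It is an eigenvector of
      \<open>gY * gX\<close>, and \<open>X_Y_ap\<close> expresses \<open>gX\<close> followed by
      \<open>gY\<close> through that operator.\<close>
    define w where "w = u \<triangleright> t ^ a \<triangleright> gX ^ (b + (l - 1)) \<triangleright> const (inverse x_l)"
    have w: "w \<triangleright> gX = u \<triangleright> t ^ a \<triangleright> gX ^ b"
      unfolding w_def power_add ap_mult by (rule power_l_inverse[OF x_l])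
    obtain \<omega>' where "w \<triangleright> (gY * gX) = w \<triangleright> const \<omega>'"
      using eig_const[OF eig_M] unfolding w_def eig_def by blast
    then have "u \<triangleright> t ^ a \<triangleright> gX ^ b \<triangleright> gY = w \<triangleright> const \<omega>' \<triangleright> const (q powi 1)"
      unfolding w[symmetric] X_Y_ap by simp
    also have "\<dots> \<in> P" unfolding w_def by (intro P_const M)
    finally show ?thesis .
  qed
  have "closed_under B_gens P"
  proof (rule closed_underI)
    fix v a assume v: "v \<in> P" and a: "a \<in> B_gens"
    have "{\<phi> q, \<psi> q} = {t, o'}" using lad unfolding ladder_def by simp
    with a consider "a = gK" | "a = gX" | "a = gY" | "a = t" | "a = o'" by blast
    then have M_a: "u \<triangleright> t ^ i \<triangleright> gX ^ j \<triangleright> a \<in> P" for i j by cases (simp_all add: MK MX MY Mt Mo)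
    show "v \<triangleright> a \<in> P"
      using v[unfolded P_def monomial_span_eq]
    proof (induct rule: VS.span_induct_alt)
      case base
      show ?case by (simp add: P_zero)
    next
      case (step c x y)
      then have "x \<triangleright> a \<in> P" using M_a by blast
      with step(2) show ?case by (simp add: scalar_act_eq ap_vadd ap_const P_add P_const)
    qed
  qed (use P_zero P_add P_const in blast)+
  moreover have "u \<in> P" using M[of 0 0] by simp
  ultimately show ?thesis using closed_B_eq_UNIV u(2) unfolding P_def by blast
qed

lemma ladder_dim:
  assumes lad: "ladder t o' s" and u: "eig \<kappa> \<omega> u" "u \<noteq> 0"
    and span: "monomial_span q act u t h l = UNIV"
    and nz: "\<And>a. a < h \<Longrightarrow> u \<triangleright> t ^ a \<noteq> 0"
  shows "VS.dim (UNIV :: 'm set) = h * l"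
proof -
  define I where "I = {..<h} \<times> {..<l}"
  define y where "y = (\<lambda>(a, b). u \<triangleright> t ^ a \<triangleright> gX ^ b)"
  define k where "k = (\<lambda>(a, b). \<kappa> * q powi (s * int a) * q powi (- 1 * int b))"
  define w where "w = (\<lambda>(a, b). \<omega> * q powi (s * int a) * q powi (1 * int b))"
  have fin: "finite I" by (simp add: I_def)
  have eig_y: "eig (k i) (w i) (y i)" for i
    unfolding y_def k_def w_def split_def
    by (rule eig_power[OF eig_X eig_power[OF ladder_eig[OF lad] u(1)]])
  have y0: "y i \<noteq> 0" if "i \<in> I" for i
    using that nz inj_power[OF inj_X] by (auto simp: y_def I_def)
  have inj: "i = j" if i: "i \<in> I" and j: "j \<in> I" and eq: "k i = k j" "w i = w j" for i j
  proof -
    obtain a b where ab: "i = (a, b)" "a < h" "b < l" using i by (auto simp: I_def)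
    obtain a' b' where ab': "j = (a', b')" "a' < h" "b' < l" using j by (auto simp: I_def)
    have nz: "\<kappa> \<noteq> 0" "\<omega> \<noteq> 0" using eig_nonzero[OF u] by blast+
    have 1: "q powi (s * int a - int b) = q powi (s * int a' - int b')"
      using eq(1) nz q0 by (simp add: k_def ab ab' power_int_add[symmetric] mult.assoc)
    have 2: "q powi (s * int a + int b) = q powi (s * int a' + int b')"
      using eq(2) nz q0 by (simp add: w_def ab ab' power_int_add mult.assoc)
    have "q powi ((s * int a - int b) - (s * int a' - int b')) = 1"
      using 1 q0 by (simp add: power_int_diff)
    then have d1: "int l dvd (s * int a - int b) - (s * int a' - int b')" by (rule powi_eq_1D)
    have "q powi ((s * int a + int b) - (s * int a' + int b')) = 1"
      using 2 q0 by (simp add: power_int_diff)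
    then have d2: "int l dvd (s * int a + int b) - (s * int a' + int b')" by (rule powi_eq_1D)
    have s: "s = 1 \<or> s = - 1" using lad unfolding ladder_def by linarith
    \<comment> \<open>Adding the two congruences eliminates \<open>b\<close>. The factor 2 is the
      reason why \<open>a\<close> may only range below \<open>h\<close>.\<close>
    have "int l dvd 2 * (s * (int a - int a'))"
      using dvd_add[OF d1 d2] by (simp add: algebra_simps)
    moreover have "\<bar>s * (int a - int a')\<bar> < int h" using s ab(2) ab'(2) by auto
    ultimately have "s * (int a - int a') = 0" by (rule dvd_twice)
    then have a: "a = a'" using s by auto
    with d2 have "int l dvd int b - int b'" by (simp add: algebra_simps)
    then have "b = b'" using ab(3) ab'(3) zdvd_not_zless[of "int b - int b'" "int l"]
      zdvd_not_zless[of "int b' - int b" "int l"] by (cases b b' rule: linorder_cases) (simp_all add: dvd_diff_commute)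
    with a show ?thesis by (simp add: ab ab')
  qed
  have inj_y: "inj_on y I"
  proof (rule inj_onI)
    fix i j assume ij: "i \<in> I" "j \<in> I" "y i = y j"
    have "y i \<triangleright> const (k i - k j) = 0" "y i \<triangleright> const (w i - w j) = 0"
      using eig_y[of i] eig_y[of j] ij(3) by (simp_all add: eig_def const_diff ap_diff)
    then show "i = j" using inj[OF ij(1,2)] y0[OF ij(1)] by (simp add: const_eq_0_iff)
  qed
  have "VS.independent (y ` I)"
  proof
    assume "VS.dependent (y ` I)"
    then obtain c where c: "\<exists>v\<in>y ` I. c v \<noteq> 0" "(\<Sum>v\<in>y ` I. scalar_act q act (c v) v) = 0"
      using fin by (auto simp: VS.dependent_finite)
    have sum: "(\<Sum>i\<in>I. y i \<triangleright> const (c (y i))) = 0"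
      using c(2) by (simp add: sum.reindex[OF inj_y] scalar_act_eq)
    have "y i \<triangleright> const (c (y i)) = 0" if "i \<in> I" for i
      by (rule eig_independent[where y = "\<lambda>i. y i \<triangleright> const (c (y i))", OF fin eig_const[OF eig_y] _ sum that])
        (rule inj)
    then show False using c(1) y0 by (auto simp: const_eq_0_iff)
  qed
  moreover have "y ` I = {u \<triangleright> t ^ a \<triangleright> gX ^ b | a b. a < h \<and> b < l}"
    by (auto simp: y_def I_def image_iff)
  then have "VS.span (y ` I) = UNIV" using span unfolding monomial_span_eq by simp
  moreover have "card (y ` I) = h * l" unfolding card_image[OF inj_y] by (simp add: I_def)
  ultimately show ?thesis by (intro VS.dim_unique[of "y ` I"]) simp_all
qed

end


subsection \<open>The modules \<open>N\<^sub>i\<close>\<close>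

context invertible_XY
begin

definition g_phi :: 'k where "g_phi = (SOME c. \<forall>v. v \<triangleright> \<phi> q ^ h \<triangleright> gX ^ h = v \<triangleright> const c)"
definition g_psi :: 'k where "g_psi = (SOME c. \<forall>v. v \<triangleright> \<psi> q ^ h \<triangleright> gX ^ h = v \<triangleright> const c)"

lemma g_phi: "v \<triangleright> \<phi> q ^ h \<triangleright> gX ^ h = v \<triangleright> const g_phi"
  using someI_ex[OF phi_h_scalar] unfolding g_phi_def by blast

lemma g_psi: "v \<triangleright> \<psi> q ^ h \<triangleright> gX ^ h = v \<triangleright> const g_psi"
  using someI_ex[OF psi_h_scalar] unfolding g_psi_def by blast

text \<open>Translates conditions on the eigenvalues \<alpha> and \<beta> of the \<open>l\<close>-th
  powers into conditions on \<gamma>. For odd \<open>l\<close> the scalar is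
  \<open>\<gamma> * inverse x_l\<close>; for even \<open>l\<close>, squaring \<open>t ^ h\<close>
  gives \<open>\<gamma> * \<gamma> * inverse x_l\<close>.\<close>

lemma ladder_power_l:
  assumes tX: "\<And>v. v \<triangleright> t \<triangleright> gX = v \<triangleright> gX \<triangleright> t" and \<gamma>: "\<And>v. v \<triangleright> t ^ h \<triangleright> gX ^ h = v \<triangleright> const \<gamma>"
  shows "\<exists>c. (\<forall>v. v \<triangleright> t ^ l = v \<triangleright> const c) \<and> (c = 0 \<longleftrightarrow> \<gamma> = 0)"
proof (cases "even l")
  case False
  then have h: "h = l" by (simp add: half_order_def)
  have "\<forall>v. v \<triangleright> t ^ l = v \<triangleright> const (\<gamma> * inverse x_l)"
    using ladder_power_h[of t \<gamma>, OF \<gamma>] h by simp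
  then show ?thesis using x_l(1) by (intro exI[of _ "\<gamma> * inverse x_l"]) simp
next
  case True
  then have h: "h + h = l" by (simp add: half_order_def flip: mult_2)
  then have h': "l - h = h" by linarith
  let ?c = "\<gamma> * inverse x_l"
  have *: "v \<triangleright> t ^ h = v \<triangleright> gX ^ h \<triangleright> const ?c" for v
    using ladder_power_h[of t \<gamma>, OF \<gamma>, of v] unfolding h' .
  have "v \<triangleright> t ^ l = v \<triangleright> const (x_l * ?c * ?c)" for v
  proof -
    have "v \<triangleright> t ^ l = v \<triangleright> t ^ h \<triangleright> t ^ h" unfolding ap_mult[symmetric] power_add[symmetric] h ..
    also have "\<dots> = v \<triangleright> gX ^ h \<triangleright> t ^ h \<triangleright> const ?c" unfolding *[of v] by (rule ap_const)
    also have "v \<triangleright> gX ^ h \<triangleright> t ^ h = v \<triangleright> gX ^ h \<triangleright> gX ^ h \<triangleright> const ?c" by (rule *)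
    also have "v \<triangleright> gX ^ h \<triangleright> gX ^ h = v \<triangleright> gX ^ l"
      unfolding ap_mult[symmetric] power_add[symmetric] h ..
    finally show ?thesis by (simp only: x_l(2) ap_const_const)
  qed
  then show ?thesis using x_l(1) by (intro exI[of _ "x_l * ?c * ?c"]) simp
qed

lemma phi_power_l: "\<exists>c. (\<forall>v. v \<triangleright> \<phi> q ^ l = v \<triangleright> const c) \<and> (c = 0 \<longleftrightarrow> g_phi = 0)"
  by (rule ladder_power_l[OF phi_X_ap g_phi])

lemma psi_power_l: "\<exists>c. (\<forall>v. v \<triangleright> \<psi> q ^ l = v \<triangleright> const c) \<and> (c = 0 \<longleftrightarrow> g_psi = 0)"
  by (rule ladder_power_l[OF psi_X_ap g_psi])

lemma power_l_eq_const:
  assumes "\<exists>c. (\<forall>v. v \<triangleright> a = v \<triangleright> const c) \<and> (c = 0 \<longleftrightarrow> \<gamma> = 0)"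
    and "v \<noteq> 0" and "v \<triangleright> a = v \<triangleright> const \<alpha>"
  shows "\<alpha> = 0 \<longleftrightarrow> \<gamma> = 0"
proof -
  obtain c where c: "\<And>v. v \<triangleright> a = v \<triangleright> const c" "c = 0 \<longleftrightarrow> \<gamma> = 0" using assms(1) by blast
  have "v \<triangleright> const (\<alpha> - c) = 0" using assms(3) c(1)[of v] by (simp add: const_diff ap_diff)
  then show ?thesis using assms(2) c(2) by (simp add: const_eq_0_iff)
qed

lemma common_eigenvector_iff:
  "common_eigenvector q act UNIV T v \<longleftrightarrow> v \<noteq> 0 \<and> (\<forall>t\<in>T. \<exists>c. v \<triangleright> t = v \<triangleright> const c)"
  by (simp add: common_eigenvector_def scalar_act_eq ap_def)

lemma commuting_subset: "commuting_odd q l \<subseteq> commuting_even q l"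
  unfolding commuting_even_def by (rule Un_upper1)

lemma common_eigenvector_eig:
  assumes "common_eigenvector q act UNIV T v" and "commuting_odd q l \<subseteq> T"
  shows "v \<noteq> 0 \<and> (\<exists>\<kappa> \<omega>. eig \<kappa> \<omega> v)"
proof -
  have "gK \<in> T" "gY * gX \<in> T" using assms(2) by (auto simp: commuting_odd_def)
  then show ?thesis using assms(1) unfolding common_eigenvector_iff eig_def by blast
qed

text \<open>Apart from \<open>K\<close> and \<open>YX\<close>, the listed operators are scalars on
  the whole module, except \<psi>\<phi>, which is one on \<open>v\<close> because of the Casimir
  element.\<close>

lemma eig_common_eigenvector:
  assumes v: "v \<noteq> 0" "eig \<kappa> \<omega> v"
  shows "common_eigenvector q act UNIV (commuting_odd q l) v"
    and "even l \<Longrightarrow> common_eigenvector q act UNIV (commuting_even q l) v"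
proof -
  have odd: "\<exists>c. v \<triangleright> t = v \<triangleright> const c" if t: "t \<in> commuting_odd q l" for t
  proof -
    consider "t = \<phi> q ^ l" | "t = \<psi> q ^ l" | "t = gX ^ l" | "t = gK" | "t = gY * gX" | "t = \<psi> q * \<phi> q"
      using t unfolding commuting_odd_def by blast
    then show ?thesis
    proof cases
      case 1
      then show ?thesis using phi_power_l by blast
    next
      case 2
      then show ?thesis using psi_power_l by blast
    next
      case 3
      then show ?thesis using x_l(2) by blast
    next
      case 6
      then show ?thesis using psi_phi_eig(1)[OF v(2)] by (simp only: ap_mult)
    qed (use v(2) in \<open>auto simp: eig_def\<close>)
  qed
  then show "common_eigenvector q act UNIV (commuting_odd q l) v"
    using v(1) by (simp add: common_eigenvector_iff)
  assume "even l"
  then have h: "l div 2 = h" by (simp add: half_order_def)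
  have "\<exists>c. v \<triangleright> t = v \<triangleright> const c" if t: "t \<in> commuting_even q l" for t
  proof -
    consider "t \<in> commuting_odd q l" | "t = \<phi> q ^ h * gX ^ h" | "t = \<psi> q ^ h * gX ^ h"
      using t unfolding commuting_even_def h by blast
    then show ?thesis
    proof cases
      case 2
      then show ?thesis using phi_h_scalar by (auto simp: ap_mult)
    next
      case 3
      then show ?thesis using psi_h_scalar by (auto simp: ap_mult)
    qed (rule odd)
  qed
  then show "common_eigenvector q act UNIV (commuting_even q l) v"
    using v(1) by (simp add: common_eigenvector_iff)
qed

lemma span_phi:
  assumes "v \<noteq> 0" "eig \<kappa> \<omega> v" and "g_phi \<noteq> 0"
  shows "monomial_span q act v (\<phi> q) h l = UNIV"
  using ladder_span[OF ladder_phi assms(2,1) g_phi disjI2[OF assms(3)]] .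

lemma span_psi:
  assumes "v \<noteq> 0" "eig \<kappa> \<omega> v" and "v \<triangleright> \<phi> q = 0 \<or> g_psi \<noteq> 0"
  shows "monomial_span q act v (\<psi> q) h l = UNIV"
  using ladder_span[OF ladder_psi assms(2,1) g_psi assms(3)] .

lemma eig_phi_power:
  assumes "eig \<kappa> \<omega> v"
  shows "\<exists>\<kappa> \<omega>. eig \<kappa> \<omega> (v \<triangleright> \<phi> q ^ r)"
  using eig_power[OF eig_phi assms, of r] by blast

text \<open>In each case one of the alternatives in \<open>ladder_span\<close> is at hand: in the
  first, second and fourth a nonzero eigenvalue of an \<open>l\<close>-th power makes \<gamma>
  nonzero, and in the others \<phi> kills \<open>u\<close>.\<close>

theorem N_module_UNIV:
  assumes "N_module q l act UNIV i P"
  shows "P = UNIV"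
  using assms
proof (cases rule: N_module.cases)
  case (N1 v \<alpha>)
  from common_eigenvector_eig[OF N1(5) order_refl] obtain \<kappa> \<omega> where v: "v \<noteq> 0" "eig \<kappa> \<omega> v" by blast
  have "g_phi \<noteq> 0"
    using power_l_eq_const[OF phi_power_l v(1) N1(6)[folded ap_def, unfolded scalar_act_eq]] N1(7) by blast
  moreover have "h = l" using N1(4) by (simp add: half_order_def)
  ultimately show ?thesis using span_phi[OF v] N1(2) by simp
next
  case (N2 v \<beta>)
  from common_eigenvector_eig[OF N2(5) order_refl] obtain \<kappa> \<omega> where v: "v \<noteq> 0" "eig \<kappa> \<omega> v" by blast
  have "g_psi \<noteq> 0"
    using power_l_eq_const[OF psi_power_l v(1) N2(7)[folded ap_def, unfolded scalar_act_eq]] N2(8) by blast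
  moreover have "h = l" using N2(4) by (simp add: half_order_def)
  ultimately show ?thesis using span_psi[OF v] N2(2) by simp
next
  case (N3 v r u)
  from common_eigenvector_eig[OF N3(5) order_refl] obtain \<kappa> \<omega> where v: "v \<noteq> 0" "eig \<kappa> \<omega> v" by blast
  have u: "u = v \<triangleright> \<phi> q ^ (r - 1)" using N3(11) by (simp add: ap_def)
  have u0: "u \<noteq> 0"
  proof (cases "r = 1")
    case True
    then show ?thesis using v(1) unfolding u True by simp
  next
    case False
    then have "1 \<le> r - 1 \<and> r - 1 < r" using N3(8) by linarith
    from N3(10)[rule_format, OF this] show ?thesis unfolding u ap_def .
  qed
  obtain \<kappa>' \<omega>' where eig_u: "eig \<kappa>' \<omega>' u" using eig_phi_power[OF v(2), of "r - 1"] unfolding u by blast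
  have "u \<triangleright> \<phi> q = v \<triangleright> (\<phi> q ^ (r - 1) * \<phi> q)" unfolding u ap_mult ..
  also have "\<phi> q ^ (r - 1) * \<phi> q = \<phi> q ^ r" by (rule power_minus_mult) (use N3(8) in linarith)
  also have "v \<triangleright> \<phi> q ^ r = 0" using N3(9) unfolding ap_def .
  finally have "u \<triangleright> \<phi> q = 0" .
  from span_psi[OF u0 eig_u disjI1[OF this]] have "monomial_span q act u (\<psi> q) h l = UNIV" .
  moreover have "h = l" using N3(4) by (simp add: half_order_def)
  ultimately show ?thesis unfolding N3(2) by simp
next
  case (N4 v \<alpha>)
  from common_eigenvector_eig[OF N4(5) commuting_subset] obtain \<kappa> \<omega> where v: "v \<noteq> 0" "eig \<kappa> \<omega> v" by blast
  have "g_phi \<noteq> 0"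
    using power_l_eq_const[OF phi_power_l v(1) N4(6)[folded ap_def, unfolded scalar_act_eq]] N4(7) by blast
  moreover have "h = l div 2" using N4(4) by (simp add: half_order_def)
  ultimately show ?thesis using span_phi[OF v] N4(2) by simp
next
  case (N5 v \<beta> r u)
  from common_eigenvector_eig[OF N5(5) commuting_subset] obtain \<kappa> \<omega> where v: "v \<noteq> 0" "eig \<kappa> \<omega> v" by blast
  have u: "u = v \<triangleright> \<phi> q ^ r" "u \<triangleright> \<phi> q = 0" using N5(10,12) by (simp_all add: ap_def)
  obtain \<kappa>' \<omega>' where eig_u: "eig \<kappa>' \<omega>' u" using eig_phi_power[OF v(2), of r] unfolding u(1) by blast
  from span_psi[OF N5(11) eig_u disjI1[OF u(2)]] have "monomial_span q act u (\<psi> q) h l = UNIV" .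
  moreover have "h = l div 2" using N5(4) by (simp add: half_order_def)
  ultimately show ?thesis unfolding N5(2) by simp
next
  case (N6 v r u)
  from common_eigenvector_eig[OF N6(5) commuting_subset] obtain \<kappa> \<omega> where v: "v \<noteq> 0" "eig \<kappa> \<omega> v" by blast
  have u: "u = v \<triangleright> \<phi> q ^ r" "u \<triangleright> \<phi> q = 0" using N6(9,11) by (simp_all add: ap_def)
  obtain \<kappa>' \<omega>' where eig_u: "eig \<kappa>' \<omega>' u" using eig_phi_power[OF v(2), of r] unfolding u(1) by blast
  from span_psi[OF N6(10) eig_u disjI1[OF u(2)]] have "monomial_span q act u (\<psi> q) h l = UNIV" .
  moreover have "h = l div 2" using N6(4) by (simp add: half_order_def)
  ultimately show ?thesis unfolding N6(2) by simp
qed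

text \<open>The last nonzero \<open>v \<phi>\<^sup>r\<close> is the generator \<open>u\<close> of \<open>N\<^sub>3\<close>, \<open>N\<^sub>5\<close> and \<open>N\<^sub>6\<close>.\<close>

lemma ex_last_phi_power:
  assumes "v \<noteq> 0" and "v \<triangleright> \<phi> q ^ n = 0"
  shows "\<exists>r<n. v \<triangleright> \<phi> q ^ r \<noteq> 0 \<and> v \<triangleright> \<phi> q ^ Suc r = 0 \<and> (\<forall>s\<le>r. v \<triangleright> \<phi> q ^ s \<noteq> 0)"
proof -
  define r where "r = (LEAST r. v \<triangleright> \<phi> q ^ r = 0)"
  have r: "v \<triangleright> \<phi> q ^ r = 0" "r \<le> n"
    unfolding r_def using assms(2) by (rule LeastI, rule Least_le)
  have less: "v \<triangleright> \<phi> q ^ s \<noteq> 0" if "s < r" for s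
    using that unfolding r_def by (rule not_less_Least)
  have "r \<noteq> 0"
  proof
    assume "r = 0"
    with r(1) assms(1) show False by simp
  qed
  then obtain r' where "r = Suc r'" using not0_implies_Suc by blast
  then show ?thesis using r less[of r'] less by (intro exI[of _ r']) (simp_all del: power_Suc)
qed

lemma phi_h_zero:
  assumes "g_phi = 0"
  shows "v \<triangleright> \<phi> q ^ h = 0"
  using ladder_power_h[of "\<phi> q" g_phi, OF g_phi, of v] assms by simp

theorem ex_N_module: "\<exists>i\<in>{1..6}. \<exists>P. N_module q l act UNIV i P"
proof -
  obtain v \<kappa> \<omega> where v: "v \<noteq> 0" "eig \<kappa> \<omega> v" using ex_eig by blast
  obtain \<alpha> where \<alpha>: "\<And>v. v \<triangleright> \<phi> q ^ l = v \<triangleright> const \<alpha>" "\<alpha> = 0 \<longleftrightarrow> g_phi = 0" using phi_power_l by blast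
  obtain \<beta> where \<beta>: "\<And>v. v \<triangleright> \<psi> q ^ l = v \<triangleright> const \<beta>" using psi_power_l by blast
  have a: "act v (cls q (\<phi> q ^ l)) = scalar_act q act \<alpha> v" and b: "act v (cls q (\<psi> q ^ l)) = scalar_act q act \<beta> v"
    using \<alpha>(1)[of v] \<beta>[of v] by (simp_all add: scalar_act_eq ap_def)
  have "\<exists>P. N_module q l act UNIV 1 P \<or> N_module q l act UNIV 2 P \<or> N_module q l act UNIV 3 P \<or>
    N_module q l act UNIV 4 P \<or> N_module q l act UNIV 5 P \<or> N_module q l act UNIV 6 P"
  proof (cases "odd l")
    case True
    note ev = torsion_free True eig_common_eigenvector(1)[OF v]
    show ?thesis
    proof (cases "\<alpha> = 0")
      case False
      from N_module.N1[OF ev a this] show ?thesis by blast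
    next
      case True
      note a0 = a[unfolded True]
      show ?thesis
      proof (cases "\<beta> = 0")
        case False
        from N_module.N2[OF ev a0 b this] show ?thesis by blast
      next
        case True
        note b0 = b[unfolded True]
        have "v \<triangleright> \<phi> q ^ l = 0" using \<alpha>(1) \<open>\<alpha> = 0\<close> by simp
        from ex_last_phi_power[OF v(1) this]
        obtain r where r: "v \<triangleright> \<phi> q ^ Suc r = 0" "\<forall>s\<le>r. v \<triangleright> \<phi> q ^ s \<noteq> 0" by blast
        have "N_module q l act UNIV 3 (monomial_span q act (act v (cls q (\<phi> q ^ (Suc r - 1)))) (\<psi> q) l l)"
          by (rule N_module.N3[OF ev a0 b0 _ _ _ refl]) (use r in \<open>simp_all add: ap_def[symmetric]\<close>)
        then show ?thesis by blast
      qed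
    qed
  next
    case False
    then have even: "even l" by simp
    note ev = torsion_free even eig_common_eigenvector(2)[OF v even]
    show ?thesis
    proof (cases "\<alpha> = 0")
      case False
      from N_module.N4[OF ev a this] show ?thesis by blast
    next
      case True
      note a0 = a[unfolded True]
      \<comment> \<open>Not only \<open>\<phi> q ^ l\<close> but already \<open>\<phi> q ^ h\<close>
        vanishes, which yields the bound \<open>l div 2 - 1\<close> on \<open>r\<close>.\<close>
      have "v \<triangleright> \<phi> q ^ h = 0" using True \<alpha>(2) by (intro phi_h_zero) simp
      from ex_last_phi_power[OF v(1) this] obtain r where r: "r < h" "v \<triangleright> \<phi> q ^ r \<noteq> 0" "v \<triangleright> \<phi> q ^ Suc r = 0" by blast
      have r': "r \<le> l div 2 - 1" using r(1) even by (simp add: half_order_def)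
      have u: "act v (cls q (\<phi> q ^ r)) \<noteq> 0" using r(2) by (simp add: ap_def)
      have uphi: "act (act v (cls q (\<phi> q ^ r))) (cls q (\<phi> q)) = 0"
        using r(3) unfolding power_Suc2 ap_mult by (simp add: ap_def)
      show ?thesis
      proof (cases "\<beta> = 0")
        case False
        from N_module.N5[OF ev a0 b this r' refl u uphi] show ?thesis by blast
      next
        case True
        from N_module.N6[OF ev a0 b[unfolded True] r' refl u uphi] show ?thesis by blast
      qed
    qed
  qed
  then obtain i :: nat and P where "i \<in> {1, 2, 3, 4, 5, 6}" "N_module q l act UNIV i P" by blast
  then show ?thesis by (intro bexI[of _ i]) auto
qed

text \<open>What remains is that \<open>u \<triangleright> t ^ a\<close> does not vanish for
  \<open>a < h\<close>. If \<open>g_phi\<close> is not 0, take \<phi> for \<open>t\<close>: its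
  power \<open>h\<close> times \<open>gX ^ h\<close> is a nonzero scalar. Otherwise take a vector
  \<open>u\<close> killed by \<phi>, and \<psi> for \<open>t\<close>; then \<phi> brings
  \<open>u \<triangleright> \<psi> q ^ Suc a\<close> back to a nonzero multiple of
  \<open>u \<triangleright> \<psi> q ^ a\<close>.\<close>

theorem dim_eq: "VS.dim (UNIV :: 'm set) = l * (if even l then l div 2 else l)"
proof -
  obtain v \<kappa> \<omega> where v: "v \<noteq> 0" "eig \<kappa> \<omega> v" using ex_eig by blast
  have "VS.dim (UNIV :: 'm set) = h * l"
  proof (cases "g_phi = 0")
    case False
    show ?thesis
    proof (rule ladder_dim[OF ladder_phi v(2,1) span_phi[OF v False]])
      fix a assume "a < h"
      have "v \<triangleright> \<phi> q ^ a \<triangleright> \<phi> q ^ (h - a) \<triangleright> gX ^ h = v \<triangleright> const g_phi"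
        unfolding g_phi[symmetric] ap_mult[symmetric] mult.assoc[symmetric] power_add[symmetric]
        using \<open>a < h\<close> by simp
      moreover have "v \<triangleright> const g_phi \<noteq> 0" using False v(1) by (simp add: const_eq_0_iff)
      ultimately show "v \<triangleright> \<phi> q ^ a \<noteq> 0" by auto
    qed
  next
    case True
    obtain r where r: "v \<triangleright> \<phi> q ^ r \<noteq> 0" "v \<triangleright> \<phi> q ^ Suc r = 0"
      using ex_last_phi_power[OF v(1) phi_h_zero[OF True]] by blast
    define u where "u = v \<triangleright> \<phi> q ^ r"
    obtain \<kappa>' \<omega>' where u: "eig \<kappa>' \<omega>' u" using eig_phi_power[OF v(2)] unfolding u_def by blast
    have u0: "u \<noteq> 0" and uphi: "u \<triangleright> \<phi> q = 0" using r unfolding u_def power_Suc2 ap_mult by blast+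
    show ?thesis
    proof (rule ladder_dim[OF ladder_psi u u0 span_psi[OF u0 u disjI1[OF uphi]]])
      fix a assume "a < h"
      then show "u \<triangleright> \<psi> q ^ a \<noteq> 0"
      proof (induct a)
        case 0
        show ?case using u0 by simp
      next
        case (Suc a)
        \<comment> \<open>The coefficient from \<open>phi_psi_power_ap\<close>. The geometric sum
          turns it into \<open>q\<close> times \<open>1 - q ^ (2 * Suc a)\<close>, which is nonzero
          because \<open>Suc a < h\<close>.\<close>
        define c where "c = q * (1 - q ^ 2) * (\<Sum>i<Suc a. q powi (2 * int i))"
        have "c = q * (1 - q powi (2 * int (Suc a)))"
        proof -
          have "q powi (2 * int i) = (q ^ 2) ^ i" for i
            using power_int_mult[of q 2 "int i"] by simp
          moreover have "(1 - q ^ 2) * (\<Sum>i<Suc a. (q ^ 2) ^ i) = 1 - (q ^ 2) ^ Suc a"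
            by (rule one_diff_power_eq[symmetric])
          ultimately show ?thesis unfolding c_def by (simp only: mult.assoc)
        qed
        moreover have "q powi (2 * int (Suc a)) \<noteq> 1"
        proof
          assume "q powi (2 * int (Suc a)) = 1"
          then have "int l dvd 2 * int (Suc a)" by (rule powi_eq_1D)
          then have "int (Suc a) = 0" by (rule dvd_twice) (use Suc.prems in simp)
          then show False by simp
        qed
        ultimately have c: "c \<noteq> 0" using q0 by simp
        have "u \<triangleright> gK \<triangleright> (gY * gX) \<triangleright> \<psi> q ^ a = u \<triangleright> \<psi> q ^ a \<triangleright> const (\<omega>' * \<kappa>')"
        proof -
          have "u \<triangleright> gK \<triangleright> (gY * gX) = u \<triangleright> const (\<omega>' * \<kappa>')"
            using u unfolding eig_def by (simp only: ap_const[of u \<kappa>'] ap_const_const)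
          then show ?thesis by (simp only: ap_const)
        qed
        moreover have "u \<triangleright> \<psi> q ^ Suc a \<triangleright> \<phi> q = u \<triangleright> gK \<triangleright> (gY * gX) \<triangleright> \<psi> q ^ a \<triangleright> const c"
          using phi_psi_power_ap[of u "Suc a"] unfolding uphi c_def by (simp del: power_Suc)
        moreover have "u \<triangleright> \<psi> q ^ a \<noteq> 0" using Suc by simp
        ultimately have "u \<triangleright> \<psi> q ^ Suc a \<triangleright> \<phi> q \<noteq> 0"
          using c eig_nonzero[OF u u0] by (simp add: const_eq_0_iff del: power_Suc)
        then show ?case by auto
      qed
    qed
  qed
  then show ?thesis by (simp add: half_order_def mult.commute)
qed

end

theorem theorem7p1:
  fixes q :: "'k::alg_closed_field" and l :: nat
    and act :: "'m::ab_group_add \<Rightarrow> 'k elem_A \<Rightarrow> 'm"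
    and act' :: "'n::ab_group_add \<Rightarrow> 'k elem_A \<Rightarrow> 'n"
  assumes "l \<ge> 3" and "primitive_root_of_unity l q"
    and "simple_right_module (alg_A q) UNIV act"
    and "bij (\<lambda>m. act m (cls q gX))" and "bij (\<lambda>m. act m (cls q gY))"
  shows "(\<exists>i\<in>{1..6}. \<exists>P. N_module q l act UNIV i P) \<and>
         (\<forall>i P. N_module q l act UNIV i P \<longrightarrow>
            simple_right_module (alg_B q) P act \<and> right_module_iso (alg_B q) UNIV act P act) \<and>
         K_finite_dim q act UNIV \<and>
         real (K_dim q act UNIV) = PI_degree (alg_A q) \<and>
         (simple_right_module (alg_A q) UNIV act' \<longrightarrow>
            K_finite_dim q act' UNIV \<and> K_dim q act' UNIV \<le> K_dim q act UNIV)"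
proof -
  have ql: "q ^ l = 1" and "q ^ 2 \<noteq> 1"
    using assms(1,2) unfolding primitive_root_of_unity_def by auto
  moreover have "q \<noteq> 0" using ql assms(1) by (auto simp: power_0_left)
  ultimately have gq: "generic q" by (simp add: generic_def)
  \<comment> \<open>Kept polymorphic in the type of the module, as it serves both \<open>act\<close>
    and \<open>act'\<close>.\<close>
  have root: "simple_A_module_root q act'' l" if "simple_right_module (alg_A q) UNIV act''"
    for act'' :: "'p::ab_group_add \<Rightarrow> 'k elem_A \<Rightarrow> 'p"
    using that gq ql assms(1)
    by unfold_locales (simp_all add: simple_right_module_def)
  interpret M: simple_A_module_root q act l by (rule root[OF assms(3)])
  interpret M: invertible_XY q act l
    by unfold_locales (use assms in \<open>simp_all add: M.ap_def\<close>)
  have PI: "PI_min_degree (alg_A q) = 2 * K_dim q act UNIV"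
    using M.PI_min_degree_le M.dim_le_PI_min_degree unfolding M.dim_eq by simp
  \<comment> \<open>Every admissible \<open>P\<close> is the whole module, so the identity is the
    required isomorphism.\<close>
  have iso: "right_module_iso (alg_B q) UNIV act UNIV act"
    unfolding right_module_iso_def by (rule exI[of _ id]) simp
  have fin: "K_finite_dim q act UNIV"
    using M.finite_dimensional unfolding K_finite_dim_def by blast
  have other: "K_finite_dim q act' UNIV \<and> K_dim q act' UNIV \<le> K_dim q act UNIV"
    if simple': "simple_right_module (alg_A q) UNIV act'"
  proof -
    interpret M': simple_A_module_root q act' l by (rule root[OF simple'])
    have "K_finite_dim q act' UNIV" using M'.finite_dimensional unfolding K_finite_dim_def by blast
    moreover have "2 * K_dim q act' UNIV \<le> 2 * K_dim q act UNIV"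
      using M'.dim_le_PI_min_degree unfolding PI .
    ultimately show ?thesis by simp
  qed
  show ?thesis
  proof (intro conjI allI impI)
    show "\<exists>i\<in>{1..6}. \<exists>P. N_module q l act UNIV i P" by (rule M.ex_N_module)
    show "simple_right_module (alg_B q) P act" "right_module_iso (alg_B q) UNIV act P act"
      if "N_module q l act UNIV i P" for i P
      using M.simple_B iso unfolding M.N_module_UNIV[OF that] by blast+
    show "K_finite_dim q act UNIV" by (rule fin)
    show "real (K_dim q act UNIV) = PI_degree (alg_A q)" unfolding PI_degree_def PI by simp
  qed (use other in blast)+
qed

end
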